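(* For $k$ a positive integer, let $p=tq^{2k+2}$. Then for each $\sigma\in\{0,1\}$, $$\sum_{\substack{\lambda\ \mathrm{even}\\ \lambda_1\leq 2k}} q^{(\sigma+1)|\lambda|/2}\, P_{\lambda}\bigl(1,q,q^2,\dots;t\bigr)=\frac{(p;p)_{\infty}^k}{(q;q)_{\infty}^k}\prod_{i=1}^k\theta\bigl(q^{(2-\sigma)i};p\bigr)\prod_{1\leq i<j\leq k}\theta\bigl(q^{j-i};p\bigr)\,\theta\bigl(q^{i+j};p\bigr),$$ where the sum is over all partitions $\lambda$ all of whose parts are even and whose largest part is at most $2k$.
   Context: $(a;q)_\infty=\prod_{i\ge0}(1-aq^i)$ and $\theta(a;p)=(a;p)_\infty(p/a;p)_\infty$. The identity is understood for complex $q,t$ with $|q|,|t|<1$, or as an identity of formal power series in $q$ with coefficients polynomial in $t$. For a partition $\lambda$: $|\lambda|=\sum_i\lambda_i$, $l(\lambda)$ is the number of parts, $m_i(\lambda)$ the multiplicity of parts equal to $i$ (the empty partition is included in the sum). With $(t;t)_m=\prod_{i=1}^m(1-t^i)$, the Hall–Littlewood polynomial in $x=(x_1,\dots,x_n)$, $l(\lambda)\le n$, is $$P_{\lambda}(x;t)=\frac{1}{v_{\lambda}(t)}\sum_{w\in S_n} w\biggl(x_1^{\lambda_1}\cdots x_n^{\lambda_n}\prod_{1\leq i<j\leq n}\frac{x_i-tx_j}{x_i-x_j}\biggr),\qquad v_{\lambda}(t)=\frac{(t;t)_{n-l(\lambda)}}{(1-t)^{n-l(\lambda)}}\prod_{i\geq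 1}\frac{(t;t)_{m_i(\lambda)}}{(1-t)^{m_i(\lambda)}},$$ and $P_\lambda(x;t)=0$ if $l(\lambda)>n$. Since $P_\lambda(x_1,\dots,x_n,0;t)=P_\lambda(x_1,\dots,x_n;t)$, it extends to infinitely many variables; $P_\lambda(1,q,q^2,\dots;t)=\lim_{n\to\infty}P_\lambda(1,q,\dots,q^{n-1};t)$. *)

theory Defs
  imports "HOL-Analysis.Analysis" "HOL-Combinatorics.Permutations"
begin

definition qpoch_inf :: "complex \<Rightarrow> complex \<Rightarrow> complex" where
  "qpoch_inf a q = (\<Prod>i. 1 - a * q ^ i)"

text \<open>
  The argument \<open>a = 0\<close> is outside the domain of the theta function. Below it only occurs for
  \<open>q = 0\<close>, as \<open>a = q ^ m\<close> and \<open>p = t * q ^ (2 * k + 2)\<close> with \<open>1 \<le> m \<le> 2 * k\<close>; there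
  \<open>p / a = t * q ^ (2 * k + 2 - m)\<close> is to be read as \<open>0\<close>, in agreement with \<open>0 / 0 = 0\<close>.
\<close>
definition theta :: "complex \<Rightarrow> complex \<Rightarrow> complex" where
  "theta a p = qpoch_inf a p * qpoch_inf (p / a) p"

text \<open>Partitions are the weakly decreasing lists of their (positive) parts.\<close>
definition is_partition :: "nat list \<Rightarrow> bool" where
  "is_partition lam \<longleftrightarrow> sorted_wrt (\<ge>) lam \<and> 0 \<notin> set lam"

text \<open>Parts are indexed from \<open>0\<close>, as are the variables \<open>x 0, \<dots>, x (n - 1)\<close> below.\<close>
definition part :: "nat list \<Rightarrow> nat \<Rightarrow> nat" where
  "part lam i = (if i < length lam then lam ! i else 0)"

text \<open>Here \<open>tpoch t m\<close> is the finite product \<open>(t;t)\<^sub>m\<close>.\<close>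
definition tpoch :: "complex \<Rightarrow> nat \<Rightarrow> complex" where
  "tpoch t m = (\<Prod>i=1..m. 1 - t ^ i)"

text \<open>Only the \<open>i\<close> that occur as parts contribute a factor different from \<open>1\<close> to the product.\<close>
definition hl_norm :: "nat \<Rightarrow> nat list \<Rightarrow> complex \<Rightarrow> complex" where
  "hl_norm n lam t =
     tpoch t (n - length lam) / (1 - t) ^ (n - length lam) *
     (\<Prod>i\<in>set lam. tpoch t (count_list lam i) / (1 - t) ^ count_list lam i)"

definition hl_sym :: "nat \<Rightarrow> nat list \<Rightarrow> complex \<Rightarrow> (nat \<Rightarrow> complex) \<Rightarrow> complex" where
  "hl_sym n lam t x =
     1 / hl_norm n lam t *
     (\<Sum>w | w permutes {..<n}.
        (\<Prod>i<n. x (w i) ^ part lam i) *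
        (\<Prod>(i, j)\<in>{(i, j). i < j \<and> j < n}. (x (w i) - t * x (w j)) / (x (w i) - x (w j))))"

text \<open>
  The symmetrization is a polynomial in \<open>x 0, \<dots>, x (n - 1)\<close>, but as an expression it only makes
  sense at points with pairwise distinct coordinates. The value of the polynomial at an arbitrary
  point is the limit along such points (in the product topology); see \<open>hall_littlewood_eq\<close> for
  the case that the coordinates are already distinct.
\<close>
definition hall_littlewood :: "nat \<Rightarrow> nat list \<Rightarrow> complex \<Rightarrow> (nat \<Rightarrow> complex) \<Rightarrow> complex" where
  "hall_littlewood n lam t x =
     (if length lam \<le> n then Lim (at x within {y. inj_on y {..<n}}) (hl_sym n lam t) else 0)"

text \<open>The principal specialization \<open>P\<^sub>\<lambda>(1, q, q\<^sup>2, \<dots>; t)\<close> in infinitely many variables.\<close>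
definition hall_littlewood_spec :: "nat list \<Rightarrow> complex \<Rightarrow> complex \<Rightarrow> complex" where
  "hall_littlewood_spec lam q t = lim (\<lambda>n. hall_littlewood n lam t (\<lambda>i. q ^ i))"

lemma at_within_inj_neq_bot:
  fixes x :: "nat \<Rightarrow> complex"
  assumes inj: "inj_on x {..<n}"
  shows "at x within {y. inj_on y {..<n}} \<noteq> bot"
proof -
  define h :: "complex \<Rightarrow> nat \<Rightarrow> complex" where "h = (\<lambda>s. x(n := x n + s))"
  have "continuous_on UNIV h"
  proof (rule continuous_on_coordinatewise_then_product)
    show "continuous_on UNIV (\<lambda>s. h s i)" for i
      by (cases "i = n") (auto simp: h_def intro!: continuous_intros)
  qed
  then have "(h \<longlongrightarrow> h 0) (at 0)"
    by (auto simp: continuous_on_def)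
  moreover have "h 0 = x"
    by (simp add: h_def)
  ultimately have "(h \<longlongrightarrow> x) (at 0)"
    by simp
  moreover have "inj_on (h s) {..<n}" for s
    using inj by (auto simp: h_def inj_on_def)
  moreover have "h s \<noteq> x" if "s \<noteq> 0" for s
    using that by (auto simp: h_def fun_upd_def fun_eq_iff)
  ultimately have "filterlim h (at x within {y. inj_on y {..<n}}) (at 0)"
    by (auto simp: filterlim_at eventually_at_filter)
  then show ?thesis
    by (metis filterlim_def filtermap_bot_iff le_bot at_neq_bot)
qed

lemma hall_littlewood_eq:
  assumes inj: "inj_on x {..<n}" and len: "length lam \<le> n"
  shows "hall_littlewood n lam t x = hl_sym n lam t x"
proof -
  let ?F = "at x within {y. inj_on y {..<n}}"
  have coord: "((\<lambda>y. y i) \<longlongrightarrow> x i) ?F" for i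
    using continuous_on_product_then_coordinatewise[OF continuous_on_id, of UNIV i]
    by (auto simp: continuous_on_def intro: tendsto_within_subset)
  have ne: "x (w i) - x (w j) \<noteq> 0" if "w permutes {..<n}" "i < j" "j < n" for w i j
  proof -
    have "w i \<in> {..<n}" "w j \<in> {..<n}"
      using that permutes_in_image[OF that(1)] by auto
    moreover have "w i \<noteq> w j"
      using that permutes_inj[OF that(1)] by (auto dest: injD)
    ultimately show ?thesis
      using inj by (auto dest: inj_onD)
  qed
  have "(hl_sym n lam t \<longlongrightarrow> hl_sym n lam t x) ?F"
    unfolding hl_sym_def case_prod_beta
    by (intro tendsto_intros tendsto_sum tendsto_prod coord) (auto dest: ne)
  then show ?thesis
    using at_within_inj_neq_bot[OF inj] len
    by (simp add: hall_littlewood_def tendsto_Lim)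
qed

end

theory Submission
  imports Defs "HOL-Complex_Analysis.Complex_Analysis"
begin

text \<open>Grouping the Hall--Littlewood symmetrization by the exponent of each variable turns the sum
over bounded even partitions into a sum over bounded exponent functions. A rational function
argument rewrites it as a sum over sign changes \<open>x a \<mapsto> 1 / x a\<close>. This sum satisfies a recursion
in the set of variables, shared by a \<open>k \<times> k\<close> determinant whose entries pair the Laurent
coefficients of \<open>\<Prod>a. (1 + x a * z) * (1 + x a / z)\<close> with affine coefficients; expressing the pairing
as a finite quadrature reduces the recursion to partial fractions. For
\<open>x a = q powr (a + (\<sigma> + 1) / 2)\<close> the Laurent coefficients come from the finite Jacobi triple product,
and in the limit the entries become theta series at the points \<open>q powr (j - \<sigma> / 2)\<close>. Zeros and
quasi-periodicity show that the limiting determinant is a constant multiple of a product of theta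
functions; the constant is found from \<open>t = 1\<close>, where the sum over sign changes factors.\<close>

section \<open>Hall--Littlewood symmetrizations\<close>

text \<open>The partial fractions behind the recursion in the set of variables evaluate the kernel
  at dilated points \<open>t * z\<close>. The affine coefficients are made for this: their support
  is an orbit of the affine Weyl group of type C, they are odd under \<open>m \<mapsto> - m\<close>,
  and the translation \<open>m \<mapsto> m + 2 * (k + 1)\<close> costs a power of \<open>t\<close>
  that undoes the dilation. What remains of it are columns that the determinant already contains.
  The quadrature turns a functional on Laurent polynomials into a finite sum, in which division by
  \<open>1 - t * z^2\<close> is possible node by node. In the limit the Gaussian powers of
  \<open>w\<close>, where \<open>w^2 = q\<close>, merge with the powers of \<open>t\<close>, and
  \<open>q\<close> and \<open>t\<close> enter the theta series only through \<open>p\<close>. Hence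
  the factor between determinant and theta product depends on \<open>p\<close> and \<open>k\<close>
  alone and may be computed for another base \<open>s\<close> with
  \<open>s ^ (2 * k + 2) = p\<close>, which corresponds to \<open>t = 1\<close>. That value lies
  outside the disc of the theorem; the determinant formula reaches it by continuity on the closed
  disc. The cases \<open>q = 0\<close> and \<open>t = 0\<close>, where \<open>p = 0\<close> and
  quasi-periodicity is lost, are settled directly.\<close>

lemma lagrange_sum:
 fixes p :: "complex poly"
 assumes fin: "finite S" and deg: "degree p < card S"
 shows "(\<Sum>a\<in>S. poly p a / (\<Prod>c\<in>S - {a}. a - c)) = coeff p (card S - 1)"
proof -
 \<comment> \<open>Unnormalized Lagrange basis polynomials. They are monic of degree
   \<open>card S - 1\<close>, so the sum in question is the top coefficient of the interpolant
   \<open>q\<close>.\<close>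
 define L where "L a = (\<Prod>c\<in>S - {a}. [:- c, 1:])" for a :: complex
 define q where "q = (\<Sum>a\<in>S. smult (poly p a / (\<Prod>c\<in>S - {a}. a - c)) (L a))"
 have degL: "degree (L a) = card S - 1" if "a \<in> S" for a
 proof -
  have "degree (L a) = (\<Sum>c\<in>S - {a}. degree [:- c, 1:])" unfolding L_def by (rule degree_prod_eq_sum_degree) auto
  thus ?thesis using that fin by simp
 qed
 have leadL: "coeff (L a) (card S - 1) = 1" if "a \<in> S" for a using lead_coeff_prod[of "\<lambda>c. [:- c, 1:]" "S - {a}"] degL[OF that]
  by (simp add: L_def)
 have polyL: "poly (L a) b = (\<Prod>c\<in>S - {a}. b - c)" for a b by (simp add: L_def poly_prod)
 have L0: "poly (L a) b = 0" if "b \<in> S" "b \<noteq> a" for a b using that fin by (auto simp: polyL)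
 have "p = q"
 proof (rule poly_eqI_degree[of S])
  fix b assume b: "b \<in> S"
  have nz: "(\<Prod>c\<in>S - {b}. b - c) \<noteq> 0" using fin by auto
  have "poly q b = (\<Sum>a\<in>S. poly p a / (\<Prod>c\<in>S - {a}. a - c) * poly (L a) b)" by (simp add: q_def poly_sum)
  also have "... = (\<Sum>a\<in>{b}. poly p a / (\<Prod>c\<in>S - {a}. a - c) * poly (L a) b)"
   by (rule sum.mono_neutral_right) (use fin b L0 in auto)
  also have "... = poly p b" using nz by (simp add: polyL)
  finally show "poly p b = poly q b" by simp
 next
  show "degree p < card S" by fact
  have "degree q \<le> card S - 1" unfolding q_def
   by (rule degree_sum_le[OF fin]) (use degL in \<open>auto intro: order_trans[OF degree_smult_le]\<close>)
  thus "degree q < card S" using deg by linarith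
 qed
 hence "coeff p (card S - 1) = coeff q (card S - 1)" by simp
 also have "... = (\<Sum>a\<in>S. poly p a / (\<Prod>c\<in>S - {a}. a - c))"
  unfolding q_def coeff_sum coeff_smult by (rule sum.cong[OF refl]) (use leadL in simp)
 finally show ?thesis by simp
qed

section \<open>The Hall-Littlewood factor and its sums over one distinguished variable\<close>

definition hlb :: "complex \<Rightarrow> complex \<Rightarrow> complex \<Rightarrow> complex" where
 "hlb t u v = (u - t * v) / (u - v)"

text \<open>Interpolation of \<open>\<Prod>c (u - t * x c)\<close>, which has leading coefficient 1,
  at the nodes \<open>x a\<close> and the additional node 0. The node 0 contributes
  \<open>t ^ card B\<close>; at \<open>x a\<close> the factor \<open>(1 - t) * x a\<close> of the
  numerator cancels the difference from the node 0 and leaves \<open>1 - t\<close> times the desired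
  summand.\<close>

lemma sum_hlb_nonzero:
 assumes fin: "finite B" and inj: "inj_on x B" and nz: "\<forall>a\<in>B. x a \<noteq> 0" and t: "t \<noteq> 1"
 shows "(\<Sum>a\<in>B. \<Prod>c\<in>B - {a}. hlb t (x a) (x c)) = (1 - t ^ card B) / (1 - t)"
proof -
 define p where "p = (\<Prod>c\<in>B. [:- t * x c, 1:])"
 define S where "S = insert 0 (x ` B)"
 have finS: "finite S" using fin by (simp add: S_def)
 have cardS: "card S = Suc (card B)" using fin nz inj by (auto simp: S_def card_image card_insert_if)
 have degp: "degree p = card B" unfolding p_def by (subst degree_prod_eq_sum_degree) auto
 have leadp: "coeff p (card B) = 1" using lead_coeff_prod[of "\<lambda>c. [:- t * x c, 1:]" B] degp by (simp add: p_def)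
 have polyp: "poly p u = (\<Prod>c\<in>B. u - t * x c)" for u by (simp add: p_def poly_prod)
 have "(\<Sum>a\<in>S. poly p a / (\<Prod>c\<in>S - {a}. a - c)) = 1" using lagrange_sum[OF finS, of p] cardS degp leadp by simp
 moreover have "(\<Sum>a\<in>S. poly p a / (\<Prod>c\<in>S - {a}. a - c)) =
   poly p 0 / (\<Prod>c\<in>S - {0}. 0 - c) + (\<Sum>a\<in>x ` B. poly p a / (\<Prod>c\<in>S - {a}. a - c))"
  using fin nz by (subst S_def, subst sum.insert) auto
 moreover have "S - {0} = x ` B" using nz by (auto simp: S_def)
 moreover have "poly p 0 / (\<Prod>c\<in>x ` B. 0 - c) = t ^ card B"
 proof -
  have "poly p 0 = (\<Prod>c\<in>B. t * (- x c))" by (simp add: polyp)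
  also have "... = t ^ card B * (\<Prod>c\<in>B. - x c)" by (simp only: prod.distrib prod_constant)
  finally have "poly p 0 = t ^ card B * (\<Prod>c\<in>B. - x c)" .
  moreover have "(\<Prod>c\<in>x ` B. 0 - c) = (\<Prod>c\<in>B. - x c)" using inj by (simp add: prod.reindex)
  moreover have "(\<Prod>c\<in>B. - x c) \<noteq> 0" using fin nz by auto
  ultimately show ?thesis by simp
 qed
 moreover have "(\<Sum>a\<in>x ` B. poly p a / (\<Prod>c\<in>S - {a}. a - c)) =
   (1 - t) * (\<Sum>a\<in>B. \<Prod>c\<in>B - {a}. hlb t (x a) (x c))"
 proof -
  have "poly p (x a) / (\<Prod>c\<in>S - {x a}. x a - c) = (1 - t) * (\<Prod>c\<in>B - {a}. hlb t (x a) (x c))"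
   if a: "a \<in> B" for a
  proof -
   have "S - {x a} = insert 0 (x ` (B - {a}))" using nz inj a by (auto simp: S_def inj_on_def)
   moreover have "0 \<notin> x ` (B - {a})" using nz by auto
   ultimately have "(\<Prod>c\<in>S - {x a}. x a - c) = x a * (\<Prod>c\<in>x ` (B - {a}). x a - c)" using fin by simp
   also have "(\<Prod>c\<in>x ` (B - {a}). x a - c) = (\<Prod>c\<in>B - {a}. x a - x c)"
    by (subst prod.reindex) (use inj in \<open>auto simp: inj_on_def\<close>)
   finally have e1: "(\<Prod>c\<in>S - {x a}. x a - c) = x a * (\<Prod>c\<in>B - {a}. x a - x c)" .
   have "poly p (x a) = (x a - t * x a) * (\<Prod>c\<in>B - {a}. x a - t * x c)" unfolding polyp by (rule prod.remove[OF fin a])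
   hence e2: "poly p (x a) = x a * ((1 - t) * (\<Prod>c\<in>B - {a}. x a - t * x c))" by (simp add: algebra_simps)
   have "x a \<noteq> 0" using nz a by auto
   thus ?thesis unfolding e1 e2 hlb_def by (subst nonzero_mult_divide_mult_cancel_left) (auto simp: prod_dividef)
  qed
  thus ?thesis using inj by (simp add: sum.reindex sum_distrib_left)
 qed
 ultimately have "t ^ card B + (1 - t) * (\<Sum>a\<in>B. \<Prod>c\<in>B - {a}. hlb t (x a) (x c)) = 1" by simp
 thus ?thesis using t by (simp add: field_simps)
qed

lemma sum_hlb:
 assumes fin: "finite B" and inj: "inj_on x B" and t: "t \<noteq> 1"
 shows "(\<Sum>a\<in>B. \<Prod>c\<in>B - {a}. hlb t (x a) (x c)) = (1 - t ^ card B) / (1 - t)"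
proof (cases "\<forall>a\<in>B. x a \<noteq> 0")
 case True
 thus ?thesis using sum_hlb_nonzero assms by blast
next
 case False
 \<comment> \<open>By injectivity only one coordinate is 0. Its own summand is
   \<open>t ^ card C\<close>, and in every other summand it contributes the factor 1.\<close>
 then obtain z where z: "z \<in> B" "x z = 0" by auto
 define C where "C = B - {z}"
 have C: "finite C" "inj_on x C" "z \<notin> C" "B = insert z C" using fin inj z by (auto simp: C_def inj_on_def)
 have nz: "\<forall>a\<in>C. x a \<noteq> 0" using inj z C_def by (auto simp: inj_on_def)
 have "(\<Prod>c\<in>B - {z}. hlb t (x z) (x c)) = (\<Prod>c\<in>C. t)"
  unfolding C_def by (rule prod.cong) (use nz z in \<open>auto simp: hlb_def C_def\<close>)
 hence 1: "(\<Prod>c\<in>B - {z}. hlb t (x z) (x c)) = t ^ card C" by simp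
 have 2: "(\<Prod>c\<in>B - {a}. hlb t (x a) (x c)) = (\<Prod>c\<in>C - {a}. hlb t (x a) (x c))" if "a \<in> C" for a
 proof -
  have "B - {a} = insert z (C - {a})" using C that by auto
  thus ?thesis using C that nz z by (simp add: hlb_def)
 qed
 have "(\<Sum>a\<in>B. \<Prod>c\<in>B - {a}. hlb t (x a) (x c)) =
   t ^ card C + (\<Sum>a\<in>C. \<Prod>c\<in>B - {a}. hlb t (x a) (x c))" unfolding 1[symmetric] using C by simp
 also have "(\<Sum>a\<in>C. \<Prod>c\<in>B - {a}. hlb t (x a) (x c)) = (1 - t ^ card C) / (1 - t)" using sum_hlb_nonzero[OF C(1,2) nz t] 2 by simp
 finally show ?thesis using C t by (simp add: field_simps)
qed

text \<open>Pairs with equal exponents carry no factor: after summation over all orderings within a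
  level set of \<open>f\<close> they yield the normalization \<open>mult_norm\<close>, and only the
  pairs with distinct exponents survive.\<close>

definition inv_prod :: "complex \<Rightarrow> (nat \<Rightarrow> complex) \<Rightarrow> nat set \<Rightarrow> (nat \<Rightarrow> nat) \<Rightarrow> complex" where
 "inv_prod t x A f = (\<Prod>(a, c)\<in>{(a, c). a \<in> A \<and> c \<in> A \<and> f c < f a}. hlb t (x a) (x c))"

primrec list_hlb :: "complex \<Rightarrow> (nat \<Rightarrow> complex) \<Rightarrow> nat list \<Rightarrow> complex" where
 "list_hlb t x [] = 1"
| "list_hlb t x (a # l) = (\<Prod>c\<in>set l. hlb t (x a) (x c)) * list_hlb t x l"

definition mult_norm :: "complex \<Rightarrow> nat list \<Rightarrow> complex" where
 "mult_norm t pl = (\<Prod>i\<in>set pl. tpoch t (count_list pl i) / (1 - t) ^ count_list pl i)"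

lemma mult_norm_superset:
 assumes "finite S" "set pl \<subseteq> S"
 shows "mult_norm t pl = (\<Prod>i\<in>S. tpoch t (count_list pl i) / (1 - t) ^ count_list pl i)" unfolding mult_norm_def
 by (rule prod.mono_neutral_left) (use assms in \<open>auto simp: tpoch_def\<close>)

lemma mult_norm_Cons:
 assumes t: "t \<noteq> 1"
 shows "mult_norm t (v # pl) = mult_norm t pl * (1 - t ^ Suc (count_list pl v)) / (1 - t)"
proof -
 let ?S = "insert v (set pl)"
 let ?g = "\<lambda>pl i. tpoch t (count_list pl i) / (1 - t) ^ count_list pl i"
 have "mult_norm t (v # pl) = ?g (v # pl) v * (\<Prod>i\<in>?S - {v}. ?g (v # pl) i)" unfolding mult_norm_def list.set by (rule prod.remove) auto
 also have "(\<Prod>i\<in>?S - {v}. ?g (v # pl) i) = (\<Prod>i\<in>?S - {v}. ?g pl i)" by (rule prod.cong) auto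
 also have "?g (v # pl) v = ?g pl v * (1 - t ^ Suc (count_list pl v)) / (1 - t)" by (simp add: tpoch_def)
 finally have "mult_norm t (v # pl) =
   (?g pl v * (\<Prod>i\<in>?S - {v}. ?g pl i)) * (1 - t ^ Suc (count_list pl v)) / (1 - t)" by simp
 also have "?g pl v * (\<Prod>i\<in>?S - {v}. ?g pl i) = mult_norm t pl"
  by (subst mult_norm_superset[of ?S pl t], simp, blast, rule prod.remove[symmetric]) auto
 finally show ?thesis .
qed

lemma inv_prod_remove:
 assumes fin: "finite A" and a: "a \<in> A" and mx: "\<And>c. c \<in> A \<Longrightarrow> f c \<le> f a"
 shows "inv_prod t x A f =
   (\<Prod>c\<in>{c\<in>A. f c < f a}. hlb t (x a) (x c)) * inv_prod t x (A - {a}) f"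
proof -
 let ?P = "{(b, c). b \<in> A \<and> c \<in> A \<and> f c < f b}"
 let ?Q = "{(b, c). b \<in> A - {a} \<and> c \<in> A - {a} \<and> f c < f b}"
 let ?R = "(\<lambda>c. (a, c)) ` {c\<in>A. f c < f a}"
 have P: "?P = ?R \<union> ?Q"
 proof (intro set_eqI iffI)
  fix z assume "z \<in> ?P"
  then obtain b c where z: "z = (b, c)" "b \<in> A" "c \<in> A" "f c < f b" by auto
  have "c \<noteq> a" using z mx[of b] by auto
  thus "z \<in> ?R \<union> ?Q" using z by (cases "b = a") auto
 qed (use a in auto)
 have fQ: "finite ?Q" by (rule finite_subset[of _ "A \<times> A"]) (use fin in auto)
 have "inv_prod t x A f = prod (\<lambda>(a, c). hlb t (x a) (x c)) ?R * prod (\<lambda>(a, c). hlb t (x a) (x c)) ?Q"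
  unfolding inv_prod_def P by (rule prod.union_disjoint) (use fin fQ in auto)
 also have "prod (\<lambda>(a, c). hlb t (x a) (x c)) ?R = (\<Prod>c\<in>{c\<in>A. f c < f a}. hlb t (x a) (x c))"
  by (subst prod.reindex) (auto simp: inj_on_def)
 finally show ?thesis by (simp add: inv_prod_def)
qed

text \<open>Summing over all orderings of \<open>A\<close> compatible with \<open>f\<close> only affects the level sets of \<open>f\<close>,
 each of which contributes its normalization factor.\<close>
lemma sum_orderings:
 assumes "finite A" "inj_on x A" "t \<noteq> 1" "sorted_wrt (\<ge>) pl" "mset pl = image_mset f (mset_set A)"
 shows "(\<Sum>l | distinct l \<and> set l = A \<and> map f l = pl. list_hlb t x l) =
      mult_norm t pl * inv_prod t x A f" using assms
proof (induction pl arbitrary: A)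
 case Nil
 hence "A = {}" by (simp add: mset_set_empty_iff)
 hence "{l. distinct l \<and> set l = A \<and> map f l = []} = {[]}" by auto
 thus ?case using \<open>A = {}\<close> by (simp add: mult_norm_def inv_prod_def)
next
 case (Cons v pl)
 \<comment> \<open>The head of an admissible ordering is an arbitrary element of the top level set
   of \<open>f\<close>; the tail is an ordering of the remaining elements.\<close>
 define M where "M = {a\<in>A. f a = v}"
 have finM: "finite M" using Cons.prems by (simp add: M_def)
 have fA: "f ` A = set (v # pl)" using Cons.prems(1,5) by (metis finite_set_mset_mset_set set_image_mset set_mset_mset)
 have mx: "f c \<le> v" if "c \<in> A" for c
 proof -
  have "f c \<in> set (v # pl)" using fA that by blast
  thus ?thesis using Cons.prems(4) by auto
 qed
 define X where "X a = {l. distinct l \<and> set l = A - {a} \<and> map f l = pl}" for a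
 have finX: "finite (X a)" for a by (rule finite_subset[OF _ finite_subset_distinct[of "A - {a}"]])
    (use Cons.prems(1) in \<open>auto simp: X_def\<close>)
 have eq: "{l. distinct l \<and> set l = A \<and> map f l = v # pl} = (\<lambda>(a, l). a # l) ` (SIGMA a:M. X a)"
 proof (intro set_eqI iffI)
  fix l assume "l \<in> {l. distinct l \<and> set l = A \<and> map f l = v # pl}"
  then obtain a l' where "l = a # l'" "distinct (a # l')" "set (a # l') = A" "f a = v" "map f l' = pl" by (cases l) auto
  thus "l \<in> (\<lambda>(a, l). a # l) ` (SIGMA a:M. X a)" by (intro image_eqI[of _ _ "(a, l')"]) (auto simp: M_def X_def)
 next
  fix l assume "l \<in> (\<lambda>(a, l). a # l) ` (SIGMA a:M. X a)"
  then obtain a l' where "l = a # l'" "a \<in> M" "l' \<in> X a" by auto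
  thus "l \<in> {l. distinct l \<and> set l = A \<and> map f l = v # pl}" by (simp add: M_def X_def insert_absorb)
 qed
 have inj: "inj_on (\<lambda>(a, l). a # l) (SIGMA a:M. X a)" by (auto simp: inj_on_def)
 have "(\<Sum>l | distinct l \<and> set l = A \<and> map f l = v # pl. list_hlb t x l) =
   (\<Sum>(a, l)\<in>(SIGMA a:M. X a). list_hlb t x (a # l))" unfolding eq by (rule sum.reindex_cong[OF inj _]) auto
 also have "... = (\<Sum>a\<in>M. \<Sum>l\<in>X a. list_hlb t x (a # l))" by (rule sum.Sigma[symmetric]) (use finM finX in auto)
 also have "... = (\<Sum>a\<in>M. (\<Prod>c\<in>A - {a}. hlb t (x a) (x c)) * (mult_norm t pl * inv_prod t x (A - {a}) f))"
 proof (rule sum.cong[OF refl])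
  fix a assume a: "a \<in> M"
  hence aA: "a \<in> A" "f a = v" by (auto simp: M_def)
  have "mset_set A = add_mset a (mset_set (A - {a}))" by (rule mset_set.remove[OF Cons.prems(1) aA(1)])
  hence ms: "mset pl = image_mset f (mset_set (A - {a}))" using Cons.prems(5) aA by simp
  have "(\<Sum>l\<in>X a. list_hlb t x (a # l)) =
    (\<Prod>c\<in>A - {a}. hlb t (x a) (x c)) * (\<Sum>l\<in>X a. list_hlb t x l)"
   unfolding sum_distrib_left by (rule sum.cong) (auto simp: X_def)
  also have "(\<Sum>l\<in>X a. list_hlb t x l) = mult_norm t pl * inv_prod t x (A - {a}) f"
   unfolding X_def by (rule Cons.IH) (use Cons.prems ms in \<open>auto simp: inj_on_def\<close>)
  finally show "(\<Sum>l\<in>X a. list_hlb t x (a # l)) =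
    (\<Prod>c\<in>A - {a}. hlb t (x a) (x c)) * (mult_norm t pl * inv_prod t x (A - {a}) f)" .
 qed
 also have "... = (\<Sum>a\<in>M. (\<Prod>c\<in>M - {a}. hlb t (x a) (x c)) * (mult_norm t pl * inv_prod t x A f))"
 proof (rule sum.cong[OF refl])
  fix a assume a: "a \<in> M"
  hence aA: "a \<in> A" "f a = v" by (auto simp: M_def)
  have eqA: "A - {a} = (M - {a}) \<union> {c\<in>A. f c < v}"
  proof (intro set_eqI iffI)
   fix c assume "c \<in> A - {a}"
   thus "c \<in> (M - {a}) \<union> {c\<in>A. f c < v}" using mx[of c] unfolding M_def by auto
  next
   fix c assume "c \<in> (M - {a}) \<union> {c\<in>A. f c < v}"
   thus "c \<in> A - {a}" using aA(2) unfolding M_def by auto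
  qed
  have disj: "(M - {a}) \<inter> {c\<in>A. f c < v} = {}" unfolding M_def by auto
  have "(\<Prod>c\<in>A - {a}. hlb t (x a) (x c)) =
    (\<Prod>c\<in>M - {a}. hlb t (x a) (x c)) * (\<Prod>c\<in>{c\<in>A. f c < f a}. hlb t (x a) (x c))"
   unfolding aA(2) eqA by (rule prod.union_disjoint[OF _ _ disj]) (use finM Cons.prems(1) in simp_all)
  moreover have "inv_prod t x A f =
    (\<Prod>c\<in>{c\<in>A. f c < f a}. hlb t (x a) (x c)) * inv_prod t x (A - {a}) f"
   by (rule inv_prod_remove[OF Cons.prems(1) aA(1)]) (use mx aA(2) in metis)
  ultimately show "(\<Prod>c\<in>A - {a}. hlb t (x a) (x c)) * (mult_norm t pl * inv_prod t x (A - {a}) f) =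
    (\<Prod>c\<in>M - {a}. hlb t (x a) (x c)) * (mult_norm t pl * inv_prod t x A f)" by (simp only: mult.assoc mult.left_commute)
 qed
 \<comment> \<open>Only the factors inside the top level set depend on the chosen head, and their
   sum over \<open>a\<close> is the factor by which \<open>mult_norm\<close> grows when
   \<open>v\<close> is prepended.\<close>
 also have "... = (1 - t ^ card M) / (1 - t) * (mult_norm t pl * inv_prod t x A f)"
 proof -
  have "inj_on x M" by (rule inj_on_subset[OF Cons.prems(2)]) (auto simp: M_def)
  from sum_hlb[OF finM this Cons.prems(3)] show ?thesis by (simp only: sum_distrib_right[symmetric])
 qed
 also have "card M = Suc (count_list pl v)"
 proof -
  have "count (mset (v # pl)) v = card M"
  proof -
   have "count (image_mset f (mset_set A)) v = card (f -` {v} \<inter> A)" using Cons.prems(1) by (simp add: count_image_mset)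
   also have "f -` {v} \<inter> A = M" by (auto simp: M_def)
   finally show ?thesis by (simp only: Cons.prems(5))
  qed
  thus ?thesis by (simp add: count_mset)
 qed
 finally show ?case using mult_norm_Cons[OF Cons.prems(3), of v pl] by simp
qed

lemma list_hlb_distinct:
 "distinct l \<Longrightarrow> list_hlb t x l = (\<Prod>(i, j)\<in>{(i, j). i < j \<and> j < length l}. hlb t (x (l ! i)) (x (l ! j)))"
proof (induction l)
 case (Cons a l)
 let ?P = "{(i, j). i < j \<and> j < length l}"
 let ?Q = "(\<lambda>j. (0, Suc j)) ` {..<length l}"
 have P: "{(i, j). i < j \<and> j < length (a # l)} = ?Q \<union> map_prod Suc Suc ` ?P"
 proof (intro set_eqI iffI)
  fix z assume "z \<in> {(i, j). i < j \<and> j < length (a # l)}"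
  then obtain i j where z: "z = (i, j)" "i < j" "j < Suc (length l)" by auto
  then obtain j' where j: "j = Suc j'" by (cases j) auto
  show "z \<in> ?Q \<union> map_prod Suc Suc ` ?P" using z j by (cases i) (force simp: image_iff)+
 qed auto
 have fin: "finite ?P" by (rule finite_subset[of _ "{..<length l} \<times> {..<length l}"]) auto
 have "(\<Prod>(i, j)\<in>{(i, j). i < j \<and> j < length (a # l)}. hlb t (x ((a # l) ! i)) (x ((a # l) ! j))) =
   (\<Prod>(i, j)\<in>?Q. hlb t (x ((a # l) ! i)) (x ((a # l) ! j))) *
   (\<Prod>(i, j)\<in>map_prod Suc Suc ` ?P. hlb t (x ((a # l) ! i)) (x ((a # l) ! j)))" unfolding P by (rule prod.union_disjoint) (use fin in auto)
 also have "(\<Prod>(i, j)\<in>?Q. hlb t (x ((a # l) ! i)) (x ((a # l) ! j))) =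
   (\<Prod>j<length l. hlb t (x a) (x (l ! j)))" by (subst prod.reindex) (auto simp: inj_on_def)
 also have "... = (\<Prod>c\<in>set l. hlb t (x a) (x c))" by (rule prod.reindex_bij_betw[OF bij_betw_nth]) (use Cons.prems in auto)
 also have "(\<Prod>(i, j)\<in>map_prod Suc Suc ` ?P. hlb t (x ((a # l) ! i)) (x ((a # l) ! j))) = list_hlb t x l"
  using Cons by (subst prod.reindex) (auto simp: inj_on_def intro!: prod.cong)
 finally show ?case by simp
qed simp

definition shape :: "(nat \<Rightarrow> nat) \<Rightarrow> nat list" where
 "shape f = rev (sorted_list_of_multiset (image_mset f (mset_set {a. f a \<noteq> 0})))"

lemma mset_shape: "mset (shape f) = image_mset f (mset_set {a. f a \<noteq> 0})" by (simp add: shape_def)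

lemma shape_eqI:
 assumes "sorted_wrt (\<ge>) lam" "mset lam = image_mset f (mset_set {a. f a \<noteq> 0})"
 shows "shape f = lam"
proof -
 have "sort lam = rev lam" by (rule properties_for_sort) (use assms(1) in \<open>auto simp: sorted_wrt_rev\<close>)
 thus ?thesis unfolding shape_def assms(2)[symmetric] by simp
qed

lemma is_partition_shape:
 assumes "finite {a. f a \<noteq> 0}"
 shows "is_partition (shape f)"
proof -
 have "sorted_wrt (\<ge>) (shape f)" by (simp add: shape_def sorted_wrt_rev)
 moreover have "set (shape f) = f ` {a. f a \<noteq> 0}"
  using mset_shape[of f] assms by (metis finite_set_mset_mset_set set_image_mset set_mset_mset)
 ultimately show ?thesis by (auto simp: is_partition_def)
qed

text \<open>The permutations are grouped by the exponent \<open>part lam (inv w a)\<close> that they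
  assign to each variable. A fibre consists of the orderings of the variables along which the
  exponents read \<open>pl\<close>, so \<open>sum_orderings\<close> evaluates it, and the resulting
  normalization cancels \<open>hl_norm\<close>; the latter is nonzero because
  \<open>norm t < 1\<close>.\<close>

lemma hl_sym_eq_sum:
 assumes inj: "inj_on x {..<n}" and t: "norm t < 1" and lam: "is_partition lam" and len: "length lam \<le> n"
 defines "F \<equiv> {f. (\<forall>a\<ge>n. f a = 0) \<and> shape f = lam}"
 shows "finite F"
  and "hl_sym n lam t x = (\<Sum>f\<in>F. (\<Prod>a<n. x a ^ f a) * inv_prod t x {..<n} f)"
proof -
 \<comment> \<open>After padding by zeros, the factor of \<open>hl_norm\<close> that belongs to the
   missing parts is the one for the multiplicity of the part 0.\<close>
 define pl where "pl = map (part lam) [0..<n]"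
 have t1: "t \<noteq> 1" using t by auto
 have srt: "sorted_wrt (\<ge>) lam" and n0: "0 \<notin> set lam" using lam by (auto simp: is_partition_def)
 have plen: "length pl = n" by (simp add: pl_def)
 have pl: "pl = lam @ replicate (n - length lam) 0" by (rule nth_equalityI) (use len in \<open>auto simp: pl_def part_def nth_append\<close>)
 have "sorted_wrt (\<ge>) (replicate m (0::nat))" for m by (induction m) auto
 hence srtpl: "sorted_wrt (\<ge>) pl" using srt by (auto simp: pl sorted_wrt_append)
 have cr: "count_list (replicate m 0) i = (if i = 0 then m else 0)" for m and i :: nat by (induction m) auto
 have norm: "hl_norm n lam t = mult_norm t pl"
 proof -
  have "mult_norm t pl = (\<Prod>i\<in>insert 0 (set lam). tpoch t (count_list pl i) / (1 - t) ^ count_list pl i)"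
   by (rule mult_norm_superset) (auto simp: pl)
  also have "... = tpoch t (n - length lam) / (1 - t) ^ (n - length lam) *
    (\<Prod>i\<in>set lam. tpoch t (count_list pl i) / (1 - t) ^ count_list pl i)" using n0 by (simp add: pl cr)
  also have "... = hl_norm n lam t" unfolding hl_norm_def
   by (intro arg_cong2[of _ _ _ _ "(*)"] prod.cong refl) (use n0 in \<open>auto simp: pl cr\<close>)
  finally show ?thesis by simp
 qed
 have tne: "t ^ i \<noteq> 1" if "i \<ge> 1" for i
 proof
  assume "t ^ i = 1"
  hence "norm t ^ i = 1" by (simp flip: norm_power)
  moreover have "norm t ^ i < 1" using t that by (simp add: power_less_one_iff)
  ultimately show False by simp
 qed
 have nz: "hl_norm n lam t \<noteq> 0"
 proof -
  have "tpoch t m \<noteq> 0" for m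
  proof -
   have "1 - t ^ i \<noteq> 0" if "i \<in> {1..m}" for i using tne[of i] that by simp
   thus ?thesis unfolding tpoch_def by (meson finite_atLeastAtMost prod_zero_iff)
  qed
  thus ?thesis using t1 by (auto simp: hl_norm_def)
 qed
 have ms: "mset pl = image_mset f (mset_set {..<n})" if f: "f \<in> F" for f
 proof -
  let ?N = "{a. f a \<noteq> 0}"
  have N: "?N \<subseteq> {..<n}" using f unfolding F_def by (auto simp: not_less[symmetric])
  hence fin: "finite ?N" by (rule finite_subset) simp
  have "mset lam = image_mset f (mset_set ?N)" using f mset_shape[of f] by (auto simp: F_def)
  hence sz: "length lam = card ?N" by (metis size_image_mset size_mset size_mset_set)
  have U: "{..<n} = ?N \<union> ({..<n} - ?N)" using N by auto
  have "mset_set {..<n} = mset_set ?N + mset_set ({..<n} - ?N)" by (subst U, rule mset_set_Union) (use fin in auto)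
  moreover have "image_mset f (mset_set ({..<n} - ?N)) = image_mset (\<lambda>_. 0) (mset_set ({..<n} - ?N))" by (rule image_mset_cong) auto
  moreover have "card ({..<n} - ?N) = n - length lam" using N fin sz by (simp add: card_Diff_subset)
  ultimately have "image_mset f (mset_set {..<n}) = mset lam + replicate_mset (n - length lam) 0"
   using \<open>mset lam = _\<close> by (simp only: image_mset_union image_mset_const_eq size_mset_set)
  thus ?thesis by (simp add: pl)
 qed
 show finF: "finite F"
 proof (rule finite_subset)
  show "F \<subseteq> {f. \<forall>a. (a \<in> {..<n} \<longrightarrow> f a \<in> set pl) \<and> (a \<notin> {..<n} \<longrightarrow> f a = 0)}"
  proof (intro subsetI CollectI allI conjI impI)
   fix f a assume f: "f \<in> F" and a: "a \<in> {..<n}"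
   have "f a \<in># image_mset f (mset_set {..<n})" using a by simp
   thus "f a \<in> set pl" unfolding ms[OF f, symmetric] by simp
  next
   fix f a assume "f \<in> F" and "a \<notin> {..<n}"
   thus "f a = 0" by (auto simp: F_def)
  qed
 qed (rule finite_set_of_finite_funs, auto)
 let ?S = "{w. w permutes {..<n}}"
 let ?g = "\<lambda>w. part lam \<circ> inv w"
 let ?h = "\<lambda>w. (\<Prod>i<n. x (w i) ^ part lam i) *
    (\<Prod>(i, j)\<in>{(i, j). i < j \<and> j < n}. (x (w i) - t * x (w j)) / (x (w i) - x (w j)))"
 have gF: "?g w \<in> F" if w: "w permutes {..<n}" for w
 proof -
  have out: "?g w a = 0" if "a \<ge> n" for a
  proof -
   have "inv w a = a" using permutes_not_in[OF permutes_inv[OF w], of a] that by auto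
   thus ?thesis using that len by (simp add: part_def)
  qed
  have "{a. ?g w a \<noteq> 0} = w ` {..<length lam}"
  proof -
   have "{a. ?g w a \<noteq> 0} = w ` {i. part lam i \<noteq> 0}" using permutes_inverses[OF w] by (auto simp: image_iff) metis
   also have "{i. part lam i \<noteq> 0} = {..<length lam}" using n0 by (auto simp: part_def in_set_conv_nth)
   finally show ?thesis .
  qed
  moreover have "mset_set (w ` {..<length lam}) = image_mset w (mset_set {..<length lam})"
   by (rule image_mset_mset_set[symmetric]) (use permutes_inj_on[OF w] in auto)
  ultimately have "image_mset (?g w) (mset_set {a. ?g w a \<noteq> 0}) = image_mset (part lam) (mset_set {..<length lam})"
   using permutes_inverses[OF w] by (simp add: multiset.map_comp comp_def)
  also have "... = mset (map (part lam) [0..<length lam])" by (simp add: mset_map lessThan_atLeast0 flip: mset_upt)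
  also have "map (part lam) [0..<length lam] = lam" by (rule nth_equalityI) (auto simp: part_def)
  finally have "image_mset (?g w) (mset_set {a. ?g w a \<noteq> 0}) = mset lam" .
  from shape_eqI[OF srt this[symmetric]] have "shape (?g w) = lam" .
  with out show ?thesis by (auto simp: F_def)
 qed
 have hw: "?h w = (\<Prod>a<n. x a ^ ?g w a) * list_hlb t x (map w [0..<n])" if w: "w permutes {..<n}" for w
 proof -
  have "(\<Prod>i<n. x (w i) ^ part lam i) = (\<Prod>i<n. x (w i) ^ ?g w (w i))" using permutes_inverses[OF w] by simp
  also have "... = (\<Prod>a<n. x a ^ ?g w a)" by (rule prod.reindex_bij_betw[OF permutes_imp_bij[OF w], of "\<lambda>a. x a ^ ?g w a"])
  finally have 1: "(\<Prod>i<n. x (w i) ^ part lam i) = (\<Prod>a<n. x a ^ ?g w a)" .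
  have "distinct (map w [0..<n])" using permutes_inj_on[OF w] by (auto simp: distinct_map)
  from list_hlb_distinct[OF this, of t x]
  have "list_hlb t x (map w [0..<n]) =
    (\<Prod>(i, j)\<in>{(i, j). i < j \<and> j < n}. (x (w i) - t * x (w j)) / (x (w i) - x (w j)))" by (auto simp: hlb_def intro!: prod.cong)
  with 1 show ?thesis by simp
 qed
 \<comment> \<open>A permutation is recorded by its list of values; it induces \<open>f\<close>
   exactly if \<open>f\<close> read along this list is the sorted exponent list
   \<open>pl\<close>.\<close>
 have bij: "bij_betw (\<lambda>w. map w [0..<n]) {w \<in> ?S. ?g w = f} {l. distinct l \<and> set l = {..<n} \<and> map f l = pl}"
  if f: "f \<in> F" for f unfolding bij_betw_def
 proof
  show "inj_on (\<lambda>w. map w [0..<n]) {w \<in> ?S. ?g w = f}"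
  proof (rule inj_onI)
   fix w w' assume a: "w \<in> {w \<in> ?S. ?g w = f}" "w' \<in> {w \<in> ?S. ?g w = f}" "map w [0..<n] = map w' [0..<n]"
   show "w = w'"
   proof
    fix i show "w i = w' i" using a permutes_not_in[of w "{..<n}" i] permutes_not_in[of w' "{..<n}" i] by (cases "i < n") auto
   qed
  qed
  show "(\<lambda>w. map w [0..<n]) ` {w \<in> ?S. ?g w = f} = {l. distinct l \<and> set l = {..<n} \<and> map f l = pl}"
  proof (intro set_eqI iffI)
   fix l assume "l \<in> (\<lambda>w. map w [0..<n]) ` {w \<in> ?S. ?g w = f}"
   then obtain w where w: "w permutes {..<n}" "?g w = f" and l: "l = map w [0..<n]" by auto
   have "f (w i) = part lam i" for i using permutes_inverses[OF w(1)] by (simp flip: w(2))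
   hence "map f l = pl" by (simp add: l pl_def)
   moreover have "set l = w ` {..<n}" by (auto simp: l)
   ultimately show "l \<in> {l. distinct l \<and> set l = {..<n} \<and> map f l = pl}"
    using permutes_inj_on[OF w(1)] permutes_image[OF w(1)] by (auto simp: l distinct_map)
  next
   fix l assume "l \<in> {l. distinct l \<and> set l = {..<n} \<and> map f l = pl}"
   hence l: "distinct l" "set l = {..<n}" "map f l = pl" by auto
   hence ln: "length l = n" using plen by (metis length_map)
   define w where "w i = (if i < n then l ! i else i)" for i
   have "bij_betw (\<lambda>i. l ! i) {..<n} {..<n}" by (rule bij_betw_nth) (simp_all add: l(1,2) ln)
   moreover have "bij_betw (\<lambda>i. l ! i) {..<n} {..<n} = bij_betw w {..<n} {..<n}" by (rule bij_betw_cong) (simp add: w_def)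
   ultimately have "bij_betw w {..<n} {..<n}" by simp
   hence w: "w permutes {..<n}" by (rule bij_imp_permutes) (auto simp: w_def)
   have fw: "f (w i) = part lam i" for i
   proof (cases "i < n")
    case True
    have "f (l ! i) = pl ! i" using l(3) ln True by (metis nth_map)
    thus ?thesis using True by (simp add: w_def pl_def)
   next
    case False
    thus ?thesis using f len by (auto simp: w_def F_def part_def)
   qed
   have "?g w = f"
   proof
    fix a show "?g w a = f a" using fw[of "inv w a"] permutes_inverses(1)[OF w] by simp
   qed
   moreover have "l = map w [0..<n]" by (rule nth_equalityI) (auto simp: ln w_def)
   ultimately show "l \<in> (\<lambda>w. map w [0..<n]) ` {w \<in> ?S. ?g w = f}" using w by blast
  qed
 qed
 have "(\<Sum>w\<in>?S. ?h w) = (\<Sum>f\<in>F. \<Sum>w\<in>{w \<in> ?S. ?g w = f}. ?h w)"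
  by (rule sum.group[symmetric]) (use finF gF finite_permutations[of "{..<n}"] in auto)
 also have "... = (\<Sum>f\<in>F. mult_norm t pl * ((\<Prod>a<n. x a ^ f a) * inv_prod t x {..<n} f))"
 proof (rule sum.cong[OF refl])
  fix f assume f: "f \<in> F"
  have "(\<Sum>w\<in>{w \<in> ?S. ?g w = f}. ?h w) =
    (\<Sum>w\<in>{w \<in> ?S. ?g w = f}. (\<Prod>a<n. x a ^ f a) * list_hlb t x (map w [0..<n]))" by (rule sum.cong[OF refl]) (subst hw, auto)
  also have "... = (\<Prod>a<n. x a ^ f a) * (\<Sum>w\<in>{w \<in> ?S. ?g w = f}. list_hlb t x (map w [0..<n]))" by (simp add: sum_distrib_left)
  also have "(\<Sum>w\<in>{w \<in> ?S. ?g w = f}. list_hlb t x (map w [0..<n])) =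
    (\<Sum>l | distinct l \<and> set l = {..<n} \<and> map f l = pl. list_hlb t x l)" by (rule sum.reindex_bij_betw[OF bij[OF f]])
  also have "... = mult_norm t pl * inv_prod t x {..<n} f" by (rule sum_orderings) (use inj t1 srtpl ms[OF f] in auto)
  finally show "(\<Sum>w\<in>{w \<in> ?S. ?g w = f}. ?h w) =
    mult_norm t pl * ((\<Prod>a<n. x a ^ f a) * inv_prod t x {..<n} f)" by (simp only: mult.left_commute)
 qed
 also have "... = mult_norm t pl * (\<Sum>f\<in>F. (\<Prod>a<n. x a ^ f a) * inv_prod t x {..<n} f)" by (rule sum_distrib_left[symmetric])
 finally have "hl_sym n lam t x =
   1 / mult_norm t pl * (mult_norm t pl * (\<Sum>f\<in>F. (\<Prod>a<n. x a ^ f a) * inv_prod t x {..<n} f))"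
  unfolding hl_sym_def norm by (rule arg_cong)
 thus "hl_sym n lam t x = (\<Sum>f\<in>F. (\<Prod>a<n. x a ^ f a) * inv_prod t x {..<n} f)" using nz norm by simp
qed

section \<open>A partial fraction identity for sums over subsets\<close>

text \<open>Rational functions with at most simple poles, all in \<open>S\<close>, and finite at infinity.\<close>
definition simple_poles :: "complex set \<Rightarrow> (complex \<Rightarrow> complex) \<Rightarrow> bool" where
 "simple_poles S f \<longleftrightarrow> finite S \<and>
   (\<exists>p. degree p \<le> card S \<and> (\<forall>u. u \<notin> S \<longrightarrow> f u * (\<Prod>a\<in>S. u - a) = poly p u))"

lemma simple_poles_const [intro]: "finite S \<Longrightarrow> simple_poles S (\<lambda>_. c)" unfolding simple_poles_def
proof (intro conjI exI[of _ "smult c (\<Prod>a\<in>S. [:- a, 1:])"])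
 assume "finite S"
 have "degree (\<Prod>a\<in>S. [:- a, 1:]) = (\<Sum>a\<in>S. degree [:- a, 1:])" by (rule degree_prod_eq_sum_degree) auto
 thus "degree (smult c (\<Prod>a\<in>S. [:- a, 1:])) \<le> card S" by (intro order_trans[OF degree_smult_le]) simp
qed (auto simp: poly_prod)

lemma simple_poles_add [intro]:
 assumes "simple_poles S f" "simple_poles S g"
 shows "simple_poles S (\<lambda>u. f u + g u)"
proof -
 obtain p q where *: "finite S" "degree p \<le> card S" "\<forall>u. u \<notin> S \<longrightarrow> f u * (\<Prod>a\<in>S. u - a) = poly p u"
  "degree q \<le> card S" "\<forall>u. u \<notin> S \<longrightarrow> g u * (\<Prod>a\<in>S. u - a) = poly q u"
  using assms unfolding simple_poles_def by blast
 thus ?thesis unfolding simple_poles_def by (intro conjI exI[of _ "p + q"]) (auto simp: distrib_right intro: degree_add_le)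
qed

lemma simple_poles_sum:
 assumes "finite S" "\<And>i. i \<in> I \<Longrightarrow> simple_poles S (f i)"
 shows "simple_poles S (\<lambda>u. \<Sum>i\<in>I. f i u)" using assms(2) by (induction I rule: infinite_finite_induct) (auto simp: assms(1))

lemma simple_poles_mult:
 assumes "simple_poles S f" "simple_poles T g" "S \<inter> T = {}"
 shows "simple_poles (S \<union> T) (\<lambda>u. f u * g u)"
proof -
 obtain p q where *: "finite S" "degree p \<le> card S" "\<forall>u. u \<notin> S \<longrightarrow> f u * (\<Prod>a\<in>S. u - a) = poly p u"
  "finite T" "degree q \<le> card T" "\<forall>u. u \<notin> T \<longrightarrow> g u * (\<Prod>a\<in>T. u - a) = poly q u"
  using assms unfolding simple_poles_def by blast
 have "degree (p * q) \<le> card S + card T" using * by (intro order_trans[OF degree_mult_le]) auto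
 moreover have "f u * g u * (\<Prod>a\<in>S \<union> T. u - a) = poly (p * q) u" if "u \<notin> S" "u \<notin> T" for u
 proof -
  have "f u * g u * (\<Prod>a\<in>S \<union> T. u - a) = (f u * (\<Prod>a\<in>S. u - a)) * (g u * (\<Prod>a\<in>T. u - a))"
   using * assms(3) by (simp add: prod.union_disjoint)
  thus ?thesis using * that by simp
 qed
 ultimately show ?thesis using * assms(3) unfolding simple_poles_def by (intro conjI exI[of _ "p * q"]) (auto simp: card_Un_disjoint)
qed

lemma simple_poles_mono:
 assumes "simple_poles S f" "S \<subseteq> T" "finite T"
 shows "simple_poles T f"
proof -
 have "simple_poles (S \<union> (T - S)) (\<lambda>u. f u * 1)" by (rule simple_poles_mult) (use assms in auto)
 thus ?thesis using assms(2) by (simp add: Un_absorb1)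
qed

lemma simple_poles_prod:
 assumes "finite I" "\<And>i. i \<in> I \<Longrightarrow> simple_poles (S i) (f i)"
  and "\<And>i j. i \<in> I \<Longrightarrow> j \<in> I \<Longrightarrow> i \<noteq> j \<Longrightarrow> S i \<inter> S j = {}"
 shows "simple_poles (\<Union>i\<in>I. S i) (\<lambda>u. \<Prod>i\<in>I. f i u)" using assms
proof (induction I rule: finite_induct)
 case empty
 show ?case by (simp add: simple_poles_const)
next
 case (insert i I)
 have "simple_poles (S i \<union> (\<Union>j\<in>I. S j)) (\<lambda>u. f i u * (\<Prod>j\<in>I. f j u))"
 proof (rule simple_poles_mult)
  show "S i \<inter> (\<Union>j\<in>I. S j) = {}" using insert by fastforce
 qed (use insert in auto)
 thus ?case using insert by simp
qed

lemma simple_poles_linear_frac: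
 assumes "\<And>u. u \<noteq> a \<Longrightarrow> f u = (\<alpha> + \<beta> * u) / (\<gamma> * (u - a))"
 shows "simple_poles {a} f" unfolding simple_poles_def
proof (intro conjI exI[of _ "[:\<alpha> / \<gamma>, \<beta> / \<gamma>:]"])
 show "\<forall>u. u \<notin> {a} \<longrightarrow> f u * (\<Prod>a\<in>{a}. u - a) = poly [:\<alpha> / \<gamma>, \<beta> / \<gamma>:] u"
  using assms by (cases "\<gamma> = 0") (auto simp: field_simps)
qed auto

text \<open>Vanishing residues make the numerator polynomial vanish on all of \<open>S\<close>.
  Since a constant at infinity is allowed, its degree may be \<open>card S\<close>, so one further
  zero \<open>z\<close> outside \<open>S\<close> is needed to force it to be 0.\<close>

lemma simple_poles_eq_0:
 assumes sp: "simple_poles S f" and z: "z \<notin> S" "f z = 0"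
  and lim: "\<And>a. a \<in> S \<Longrightarrow> ((\<lambda>u. (u - a) * f u) \<longlongrightarrow> 0) (at a)"
  and u: "u \<notin> S"
 shows "f u = 0"
proof -
 obtain p where p: "finite S" "degree p \<le> card S" "\<And>u. u \<notin> S \<Longrightarrow> f u * (\<Prod>a\<in>S. u - a) = poly p u"
  using sp unfolding simple_poles_def by blast
 have root: "poly p a = 0" if a: "a \<in> S" for a
 proof -
  have "((\<lambda>u. (u - a) * f u * (\<Prod>c\<in>S - {a}. u - c)) \<longlongrightarrow> 0 * (\<Prod>c\<in>S - {a}. a - c)) (at a)"
   by (intro tendsto_mult lim[OF a] tendsto_prod tendsto_intros)
  moreover have "eventually (\<lambda>u. (u - a) * f u * (\<Prod>c\<in>S - {a}. u - c) = poly p u) (at a)"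
  proof -
   have "eventually (\<lambda>u. u \<in> - (S - {a})) (at a)"
    by (rule eventually_at_in_open') (use p(1) in \<open>auto simp del: Compl_Diff_eq intro: finite_imp_closed\<close>)
   moreover have "eventually (\<lambda>u. u \<noteq> a) (at a)" by (simp add: eventually_at_filter)
   ultimately show ?thesis
   proof eventually_elim
    case (elim u)
    hence "u \<notin> S" by auto
    have "poly p u = f u * (\<Prod>c\<in>S. u - c)" using p(3)[OF \<open>u \<notin> S\<close>] by simp
    also have "(\<Prod>c\<in>S. u - c) = (u - a) * (\<Prod>c\<in>S - {a}. u - c)" by (rule prod.remove[OF p(1) a])
    finally show ?case by simp
   qed
  qed
  ultimately have "(poly p \<longlongrightarrow> 0 * (\<Prod>c\<in>S - {a}. a - c)) (at a)" by (rule Lim_transform_eventually)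
  hence "(poly p \<longlongrightarrow> 0) (at a)" by simp
  moreover have "(poly p \<longlongrightarrow> poly p a) (at a)" using poly_isCont isCont_def by blast
  ultimately show ?thesis using LIM_unique by blast
 qed
 have "p = 0"
 proof (rule poly_eqI_degree[of "insert z S"])
  fix c assume "c \<in> insert z S"
  thus "poly p c = poly 0 c" using root p(3)[OF z(1)] z by auto
 qed (use p z in auto)
 thus ?thesis using p(3)[OF u] u p(1) by auto
qed

section \<open>Products over pairs and the Littlewood product\<close>

definition pair_prod :: "nat set \<Rightarrow> (nat \<Rightarrow> nat \<Rightarrow> complex) \<Rightarrow> complex" where
 "pair_prod A g = (\<Prod>(i, j)\<in>{(i, j). i \<in> A \<and> j \<in> A \<and> i < j}. g i j)"

lemma pair_prod_empty [simp]: "pair_prod {} g = 1" by (simp add: pair_prod_def)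

lemma pair_prod_insert:
 assumes "finite A" "a \<notin> A" "\<And>i j. g i j = g j i"
 shows "pair_prod (insert a A) g = (\<Prod>l\<in>A. g a l) * pair_prod A g"
proof -
 let ?P = "\<lambda>A. {(i, j). i \<in> A \<and> j \<in> A \<and> i < j}"
 let ?Q = "(\<lambda>l. if a < l then (a, l) else (l, a)) ` A"
 have P: "?P (insert a A) = ?Q \<union> ?P A"
 proof (intro set_eqI iffI)
  fix z assume "z \<in> ?P (insert a A)"
  then obtain i j where z: "z = (i, j)" "i \<in> insert a A" "j \<in> insert a A" "i < j" by auto
  consider "i = a" "j \<in> A" | "j = a" "i \<in> A" | "i \<in> A" "j \<in> A" using z by auto
  thus "z \<in> ?Q \<union> ?P A"
  proof cases
   case 2
   hence "i = (if a < i then a else i)" "a = (if a < i then i else a)" "\<not> a < i" using z by auto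
   thus ?thesis using 2 z by (auto simp: image_iff)
  qed (use z in \<open>auto simp: image_iff\<close>)
 next
  fix z assume "z \<in> ?Q \<union> ?P A"
  thus "z \<in> ?P (insert a A)"
  proof
   assume "z \<in> ?Q"
   then obtain l where l: "l \<in> A" "z = (if a < l then (a, l) else (l, a))" by auto
   moreover have "l \<noteq> a" using l assms(2) by auto
   ultimately show ?thesis by (cases "a < l") auto
  qed auto
 qed
 have fin: "finite (?P A)" by (rule finite_subset[of _ "A \<times> A"]) (use assms in auto)
 have "pair_prod (insert a A) g = prod (\<lambda>(i, j). g i j) ?Q * prod (\<lambda>(i, j). g i j) (?P A)"
  unfolding pair_prod_def P using fin assms by (intro prod.union_disjoint) auto
 also have "prod (\<lambda>(i, j). g i j) ?Q = (\<Prod>l\<in>A. g a l)"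
 proof (subst prod.reindex)
  show "inj_on (\<lambda>l. if a < l then (a, l) else (l, a)) A" by (auto simp: inj_on_def split: if_splits)
  show "prod ((\<lambda>(i, j). g i j) \<circ> (\<lambda>l. if a < l then (a, l) else (l, a))) A = (\<Prod>l\<in>A. g a l)"
   by (rule prod.cong) (simp_all add: assms(3)[of _ a])
 qed
 finally show ?thesis by (simp add: pair_prod_def)
qed

lemma pair_prod_Un:
 assumes "finite A" "finite B" "A \<inter> B = {}" "\<And>i j. g i j = g j i"
 shows "pair_prod (A \<union> B) g = pair_prod A g * pair_prod B g * (\<Prod>i\<in>A. \<Prod>j\<in>B. g i j)" using assms(1,3)
proof (induction A rule: finite_induct)
 case (insert a A)
 have "pair_prod (insert a A \<union> B) g = pair_prod (insert a (A \<union> B)) g" by simp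
 also have "... = (\<Prod>l\<in>A \<union> B. g a l) * pair_prod (A \<union> B) g" by (rule pair_prod_insert) (use insert assms in auto)
 also have "(\<Prod>l\<in>A \<union> B. g a l) = (\<Prod>l\<in>A. g a l) * (\<Prod>l\<in>B. g a l)"
  by (rule prod.union_disjoint) (use insert assms in auto)
 finally show ?case using insert assms by (simp add: pair_prod_insert)
qed simp

definition lw_factor :: "complex \<Rightarrow> complex \<Rightarrow> complex \<Rightarrow> complex" where
 "lw_factor t u v = (1 - t * u * v) / (1 - u * v)"

text \<open>The product side of the unbounded Littlewood identity for partitions with even parts, in
  the variables \<open>y i\<close> with \<open>i\<close> in \<open>A\<close>.\<close>

definition lw_phi :: "complex \<Rightarrow> (nat \<Rightarrow> complex) \<Rightarrow> nat set \<Rightarrow> complex" where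
 "lw_phi t y A = (\<Prod>i\<in>A. 1 / (1 - (y i)\<^sup>2)) * pair_prod A (\<lambda>i j. lw_factor t (y i) (y j))"

lemma lw_factor_commute: "lw_factor t u v = lw_factor t v u" by (simp add: lw_factor_def mult.commute mult.left_commute)

lemma lw_phi_insert:
 assumes "finite A" "a \<notin> A"
 shows "lw_phi t y (insert a A) =
   1 / (1 - (y a)\<^sup>2) * (\<Prod>l\<in>A. lw_factor t (y a) (y l)) * lw_phi t y A"
proof -
 have "pair_prod (insert a A) (\<lambda>i j. lw_factor t (y i) (y j)) =
   (\<Prod>l\<in>A. lw_factor t (y a) (y l)) * pair_prod A (\<lambda>i j. lw_factor t (y i) (y j))"
  by (rule pair_prod_insert) (use assms in \<open>auto intro: lw_factor_commute\<close>)
 thus ?thesis using assms by (simp add: lw_phi_def)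
qed

lemma lw_phi_cong: "(\<And>i. i \<in> A \<Longrightarrow> y i = y' i) \<Longrightarrow> lw_phi t y A = lw_phi t y' A"
 by (auto simp: lw_phi_def pair_prod_def intro!: arg_cong2[of _ _ _ _ "(*)"] prod.cong)

text \<open>\<open>T\<close> stands for the set of variables whose exponent in the unbounded sum is
  positive: each contributes a square, the excess is summed up again by \<open>lw_phi t y T\<close>,
  and each exponent exceeds those outside \<open>T\<close>.\<close>

definition lw_weight :: "complex \<Rightarrow> (nat \<Rightarrow> complex) \<Rightarrow> nat set \<Rightarrow> nat set \<Rightarrow> complex" where
 "lw_weight t y A T =
   (\<Prod>j\<in>T. (y j)\<^sup>2) * lw_phi t y T * (\<Prod>j\<in>T. \<Prod>i\<in>A - T. hlb t (y j) (y i))"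

lemma sum_Pow_insert:
 fixes g :: "'a set \<Rightarrow> 'b::comm_monoid_add"
 assumes "finite A" "a \<notin> A"
 shows "(\<Sum>T\<in>Pow (insert a A). g T) = (\<Sum>T\<in>Pow A. g T + g (insert a T))"
proof -
 have inj: "inj_on (insert a) (Pow A)"
 proof (rule inj_onI)
  fix S T assume "S \<in> Pow A" "T \<in> Pow A" "insert a S = insert a T"
  thus "S = T" using assms(2) by (metis PowD insert_ident subsetD)
 qed
 have "(\<Sum>T\<in>Pow (insert a A). g T) = (\<Sum>T\<in>Pow A. g T) + (\<Sum>T\<in>insert a ` Pow A. g T)"
  unfolding Pow_insert by (rule sum.union_disjoint) (use assms in auto)
 also have "(\<Sum>T\<in>insert a ` Pow A. g T) = (\<Sum>T\<in>Pow A. g (insert a T))" by (simp add: sum.reindex[OF inj])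
 finally show ?thesis by (simp add: sum.distrib)
qed

lemma lw_weight_same:
 assumes "finite B" "n \<notin> B" "T \<subseteq> B"
 shows "lw_weight t y (insert n B) T = (\<Prod>j\<in>T. hlb t (y j) (y n)) * lw_weight t y B T"
proof -
 have "insert n B - T = insert n (B - T)" using assms by auto
 moreover have "n \<notin> B - T" "finite (B - T)" using assms by auto
 ultimately show ?thesis by (simp add: lw_weight_def prod.distrib)
qed

lemma lw_weight_insert:
 assumes "finite B" "n \<notin> B" "T \<subseteq> B"
 shows "lw_weight t y (insert n B) (insert n T) =
   (y n)\<^sup>2 / (1 - (y n)\<^sup>2) * (\<Prod>l\<in>T. lw_factor t (y n) (y l)) * (\<Prod>i\<in>B - T. hlb t (y n) (y i)) *
   lw_weight t y B T"
proof -
 have "insert n B - insert n T = B - T" "finite T" "n \<notin> T" using assms by (auto intro: finite_subset)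
 thus ?thesis by (simp add: lw_weight_def lw_phi_insert)
qed

section \<open>Poles and residues in a single variable\<close>

lemma simple_poles_hlb1: "simple_poles {v} (\<lambda>u. hlb t u v)" by (rule simple_poles_linear_frac[of _ _ "- t * v" 1 1]) (simp add: hlb_def)

lemma simple_poles_hlb2: "simple_poles {v} (\<lambda>u. hlb t v u)"
proof (rule simple_poles_linear_frac[of _ _ v "- t" "- 1"])
 fix u assume "u \<noteq> v"
 thus "hlb t v u = (v + - t * u) / (- 1 * (u - v))" by (simp add: hlb_def divide_simps algebra_simps)
qed

lemma simple_poles_lw_factor: "v \<noteq> 0 \<Longrightarrow> simple_poles {1 / v} (\<lambda>u. lw_factor t u v)"
proof (rule simple_poles_linear_frac[of _ _ 1 "- t * v" "- v"])
 fix u assume "v \<noteq> 0"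
 thus "lw_factor t u v = (1 + - t * v * u) / (- v * (u - 1 / v))" by (simp add: lw_factor_def algebra_simps)
qed

lemma simple_poles_square:
 assumes "\<And>u. f u = (\<alpha> + \<beta> * u\<^sup>2) / (1 - u\<^sup>2)"
 shows "simple_poles {1, -1} f" unfolding simple_poles_def
proof (intro conjI exI[of _ "- [:\<alpha>, 0, \<beta>:]"] allI impI)
 fix u :: complex assume "u \<notin> {1, -1}"
 hence "1 - u\<^sup>2 \<noteq> 0" by (auto simp: power2_eq_1_iff)
 moreover have pe: "(\<Prod>a\<in>{1, -1}. u - a) = - (1 - u\<^sup>2)" by (simp add: power2_eq_square algebra_simps)
 moreover have "x / w * - w = - x" if "w \<noteq> 0" for x w :: complex using that by simp
 ultimately have "f u * (\<Prod>a\<in>{1, -1}. u - a) = - (\<alpha> + \<beta> * u\<^sup>2)" unfolding assms pe by blast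
 also have "... = poly (- [:\<alpha>, 0, \<beta>:]) u" by (simp add: power2_eq_square)
 finally show "f u * (\<Prod>a\<in>{1, -1}. u - a) = poly (- [:\<alpha>, 0, \<beta>:]) u" .
qed auto

text \<open>The difference of the two sides, as a function of the variable \<open>u = y n\<close> alone.\<close>
definition lw_diff :: "complex \<Rightarrow> (nat \<Rightarrow> complex) \<Rightarrow> nat set \<Rightarrow> complex \<Rightarrow> complex" where
 "lw_diff t y B u =
   1 / (1 - u\<^sup>2) * (\<Prod>l\<in>B. lw_factor t u (y l)) * lw_phi t y B -
   (\<Sum>T\<in>Pow B. (u\<^sup>2 / (1 - u\<^sup>2) * (\<Prod>l\<in>T. lw_factor t u (y l)) * (\<Prod>i\<in>B - T. hlb t u (y i)) +
    (\<Prod>j\<in>T. hlb t (y j) u)) * lw_weight t y B T)"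

text \<open>Genericity keeps the points 1, -1, \<open>y i\<close> and \<open>1 / y i\<close> apart,
  so that all poles below are simple; the case \<open>i = j\<close> of the last condition excludes
  \<open>y i = 1\<close> and \<open>y i = - 1\<close>.\<close>

definition lw_generic :: "(nat \<Rightarrow> complex) \<Rightarrow> nat set \<Rightarrow> bool" where
 "lw_generic y A \<longleftrightarrow> finite A \<and> inj_on y A \<and> (\<forall>i\<in>A. y i \<noteq> 0) \<and> (\<forall>i\<in>A. \<forall>j\<in>A. y i * y j \<noteq> 1)"

definition lw_poles :: "(nat \<Rightarrow> complex) \<Rightarrow> nat set \<Rightarrow> complex set" where
 "lw_poles y B = {1, -1} \<union> y ` B \<union> (\<lambda>i. 1 / y i) ` B"

lemma lw_genericD:
 assumes "lw_generic y B" "i \<in> B"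
 shows "y i \<noteq> 0" "y i \<noteq> 1" "y i \<noteq> - 1" "1 / y i \<noteq> 1" "1 / y i \<noteq> - 1" "(y i)\<^sup>2 \<noteq> 1"
  "j \<in> B \<Longrightarrow> y j \<noteq> 1 / y i" "j \<in> B \<Longrightarrow> y i * y j \<noteq> 1" "j \<in> B \<Longrightarrow> y i = y j \<Longrightarrow> i = j"
  "j \<in> B \<Longrightarrow> 1 / y j \<noteq> y i"
proof -
 show a: "y i \<noteq> 0" "(y i)\<^sup>2 \<noteq> 1" using assms by (auto simp: lw_generic_def power2_eq_square)
 show "y i \<noteq> 1" "y i \<noteq> - 1" using a by auto
 have "y i \<noteq> - 1" using a(2) by (metis power2_minus power_one)
 thus "1 / y i \<noteq> - 1" using a by (auto simp: divide_simps minus_equation_iff)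
 show "1 / y i \<noteq> 1" using a by (auto simp: divide_simps)
 show *: "j \<in> B \<Longrightarrow> y i * y j \<noteq> 1" "j \<in> B \<Longrightarrow> y i = y j \<Longrightarrow> i = j"
  using assms by (auto simp: lw_generic_def inj_on_def)
 thus "j \<in> B \<Longrightarrow> y j \<noteq> 1 / y i" using a by (auto simp: divide_simps mult.commute)
 show "j \<in> B \<Longrightarrow> 1 / y j \<noteq> y i" using *(1) assms by (auto simp: lw_generic_def divide_simps)
qed

lemma lw_generic_subset: "lw_generic y A \<Longrightarrow> B \<subseteq> A \<Longrightarrow> lw_generic y B"
 unfolding lw_generic_def by (auto intro: finite_subset inj_on_subset)

text \<open>In each product the factors have simple poles in pairwise disjoint sets: 1 and -1, the
  points \<open>1 / y l\<close> with \<open>l\<close> in \<open>T\<close>, and the points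
  \<open>y i\<close> with \<open>i\<close> outside \<open>T\<close>.\<close>

lemma simple_poles_lw_diff:
 assumes g: "lw_generic y B"
 shows "simple_poles (lw_poles y B) (lw_diff t y B)"
proof -
 let ?S = "lw_poles y B"
 have fin: "finite B" "finite ?S" using g by (auto simp: lw_generic_def lw_poles_def)
 note gD = lw_genericD[OF g]
 have c: "simple_poles (\<Union>l\<in>T. {1 / y l}) (\<lambda>u. \<Prod>l\<in>T. lw_factor t u (y l))" if T: "T \<subseteq> B" for T
 proof (rule simple_poles_prod)
  show "finite T" using T fin(1) by (rule finite_subset)
  show "simple_poles {1 / y l} (\<lambda>u. lw_factor t u (y l))" if "l \<in> T" for l by (rule simple_poles_lw_factor) (use gD(1) T that in auto)
  show "{1 / y i} \<inter> {1 / y j} = {}" if "i \<in> T" "j \<in> T" "i \<noteq> j" for i j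
  proof -
   have "y i \<noteq> y j" using gD(9)[of i j] T that by auto
   thus ?thesis by simp
  qed
 qed
 have disj: "{y i} \<inter> {y j} = {}" if "i \<in> B" "j \<in> B" "i \<noteq> j" for i j using gD(9)[of i j] that by auto
 have h: "simple_poles (\<Union>i\<in>B - T. {y i}) (\<lambda>u. \<Prod>i\<in>B - T. hlb t u (y i))" for T
  by (rule simple_poles_prod) (use fin disj simple_poles_hlb1 in blast)+
 have h2: "simple_poles (\<Union>i\<in>T. {y i}) (\<lambda>u. \<Prod>i\<in>T. hlb t (y i) u)" if T: "T \<subseteq> B" for T
 proof (rule simple_poles_prod)
  show "finite T" using T fin(1) by (rule finite_subset)
 qed (use T disj simple_poles_hlb2 in blast)+
 have s1: "simple_poles {1, -1} (\<lambda>u. 1 / (1 - u\<^sup>2))" by (rule simple_poles_square[of _ 1 0]) simp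
 have s2: "simple_poles {1, -1} (\<lambda>u. u\<^sup>2 / (1 - u\<^sup>2))" by (rule simple_poles_square[of _ 0 1]) simp
 have const: "simple_poles ?S (\<lambda>u. f u * k)" if "simple_poles ?S f" for f k
  using simple_poles_mult[OF that simple_poles_const[OF finite.emptyI, of k]] by simp
 have d1: "{1, -1} \<inter> (\<Union>l\<in>T. {1 / y l}) = {}" if T: "T \<subseteq> B" for T
 proof (intro equals0I)
  fix z assume "z \<in> {1, -1} \<inter> (\<Union>l\<in>T. {1 / y l})"
  then obtain l where "l \<in> T" "z = 1 / y l" "z = 1 \<or> z = - 1" by blast
  thus False using gD(4)[of l] gD(5)[of l] T by (metis subsetD)
 qed
 have d2: "({1, -1} \<union> (\<Union>l\<in>T. {1 / y l})) \<inter> (\<Union>i\<in>B - T. {y i}) = {}" if T: "T \<subseteq> B" for T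
 proof (intro equals0I)
  fix z assume "z \<in> ({1, -1} \<union> (\<Union>l\<in>T. {1 / y l})) \<inter> (\<Union>i\<in>B - T. {y i})"
  then obtain i where i: "i \<in> B" "z = y i" "z = 1 \<or> z = - 1 \<or> (\<exists>l\<in>T. z = 1 / y l)" by blast
  thus False using gD(2)[of i] gD(3)[of i] gD(10)[of i] T by (metis subsetD)
 qed
 have sub: "{1, -1} \<union> (\<Union>l\<in>T. {1 / y l}) \<subseteq> ?S" "(\<Union>i\<in>B - T. {y i}) \<subseteq> ?S" if "T \<subseteq> B" for T
  using that by (auto simp: lw_poles_def)
 have 1: "simple_poles ?S (\<lambda>u. 1 / (1 - u\<^sup>2) * (\<Prod>l\<in>B. lw_factor t u (y l)))"
  by (rule simple_poles_mono[OF simple_poles_mult[OF s1 c[OF subset_refl] d1[OF subset_refl]] sub(1)[OF subset_refl] fin(2)])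
 have 2: "simple_poles ?S (\<lambda>u. u\<^sup>2 / (1 - u\<^sup>2) * (\<Prod>l\<in>T. lw_factor t u (y l)) * (\<Prod>i\<in>B - T. hlb t u (y i)))"
  if T: "T \<subseteq> B" for T by (rule simple_poles_mono[OF simple_poles_mult[OF simple_poles_mult[OF s2 c[OF T] d1[OF T]] h d2[OF T]] _ fin(2)])
    (intro Un_least[OF sub(1)[OF T] sub(2)[OF T]])
 have 3: "simple_poles ?S (\<lambda>u. \<Prod>i\<in>T. hlb t (y i) u)" if T: "T \<subseteq> B" for T
  by (rule simple_poles_mono[OF h2[OF T]]) (use T fin in \<open>auto simp: lw_poles_def\<close>)
 have "simple_poles ?S (\<lambda>u. 1 / (1 - u\<^sup>2) * (\<Prod>l\<in>B. lw_factor t u (y l)) * lw_phi t y B +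
   (\<Sum>T\<in>Pow B. (u\<^sup>2 / (1 - u\<^sup>2) * (\<Prod>l\<in>T. lw_factor t u (y l)) * (\<Prod>i\<in>B - T. hlb t u (y i)) +
    (\<Prod>j\<in>T. hlb t (y j) u)) * lw_weight t y B T) * - 1)" by (intro simple_poles_add const simple_poles_sum fin 1 2 3) auto
 also have "(\<lambda>u. 1 / (1 - u\<^sup>2) * (\<Prod>l\<in>B. lw_factor t u (y l)) * lw_phi t y B +
   (\<Sum>T\<in>Pow B. (u\<^sup>2 / (1 - u\<^sup>2) * (\<Prod>l\<in>T. lw_factor t u (y l)) * (\<Prod>i\<in>B - T. hlb t u (y i)) +
    (\<Prod>j\<in>T. hlb t (y j) u)) * lw_weight t y B T) * - 1) = lw_diff t y B"
  unfolding lw_diff_def by (rule ext) (simp only: mult_minus1_right add_uminus_conv_diff)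
 finally show ?thesis .
qed

lemma tendsto_hlb1: "(f \<longlongrightarrow> a) F \<Longrightarrow> a \<noteq> v \<Longrightarrow> ((\<lambda>u. hlb t (f u) v) \<longlongrightarrow> hlb t a v) F"
 unfolding hlb_def by (auto intro!: tendsto_intros)
lemma tendsto_hlb2: "(f \<longlongrightarrow> a) F \<Longrightarrow> a \<noteq> v \<Longrightarrow> ((\<lambda>u. hlb t v (f u)) \<longlongrightarrow> hlb t v a) F"
 unfolding hlb_def by (auto intro!: tendsto_intros)
lemma tendsto_lw_factor: "(f \<longlongrightarrow> a) F \<Longrightarrow> a * v \<noteq> 1 \<Longrightarrow> ((\<lambda>u. lw_factor t (f u) v) \<longlongrightarrow> lw_factor t a v) F"
 unfolding lw_factor_def by (auto intro!: tendsto_intros)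

text \<open>Inverting a variable exchanges the two kinds of factors. The cancellation of residues
  and the effect of sign changes both rest on this.\<close>

lemma hlb_eq_lw_factor: "a \<noteq> 0 \<Longrightarrow> hlb t (1 / a) v = lw_factor t a v"
proof -
 assume a: "a \<noteq> 0"
 have "hlb t (1 / a) v = (a * (1 / a - t * v)) / (a * (1 / a - v))" using a unfolding hlb_def by (subst nonzero_mult_divide_mult_cancel_left) auto
 also have "... = lw_factor t a v" using a by (simp add: lw_factor_def algebra_simps)
 finally show ?thesis .
qed

lemma tendsto_pole_mult:
 fixes p h :: "complex \<Rightarrow> complex"
 assumes "((\<lambda>u. (u - a) * p u) \<longlongrightarrow> r) (at a)" "(h \<longlongrightarrow> l) (at a)"
 shows "((\<lambda>u. (u - a) * (p u * h u)) \<longlongrightarrow> r * l) (at a)" using tendsto_mult[OF assms] by (simp add: mult.assoc)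

lemma tendsto_no_pole:
 fixes h :: "complex \<Rightarrow> complex"
 assumes "(h \<longlongrightarrow> l) (at a)"
 shows "((\<lambda>u. (u - a) * h u) \<longlongrightarrow> 0) (at a)"
proof -
 have "((\<lambda>u. (u - a) * h u) \<longlongrightarrow> (a - a) * l) (at a)" by (intro tendsto_intros assms)
 thus ?thesis by simp
qed

lemma tendsto_at_eqI:
 fixes f g :: "complex \<Rightarrow> complex"
 assumes "(g \<longlongrightarrow> l) (at a)" "open S" "a \<in> S" "\<And>u. u \<in> S \<Longrightarrow> u \<noteq> a \<Longrightarrow> g u = f u"
 shows "(f \<longlongrightarrow> l) (at a)"
proof (rule Lim_transform_eventually[OF assms(1)])
 have "eventually (\<lambda>u. u \<in> S) (at a)" by (rule eventually_at_in_open') (use assms in auto)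
 moreover have "eventually (\<lambda>u. u \<noteq> a) (at a)" by (simp add: eventually_at_filter)
 ultimately show "eventually (\<lambda>u. g u = f u) (at a)" by eventually_elim (use assms(4) in auto)
qed

lemma tendsto_pole_square:
 fixes a :: complex
 assumes a: "a\<^sup>2 = 1"
 shows "((\<lambda>u. (u - a) * (1 / (1 - u\<^sup>2))) \<longlongrightarrow> - 1 / (a + a)) (at a)"
proof (rule tendsto_at_eqI[of "\<lambda>u. - 1 / (u + a)" _ _ "- {- a}"])
 have "a \<noteq> 0" using a by auto
 hence "a + a \<noteq> 0" by simp
 thus "((\<lambda>u. - 1 / (u + a)) \<longlongrightarrow> - 1 / (a + a)) (at a)" by (intro tendsto_intros)
 show "a \<in> - {- a}" using \<open>a + a \<noteq> 0\<close> by (auto simp: eq_neg_iff_add_eq_0)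
next
 fix u assume "u \<in> - {- a}" "u \<noteq> a"
 hence "u + a \<noteq> 0" "u - a \<noteq> 0" by (auto simp: eq_neg_iff_add_eq_0)
 moreover have "1 - u\<^sup>2 = - ((u - a) * (u + a))" using a by (simp add: algebra_simps power2_eq_square)
 ultimately show "- 1 / (u + a) = (u - a) * (1 / (1 - u\<^sup>2))" by simp
qed auto

lemma tendsto_pole_hlb1: "((\<lambda>u. (u - v) * hlb t u v) \<longlongrightarrow> (1 - t) * v) (at v)"
proof (rule tendsto_at_eqI[of "\<lambda>u. u - t * v" _ _ UNIV])
 have "((\<lambda>u. u - t * v) \<longlongrightarrow> v - t * v) (at v)" by (intro tendsto_intros)
 thus "((\<lambda>u. u - t * v) \<longlongrightarrow> (1 - t) * v) (at v)" by (simp add: algebra_simps)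
qed (auto simp: hlb_def)

lemma tendsto_pole_hlb2: "((\<lambda>u. (u - v) * hlb t v u) \<longlongrightarrow> - (1 - t) * v) (at v)"
proof (rule tendsto_at_eqI[of "\<lambda>u. - (v - t * u)" _ _ UNIV])
 have "((\<lambda>u. - (v - t * u)) \<longlongrightarrow> - (v - t * v)) (at v)" by (intro tendsto_intros)
 thus "((\<lambda>u. - (v - t * u)) \<longlongrightarrow> - (1 - t) * v) (at v)" by (simp add: algebra_simps)
next
 fix u assume "u \<noteq> v"
 thus "- (v - t * u) = (u - v) * hlb t v u" by (simp add: hlb_def divide_simps) (simp add: algebra_simps)
qed auto

lemma tendsto_pole_lw_factor:
 assumes v: "v \<noteq> 0"
 shows "((\<lambda>u. (u - 1 / v) * lw_factor t u v) \<longlongrightarrow> - (1 - t) / v) (at (1 / v))"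
proof (rule tendsto_at_eqI[of "\<lambda>u. - (1 - t * u * v) / v" _ _ UNIV])
 have "((\<lambda>u. - (1 - t * u * v) / v) \<longlongrightarrow> - (1 - t * (1 / v) * v) / v) (at (1 / v))" using v by (intro tendsto_intros)
 thus "((\<lambda>u. - (1 - t * u * v) / v) \<longlongrightarrow> - (1 - t) / v) (at (1 / v))" using v by simp
next
 fix u assume "u \<noteq> 1 / v"
 hence "1 - u * v \<noteq> 0" using v by (auto simp: divide_simps)
 thus "- (1 - t * u * v) / v = (u - 1 / v) * lw_factor t u v" using v by (simp add: lw_factor_def divide_simps) (simp add: algebra_simps)
qed auto

lemma lw_diff_tendsto:
 assumes "((\<lambda>u. (u - a) * (1 / (1 - u\<^sup>2) * (\<Prod>l\<in>B. lw_factor t u (y l)))) \<longlongrightarrow> KA) (at a)"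
  and "\<And>T. T \<subseteq> B \<Longrightarrow> ((\<lambda>u. (u - a) *
    (u\<^sup>2 / (1 - u\<^sup>2) * (\<Prod>l\<in>T. lw_factor t u (y l)) * (\<Prod>i\<in>B - T. hlb t u (y i)))) \<longlongrightarrow> KB T) (at a)"
  and "\<And>T. T \<subseteq> B \<Longrightarrow> ((\<lambda>u. (u - a) * (\<Prod>j\<in>T. hlb t (y j) u)) \<longlongrightarrow> KC T) (at a)"
  and "KA * lw_phi t y B = (\<Sum>T\<in>Pow B. (KB T + KC T) * lw_weight t y B T)"
 shows "((\<lambda>u. (u - a) * lw_diff t y B u) \<longlongrightarrow> 0) (at a)"
proof -
 let ?f0 = "\<lambda>u. 1 / (1 - u\<^sup>2) * (\<Prod>l\<in>B. lw_factor t u (y l))"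
 let ?f1 = "\<lambda>T u. u\<^sup>2 / (1 - u\<^sup>2) * (\<Prod>l\<in>T. lw_factor t u (y l)) * (\<Prod>i\<in>B - T. hlb t u (y i))"
 let ?f2 = "\<lambda>T u. \<Prod>j\<in>T. hlb t (y j) u"
 have "((\<lambda>u. ((u - a) * ?f0 u) * lw_phi t y B -
   (\<Sum>T\<in>Pow B. ((u - a) * ?f1 T u + (u - a) * ?f2 T u) * lw_weight t y B T)) \<longlongrightarrow>
   KA * lw_phi t y B - (\<Sum>T\<in>Pow B. (KB T + KC T) * lw_weight t y B T)) (at a)"
  by (intro tendsto_diff tendsto_mult tendsto_sum tendsto_add tendsto_const assms(1,2,3)) auto
 moreover have "((u - a) * ?f0 u) * lw_phi t y B -
   (\<Sum>T\<in>Pow B. ((u - a) * ?f1 T u + (u - a) * ?f2 T u) * lw_weight t y B T) =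
   (u - a) * lw_diff t y B u" for u unfolding lw_diff_def right_diff_distrib sum_distrib_left
  by (intro arg_cong2[of _ _ _ _ "(-)"] sum.cong refl) (simp_all only: distrib_left distrib_right mult.assoc)
 ultimately show ?thesis using assms(4) by simp
qed

text \<open>At a point with \<open>a = 1 / a\<close> both kinds of factors coincide. Hence every
  \<open>T\<close> has the same residue apart from its weight, and the weights sum to
  \<open>lw_phi t y B\<close> by the induction hypothesis.\<close>

lemma lw_diff_pole_unit:
 assumes g: "lw_generic y B" and IH: "(\<Sum>T\<in>Pow B. lw_weight t y B T) = lw_phi t y B"
  and a: "a = 1 \<or> a = - 1"
 shows "((\<lambda>u. (u - a) * lw_diff t y B u) \<longlongrightarrow> 0) (at a)"
proof -
 note gD = lw_genericD[OF g]
 have fin: "finite B" using g by (auto simp: lw_generic_def)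
 have a2: "a\<^sup>2 = 1" "a \<noteq> 0" "1 / a = a" "a + a \<noteq> 0" using a by auto
 have ne: "a \<noteq> y l" "a * y l \<noteq> 1" if "l \<in> B" for l using gD(2,3)[OF that] a by (auto simp: minus_equation_iff)
 define L where "L = - 1 / (a + a) * (\<Prod>l\<in>B. lw_factor t a (y l))"
 have eq: "(\<Prod>l\<in>T. lw_factor t a (y l)) * (\<Prod>i\<in>B - T. hlb t a (y i)) = (\<Prod>l\<in>B. lw_factor t a (y l))"
   if "T \<subseteq> B" for T
 proof -
  have "hlb t a v = lw_factor t a v" for v using hlb_eq_lw_factor[of a t v] a2 by simp
  thus ?thesis using prod.subset_diff[OF that fin, of "\<lambda>l. lw_factor t a (y l)"] by (simp add: mult.commute)
 qed
 show ?thesis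
 proof (rule lw_diff_tendsto[where KA = L and KB = "\<lambda>_. L" and KC = "\<lambda>_. 0"])
  show "((\<lambda>u. (u - a) * (1 / (1 - u\<^sup>2) * (\<Prod>l\<in>B. lw_factor t u (y l)))) \<longlongrightarrow> L) (at a)"
   unfolding L_def by (intro tendsto_pole_mult tendsto_pole_square a2 tendsto_prod tendsto_lw_factor tendsto_intros) (use ne in auto)
 next
  fix T assume T: "T \<subseteq> B"
  have "((\<lambda>u. (u - a) * (1 / (1 - u\<^sup>2) * (u\<^sup>2 * (\<Prod>l\<in>T. lw_factor t u (y l)) * (\<Prod>i\<in>B - T. hlb t u (y i))))) \<longlongrightarrow>
    - 1 / (a + a) * (a\<^sup>2 * (\<Prod>l\<in>T. lw_factor t a (y l)) * (\<Prod>i\<in>B - T. hlb t a (y i)))) (at a)"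
   by (intro tendsto_pole_mult tendsto_pole_square a2 tendsto_mult tendsto_prod tendsto_lw_factor tendsto_hlb1 tendsto_intros)
     (use ne T in auto)
  thus "((\<lambda>u. (u - a) * (u\<^sup>2 / (1 - u\<^sup>2) * (\<Prod>l\<in>T. lw_factor t u (y l)) * (\<Prod>i\<in>B - T. hlb t u (y i)))) \<longlongrightarrow> L) (at a)"
   using eq[OF T] a2(1) by (simp add: L_def mult.assoc)
  show "((\<lambda>u. (u - a) * (\<Prod>j\<in>T. hlb t (y j) u)) \<longlongrightarrow> 0) (at a)"
   by (rule tendsto_no_pole[where l = "\<Prod>j\<in>T. hlb t (y j) a"], intro tendsto_prod tendsto_hlb2 tendsto_intros)
     (use ne T in auto)
 next
  show "L * lw_phi t y B = (\<Sum>T\<in>Pow B. (L + 0) * lw_weight t y B T)" by (simp add: sum_distrib_left[symmetric] IH)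
 qed
qed

text \<open>For \<open>m\<close> not in \<open>T\<close>, the subsets \<open>T\<close> and
  \<open>insert m T\<close> are paired: one has its pole in \<open>hlb t u (y m)\<close>, the other
  in \<open>hlb t (y m) u\<close>. These have opposite residues, and the remaining factors are
  merely interchanged between coefficient and weight.\<close>

lemma lw_diff_pole_y:
 assumes g: "lw_generic y (insert m C)" and m: "m \<notin> C"
 shows "((\<lambda>u. (u - y m) * lw_diff t y (insert m C) u) \<longlongrightarrow> 0) (at (y m))"
proof -
 define a where "a = y m"
 note gD = lw_genericD[OF g]
 have fin: "finite C" using g by (auto simp: lw_generic_def)
 have a2: "a \<noteq> 0" "1 - a\<^sup>2 \<noteq> 0" using gD[of m] by (auto simp: a_def)
 have ne: "a \<noteq> y l" if "l \<in> C" for l using gD(9)[of m l] that m by (auto simp: a_def)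
 have ne2: "a * y l \<noteq> 1" if "l \<in> insert m C" for l using gD(8)[of m l] that by (auto simp: a_def)
 define R where "R T = a\<^sup>2 / (1 - a\<^sup>2) * (\<Prod>l\<in>T. lw_factor t a (y l)) * (\<Prod>i\<in>C - T. hlb t a (y i))" for T
 define S where "S T = (\<Prod>j\<in>T. hlb t (y j) a)" for T
 define L1 where "L1 T = (if m \<in> T then 0 else (1 - t) * a * R T)" for T
 define L2 where "L2 T = (if m \<in> T then - (1 - t) * a * S (T - {m}) else 0)" for T
 have "((\<lambda>u. (u - a) * lw_diff t y (insert m C) u) \<longlongrightarrow> 0) (at a)"
 proof (rule lw_diff_tendsto[where KA = 0 and KB = L1 and KC = L2])
  show "((\<lambda>u. (u - a) * (1 / (1 - u\<^sup>2) * (\<Prod>l\<in>insert m C. lw_factor t u (y l)))) \<longlongrightarrow> 0) (at a)"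
   by (rule tendsto_no_pole[where l = "1 / (1 - a\<^sup>2) * (\<Prod>l\<in>insert m C. lw_factor t a (y l))"],
     intro tendsto_intros tendsto_prod tendsto_lw_factor) (use ne2 a2 in auto)
 next
  fix T assume T: "T \<subseteq> insert m C"
  show "((\<lambda>u. (u - a) * (u\<^sup>2 / (1 - u\<^sup>2) * (\<Prod>l\<in>T. lw_factor t u (y l)) * (\<Prod>i\<in>insert m C - T. hlb t u (y i)))) \<longlongrightarrow> L1 T) (at a)"
  proof (cases "m \<in> T")
   case True
   hence "insert m C - T = C - T" by auto
   thus ?thesis unfolding L1_def using True
    by (simp only: if_True, intro tendsto_no_pole[where l = "a\<^sup>2 / (1 - a\<^sup>2) * (\<Prod>l\<in>T. lw_factor t a (y l)) * (\<Prod>i\<in>C - T. hlb t a (y i))"]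
       tendsto_intros tendsto_prod tendsto_lw_factor tendsto_hlb1)
      (use ne2 ne T a2 in auto)
  next
   case False
   hence "insert m C - T = insert m (C - T)" "T \<subseteq> C" using T by auto
   hence e: "u\<^sup>2 / (1 - u\<^sup>2) * (\<Prod>l\<in>T. lw_factor t u (y l)) * (\<Prod>i\<in>insert m C - T. hlb t u (y i)) =
     hlb t u a * (u\<^sup>2 / (1 - u\<^sup>2) * (\<Prod>l\<in>T. lw_factor t u (y l)) * (\<Prod>i\<in>C - T. hlb t u (y i)))" for u
    using m fin by (simp add: a_def mult_ac)
   show ?thesis unfolding e L1_def R_def using False
    by (simp only: if_False, intro tendsto_pole_mult tendsto_pole_hlb1 tendsto_intros tendsto_prod tendsto_lw_factor tendsto_hlb1)
      (use ne2 ne T a2 in auto)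
  qed
  show "((\<lambda>u. (u - a) * (\<Prod>j\<in>T. hlb t (y j) u)) \<longlongrightarrow> L2 T) (at a)"
  proof (cases "m \<in> T")
   case True
   have "finite T" by (rule finite_subset[OF T]) (use fin in auto)
   hence e: "(\<Prod>j\<in>T. hlb t (y j) u) = hlb t a u * (\<Prod>j\<in>T - {m}. hlb t (y j) u)" for u
    unfolding a_def by (rule prod.remove) (rule True)
   show ?thesis unfolding e L2_def S_def using True
    by (simp only: if_True, intro tendsto_pole_mult tendsto_pole_hlb2 tendsto_intros tendsto_prod tendsto_hlb2)
      (use ne T in auto)
  next
   case False
   thus ?thesis unfolding L2_def
    by (simp only: if_False, intro tendsto_no_pole[where l = "\<Prod>j\<in>T. hlb t (y j) a"] tendsto_intros tendsto_prod tendsto_hlb2)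
      (use ne T in auto)
  qed
 next
  have "(\<Sum>T\<in>Pow (insert m C). (L1 T + L2 T) * lw_weight t y (insert m C) T) = 0" unfolding sum_Pow_insert[OF fin m]
  proof (rule sum.neutral, rule ballI)
   fix T assume "T \<in> Pow C"
   hence T: "T \<subseteq> C" "m \<notin> T" using m by auto
   have "insert m T - {m} = T" using T by auto
   hence "L1 T = (1 - t) * a * R T" "L2 T = 0" "L1 (insert m T) = 0" "L2 (insert m T) = - (1 - t) * a * S T" using T by (auto simp: L1_def L2_def)
   moreover have "lw_weight t y (insert m C) T = S T * lw_weight t y C T" by (simp add: lw_weight_same[OF fin m T(1)] S_def a_def)
   moreover have "lw_weight t y (insert m C) (insert m T) = R T * lw_weight t y C T" by (simp add: lw_weight_insert[OF fin m T(1)] R_def a_def)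
   ultimately show "(L1 T + L2 T) * lw_weight t y (insert m C) T +
     (L1 (insert m T) + L2 (insert m T)) * lw_weight t y (insert m C) (insert m T) = 0" by (simp only:) (simp add: algebra_simps)
  qed
  thus "0 * lw_phi t y (insert m C) = (\<Sum>T\<in>Pow (insert m C). (L1 T + L2 T) * lw_weight t y (insert m C) T)" by simp
 qed
 thus ?thesis by (simp add: a_def)
qed

text \<open>Only the subsets containing \<open>m\<close> have this pole. Inverting
  \<open>y m\<close> turns the factors at \<open>1 / y m\<close> and at \<open>y m\<close> into
  products over all of \<open>C\<close> that no longer depend on \<open>T\<close>, so the identity
  for \<open>C\<close> finishes the sum.\<close>

lemma lw_diff_pole_inverse:
 assumes g: "lw_generic y (insert m C)" and m: "m \<notin> C"
  and IH: "(\<Sum>T\<in>Pow C. lw_weight t y C T) = lw_phi t y C"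
 shows "((\<lambda>u. (u - 1 / y m) * lw_diff t y (insert m C) u) \<longlongrightarrow> 0) (at (1 / y m))"
proof -
 define v where "v = y m"
 define a where "a = 1 / v"
 note gD = lw_genericD[OF g]
 have fin: "finite C" using g by (auto simp: lw_generic_def)
 have v: "v \<noteq> 0" "1 - v\<^sup>2 \<noteq> 0" using gD[of m] by (auto simp: v_def)
 hence a2: "a \<noteq> 0" "1 - a\<^sup>2 \<noteq> 0" "a\<^sup>2 * v\<^sup>2 = 1" by (auto simp: a_def field_simps)
 have ne: "a * y l \<noteq> 1" if "l \<in> C" for l
 proof -
  have "v \<noteq> y l" using gD(9)[of m l] that m unfolding v_def by blast
  thus ?thesis using v(1) by (simp add: a_def)
 qed
 have ne2: "a \<noteq> y l" if "l \<in> insert m C" for l using gD(10)[of l m] that by (auto simp: a_def v_def)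
 define L0 where "L0 = - (1 - t) / v * (1 / (1 - a\<^sup>2) * (\<Prod>l\<in>C. lw_factor t a (y l)))"
 define R where "R T = (\<Prod>l\<in>T. lw_factor t a (y l)) * (\<Prod>i\<in>C - T. hlb t a (y i))" for T
 define L1 where "L1 T = (if m \<in> T then - (1 - t) / v * (a\<^sup>2 / (1 - a\<^sup>2) * R (T - {m})) else 0)" for T
 have "((\<lambda>u. (u - a) * lw_diff t y (insert m C) u) \<longlongrightarrow> 0) (at a)"
 proof (rule lw_diff_tendsto[where KA = L0 and KB = L1 and KC = "\<lambda>_. 0"])
  have e: "1 / (1 - u\<^sup>2) * (\<Prod>l\<in>insert m C. lw_factor t u (y l)) =
    lw_factor t u v * (1 / (1 - u\<^sup>2) * (\<Prod>l\<in>C. lw_factor t u (y l)))" for u using fin m by (simp add: v_def)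
  show "((\<lambda>u. (u - a) * (1 / (1 - u\<^sup>2) * (\<Prod>l\<in>insert m C. lw_factor t u (y l)))) \<longlongrightarrow> L0) (at a)"
   unfolding e L0_def a_def by (intro tendsto_pole_mult tendsto_pole_lw_factor v tendsto_intros tendsto_prod tendsto_lw_factor)
     (use ne a2 in \<open>auto simp: a_def\<close>)
 next
  fix T assume T: "T \<subseteq> insert m C"
  show "((\<lambda>u. (u - a) * (u\<^sup>2 / (1 - u\<^sup>2) * (\<Prod>l\<in>T. lw_factor t u (y l)) * (\<Prod>i\<in>insert m C - T. hlb t u (y i)))) \<longlongrightarrow> L1 T) (at a)"
  proof (cases "m \<in> T")
   case False
   thus ?thesis unfolding L1_def
    by (simp only: if_False, intro tendsto_no_pole[where l = "a\<^sup>2 / (1 - a\<^sup>2) * (\<Prod>l\<in>T. lw_factor t a (y l)) * (\<Prod>i\<in>insert m C - T. hlb t a (y i))"]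
       tendsto_intros tendsto_prod tendsto_lw_factor tendsto_hlb1)
      (use ne2 ne T a2 in auto)
  next
   case True
   have "finite T" by (rule finite_subset[OF T]) (use fin in auto)
   have "insert m C - T = C - (T - {m})" using True m by auto
   moreover have "(\<Prod>l\<in>T. lw_factor t u (y l)) = lw_factor t u v * (\<Prod>l\<in>T - {m}. lw_factor t u (y l))" for u
    unfolding v_def by (rule prod.remove[OF \<open>finite T\<close> True])
   ultimately have e: "u\<^sup>2 / (1 - u\<^sup>2) * (\<Prod>l\<in>T. lw_factor t u (y l)) * (\<Prod>i\<in>insert m C - T. hlb t u (y i)) =
     lw_factor t u v * (u\<^sup>2 / (1 - u\<^sup>2) * ((\<Prod>l\<in>T - {m}. lw_factor t u (y l)) * (\<Prod>i\<in>C - (T - {m}). hlb t u (y i))))" for u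
    by (simp only: mult_ac)
   show ?thesis unfolding e L1_def R_def a_def using True
    by (simp only: if_True, intro tendsto_pole_mult tendsto_pole_lw_factor v tendsto_intros tendsto_prod tendsto_lw_factor tendsto_hlb1)
      (use ne2 ne T a2 in \<open>auto simp: a_def\<close>)
  qed
  show "((\<lambda>u. (u - a) * (\<Prod>j\<in>T. hlb t (y j) u)) \<longlongrightarrow> 0) (at a)"
   by (intro tendsto_no_pole[where l = "\<Prod>j\<in>T. hlb t (y j) a"] tendsto_intros tendsto_prod tendsto_hlb2) (use ne2 T in auto)
 next
  define Q where "Q = (\<Prod>l\<in>C. lw_factor t a (y l)) * (\<Prod>l\<in>C. lw_factor t v (y l))"
  have va: "hlb t v w = lw_factor t a w" "hlb t a w = lw_factor t v w" for w
   using hlb_eq_lw_factor[of a t w] hlb_eq_lw_factor[of v t w] a2 v by (auto simp: a_def)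
  have RQ: "R T * ((\<Prod>l\<in>T. lw_factor t v (y l)) * (\<Prod>i\<in>C - T. hlb t v (y i))) = Q" if "T \<subseteq> C" for T
   unfolding R_def va Q_def using prod.subset_diff[OF that fin, of "\<lambda>l. lw_factor t a (y l)"]
    prod.subset_diff[OF that fin, of "\<lambda>l. lw_factor t v (y l)"] by simp
  have "(\<Sum>T\<in>Pow (insert m C). (L1 T + 0) * lw_weight t y (insert m C) T) =
    (\<Sum>T\<in>Pow C. - (1 - t) / v * (1 / ((1 - a\<^sup>2) * (1 - v\<^sup>2))) * Q * lw_weight t y C T)" unfolding sum_Pow_insert[OF fin m]
  proof (rule sum.cong[OF refl])
   fix T assume "T \<in> Pow C"
   hence T: "T \<subseteq> C" "m \<notin> T" using m by auto
   have "insert m T - {m} = T" using T by auto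
   hence 1: "L1 T = 0" "L1 (insert m T) = - (1 - t) / v * (a\<^sup>2 / (1 - a\<^sup>2) * R T)" using T by (auto simp: L1_def)
   have 2: "lw_weight t y (insert m C) (insert m T) =
     v\<^sup>2 / (1 - v\<^sup>2) * ((\<Prod>l\<in>T. lw_factor t v (y l)) * (\<Prod>i\<in>C - T. hlb t v (y i))) * lw_weight t y C T"
    by (simp add: lw_weight_insert[OF fin m T(1)] v_def mult.assoc)
   have "(L1 T + 0) * lw_weight t y (insert m C) T + (L1 (insert m T) + 0) * lw_weight t y (insert m C) (insert m T) =
    - (1 - t) / v * (a\<^sup>2 / (1 - a\<^sup>2) * (v\<^sup>2 / (1 - v\<^sup>2))) *
    (R T * ((\<Prod>l\<in>T. lw_factor t v (y l)) * (\<Prod>i\<in>C - T. hlb t v (y i)))) * lw_weight t y C T"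
    unfolding 1 2 by (simp only: mult_ac add_0_left add_0_right mult_zero_left)
   also have "a\<^sup>2 / (1 - a\<^sup>2) * (v\<^sup>2 / (1 - v\<^sup>2)) = 1 / ((1 - a\<^sup>2) * (1 - v\<^sup>2))" using a2(3) by simp
   finally show "(L1 T + 0) * lw_weight t y (insert m C) T + (L1 (insert m T) + 0) * lw_weight t y (insert m C) (insert m T) =
    - (1 - t) / v * (1 / ((1 - a\<^sup>2) * (1 - v\<^sup>2))) * Q * lw_weight t y C T" by (simp only: RQ[OF T(1)])
  qed
  also have "... = - (1 - t) / v * (1 / ((1 - a\<^sup>2) * (1 - v\<^sup>2))) * Q * lw_phi t y C" by (simp only: sum_distrib_left[symmetric] IH)
  also have "... = L0 * lw_phi t y (insert m C)" by (simp add: lw_phi_insert[OF fin m] L0_def Q_def v_def mult.assoc)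
  finally show "L0 * lw_phi t y (insert m C) = (\<Sum>T\<in>Pow (insert m C). (L1 T + 0) * lw_weight t y (insert m C) T)" by simp
 qed
 thus ?thesis by (simp add: a_def v_def)
qed

text \<open>Both sides are rational functions of each variable; the poles cancel, the difference is
 bounded at infinity and vanishes at \<open>0\<close>.\<close>
theorem littlewood_recursion:
 assumes "lw_generic y A"
 shows "(\<Sum>T\<in>Pow A. lw_weight t y A T) = lw_phi t y A" using assms
proof (induction "card A" arbitrary: A rule: less_induct)
 case less
 have fin: "finite A" using less.prems by (simp add: lw_generic_def)
 show ?case
 proof (cases "A = {}")
  case True
  thus ?thesis by (simp add: lw_weight_def lw_phi_def)
 next
  case False
  then obtain n where n: "n \<in> A" by auto
  define B where "B = A - {n}"
  have A: "A = insert n B" "n \<notin> B" "finite B" using n fin by (auto simp: B_def)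
  have gB: "lw_generic y B" using less.prems lw_generic_subset B_def by blast
  have card: "card B < card A" using A by simp
  note IHB = less.hyps[OF card gB]
  note gD = lw_genericD[OF gB]
  have "lw_diff t y B (y n) = 0"
  proof (rule simple_poles_eq_0[OF simple_poles_lw_diff[OF gB], of 0])
   show "0 \<notin> lw_poles y B" using gD(1) by (auto simp: lw_poles_def)
   \<comment> \<open>The base point 0 is not a pole; there the products in \<open>u\<close> become
     trivial, and the difference vanishes by the induction hypothesis for \<open>B\<close>.\<close>
   have "hlb t (y j) 0 = 1" if "j \<in> B" for j using gD(1)[OF that] by (simp add: hlb_def)
   hence "(\<Prod>j\<in>T. hlb t (y j) 0) = 1" if "T \<in> Pow B" for T using that by (intro prod.neutral) auto
   thus "lw_diff t y B 0 = 0" using IHB by (simp add: lw_diff_def lw_factor_def)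
   show "y n \<notin> lw_poles y B"
   proof
    note D = lw_genericD[OF less.prems]
    assume "y n \<in> lw_poles y B"
    then consider "y n = 1 \<or> y n = - 1" | i where "i \<in> B" "y n = y i" | i where "i \<in> B" "y n = 1 / y i"
     unfolding lw_poles_def by blast
    thus False
    proof cases
     case 1
     thus ?thesis using D(2,3)[OF n] by blast
    next
     case (2 i)
     thus ?thesis using D(9)[OF n, of i] A by blast
    next
     case (3 i)
     thus ?thesis using D(7)[of i n] A by blast
    qed
   qed
  next
   fix a assume "a \<in> lw_poles y B"
   then consider "a = 1 \<or> a = - 1" | m where "m \<in> B" "a = y m" | m where "m \<in> B" "a = 1 / y m" by (auto simp: lw_poles_def)
   thus "((\<lambda>u. (u - a) * lw_diff t y B u) \<longlongrightarrow> 0) (at a)"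
   proof cases
    case 1
    thus ?thesis by (rule lw_diff_pole_unit[OF gB IHB])
   next
    case (2 m)
    hence "B = insert m (B - {m})" by auto
    thus ?thesis using lw_diff_pole_y[of y m "B - {m}" t] gB 2 by simp
   next
    case (3 m)
    hence B: "B = insert m (B - {m})" by auto
    have "card (B - {m}) < card A" using card 3 A(3) by (meson card_Diff1_less order_less_trans)
    hence "(\<Sum>T\<in>Pow (B - {m}). lw_weight t y (B - {m}) T) = lw_phi t y (B - {m})" by (rule less.hyps) (use gB lw_generic_subset in blast)
    thus ?thesis using lw_diff_pole_inverse[of y m "B - {m}" t] gB 3 B by simp
   qed
  qed
  moreover have "(\<Sum>T\<in>Pow A. lw_weight t y A T) = (\<Sum>T\<in>Pow B. ((y n)\<^sup>2 / (1 - (y n)\<^sup>2) *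
     (\<Prod>l\<in>T. lw_factor t (y n) (y l)) * (\<Prod>i\<in>B - T. hlb t (y n) (y i)) +
    (\<Prod>j\<in>T. hlb t (y j) (y n))) * lw_weight t y B T)" unfolding A(1) sum_Pow_insert[OF A(3,2)]
   by (rule sum.cong[OF refl]) (use A in \<open>simp add: lw_weight_same lw_weight_insert distrib_right add.commute\<close>)
  moreover have "lw_phi t y A = 1 / (1 - (y n)\<^sup>2) * (\<Prod>l\<in>B. lw_factor t (y n) (y l)) * lw_phi t y B"
   unfolding A(1) using A by (simp add: lw_phi_insert)
  ultimately show ?thesis by (simp add: lw_diff_def)
 qed
qed

section \<open>Sums over sign changes\<close>

definition bounded_funs :: "nat \<Rightarrow> nat set \<Rightarrow> (nat \<Rightarrow> nat) set" where
 "bounded_funs k A = {f. (\<forall>a\<in>A. f a \<le> k) \<and> (\<forall>a. a \<notin> A \<longrightarrow> f a = 0)}"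

lemma finite_bounded_funs: "finite A \<Longrightarrow> finite (bounded_funs k A)"
 by (rule finite_subset[OF _ finite_set_of_finite_funs[of A "{..k}" 0]])
   (auto simp: bounded_funs_def)

text \<open>An even partition is encoded by half of its parts, hence the exponent
  \<open>2 * f a\<close> and the bound \<open>k\<close> instead of \<open>2 * k\<close>.\<close>

definition bl_sum :: "complex \<Rightarrow> (nat \<Rightarrow> complex) \<Rightarrow> nat set \<Rightarrow> nat \<Rightarrow> complex" where
 "bl_sum t x A k = (\<Sum>f\<in>bounded_funs k A. (\<Prod>a\<in>A. x a ^ (2 * f a)) * inv_prod t x A f)"

lemma bl_sum_0: "bl_sum t x A 0 = 1"
proof -
 have "bounded_funs 0 A = {\<lambda>_. 0}" by (auto simp: bounded_funs_def fun_eq_iff)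
 thus ?thesis by (simp add: bl_sum_def inv_prod_def)
qed

lemma inv_prod_top:
 assumes fin: "finite A" and S: "S \<subseteq> A" and g: "g \<in> bounded_funs k (A - S)"
 shows "inv_prod t x A (\<lambda>a. if a \<in> S then Suc k else g a) =
  (\<Prod>i\<in>S. \<Prod>j\<in>A - S. hlb t (x i) (x j)) * inv_prod t x (A - S) g"
proof -
 let ?f = "\<lambda>a. if a \<in> S then Suc k else g a"
 let ?Q = "{(a, c). a \<in> A - S \<and> c \<in> A - S \<and> g c < g a}"
 have P: "{(a, c). a \<in> A \<and> c \<in> A \<and> ?f c < ?f a} = S \<times> (A - S) \<union> ?Q"
 proof (intro set_eqI iffI)
  fix z assume "z \<in> {(a, c). a \<in> A \<and> c \<in> A \<and> ?f c < ?f a}"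
  then obtain a c where z: "z = (a, c)" "a \<in> A" "c \<in> A" "?f c < ?f a" by auto
  moreover have "?f a \<le> Suc k" using g z(2) by (auto simp: bounded_funs_def le_SucI)
  ultimately show "z \<in> S \<times> (A - S) \<union> ?Q" by (auto split: if_splits)
 next
  fix z assume "z \<in> S \<times> (A - S) \<union> ?Q"
  thus "z \<in> {(a, c). a \<in> A \<and> c \<in> A \<and> ?f c < ?f a}" using S g by (auto simp: bounded_funs_def less_Suc_eq_le)
 qed
 have "finite ?Q" by (rule finite_subset[of _ "A \<times> A"]) (use fin in auto)
 moreover have "finite S" using S fin by (rule finite_subset)
 ultimately have "inv_prod t x A ?f = prod (\<lambda>(a, c). hlb t (x a) (x c)) (S \<times> (A - S)) * inv_prod t x (A - S) g"
  unfolding inv_prod_def P by (intro prod.union_disjoint) (use fin in auto)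
 thus ?thesis by (simp add: prod.cartesian_product)
qed

text \<open>The exponent functions are split according to the set \<open>S\<close> of variables with
  the maximal value \<open>Suc k\<close>; each of these exceeds all others, which accounts for the
  cross product, and the others form a sum with bound \<open>k\<close>.\<close>

lemma bl_sum_Suc:
 assumes fin: "finite A"
 shows "bl_sum t x A (Suc k) = (\<Sum>S\<in>Pow A. (\<Prod>i\<in>S. x i ^ (2 * Suc k)) *
   (\<Prod>i\<in>S. \<Prod>j\<in>A - S. hlb t (x i) (x j)) * bl_sum t x (A - S) k)"
proof -
 let ?h = "\<lambda>S g. (\<Prod>i\<in>S. x i ^ (2 * Suc k)) * (\<Prod>i\<in>S. \<Prod>j\<in>A - S. hlb t (x i) (x j)) *
   ((\<Prod>a\<in>A - S. x a ^ (2 * g a)) * inv_prod t x (A - S) g)"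
 have "(\<Sum>S\<in>Pow A. (\<Prod>i\<in>S. x i ^ (2 * Suc k)) *
   (\<Prod>i\<in>S. \<Prod>j\<in>A - S. hlb t (x i) (x j)) * bl_sum t x (A - S) k) =
   (\<Sum>S\<in>Pow A. \<Sum>g\<in>bounded_funs k (A - S). ?h S g)" by (simp add: bl_sum_def sum_distrib_left)
 also have "... = (\<Sum>(S, g)\<in>(SIGMA S:Pow A. bounded_funs k (A - S)). ?h S g)" by (rule sum.Sigma) (use fin finite_bounded_funs in auto)
 also have "... = (\<Sum>f\<in>bounded_funs (Suc k) A. (\<Prod>a\<in>A. x a ^ (2 * f a)) * inv_prod t x A f)"
 proof (rule sum.reindex_bij_witness[where
    j = "\<lambda>(S, g) a. if a \<in> S then Suc k else g a" and
    i = "\<lambda>f. ({a \<in> A. f a = Suc k}, \<lambda>a. if f a = Suc k then 0 else f a)"])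
  fix z assume "z \<in> (SIGMA S:Pow A. bounded_funs k (A - S))"
  then obtain S g where z: "z = (S, g)" "S \<subseteq> A" "g \<in> bounded_funs k (A - S)" by auto
  let ?f = "\<lambda>a. if a \<in> S then Suc k else g a"
  have gk: "g a \<le> k" for a using z(3) by (cases "a \<in> A - S") (auto simp: bounded_funs_def)
  hence gS: "g a \<noteq> Suc k" for a by (metis Suc_n_not_le_n)
  have gz: "a \<in> S \<Longrightarrow> g a = 0" for a using z(3) by (auto simp: bounded_funs_def)
  show "(case case z of (S, g) \<Rightarrow> \<lambda>a. if a \<in> S then Suc k else g a of f \<Rightarrow>
    ({a \<in> A. f a = Suc k}, \<lambda>a. if f a = Suc k then 0 else f a)) = z" using z(1,2) gS gz by (auto simp: fun_eq_iff)
  show "(case z of (S, g) \<Rightarrow> \<lambda>a. if a \<in> S then Suc k else g a) \<in> bounded_funs (Suc k) A"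
   using z gk by (auto simp: bounded_funs_def le_SucI)
  have "(\<Prod>a\<in>A. x a ^ (2 * ?f a)) = (\<Prod>a\<in>A - S. x a ^ (2 * ?f a)) * (\<Prod>a\<in>S. x a ^ (2 * ?f a))"
   by (rule prod.subset_diff[OF z(2) fin])
  also have "(\<Prod>a\<in>S. x a ^ (2 * ?f a)) = (\<Prod>i\<in>S. x i ^ (2 * Suc k))" by (rule prod.cong) auto
  also have "(\<Prod>a\<in>A - S. x a ^ (2 * ?f a)) = (\<Prod>a\<in>A - S. x a ^ (2 * g a))" by (rule prod.cong) auto
  finally show "(\<Prod>a\<in>A. x a ^ (2 * (case z of (S, g) \<Rightarrow> \<lambda>a. if a \<in> S then Suc k else g a) a)) *
     inv_prod t x A (case z of (S, g) \<Rightarrow> \<lambda>a. if a \<in> S then Suc k else g a) = (case z of (S, g) \<Rightarrow> ?h S g)"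
   unfolding z(1) prod.case inv_prod_top[OF fin z(2,3)] by (simp only: mult_ac)
 next
  fix f assume f: "f \<in> bounded_funs (Suc k) A"
  show "(case ({a \<in> A. f a = Suc k}, \<lambda>a. if f a = Suc k then 0 else f a) of
    (S, g) \<Rightarrow> \<lambda>a. if a \<in> S then Suc k else g a) = f" using f by (auto simp: bounded_funs_def fun_eq_iff)
  show "({a \<in> A. f a = Suc k}, \<lambda>a. if f a = Suc k then 0 else f a) \<in> (SIGMA S:Pow A. bounded_funs k (A - S))"
   using f by (auto simp: bounded_funs_def le_Suc_eq)
 qed
 finally show ?thesis by (simp add: bl_sum_def)
qed

section \<open>Sums over inversions of the variables\<close>

definition flip :: "nat set \<Rightarrow> (nat \<Rightarrow> complex) \<Rightarrow> nat \<Rightarrow> complex" where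
 "flip B x = (\<lambda>i. if i \<in> B then 1 / x i else x i)"

text \<open>A sum over the sign changes in the Weyl group of type C: \<open>B\<close> is the set of
  inverted variables, and the bound \<open>k\<close> enters only through the monomial.\<close>

definition sign_sum :: "complex \<Rightarrow> (nat \<Rightarrow> complex) \<Rightarrow> nat set \<Rightarrow> nat \<Rightarrow> complex" where
 "sign_sum t x A k = (\<Sum>B\<in>Pow A. (\<Prod>i\<in>B. x i ^ (2 * k)) * lw_phi t (flip B x) A)"

lemma lw_generic_flip:
 assumes "lw_generic x A"
 shows "lw_generic (flip B x) A"
proof -
 have x: "finite A" "\<And>i. i \<in> A \<Longrightarrow> x i \<noteq> 0" "\<And>i j. i \<in> A \<Longrightarrow> j \<in> A \<Longrightarrow> x i * x j \<noteq> 1"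
  "\<And>i j. i \<in> A \<Longrightarrow> j \<in> A \<Longrightarrow> x i = x j \<Longrightarrow> i = j"
  using assms by (auto simp: lw_generic_def inj_on_def)
 have "i = j" if "i \<in> A" "j \<in> A" "flip B x i = flip B x j" for i j using that x(2)[of i] x(2)[of j] x(3)[of i j] x(4)[of i j]
  by (cases "i \<in> B"; cases "j \<in> B") (auto simp: flip_def field_simps)
 moreover have "flip B x i * flip B x j \<noteq> 1" if "i \<in> A" "j \<in> A" for i j
 proof (cases "i = j")
  case True
  have "x i * x i \<noteq> 1" using x(3) that by blast
  thus ?thesis using x(2)[of i] that True by (cases "i \<in> B") (auto simp: flip_def field_simps)
 next
  case False
  hence "x i \<noteq> x j" using x(4) that by blast
  thus ?thesis using that x(2)[of i] x(2)[of j] x(3)[of i j] by (cases "i \<in> B"; cases "j \<in> B") (auto simp: flip_def field_simps)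
 qed
 ultimately show ?thesis using x(1,2) unfolding lw_generic_def by (auto simp: inj_on_def flip_def)
qed

text \<open>Mixed pairs, with one variable inverted, become Hall-Littlewood factors by
  \<open>hlb_eq_lw_factor\<close>; pairs on the same side keep their form.\<close>

lemma lw_phi_flip:
 assumes g: "lw_generic x A" and B: "B \<subseteq> A"
 shows "lw_phi t (flip B x) A = lw_phi t (\<lambda>i. 1 / x i) B * lw_phi t x (A - B) *
   (\<Prod>i\<in>B. \<Prod>j\<in>A - B. hlb t (x i) (x j))"
proof -
 have fin: "finite A" "finite B" using g B by (auto simp: lw_generic_def intro: finite_subset)
 let ?g = "\<lambda>i j. lw_factor t (flip B x i) (flip B x j)"
 have A: "A = B \<union> (A - B)" using B by auto
 have 1: "pair_prod A ?g = pair_prod B ?g * pair_prod (A - B) ?g * (\<Prod>i\<in>B. \<Prod>j\<in>A - B. ?g i j)"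
  by (subst A, rule pair_prod_Un) (use fin lw_factor_commute in auto)
 have 2: "(\<Prod>i\<in>A. 1 / (1 - (flip B x i)\<^sup>2)) = (\<Prod>i\<in>B. 1 / (1 - (flip B x i)\<^sup>2)) * (\<Prod>i\<in>A - B. 1 / (1 - (flip B x i)\<^sup>2))"
  by (subst prod.subset_diff[OF B fin(1)]) (simp add: mult.commute)
 have "lw_phi t (flip B x) A = lw_phi t (flip B x) B * lw_phi t (flip B x) (A - B) * (\<Prod>i\<in>B. \<Prod>j\<in>A - B. ?g i j)"
  unfolding lw_phi_def 1 2 by (simp only: mult_ac)
 also have "lw_phi t (flip B x) B = lw_phi t (\<lambda>i. 1 / x i) B" by (rule lw_phi_cong) (simp add: flip_def)
 also have "lw_phi t (flip B x) (A - B) = lw_phi t x (A - B)" by (rule lw_phi_cong) (simp add: flip_def)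
 also have "(\<Prod>i\<in>B. \<Prod>j\<in>A - B. ?g i j) = (\<Prod>i\<in>B. \<Prod>j\<in>A - B. hlb t (x i) (x j))"
 proof (intro prod.cong refl)
  fix i j assume ij: "i \<in> B" "j \<in> A - B"
  hence "x i \<noteq> 0" using g B by (auto simp: lw_generic_def)
  thus "?g i j = hlb t (x i) (x j)" using hlb_eq_lw_factor[of "1 / x i" t "x j"] ij by (simp add: flip_def)
 qed
 finally show ?thesis .
qed

lemma sum_Pow_Pow_Diff:
 fixes F :: "'a set \<Rightarrow> 'a set \<Rightarrow> complex"
 assumes "finite A"
 shows "(\<Sum>S\<in>Pow A. \<Sum>T\<in>Pow (A - S). F S T) = (\<Sum>B\<in>Pow A. \<Sum>T\<in>Pow B. F (B - T) T)"
proof -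
 have "(\<Sum>S\<in>Pow A. \<Sum>T\<in>Pow (A - S). F S T) = (\<Sum>(S, T)\<in>(SIGMA S:Pow A. Pow (A - S)). F S T)"
  by (rule sum.Sigma) (use assms in auto)
 also have "... = (\<Sum>(B, T)\<in>(SIGMA B:Pow A. Pow B). F (B - T) T)"
  by (rule sum.reindex_bij_witness[where i = "\<lambda>(B, T). (B - T, T)" and j = "\<lambda>(S, T). (S \<union> T, T)"])
    (auto intro!: arg_cong2[of _ _ _ _ F])
 also have "... = (\<Sum>B\<in>Pow A. \<Sum>T\<in>Pow B. F (B - T) T)"
  by (rule sum.Sigma[symmetric]) (use assms in \<open>auto intro: finite_subset\<close>)
 finally show ?thesis .
qed

lemma hlb_inverse: "u \<noteq> 0 \<Longrightarrow> v \<noteq> 0 \<Longrightarrow> hlb t (1 / v) (1 / u) = hlb t u v"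
proof -
 assume uv: "u \<noteq> 0" "v \<noteq> 0"
 have "hlb t (1 / v) (1 / u) = (u * v * (1 / v - t * (1 / u))) / (u * v * (1 / v - 1 / u))"
  using uv unfolding hlb_def by (subst nonzero_mult_divide_mult_cancel_left) auto
 also have "... = hlb t u v" using uv by (simp add: hlb_def algebra_simps)
 finally show ?thesis .
qed

text \<open>\<open>S\<close> is the set of maximal exponents and \<open>T\<close> the set of
  inverted variables among the rest. With \<open>B = S \<union> T\<close> fixed, one has
  \<open>x ^ (2 * Suc k) * (1 / x) ^ 2 = x ^ (2 * k)\<close> on \<open>T\<close>, so the sum over
  \<open>T\<close> is \<open>littlewood_recursion\<close> for the inverses \<open>1 / x i\<close> on
  \<open>B\<close>.\<close>

lemma sign_sum_Suc:
 assumes g: "lw_generic x A"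
 shows "sign_sum t x A (Suc k) = (\<Sum>S\<in>Pow A. (\<Prod>i\<in>S. x i ^ (2 * Suc k)) *
   (\<Prod>i\<in>S. \<Prod>j\<in>A - S. hlb t (x i) (x j)) * sign_sum t x (A - S) k)"
proof -
 have fin: "finite A" using g by (simp add: lw_generic_def)
 let ?y = "\<lambda>i. 1 / x i"
 define D where "D S T = (\<Prod>i\<in>S. \<Prod>j\<in>T. hlb t (x i) (x j))" for S T
 have "(\<Sum>S\<in>Pow A. (\<Prod>i\<in>S. x i ^ (2 * Suc k)) * D S (A - S) * sign_sum t x (A - S) k) =
   (\<Sum>S\<in>Pow A. \<Sum>T\<in>Pow (A - S). (\<Prod>i\<in>S. x i ^ (2 * Suc k)) * D S (A - S) *
    ((\<Prod>i\<in>T. x i ^ (2 * k)) * (lw_phi t ?y T * lw_phi t x (A - S - T) * D T (A - S - T))))" unfolding sign_sum_def sum_distrib_left D_def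
  by (intro sum.cong refl arg_cong2[of _ _ _ _ "(*)"] lw_phi_flip) (auto intro: lw_generic_subset[OF g])
 also have "... = (\<Sum>B\<in>Pow A. \<Sum>T\<in>Pow B. (\<Prod>i\<in>B - T. x i ^ (2 * Suc k)) * D (B - T) (A - (B - T)) *
    ((\<Prod>i\<in>T. x i ^ (2 * k)) * (lw_phi t ?y T * lw_phi t x (A - (B - T) - T) * D T (A - (B - T) - T))))"
  by (rule sum_Pow_Pow_Diff[OF fin])
 also have "... = (\<Sum>B\<in>Pow A. (\<Prod>i\<in>B. x i ^ (2 * Suc k)) * (lw_phi t (flip B x) A))"
 proof (rule sum.cong[OF refl])
  fix B assume "B \<in> Pow A"
  hence B: "B \<subseteq> A" "finite B" using fin by (auto intro: finite_subset)
  have gy: "lw_generic ?y B"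
  proof -
   have "lw_generic (flip B x) B" by (rule lw_generic_flip[OF lw_generic_subset[OF g B(1)]])
   moreover have "lw_generic (flip B x) B = lw_generic ?y B"
    unfolding lw_generic_def by (intro arg_cong2[of _ _ _ _ "(\<and>)"] ball_cong refl inj_on_cong) (simp_all add: flip_def)
   ultimately show ?thesis by blast
  qed
  have "(\<Prod>i\<in>B - T. x i ^ (2 * Suc k)) * D (B - T) (A - (B - T)) *
    ((\<Prod>i\<in>T. x i ^ (2 * k)) * (lw_phi t ?y T * lw_phi t x (A - (B - T) - T) * D T (A - (B - T) - T))) =
    (\<Prod>i\<in>B. x i ^ (2 * Suc k)) * lw_phi t x (A - B) * D B (A - B) * lw_weight t ?y B T"
   if T: "T \<subseteq> B" for T
  proof -
   have fT: "finite T" using T B(2) by (rule finite_subset)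
   have s: "A - (B - T) - T = A - B" "A - (B - T) = T \<union> (A - B)" "T \<inter> (A - B) = {}"
    "T \<union> (A - B) - T = A - B" using T B by auto
   have x0: "x i \<noteq> 0" if "i \<in> B" for i using that B g by (auto simp: lw_generic_def)
   have 1: "D (B - T) (T \<union> (A - B)) = D (B - T) T * D (B - T) (A - B)" unfolding D_def prod.distrib[symmetric]
    by (rule prod.cong[OF refl], rule prod.union_disjoint) (use fin fT s in auto)
   have 2: "D B (A - B) = D (B - T) (A - B) * D T (A - B)" unfolding D_def by (rule prod.subset_diff[OF T B(2)])
   have 3: "(\<Prod>i\<in>B. x i ^ (2 * Suc k)) = (\<Prod>i\<in>B - T. x i ^ (2 * Suc k)) * (\<Prod>i\<in>T. x i ^ (2 * Suc k))"
    by (rule prod.subset_diff[OF T B(2)])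
   have 4: "(\<Prod>i\<in>T. x i ^ (2 * Suc k)) * (\<Prod>i\<in>T. (?y i)\<^sup>2) = (\<Prod>i\<in>T. x i ^ (2 * k))"
    unfolding prod.distrib[symmetric] by (rule prod.cong[OF refl]) (use x0 T in \<open>auto simp: power_divide power2_eq_square\<close>)
   have 5: "(\<Prod>j\<in>T. \<Prod>i\<in>B - T. hlb t (?y j) (?y i)) = D (B - T) T"
   proof -
    have "(\<Prod>j\<in>T. \<Prod>i\<in>B - T. hlb t (?y j) (?y i)) = (\<Prod>j\<in>T. \<Prod>i\<in>B - T. hlb t (x i) (x j))"
     by (intro prod.cong refl hlb_inverse) (use x0 T in auto)
    thus ?thesis unfolding D_def by (subst prod.swap)
   qed
   show ?thesis unfolding lw_weight_def s 1 2 3 5 4[symmetric] by (simp only: mult_ac)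
  qed
  hence "(\<Sum>T\<in>Pow B. (\<Prod>i\<in>B - T. x i ^ (2 * Suc k)) * D (B - T) (A - (B - T)) *
    ((\<Prod>i\<in>T. x i ^ (2 * k)) * (lw_phi t ?y T * lw_phi t x (A - (B - T) - T) * D T (A - (B - T) - T)))) =
    (\<Prod>i\<in>B. x i ^ (2 * Suc k)) * lw_phi t x (A - B) * D B (A - B) * (\<Sum>T\<in>Pow B. lw_weight t ?y B T)"
   unfolding sum_distrib_left by (intro sum.cong refl) blast
  also have "... = (\<Prod>i\<in>B. x i ^ (2 * Suc k)) * lw_phi t (flip B x) A"
   unfolding littlewood_recursion[OF gy] lw_phi_flip[OF g B(1)] D_def by (simp only: mult_ac)
  finally show "(\<Sum>T\<in>Pow B. (\<Prod>i\<in>B - T. x i ^ (2 * Suc k)) * D (B - T) (A - (B - T)) *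
    ((\<Prod>i\<in>T. x i ^ (2 * k)) * (lw_phi t ?y T * lw_phi t x (A - (B - T) - T) * D T (A - (B - T) - T)))) =
    (\<Prod>i\<in>B. x i ^ (2 * Suc k)) * lw_phi t (flip B x) A" .
 qed
 finally show ?thesis by (simp add: sign_sum_def D_def)
qed

text \<open>Both sides obey the same recursion in \<open>k\<close>. The initial value at
  \<open>k = 0\<close> is an assumption here; it will follow from the determinant formula, whose
  determinant is then empty.\<close>

lemma bl_sum_eq_sign_sum:
 assumes "lw_generic x A" "\<And>B. B \<subseteq> A \<Longrightarrow> sign_sum t x B 0 = 1"
 shows "bl_sum t x A k = sign_sum t x A k" using assms
proof (induction k arbitrary: A)
 case 0
 thus ?case by (simp add: bl_sum_0)
next
 case (Suc k)
 have fin: "finite A" using Suc.prems by (simp add: lw_generic_def)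
 have "bl_sum t x (A - S) k = sign_sum t x (A - S) k" if "S \<in> Pow A" for S
 proof (rule Suc.IH)
  show "lw_generic x (A - S)" by (rule lw_generic_subset[OF Suc.prems(1)]) auto
  show "sign_sum t x B 0 = 1" if "B \<subseteq> A - S" for B by (rule Suc.prems(2)) (use that in auto)
 qed
 thus ?case unfolding bl_sum_Suc[OF fin] sign_sum_Suc[OF Suc.prems(1)] by simp
qed

text \<open>All factors that connect a variable of value \<open>u\<close> with the variables
  \<open>x l\<close> and with their inverses. It is invariant under inversion of the
  \<open>x l\<close>, so it does not notice their sign changes.\<close>

definition star_coeff :: "complex \<Rightarrow> (nat \<Rightarrow> complex) \<Rightarrow> nat set \<Rightarrow> complex \<Rightarrow> complex" where
 "star_coeff t x A u = 1 / (1 - u\<^sup>2) * (\<Prod>l\<in>A. lw_factor t u (x l) * lw_factor t u (1 / x l))"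

text \<open>The factor on the left is a sum of \<open>hlb\<close> products in the inverted
  variables, by \<open>sum_hlb\<close>. Its summand for \<open>i\<close> supplies the missing
  factors between the variable \<open>i\<close> and the inverses of the others, which makes the
  coefficient of the smaller sum independent of all signs but that of \<open>i\<close>.\<close>

lemma sign_sum_star:
 assumes g: "lw_generic x A" and t: "t \<noteq> 1"
 shows "(1 - t ^ card A) / (1 - t) * sign_sum t x A k =
  (\<Sum>i\<in>A. (star_coeff t x (A - {i}) (x i) + x i ^ (2 * k) * star_coeff t x (A - {i}) (1 / x i)) *
    sign_sum t x (A - {i}) k)"
proof -
 have fin: "finite A" using g by (simp add: lw_generic_def)
 let ?c = "\<lambda>B. \<Prod>i\<in>B. x i ^ (2 * k)"
 have eq: "(1 - t ^ card A) / (1 - t) * lw_phi t (flip B x) A =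
   (\<Sum>i\<in>A. star_coeff t x (A - {i}) (flip B x i) * lw_phi t (flip B x) (A - {i}))" for B
 proof -
  let ?y = "flip B x"
  have gy: "lw_generic ?y A" by (rule lw_generic_flip[OF g])
  have y0: "?y i \<noteq> 0" if "i \<in> A" for i using gy that by (auto simp: lw_generic_def)
  have "inj_on (\<lambda>i. 1 / ?y i) A" using gy by (auto simp: lw_generic_def inj_on_def)
  from sum_hlb[OF fin this t]
  have "(1 - t ^ card A) / (1 - t) = (\<Sum>i\<in>A. \<Prod>c\<in>A - {i}. hlb t (1 / ?y i) (1 / ?y c))" by simp
  also have "... = (\<Sum>i\<in>A. \<Prod>c\<in>A - {i}. lw_factor t (?y i) (1 / ?y c))" by (intro sum.cong prod.cong refl hlb_eq_lw_factor y0) auto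
  finally have "(1 - t ^ card A) / (1 - t) * lw_phi t ?y A =
    (\<Sum>i\<in>A. (\<Prod>c\<in>A - {i}. lw_factor t (?y i) (1 / ?y c)) * lw_phi t ?y A)" by (simp add: sum_distrib_right)
  also have "... = (\<Sum>i\<in>A. star_coeff t x (A - {i}) (?y i) * lw_phi t ?y (A - {i}))"
  proof (rule sum.cong[OF refl])
   fix i assume i: "i \<in> A"
   have A: "A = insert i (A - {i})" using i by auto
   have "lw_phi t ?y A = 1 / (1 - (?y i)\<^sup>2) * (\<Prod>l\<in>A - {i}. lw_factor t (?y i) (?y l)) * lw_phi t ?y (A - {i})"
    by (subst A, rule lw_phi_insert) (use fin in auto)
   moreover have "(\<Prod>c\<in>A - {i}. lw_factor t (?y i) (1 / ?y c)) * (\<Prod>l\<in>A - {i}. lw_factor t (?y i) (?y l)) =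
    (\<Prod>l\<in>A - {i}. lw_factor t (?y i) (x l) * lw_factor t (?y i) (1 / x l))"
    unfolding prod.distrib[symmetric] by (rule prod.cong[OF refl]) (simp add: flip_def mult.commute)
   ultimately show "(\<Prod>c\<in>A - {i}. lw_factor t (?y i) (1 / ?y c)) * lw_phi t ?y A =
     star_coeff t x (A - {i}) (?y i) * lw_phi t ?y (A - {i})" unfolding star_coeff_def by (simp add: mult_ac)
  qed
  finally show ?thesis .
 qed
 have "(1 - t ^ card A) / (1 - t) * sign_sum t x A k =
   (\<Sum>B\<in>Pow A. ?c B * ((1 - t ^ card A) / (1 - t) * lw_phi t (flip B x) A))"
  unfolding sign_sum_def sum_distrib_left by (simp only: mult.left_commute)
 also have "... = (\<Sum>B\<in>Pow A. \<Sum>i\<in>A. ?c B * (star_coeff t x (A - {i}) (flip B x i) * lw_phi t (flip B x) (A - {i})))"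
  unfolding eq sum_distrib_left ..
 also have "... = (\<Sum>i\<in>A. \<Sum>B\<in>Pow A. ?c B * (star_coeff t x (A - {i}) (flip B x i) * lw_phi t (flip B x) (A - {i})))"
  by (rule sum.swap)
 also have "... = (\<Sum>i\<in>A. (star_coeff t x (A - {i}) (x i) + x i ^ (2 * k) * star_coeff t x (A - {i}) (1 / x i)) *
    sign_sum t x (A - {i}) k)"
 proof (rule sum.cong[OF refl])
  fix i assume i: "i \<in> A"
  have A: "Pow A = Pow (insert i (A - {i}))" using i by (simp add: insert_absorb)
  have "(\<Sum>B\<in>Pow A. ?c B * (star_coeff t x (A - {i}) (flip B x i) * lw_phi t (flip B x) (A - {i}))) =
   (\<Sum>B\<in>Pow (A - {i}). ?c B * (star_coeff t x (A - {i}) (flip B x i) * lw_phi t (flip B x) (A - {i})) +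
    ?c (insert i B) * (star_coeff t x (A - {i}) (flip (insert i B) x i) * lw_phi t (flip (insert i B) x) (A - {i})))"
   unfolding A by (rule sum_Pow_insert) (use fin in auto)
  also have "... = (\<Sum>B\<in>Pow (A - {i}). (star_coeff t x (A - {i}) (x i) + x i ^ (2 * k) * star_coeff t x (A - {i}) (1 / x i)) *
    (?c B * lw_phi t (flip B x) (A - {i})))"
  proof (rule sum.cong[OF refl])
   fix B assume "B \<in> Pow (A - {i})"
   hence B: "i \<notin> B" "finite B" using fin by (auto intro: finite_subset)
   have "lw_phi t (flip (insert i B) x) (A - {i}) = lw_phi t (flip B x) (A - {i})" by (rule lw_phi_cong) (auto simp: flip_def)
   thus "?c B * (star_coeff t x (A - {i}) (flip B x i) * lw_phi t (flip B x) (A - {i})) +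
    ?c (insert i B) * (star_coeff t x (A - {i}) (flip (insert i B) x i) * lw_phi t (flip (insert i B) x) (A - {i})) =
    (star_coeff t x (A - {i}) (x i) + x i ^ (2 * k) * star_coeff t x (A - {i}) (1 / x i)) *
    (?c B * lw_phi t (flip B x) (A - {i}))" using B by (simp add: flip_def algebra_simps)
  qed
  finally show "(\<Sum>B\<in>Pow A. ?c B * (star_coeff t x (A - {i}) (flip B x i) * lw_phi t (flip B x) (A - {i}))) =
    (star_coeff t x (A - {i}) (x i) + x i ^ (2 * k) * star_coeff t x (A - {i}) (1 / x i)) *
    sign_sum t x (A - {i}) k" by (simp add: sign_sum_def sum_distrib_left)
 qed
 finally show ?thesis .
qed

section \<open>Affine coefficients and quadrature at roots of unity\<close>

text \<open>The residue classes of \<open>i\<close> and \<open>- i\<close> modulo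
  \<open>2 * K\<close> form the orbit of \<open>i\<close> under the affine Weyl group of rank one,
  and the sign is that of the linear part. The exponent of \<open>t\<close> is quadratic, so that
  translation by \<open>2 * K\<close> multiplies by a power that is linear in
  \<open>m\<close>.\<close>

definition affine_coeff :: "complex \<Rightarrow> nat \<Rightarrow> nat \<Rightarrow> int \<Rightarrow> complex" where
 "affine_coeff t K i m =
   (if 2 * int K dvd m - int i then t ^ nat ((m\<^sup>2 - (int i)\<^sup>2) div (4 * int K))
   else if 2 * int K dvd m + int i then - (t ^ nat ((m\<^sup>2 - (int i)\<^sup>2) div (4 * int K)))
   else 0)"

lemma affine_coeff_exclusive:
 assumes "0 < i" "i < K" "2 * int K dvd m - int i"
 shows "\<not> 2 * int K dvd m + int i"
proof
 assume "2 * int K dvd m + int i"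
 hence "2 * int K dvd (m + int i) - (m - int i)" using assms(3) by (rule dvd_diff)
 hence "2 * int K dvd 2 * int i" by simp
 hence "int K dvd int i" by simp
 thus False using assms(1,2) by (auto dest: zdvd_imp_le)
qed

lemma affine_coeff_minus:
 assumes "0 < i" "i < K"
 shows "affine_coeff t K i (- m) = - affine_coeff t K i m"
proof -
 have "2 * int K dvd - m - int i \<longleftrightarrow> 2 * int K dvd m + int i"
  by (metis (no_types, opaque_lifting) dvd_minus_iff minus_diff_eq add.commute diff_minus_eq_add)
 moreover have "2 * int K dvd - m + int i \<longleftrightarrow> 2 * int K dvd m - int i" by (metis dvd_minus_iff minus_diff_eq uminus_add_conv_diff)
 ultimately show ?thesis using affine_coeff_exclusive[OF assms, of m] by (auto simp: affine_coeff_def)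
qed

lemma affine_coeff_exponent:
 assumes i: "0 < i" "i < K" and m: "2 * int K dvd m - int i \<or> 2 * int K dvd m + int i"
 obtains e where "m\<^sup>2 - (int i)\<^sup>2 = 4 * int K * e" "e \<ge> 0" "(m\<^sup>2 - (int i)\<^sup>2) div (4 * int K) = e"
proof -
 obtain r :: int and s :: int where m': "m = s * int i + 2 * int K * r" "s = 1 \<or> s = - 1"
 proof -
  from m show ?thesis
  proof
   assume "2 * int K dvd m - int i"
   then obtain r where "m - int i = 2 * int K * r" by auto
   thus ?thesis by (intro that[of 1 r]) auto
  next
   assume "2 * int K dvd m + int i"
   then obtain r where "m + int i = 2 * int K * r" by auto
   thus ?thesis by (intro that[of "-1" r]) auto
  qed
 qed
 \<comment> \<open>With \<open>m = s * i + 2 * K * r\<close> the quotient is the integer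
   \<open>K * r^2 + s * i * r\<close>. It is nonnegative since \<open>i < K\<close>, which justifies
   the natural exponents.\<close>
 define e where "e = int K * r\<^sup>2 + s * int i * r"
 have s2: "s * s = 1" using m'(2) by auto
 have "m\<^sup>2 = (s * s) * (int i)\<^sup>2 + 4 * int K * e" unfolding m'(1) e_def by (simp add: power2_eq_square algebra_simps)
 hence eq: "m\<^sup>2 - (int i)\<^sup>2 = 4 * int K * e" by (simp add: s2)
 have "e \<ge> 0"
 proof (cases "r = 0")
  case False
  hence "\<bar>r\<bar> \<ge> 1" by simp
  have "\<bar>s * int i * r\<bar> \<le> int K * (\<bar>r\<bar> * \<bar>r\<bar>)"
  proof -
   have "\<bar>s * int i * r\<bar> = int i * \<bar>r\<bar>" using m'(2) by (auto simp: abs_mult)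
   also have "... \<le> int K * \<bar>r\<bar>" using i by (intro mult_right_mono) auto
   also have "... \<le> int K * (\<bar>r\<bar> * \<bar>r\<bar>)"
    using mult_left_mono[OF \<open>\<bar>r\<bar> \<ge> 1\<close>, of "\<bar>r\<bar>"] by (intro mult_left_mono) auto
   finally show ?thesis .
  qed
  hence "\<bar>s * int i * r\<bar> \<le> int K * r\<^sup>2" by (simp add: power2_eq_square)
  thus ?thesis unfolding e_def by linarith
 qed (simp add: e_def)
 moreover have "(m\<^sup>2 - (int i)\<^sup>2) div (4 * int K) = e" using eq i by simp
 ultimately show ?thesis using that eq by blast
qed

text \<open>The difference of the two exponents is
  \<open>((m + 2 * K)^2 - m^2) / (4 * K) = m + K\<close>.\<close>

lemma affine_coeff_shift:
 assumes i: "0 < i" "i < K" and t: "t \<noteq> 0"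
 shows "affine_coeff t K i (m + 2 * int K) = t powi (m + int K) * affine_coeff t K i m"
proof -
 have d: "2 * int K dvd m + 2 * int K - int i \<longleftrightarrow> 2 * int K dvd m - int i"
  "2 * int K dvd m + 2 * int K + int i \<longleftrightarrow> 2 * int K dvd m + int i"
 proof -
  have "m + 2 * int K - int i = (m - int i) + 2 * int K" "m + 2 * int K + int i = (m + int i) + 2 * int K" by simp_all
  thus "2 * int K dvd m + 2 * int K - int i \<longleftrightarrow> 2 * int K dvd m - int i"
   "2 * int K dvd m + 2 * int K + int i \<longleftrightarrow> 2 * int K dvd m + int i" by (simp_all only: dvd_add_triv_right_iff)
 qed
 show ?thesis
 proof (cases "2 * int K dvd m - int i \<or> 2 * int K dvd m + int i")
  case False
  thus ?thesis using d by (simp add: affine_coeff_def)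
 next
  case True
  obtain e where e: "m\<^sup>2 - (int i)\<^sup>2 = 4 * int K * e" "e \<ge> 0" "(m\<^sup>2 - (int i)\<^sup>2) div (4 * int K) = e"
   using affine_coeff_exponent[OF i True] by blast
  obtain e' where e': "(m + 2 * int K)\<^sup>2 - (int i)\<^sup>2 = 4 * int K * e'" "e' \<ge> 0"
   "((m + 2 * int K)\<^sup>2 - (int i)\<^sup>2) div (4 * int K) = e'" using affine_coeff_exponent[OF i, of "m + 2 * int K"] True d by blast
  have "4 * int K * e' = 4 * int K * (e + m + int K)" using e(1) e'(1) by (simp add: power2_eq_square algebra_simps)
  hence ee: "e' = m + int K + e" using i by simp
  have p: "t ^ nat j = t powi j" if "j \<ge> 0" for j using that by (simp add: power_int_def)
  have "t powi e' = t powi (m + int K) * t powi e" unfolding ee using t by (intro power_int_add) simp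
  hence "t ^ nat e' = t powi (m + int K) * t ^ nat e" unfolding p[OF e(2)] p[OF e'(2)] .
  thus ?thesis using d e(3) e'(3) by (auto simp: affine_coeff_def)
 qed
qed

lemma norm_affine_coeff_le: "norm t \<le> 1 \<Longrightarrow> norm (affine_coeff t K i m) \<le> 1"
 by (auto simp: affine_coeff_def norm_power power_le_one)

lemma continuous_affine_coeff: "continuous_on S (\<lambda>t. affine_coeff t K i m)"
 by (cases "2 * int K dvd m - int i"; cases "2 * int K dvd m + int i";
   simp add: affine_coeff_def; intro continuous_intros)

section \<open>Quadrature on roots of unity\<close>

lemma sum_roots_unity_powi:
 assumes N: "N > 0"
 shows "(\<Sum>z | z ^ N = 1. z powi j) = (if int N dvd j then of_nat N else (0::complex))"
proof -
 let ?Z = "{z::complex. z ^ N = 1}"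
 have fin: "finite ?Z" "card ?Z = N" using N card_roots_unity_eq[of N] finite_roots_unity[of N] by auto
 show ?thesis
 proof (cases "int N dvd j")
  case True
  then obtain r where r: "j = int N * r" by auto
  have "z powi j = 1" if "z \<in> ?Z" for z using that by (simp add: r power_int_mult)
  thus ?thesis using True fin by simp
 next
  case False
  define w where "w = cis (2 * pi / real N)"
  have wN: "w ^ N = 1" unfolding w_def Complex.DeMoivre using N by simp
  have w0: "w \<noteq> 0" by (simp add: w_def)
  have "w powi j \<noteq> 1"
  proof
   assume "w powi j = 1"
   define r where "r = nat (j mod int N)"
   have "j mod int N \<ge> 0" "j mod int N < int N" "j mod int N \<noteq> 0" using N False by (simp_all add: dvd_eq_mod_eq_0)
   moreover from this have ir: "int r = j mod int N" by (simp add: r_def)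
   ultimately have rb: "r < N" "r > 0" by linarith+
   have "j = int N * (j div int N) + int r" unfolding ir by simp
   hence "w powi j = w powi (int N * (j div int N)) * w powi int r" using power_int_add[of w "int N * (j div int N)" "int r"] w0 by simp
   hence "w ^ r = 1" using \<open>w powi j = 1\<close> wN by (simp add: power_int_mult)
   hence "cis (real r * (2 * pi / real N)) = 1" by (simp only: w_def Complex.DeMoivre)
   hence "Re (cis (real r * (2 * pi / real N))) = 1" by simp
   hence "cos (real r * (2 * pi / real N)) = 1" by simp
   then obtain n :: int where "real r * (2 * pi / real N) = of_int n * 2 * pi" using cos_one_2pi_int by blast
   hence "real r = of_int n * real N" using N pi_gt_zero by (simp add: field_simps)
   hence "real_of_int (int r) = real_of_int (n * int N)" by simp
   hence "int r = n * int N" by (simp only: of_int_eq_iff)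
   hence "int N dvd int r" by simp
   thus False using rb by (auto dest: zdvd_imp_le)
  qed
  \<comment> \<open>Rotation by \<open>w\<close> permutes the roots of unity, so the sum is a fixed
    point of multiplication by \<open>w powi j\<close>, which is not 1.\<close>
  moreover have "(\<Sum>z\<in>?Z. z powi j) = w powi j * (\<Sum>z\<in>?Z. z powi j)"
  proof -
   have "(\<Sum>z\<in>?Z. z powi j) = (\<Sum>z\<in>?Z. (w * z) powi j)"
    by (rule sum.reindex_bij_witness[where j = "\<lambda>z. z / w" and i = "\<lambda>z. w * z"])
      (use w0 wN in \<open>auto simp: power_mult_distrib power_divide\<close>)
   also have "... = (\<Sum>z\<in>?Z. w powi j * z powi j)" by (simp only: power_int_mult_distrib)
   finally show ?thesis by (subst sum_distrib_left)
  qed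
  ultimately show ?thesis using False by simp
 qed
qed

text \<open>A finite quadrature representing the functionals \<open>z ^ m \<mapsto> affine_coeff t K i m\<close> on
 Laurent polynomials of bounded degree, by weights on roots of unity.\<close>
locale quadrature =
 fixes t :: complex and k :: nat and Z :: "complex set" and TH :: "nat \<Rightarrow> complex \<Rightarrow> complex" and N :: nat
 assumes finite_Z: "finite Z" and norm_Z: "z \<in> Z \<Longrightarrow> norm z = 1" and inverse_Z: "z \<in> Z \<Longrightarrow> 1 / z \<in> Z"
  and weight_inverse: "i < k \<Longrightarrow> z \<in> Z \<Longrightarrow> TH i (1 / z) = - TH i z"
  and moment: "i < k \<Longrightarrow> \<bar>m\<bar> \<le> int N \<Longrightarrow> (\<Sum>z\<in>Z. TH i z * z powi m) = affine_coeff t (Suc k) (Suc i) m"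

text \<open>Discrete Fourier inversion: \<open>TH i\<close> is the trigonometric polynomial with the
  prescribed moments as coefficients. Frequencies between \<open>- N\<close> and \<open>N\<close>
  are distinct modulo \<open>2 * N + 1\<close>, so there is no aliasing on that many roots of
  unity.\<close>

lemma quadrature_exists: "\<exists>Z TH. quadrature t k Z TH N"
proof -
 define M where "M = 2 * N + 1"
 define Z where "Z = {z::complex. z ^ M = 1}"
 define I where "I = {- int N..int N}"
 define TH where "TH i z = (\<Sum>m\<in>I. affine_coeff t (Suc k) (Suc i) m * z powi (- m)) / of_nat M" for i and z :: complex
 have M: "M > 0" by (simp add: M_def)
 have "quadrature t k Z TH N"
 proof
  show "finite Z" using finite_roots_unity[of M] M by (simp add: Z_def)
  show "norm z = 1" if "z \<in> Z" for z
  proof -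
   have "norm z ^ M = 1" using that by (simp add: Z_def flip: norm_power)
   thus ?thesis using M by (metis norm_ge_zero power_eq_1_iff abs_norm_cancel order_less_le power_one real_root_pos2 zero_neq_one)
  qed
  show "1 / z \<in> Z" if "z \<in> Z" for z using that by (simp add: Z_def power_divide)
  show "TH i (1 / z) = - TH i z" if i: "i < k" for i z
  proof -
   have "(\<Sum>m\<in>I. affine_coeff t (Suc k) (Suc i) m * (1 / z) powi (- m)) =
      (\<Sum>m\<in>I. affine_coeff t (Suc k) (Suc i) (- m) * (1 / z) powi m)"
    by (rule sum.reindex_bij_witness[where i = uminus and j = uminus]) (auto simp: I_def)
   also have "... = (\<Sum>m\<in>I. - (affine_coeff t (Suc k) (Suc i) m * z powi (- m)))"
    using i by (intro sum.cong refl) (simp add: affine_coeff_minus power_int_minus power_int_inverse divide_inverse)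
   finally show ?thesis by (simp add: TH_def sum_negf)
  qed
  show "(\<Sum>z\<in>Z. TH i z * z powi m) = affine_coeff t (Suc k) (Suc i) m" if m: "\<bar>m\<bar> \<le> int N" for i m
  proof -
   have z0: "z \<noteq> 0" if "z \<in> Z" for z using that M by (auto simp: Z_def power_0_left)
   have "(\<Sum>z\<in>Z. TH i z * z powi m) =
     (\<Sum>z\<in>Z. \<Sum>n\<in>I. affine_coeff t (Suc k) (Suc i) n / of_nat M * z powi (m - n))"
    unfolding TH_def sum_divide_distrib sum_distrib_right by (intro sum.cong refl) (simp add: z0 power_int_diff power_int_minus divide_inverse)
   also have "... = (\<Sum>n\<in>I. affine_coeff t (Suc k) (Suc i) n / of_nat M * (\<Sum>z\<in>Z. z powi (m - n)))"
    unfolding sum_distrib_left by (rule sum.swap)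
   also have "... = (\<Sum>n\<in>I. if n = m then affine_coeff t (Suc k) (Suc i) n else 0)"
   proof (rule sum.cong[OF refl])
    fix n assume n: "n \<in> I"
    have "int M dvd m - n \<longleftrightarrow> n = m"
    proof
     assume "int M dvd m - n"
     have "m - n = 0"
     proof (rule ccontr)
      assume "m - n \<noteq> 0"
      hence "int M \<le> \<bar>m - n\<bar>" using dvd_imp_le_int[of "m - n" "int M"] \<open>int M dvd m - n\<close> by simp
      moreover have "int M = 2 * int N + 1" by (simp add: M_def)
      moreover have "- int N \<le> n" "n \<le> int N" using n by (auto simp: I_def)
      ultimately show False using m by linarith
     qed
     thus "n = m" by simp
    qed auto
    thus "affine_coeff t (Suc k) (Suc i) n / of_nat M * (\<Sum>z\<in>Z. z powi (m - n)) =
      (if n = m then affine_coeff t (Suc k) (Suc i) n else 0)" using sum_roots_unity_powi[OF M, of "m - n"] M by (auto simp: Z_def)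
   qed
   also have "... = affine_coeff t (Suc k) (Suc i) m" using m by (auto simp: I_def)
   finally show ?thesis .
  qed
 qed
 thus ?thesis by blast
qed

section \<open>Determinants\<close>

text \<open>The Leibniz formula with the size as an ordinary number, which suits induction on the
  size and the replacement of a single column.\<close>

definition pdet :: "nat \<Rightarrow> (nat \<Rightarrow> nat \<Rightarrow> complex) \<Rightarrow> complex" where
 "pdet k M = (\<Sum>pm | pm permutes {..<k}. of_int (sign pm) * (\<Prod>j<k. M (pm j) j))"

lemma pdet_cong: "(\<And>i j. i < k \<Longrightarrow> j < k \<Longrightarrow> M i j = M' i j) \<Longrightarrow> pdet k M = pdet k M'"
 unfolding pdet_def by (intro sum.cong refl arg_cong2[of _ _ _ _ "(*)"] prod.cong) (auto dest: permutes_in_image)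

lemma pdet_0 [simp]: "pdet 0 M = 1" by (simp add: pdet_def sign_id)

lemma pdet_scale_columns: "pdet k (\<lambda>i j. c j * M i j) = (\<Prod>j<k. c j) * pdet k M"
 unfolding pdet_def by (simp add: prod.distrib sum_distrib_left mult.left_commute)

lemma pdet_scale_rows: "pdet k (\<lambda>i j. c i * M i j) = (\<Prod>i<k. c i) * pdet k M"
proof -
 have "(\<Prod>j<k. c (pm j)) = (\<Prod>i<k. c i)" if "pm permutes {..<k}" for pm by (rule prod.permute[OF that, symmetric, unfolded comp_def])
 thus ?thesis unfolding pdet_def sum_distrib_left prod.distrib by (intro sum.cong refl) (simp add: mult.left_commute)
qed

lemma pdet_permute_columns:
 assumes tr: "tr permutes {..<k}"
 shows "pdet k (\<lambda>i j. M i (tr j)) = of_int (sign tr) * pdet k M"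
proof -
 let ?P = "{pm. pm permutes {..<k}}"
 have "pdet k (\<lambda>i j. M i (tr j)) = (\<Sum>pm\<in>?P. of_int (sign (pm \<circ> tr)) * (\<Prod>j<k. M ((pm \<circ> tr) j) (tr j)))"
  unfolding pdet_def by (rule sum.reindex_bij_witness[where i = "\<lambda>pm. pm \<circ> tr" and j = "\<lambda>pm. pm \<circ> inv tr"])
   (use tr in \<open>auto intro: permutes_compose permutes_inv simp: comp_assoc permutes_inv_o\<close>)
 also have "... = (\<Sum>pm\<in>?P. of_int (sign tr) * (of_int (sign pm) * (\<Prod>j<k. M (pm j) j)))"
 proof (rule sum.cong[OF refl])
  fix pm assume pm: "pm \<in> ?P"
  have "(\<Prod>j<k. M ((pm \<circ> tr) j) (tr j)) = (\<Prod>j<k. M (pm j) j)"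
   using prod.permute[OF tr, of "\<lambda>j. M (pm j) j"] by (simp add: comp_def)
  moreover have "sign (pm \<circ> tr) = sign pm * sign tr"
   using pm tr by (intro sign_compose) (auto intro: permutation_permutes[THEN iffD2] exI[of _ "{..<k}"])
  ultimately show "of_int (sign (pm \<circ> tr)) * (\<Prod>j<k. M ((pm \<circ> tr) j) (tr j)) =
    of_int (sign tr) * (of_int (sign pm) * (\<Prod>j<k. M (pm j) j))" by simp
 qed
 finally show ?thesis by (simp add: pdet_def sum_distrib_left)
qed

lemma pdet_equal_columns:
 assumes "a < k" "b < k" "a \<noteq> b" "\<And>i. i < k \<Longrightarrow> M i a = M i b"
 shows "pdet k M = 0"
proof -
 let ?tr = "Transposition.transpose a b"
 have tr: "?tr permutes {..<k}" by (rule permutes_swap_id) (use assms in auto)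
 have "pdet k (\<lambda>i j. M i (?tr j)) = pdet k M" by (rule pdet_cong) (use assms in \<open>auto simp: Transposition.transpose_def\<close>)
 moreover have "pdet k (\<lambda>i j. M i (?tr j)) = - pdet k M" unfolding pdet_permute_columns[OF tr] using assms(3) by (simp add: sign_swap_id)
 ultimately show ?thesis by simp
qed

lemma pdet_last_column:
 "pdet (Suc k) M = (\<Sum>pm | pm permutes {..<Suc k}. of_int (sign pm) * (\<Prod>j<k. M (pm j) j) * M (pm k) k)"
 unfolding pdet_def by (simp add: mult.assoc)

lemma pdet_last_column_sum:
 assumes "finite I"
 shows "pdet (Suc k) (\<lambda>i j. if j = k then \<Sum>l\<in>I. c l * f l i else M i j) =
  (\<Sum>l\<in>I. c l * pdet (Suc k) (\<lambda>i j. if j = k then f l i else M i j))"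
proof -
 have "pdet (Suc k) (\<lambda>i j. if j = k then \<Sum>l\<in>I. c l * f l i else M i j) =
  (\<Sum>pm | pm permutes {..<Suc k}. \<Sum>l\<in>I. c l * (of_int (sign pm) * (\<Prod>j<k. M (pm j) j) * f l (pm k)))"
  unfolding pdet_last_column by (intro sum.cong refl) (simp add: sum_distrib_left mult_ac)
 also have "... = (\<Sum>l\<in>I. c l * (\<Sum>pm | pm permutes {..<Suc k}. of_int (sign pm) * (\<Prod>j<k. M (pm j) j) * f l (pm k)))"
  unfolding sum_distrib_left by (rule sum.swap)
 finally show ?thesis unfolding pdet_last_column by simp
qed

lemma permutes_lessThan_Suc_fix:
 "{pm. pm permutes {..<Suc k} \<and> pm k = k} = {pm. pm permutes {..<k}}"
proof (intro set_eqI iffI)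
 fix pm assume "pm \<in> {pm. pm permutes {..<Suc k} \<and> pm k = k}"
 hence "pm permutes {..<Suc k}" "pm k = k" by auto
 hence "pm permutes {..<k}" unfolding permutes_def by (auto simp: less_Suc_eq)
 thus "pm \<in> {pm. pm permutes {..<k}}" by simp
next
 fix pm assume "pm \<in> {pm. pm permutes {..<k}}"
 hence pm: "pm permutes {..<k}" by simp
 hence "pm permutes {..<Suc k}" by (rule permutes_subset) auto
 moreover have "pm k = k" by (rule permutes_not_in[OF pm]) auto
 ultimately show "pm \<in> {pm. pm permutes {..<Suc k} \<and> pm k = k}" by simp
qed

section \<open>Vandermonde determinants of types A and C\<close>

definition vdm :: "nat \<Rightarrow> (nat \<Rightarrow> complex) \<Rightarrow> complex" where
 "vdm k w = (\<Prod>j<k. \<Prod>i<j. w j - w i)"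

lemma vdm_Suc: "vdm (Suc k) w = vdm k w * (\<Prod>i<k. w k - w i)" by (simp add: vdm_def)

lemma vdm_eq_0_iff: "vdm k w = 0 \<longleftrightarrow> \<not> inj_on w {..<k}"
proof -
 have "inj_on w {..<k} \<longleftrightarrow> (\<forall>j<k. \<forall>i<j. w j \<noteq> w i)"
 proof
  assume "inj_on w {..<k}"
  thus "\<forall>j<k. \<forall>i<j. w j \<noteq> w i" by (auto dest: inj_onD)
 next
  assume *: "\<forall>j<k. \<forall>i<j. w j \<noteq> w i"
  show "inj_on w {..<k}"
  proof (rule inj_onI)
   fix i j assume "i \<in> {..<k}" "j \<in> {..<k}" "w i = w j"
   thus "i = j" using *[rule_format, of i j] *[rule_format, of j i] by (cases i j rule: linorder_cases) auto
  qed
 qed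
 thus ?thesis by (auto simp: vdm_def)
qed

text \<open>As a polynomial in its last variable, the determinant has the other variables as roots.\<close>
lemma pdet_monic_polys:
 assumes "\<And>i. degree (P i) = i" "\<And>i. coeff (P i) i = 1"
 shows "pdet k (\<lambda>i j. poly (P i) (w j)) = vdm k w"
proof (induction k arbitrary: w)
 case 0
 show ?case by (simp add: vdm_def)
next
 case (Suc k)
 show ?case
 proof (cases "inj_on w {..<Suc k}")
  case False
  then obtain a b where "a < Suc k" "b < Suc k" "a \<noteq> b" "w a = w b" by (auto simp: inj_on_def)
  hence "pdet (Suc k) (\<lambda>i j. poly (P i) (w j)) = 0" by (intro pdet_equal_columns[of a _ b]) auto
  thus ?thesis using False vdm_eq_0_iff by simp
 next
  case True
  define Q where "Q = (\<Sum>pm | pm permutes {..<Suc k}.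
    smult (of_int (sign pm) * (\<Prod>j<k. poly (P (pm j)) (w j))) (P (pm k)))"
  define L where "L = (\<Prod>i<k. [:- w i, 1:])"
  let ?W = "\<lambda>z j. if j = k then z else w j"
  have polyQ: "poly Q z = pdet (Suc k) (\<lambda>i j. poly (P i) (?W z j))" for z unfolding Q_def pdet_last_column by (simp add: poly_sum)
  have le: "pm k \<le> k" if "pm permutes {..<Suc k}" for pm using permutes_in_image[OF that, of k] by auto
  have degQ: "degree Q \<le> k" unfolding Q_def by (rule degree_sum_le)
    (use assms(1) le in \<open>auto intro!: order_trans[OF degree_smult_le] finite_permutations\<close>)
  have degL: "degree L = k" unfolding L_def by (subst degree_prod_eq_sum_degree) auto
  have leadL: "coeff L k = 1" using lead_coeff_prod[of "\<lambda>i. [:- w i, 1:]" "{..<k}"] degL by (simp add: L_def)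
  have coeffQ: "coeff Q k = vdm k w"
  proof -
   have "coeff Q k = (\<Sum>pm | pm permutes {..<Suc k}. (of_int (sign pm) * (\<Prod>j<k. poly (P (pm j)) (w j))) * coeff (P (pm k)) k)"
    by (simp add: Q_def coeff_sum)
   also have "... = (\<Sum>pm\<in>{pm. pm permutes {..<Suc k} \<and> pm k = k}. (of_int (sign pm) * (\<Prod>j<k. poly (P (pm j)) (w j))) * coeff (P (pm k)) k)"
   proof (rule sum.mono_neutral_right)
    show "\<forall>pm\<in>{pm. pm permutes {..<Suc k}} - {pm. pm permutes {..<Suc k} \<and> pm k = k}.
      of_int (sign pm) * (\<Prod>j<k. poly (P (pm j)) (w j)) * coeff (P (pm k)) k = 0"
    proof
     fix pm assume "pm \<in> {pm. pm permutes {..<Suc k}} - {pm. pm permutes {..<Suc k} \<and> pm k = k}"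
     hence "pm k < k" using le[of pm] by auto
     thus "of_int (sign pm) * (\<Prod>j<k. poly (P (pm j)) (w j)) * coeff (P (pm k)) k = 0" using assms(1)[of "pm k"] by (simp add: coeff_eq_0)
    qed
   qed (auto intro: finite_permutations)
   also have "... = (\<Sum>pm | pm permutes {..<k}. of_int (sign pm) * (\<Prod>j<k. poly (P (pm j)) (w j)))"
    unfolding permutes_lessThan_Suc_fix[symmetric] by (intro sum.cong refl) (simp add: assms(2))
   also have "... = vdm k w" using Suc.IH[of w] by (simp add: pdet_def)
   finally show ?thesis .
  qed
  \<comment> \<open>\<open>Q\<close> has degree at most \<open>k\<close>, its coefficient of degree
    \<open>k\<close> is \<open>vdm k w\<close> and comes from the permutations fixing
    \<open>k\<close>, and it vanishes at the \<open>k\<close> points \<open>w i\<close>, where two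
    columns agree.\<close>
  have "Q = smult (vdm k w) L"
  proof (rule ccontr)
   assume "Q \<noteq> smult (vdm k w) L"
   define D where "D = Q - smult (vdm k w) L"
   have "D \<noteq> 0" using \<open>Q \<noteq> smult (vdm k w) L\<close> by (simp add: D_def)
   have "coeff D k = 0" using coeffQ leadL by (simp add: D_def)
   moreover have "degree D \<le> k" unfolding D_def
    by (rule degree_diff_le) (use degQ degL in \<open>auto intro: order_trans[OF degree_smult_le]\<close>)
   moreover have "degree D \<noteq> k"
   proof
    assume "degree D = k"
    hence "lead_coeff D = 0" using \<open>coeff D k = 0\<close> by simp
    thus False using \<open>D \<noteq> 0\<close> by simp
   qed
   ultimately have dD: "degree D < k" by simp
   have "poly D (w i) = 0" if "i < k" for i
   proof -
    have "poly Q (w i) = 0" unfolding polyQ by (rule pdet_equal_columns[of i _ k]) (use that in auto)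
    moreover have "poly L (w i) = 0" using that by (auto simp: L_def poly_prod)
    ultimately show ?thesis by (simp add: D_def)
   qed
   hence "w ` {..<k} \<subseteq> {z. poly D z = 0}" by auto
   hence "card (w ` {..<k}) \<le> card {z. poly D z = 0}" by (rule card_mono[rotated]) (simp add: poly_roots_finite \<open>D \<noteq> 0\<close>)
   moreover have "card (w ` {..<k}) = k" using True by (subst card_image) (auto intro: inj_on_subset)
   ultimately show False using card_poly_roots_bound[OF \<open>D \<noteq> 0\<close>] dD by linarith
  qed
  hence "poly Q (w k) = vdm k w * (\<Prod>i<k. w k - w i)" by (simp add: L_def poly_prod)
  moreover have "poly Q (w k) = pdet (Suc k) (\<lambda>i j. poly (P i) (w j))" unfolding polyQ by (rule pdet_cong) auto
  ultimately show ?thesis by (simp add: vdm_Suc)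
 qed
qed

text \<open>Chebyshev polynomials of the second kind, in the variable \<open>z + 1 / z\<close>.\<close>
fun cheb :: "nat \<Rightarrow> complex poly" where
 "cheb 0 = 1"
| "cheb (Suc 0) = [:0, 1:]"
| "cheb (Suc (Suc n)) = pCons 0 (cheb (Suc n)) - cheb n"

lemma cheb_degree: "degree (cheb n) = n" "coeff (cheb n) n = 1"
proof -
 have "degree (cheb n) = n \<and> coeff (cheb n) n = 1"
 proof (induction n rule: cheb.induct)
  case (3 n)
  have d: "degree (pCons 0 (cheb (Suc n))) = Suc (Suc n)" using 3 by (auto simp: degree_pCons_eq_if)
  hence "degree (cheb (Suc (Suc n))) = Suc (Suc n)" using 3 unfolding cheb.simps diff_conv_add_uminus by (subst degree_add_eq_left) auto
  moreover have "coeff (cheb n) (Suc (Suc n)) = 0" using 3 by (intro coeff_eq_0) simp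
  ultimately show ?case using 3 by simp
 qed auto
 thus "degree (cheb n) = n" "coeff (cheb n) n = 1" by auto
qed

lemma poly_cheb:
 assumes "z \<noteq> 0"
 shows "(z - 1 / z) * poly (cheb n) (z + 1 / z) = z ^ Suc n - (1 / z) ^ Suc n"
proof (induction n rule: cheb.induct)
 case 2
 show ?case by (simp add: algebra_simps power2_eq_square power_divide)
next
 case (3 n)
 have e1: "(z - y) * ((z + y) * a - b) = (z + y) * ((z - y) * a) - (z - y) * b" for y a b :: complex by (simp add: algebra_simps)
 have e2: "(z + y) * (z ^ Suc (Suc n) - y ^ Suc (Suc n)) - (z ^ Suc n - y ^ Suc n) =
   z ^ Suc (Suc (Suc n)) - y ^ Suc (Suc (Suc n))
   + ((z * y) * z ^ Suc n - z ^ Suc n) - ((z * y) * y ^ Suc n - y ^ Suc n)" for y :: complex by (simp add: algebra_simps)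
 have "poly (cheb (Suc (Suc n))) (z + 1 / z) = (z + 1 / z) * poly (cheb (Suc n)) (z + 1 / z) - poly (cheb n) (z + 1 / z)" by simp
 hence "(z - 1 / z) * poly (cheb (Suc (Suc n))) (z + 1 / z) =
   (z + 1 / z) * ((z - 1 / z) * poly (cheb (Suc n)) (z + 1 / z)) - (z - 1 / z) * poly (cheb n) (z + 1 / z)" by (simp only: e1)
 also have "... = z ^ Suc (Suc (Suc n)) - (1 / z) ^ Suc (Suc (Suc n))
   + ((z * (1 / z)) * z ^ Suc n - z ^ Suc n) - ((z * (1 / z)) * (1 / z) ^ Suc n - (1 / z) ^ Suc n)" by (simp only: 3 e2)
 also have "z * (1 / z) = 1" using assms by simp
 finally show ?case by simp
qed simp

text \<open>The Weyl denominator of type C. At nonzero points it vanishes exactly if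
  \<open>z i = z j\<close> or \<open>z i = 1 / z j\<close> for some \<open>i \<noteq> j\<close>, or
  \<open>z i = 1 / z i\<close> for some \<open>i\<close>.\<close>

definition cvdm :: "nat \<Rightarrow> (nat \<Rightarrow> complex) \<Rightarrow> complex" where
 "cvdm k z = (\<Prod>j<k. z j - 1 / z j) * vdm k (\<lambda>j. z j + 1 / z j)"

lemma pdet_cvdm:
 assumes "\<And>j. j < k \<Longrightarrow> z j \<noteq> 0"
 shows "pdet k (\<lambda>i j. z j ^ Suc i - (1 / z j) ^ Suc i) = cvdm k z"
proof -
 have "pdet k (\<lambda>i j. z j ^ Suc i - (1 / z j) ^ Suc i) =
   pdet k (\<lambda>i j. (z j - 1 / z j) * poly (cheb i) (z j + 1 / z j))" by (rule pdet_cong) (simp only: poly_cheb[OF assms])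
 also have "... = cvdm k z" by (simp only: pdet_scale_columns cvdm_def pdet_monic_polys[OF cheb_degree])
 finally show ?thesis .
qed

text \<open>Adding the preceding Chebyshev polynomial keeps each row polynomial monic of degree
  \<open>i\<close>, so the determinant does not change. For \<open>\<sigma> = 1\<close> this makes
  room for the extra factor \<open>1 + 1 / z\<close> beside the kernel.\<close>

lemma pdet_cvdm_shifted:
 assumes "\<And>j. j < k \<Longrightarrow> z j \<noteq> 0"
 shows "pdet k (\<lambda>i j. (z j ^ Suc i - (1 / z j) ^ Suc i) + (z j ^ i - (1 / z j) ^ i)) = cvdm k z"
proof -
 \<comment> \<open>At \<open>i = 0\<close> the added difference \<open>z ^ 0 - (1 / z) ^ 0\<close>
   vanishes, so nothing is added there.\<close>
 define P where "P i = (case i of 0 \<Rightarrow> cheb 0 | Suc n \<Rightarrow> cheb i + cheb n)" for i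
 have P: "degree (P i) = i" "coeff (P i) i = 1" for i by (cases i; simp add: P_def cheb_degree degree_add_eq_left coeff_eq_0)+
 have "pdet k (\<lambda>i j. (z j ^ Suc i - (1 / z j) ^ Suc i) + (z j ^ i - (1 / z j) ^ i)) =
   pdet k (\<lambda>i j. (z j - 1 / z j) * poly (P i) (z j + 1 / z j))"
 proof (rule pdet_cong)
  fix i j assume "i < k" "j < k"
  show "(z j ^ Suc i - (1 / z j) ^ Suc i) + (z j ^ i - (1 / z j) ^ i) = (z j - 1 / z j) * poly (P i) (z j + 1 / z j)"
  proof (cases i)
   case (Suc n)
   thus ?thesis unfolding P_def using poly_cheb[OF assms[OF \<open>j < k\<close>]] by (simp only: nat.case poly_add distrib_left)
  qed (simp add: P_def)
 qed
 also have "... = cvdm k z" by (simp only: pdet_scale_columns cvdm_def pdet_monic_polys[OF P])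
 finally show ?thesis .
qed

section \<open>The recursion for the determinant\<close>

definition kern :: "(nat \<Rightarrow> complex) \<Rightarrow> nat set \<Rightarrow> complex \<Rightarrow> complex" where
 "kern x A z = (\<Prod>a\<in>A. (1 + x a * z) * (1 + x a / z))"

text \<open>The residue sum of a rational function that decays at infinity at least like
  \<open>1 / u^2\<close>. Indexed nodes allow poles of different origin to be kept in one sum
  type.\<close>

lemma lagrange_sum_indexed:
 fixes a :: "'b \<Rightarrow> complex"
 assumes fin: "finite I" and inj: "inj_on a I" and deg: "Suc (degree p) < card I"
 shows "(\<Sum>i\<in>I. poly p (a i) / (\<Prod>c\<in>I - {i}. a i - a c)) = 0"
proof -
 have "card (a ` I) = card I" by (rule card_image[OF inj])
 hence "(\<Sum>b\<in>a ` I. poly p b / (\<Prod>c\<in>a ` I - {b}. b - c)) = 0" using lagrange_sum[of "a ` I" p] fin deg by (simp add: coeff_eq_0)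
 also have "(\<Sum>b\<in>a ` I. poly p b / (\<Prod>c\<in>a ` I - {b}. b - c)) =
   (\<Sum>i\<in>I. poly p (a i) / (\<Prod>c\<in>I - {i}. a i - a c))"
 proof (subst sum.reindex[OF inj], rule sum.cong[OF refl])
  fix i assume i: "i \<in> I"
  have "a ` I - {a i} = a ` (I - {i})" using inj i by (auto simp: inj_on_def)
  moreover have "inj_on a (I - {i})" using inj by (rule inj_on_subset) auto
  ultimately show "((\<lambda>b. poly p b / (\<Prod>c\<in>a ` I - {b}. b - c)) \<circ> a) i = poly p (a i) / (\<Prod>c\<in>I - {i}. a i - a c)"
   by (simp add: prod.reindex)
 qed
 finally show ?thesis .
qed

lemma Plus_Diff_Inl: "(A <+> B) - {Inl a} = (A - {a}) <+> B"
 and Plus_Diff_Inr: "(A <+> B) - {Inr b} = A <+> (B - {b})" by auto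

lemma norm_gt_1_of_mult_square:
 fixes s t :: complex
 assumes s: "t * s\<^sup>2 = 1" and t: "norm t < 1"
 shows "norm s > 1"
proof -
 have eq: "norm t * norm s ^ 2 = 1" using arg_cong[OF s, of norm] by (simp add: norm_mult norm_power)
 show ?thesis
 proof (rule ccontr)
  assume "\<not> norm s > 1"
  hence "norm s ^ 2 \<le> 1" by (simp add: power_le_one)
  hence "norm t * norm s ^ 2 \<le> norm t * 1" by (intro mult_left_mono) auto
  thus False using eq t by simp
 qed
qed

text \<open>The kernel satisfies a partial fraction identity in an auxiliary variable \<open>u\<close>; the poles at
 \<open>u = x i\<close> and \<open>u = 1 / x i\<close> give the sum over \<open>i\<close>, those at \<open>u = - z j\<close> and \<open>u = - 1 / z j\<close> the
 shifts \<open>z j \<mapsto> t * z j\<close>, and the remaining ones are at \<open>0\<close> and \<open>\<plusminus> s\<close> with \<open>t * s ^ 2 = 1\<close>.\<close>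
locale star_point =
 fixes t s :: complex and x :: "nat \<Rightarrow> complex" and A :: "nat set" and k :: nat and z :: "nat \<Rightarrow> complex"
 assumes t: "t \<noteq> 0" "norm t < 1" and s: "t * s\<^sup>2 = 1"
  and gen: "lw_generic x A" and xn: "\<And>i. i \<in> A \<Longrightarrow> norm (x i) < 1" and xt: "\<And>i. i \<in> A \<Longrightarrow> (x i)\<^sup>2 \<noteq> t"
  and zn: "\<And>j. j < k \<Longrightarrow> norm (z j) = 1" and zc: "cvdm k z \<noteq> 0"
begin

lemma fin: "finite A" using gen by (simp add: lw_generic_def)

lemma x0: "i \<in> A \<Longrightarrow> x i \<noteq> 0" using gen by (simp add: lw_generic_def)

lemma z0: "j < k \<Longrightarrow> z j \<noteq> 0" using zn[of j] by auto

lemma s0: "s \<noteq> 0" using s by auto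

lemma s_norm: "norm s > 1" by (rule norm_gt_1_of_mult_square[OF s t(2)])

lemma z_sq: "j < k \<Longrightarrow> z j - 1 / z j \<noteq> 0" using zc by (auto simp: cvdm_def)

abbreviation W :: "nat \<Rightarrow> complex" where "W j \<equiv> z j + 1 / z j"

lemma W_inj: "i < k \<Longrightarrow> j < k \<Longrightarrow> i \<noteq> j \<Longrightarrow> W i \<noteq> W j"
proof -
 have "vdm k W \<noteq> 0" using zc by (simp add: cvdm_def)
 hence "inj_on W {..<k}" by (simp add: vdm_eq_0_iff)
 thus "i < k \<Longrightarrow> j < k \<Longrightarrow> i \<noteq> j \<Longrightarrow> W i \<noteq> W j" by (meson inj_onD lessThan_iff)
qed

abbreviation N where "N u \<equiv> (\<Prod>i\<in>A. (1 - t * u * x i) * (1 - t * u / x i))"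
abbreviation E where "E u \<equiv> (\<Prod>i\<in>A. (u - x i) * (u - 1 / x i))"
abbreviation Q where "Q u \<equiv> (\<Prod>j<k. (u + z j) * (u + 1 / z j))"

text \<open>The poles of \<open>N u / (u * (u - s) * (u + s) * E u * Q u)\<close>. The three poles
  besides those of \<open>E\<close> and \<open>Q\<close> make the degree of the denominator exceed
  that of the numerator by at least 3, so the residues sum to 0.\<close>

definition pole :: "(unit + bool) + ((nat + nat) + (nat + nat)) \<Rightarrow> complex" where
 "pole p = (case p of
   Inl (Inl _) \<Rightarrow> 0
  | Inl (Inr b) \<Rightarrow> (if b then s else - s)
  | Inr (Inl (Inl i)) \<Rightarrow> x i
  | Inr (Inl (Inr i)) \<Rightarrow> 1 / x i
  | Inr (Inr (Inl j)) \<Rightarrow> - z j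
  | Inr (Inr (Inr j)) \<Rightarrow> - (1 / z j))"

definition idx :: "((unit + bool) + ((nat + nat) + (nat + nat))) set" where
 "idx = (UNIV <+> UNIV) <+> ((A <+> A) <+> ({..<k} <+> {..<k}))"

lemma pole_simps [simp]:
 "pole (Inl (Inl ())) = 0" "pole (Inl (Inr True)) = s" "pole (Inl (Inr False)) = - s"
 "pole (Inr (Inl (Inl i))) = x i" "pole (Inr (Inl (Inr i))) = 1 / x i"
 "pole (Inr (Inr (Inl j))) = - z j" "pole (Inr (Inr (Inr j))) = - (1 / z j)" by (simp_all add: pole_def)

lemma norm_inv_x: "i \<in> A \<Longrightarrow> norm (1 / x i) > 1" using xn[of i] x0[of i] by (simp add: norm_divide divide_simps)

lemma x_sq: "i \<in> A \<Longrightarrow> x i \<noteq> s" "i \<in> A \<Longrightarrow> x i \<noteq> - s" "i \<in> A \<Longrightarrow> 1 / x i \<noteq> s" "i \<in> A \<Longrightarrow> 1 / x i \<noteq> - s"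
proof -
 show "i \<in> A \<Longrightarrow> x i \<noteq> s" "i \<in> A \<Longrightarrow> x i \<noteq> - s" using xn[of i] s_norm by auto
 have "(1 / x i)\<^sup>2 \<noteq> s\<^sup>2" if "i \<in> A"
 proof
  assume "(1 / x i)\<^sup>2 = s\<^sup>2"
  hence "t * (1 / x i)\<^sup>2 = 1" using s by simp
  thus False using x0[OF that] xt[OF that] by (simp add: power_divide)
 qed
 thus "i \<in> A \<Longrightarrow> 1 / x i \<noteq> s" "i \<in> A \<Longrightarrow> 1 / x i \<noteq> - s" by (metis power2_minus)+
qed

lemma idxE:
 assumes "p \<in> idx"
 obtains "p = Inl (Inl ())" | "p = Inl (Inr True)" | "p = Inl (Inr False)"
  | i where "i \<in> A" "p = Inr (Inl (Inl i))" | i where "i \<in> A" "p = Inr (Inl (Inr i))"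
  | j where "j < k" "p = Inr (Inr (Inl j))" | j where "j < k" "p = Inr (Inr (Inr j))"
proof (cases p)
 case (Inl u)
 thus ?thesis using that by (cases u) (metis (full_types) old.unit.exhaust, metis (full_types))
next
 case (Inr u)
 thus ?thesis using that assms unfolding idx_def by (cases u) (auto elim!: PlusE)
qed

lemma z_distinct:
 assumes "i < k" "j < k"
 shows "z i = z j \<Longrightarrow> i = j" "z i \<noteq> 1 / z j"
proof -
 show 1: "z i = z j \<Longrightarrow> i = j" using W_inj[OF assms] by auto
 show "z i \<noteq> 1 / z j"
 proof
  assume e: "z i = 1 / z j"
  hence "W i = W j" using z0[OF assms(2)] by simp
  hence "i = j" using W_inj[OF assms] by blast
  thus False using e z_sq[OF assms(2)] by simp
 qed
qed

text \<open>The norms separate the \<open>x i\<close> (below 1), the \<open>z j\<close> (equal to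
  1), and \<open>1 / x i\<close> and \<open>s\<close> (above 1). Of the rest, \<open>1 / x i\<close>
  meets \<open>s\<close> or \<open>- s\<close> only if \<open>(x i)^2 = t\<close>, and coincidences
  among the \<open>z j\<close> and their inverses are excluded by
  \<open>cvdm k z \<noteq> 0\<close>.\<close>

lemma inj_pole: "inj_on pole idx"
proof (rule inj_onI)
 fix p q assume pq: "p \<in> idx" "q \<in> idx" and eq: "pole p = pole q"
 have xx: "x i = x j \<Longrightarrow> i = j" "x i \<noteq> 1 / x j" if "i \<in> A" "j \<in> A" for i j
  using lw_genericD(9)[OF gen that] lw_genericD(7)[OF gen that(2,1)] by auto
 have nz: "norm (1 / z j) = 1" if "j < k" for j using zn[OF that] by (simp add: norm_divide)
 have l1: "norm a < 1 \<Longrightarrow> norm b = 1 \<Longrightarrow> a \<noteq> b" and l2: "norm a > 1 \<Longrightarrow> norm b = 1 \<Longrightarrow> a \<noteq> b"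
  and l3: "norm a < 1 \<Longrightarrow> norm b = 1 \<Longrightarrow> a \<noteq> - b" and l4: "norm a > 1 \<Longrightarrow> norm b = 1 \<Longrightarrow> a \<noteq> - b"
  and l5: "norm a > 1 \<Longrightarrow> norm b = 1 \<Longrightarrow> - a \<noteq> b" for a b :: complex by auto
 note F = xx x0 z0 s0 x_sq z_distinct l1[OF xn zn] l1[OF xn nz] l2[OF norm_inv_x zn] l2[OF norm_inv_x nz]
  l3[OF xn zn] l3[OF xn nz] l4[OF norm_inv_x zn] l4[OF norm_inv_x nz]
  l2[OF s_norm zn] l2[OF s_norm nz] l4[OF s_norm zn] l4[OF s_norm nz] l5[OF s_norm zn] l5[OF s_norm nz]
 from pq(1) pq(2) eq show "p = q"
 proof (elim idxE; simp)
 qed (metis F)+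
qed

definition res :: "(unit + bool) + ((nat + nat) + (nat + nat)) \<Rightarrow> complex" where
 "res p = N (pole p) / (\<Prod>c\<in>idx - {p}. pole p - pole c)"

lemma prod_idx_remove:
 fixes g :: "_ \<Rightarrow> complex"
 shows "(\<Prod>c\<in>idx - {Inl (Inl ())}. g c) = g (Inl (Inr True)) * g (Inl (Inr False)) *
   (\<Prod>i\<in>A. g (Inr (Inl (Inl i))) * g (Inr (Inl (Inr i)))) * (\<Prod>j<k. g (Inr (Inr (Inl j))) * g (Inr (Inr (Inr j))))"
  and "(\<Prod>c\<in>idx - {Inl (Inr b)}. g c) = g (Inl (Inl ())) * g (Inl (Inr (\<not> b))) *
   (\<Prod>i\<in>A. g (Inr (Inl (Inl i))) * g (Inr (Inl (Inr i)))) * (\<Prod>j<k. g (Inr (Inr (Inl j))) * g (Inr (Inr (Inr j))))"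
  and "i \<in> A \<Longrightarrow> (\<Prod>c\<in>idx - {Inr (Inl (Inl i))}. g c) = g (Inl (Inl ())) * (g (Inl (Inr True)) * g (Inl (Inr False))) *
   (g (Inr (Inl (Inr i))) * (\<Prod>i\<in>A - {i}. g (Inr (Inl (Inl i))) * g (Inr (Inl (Inr i))))) * (\<Prod>j<k. g (Inr (Inr (Inl j))) * g (Inr (Inr (Inr j))))"
  and "i \<in> A \<Longrightarrow> (\<Prod>c\<in>idx - {Inr (Inl (Inr i))}. g c) = g (Inl (Inl ())) * (g (Inl (Inr True)) * g (Inl (Inr False))) *
   (g (Inr (Inl (Inl i))) * (\<Prod>i\<in>A - {i}. g (Inr (Inl (Inl i))) * g (Inr (Inl (Inr i))))) * (\<Prod>j<k. g (Inr (Inr (Inl j))) * g (Inr (Inr (Inr j))))"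
  and "j < k \<Longrightarrow> (\<Prod>c\<in>idx - {Inr (Inr (Inl j))}. g c) = g (Inl (Inl ())) * (g (Inl (Inr True)) * g (Inl (Inr False))) *
   (\<Prod>i\<in>A. g (Inr (Inl (Inl i))) * g (Inr (Inl (Inr i)))) *
   (g (Inr (Inr (Inr j))) * (\<Prod>j\<in>{..<k} - {j}. g (Inr (Inr (Inl j))) * g (Inr (Inr (Inr j)))))"
  and "j < k \<Longrightarrow> (\<Prod>c\<in>idx - {Inr (Inr (Inr j))}. g c) = g (Inl (Inl ())) * (g (Inl (Inr True)) * g (Inl (Inr False))) *
   (\<Prod>i\<in>A. g (Inr (Inl (Inl i))) * g (Inr (Inl (Inr i)))) *
   (g (Inr (Inr (Inl j))) * (\<Prod>j\<in>{..<k} - {j}. g (Inr (Inr (Inl j))) * g (Inr (Inr (Inr j)))))"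
proof -
 have u: "(UNIV :: unit set) - {()} = {}" "(UNIV :: unit set) = {()}" by auto
 have b: "prod h (UNIV :: bool set) = h True * h False" "prod h (UNIV - {b}) = h (\<not> b)" for h :: "bool \<Rightarrow> complex" and b
  by (simp add: UNIV_bool mult.commute) (cases b, simp_all add: UNIV_bool insert_Diff_if)
 note [simp] = idx_def Plus_Diff_Inl Plus_Diff_Inr prod.Plus fin comp_def
 note UNIV_Plus_UNIV [simp del]
 show "(\<Prod>c\<in>idx - {Inl (Inl ())}. g c) = g (Inl (Inr True)) * g (Inl (Inr False)) *
   (\<Prod>i\<in>A. g (Inr (Inl (Inl i))) * g (Inr (Inl (Inr i)))) * (\<Prod>j<k. g (Inr (Inr (Inl j))) * g (Inr (Inr (Inr j))))"
  by (simp add: b u prod.distrib mult_ac)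
 show "(\<Prod>c\<in>idx - {Inl (Inr b)}. g c) = g (Inl (Inl ())) * g (Inl (Inr (\<not> b))) *
   (\<Prod>i\<in>A. g (Inr (Inl (Inl i))) * g (Inr (Inl (Inr i)))) * (\<Prod>j<k. g (Inr (Inr (Inl j))) * g (Inr (Inr (Inr j))))"
  by (simp add: b u(2) prod.distrib mult_ac)
 have ins: "(\<Prod>l\<in>A. h l) = h i * (\<Prod>l\<in>A - {i}. h l)" if "i \<in> A" for h :: "nat \<Rightarrow> complex" and i
  by (rule prod.remove[OF fin that])
 have ins2: "(\<Prod>l<k. h l) = h i * (\<Prod>l\<in>{..<k} - {i}. h l)" if "i < k" for h :: "nat \<Rightarrow> complex" and i
  by (rule prod.remove) (use that in auto)
 show "(\<Prod>c\<in>idx - {Inr (Inl (Inl i))}. g c) = g (Inl (Inl ())) * (g (Inl (Inr True)) * g (Inl (Inr False))) *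
   (g (Inr (Inl (Inr i))) * (\<Prod>i\<in>A - {i}. g (Inr (Inl (Inl i))) * g (Inr (Inl (Inr i))))) * (\<Prod>j<k. g (Inr (Inr (Inl j))) * g (Inr (Inr (Inr j))))"
  if "i \<in> A" by (simp add: b u(2) prod.distrib ins[OF that, of "\<lambda>i. g (Inr (Inl (Inr i)))"] mult_ac)
 show "(\<Prod>c\<in>idx - {Inr (Inl (Inr i))}. g c) = g (Inl (Inl ())) * (g (Inl (Inr True)) * g (Inl (Inr False))) *
   (g (Inr (Inl (Inl i))) * (\<Prod>i\<in>A - {i}. g (Inr (Inl (Inl i))) * g (Inr (Inl (Inr i))))) * (\<Prod>j<k. g (Inr (Inr (Inl j))) * g (Inr (Inr (Inr j))))"
  if "i \<in> A" by (simp add: b u(2) prod.distrib ins[OF that, of "\<lambda>i. g (Inr (Inl (Inl i)))"] mult_ac)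
 show "(\<Prod>c\<in>idx - {Inr (Inr (Inl j))}. g c) = g (Inl (Inl ())) * (g (Inl (Inr True)) * g (Inl (Inr False))) *
   (\<Prod>i\<in>A. g (Inr (Inl (Inl i))) * g (Inr (Inl (Inr i)))) *
   (g (Inr (Inr (Inr j))) * (\<Prod>j\<in>{..<k} - {j}. g (Inr (Inr (Inl j))) * g (Inr (Inr (Inr j)))))" if "j < k"
  by (simp add: b u(2) prod.distrib ins2[OF that, of "\<lambda>i. g (Inr (Inr (Inr i)))"] mult_ac)
 show "(\<Prod>c\<in>idx - {Inr (Inr (Inr j))}. g c) = g (Inl (Inl ())) * (g (Inl (Inr True)) * g (Inl (Inr False))) *
   (\<Prod>i\<in>A. g (Inr (Inl (Inl i))) * g (Inr (Inl (Inr i)))) *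
   (g (Inr (Inr (Inl j))) * (\<Prod>j\<in>{..<k} - {j}. g (Inr (Inr (Inl j))) * g (Inr (Inr (Inr j)))))" if "j < k"
  by (simp add: b u(2) prod.distrib ins2[OF that, of "\<lambda>i. g (Inr (Inr (Inl i)))"] mult_ac)
qed

lemma sum_res: "(\<Sum>p\<in>idx. res p) = 0"
proof -
 define P where "P = (\<Prod>i\<in>A. [:1, - t * x i:] * [:1, - t / x i:])"
 have polyP: "poly P u = N u" for u unfolding P_def poly_prod by (intro prod.cong refl) (simp add: algebra_simps)
 have "degree P \<le> (\<Sum>i\<in>A. degree ([:1, - t * x i:] * [:1, - t / x i:]))"
  using degree_prod_sum_le[OF fin, of "\<lambda>i. [:1, - t * x i:] * [:1, - t / x i:]"] unfolding P_def by (simp only: comp_def)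
 also have "... \<le> (\<Sum>i\<in>A. 2)"
 proof (rule sum_mono)
  fix i
  show "degree ([:1, - t * x i:] * [:1, - t / x i:]) \<le> 2" by (rule order_trans[OF degree_mult_le]) (simp add: degree_pCons_eq_if)
 qed
 finally have "degree P \<le> 2 * card A" by simp
 moreover have "card idx = 3 + 2 * card A + 2 * k" unfolding idx_def by (simp add: card_Plus fin)
 ultimately have "Suc (degree P) < card idx" by simp
 moreover have "finite idx" unfolding idx_def by (simp add: fin)
 ultimately show ?thesis using lagrange_sum_indexed[OF _ inj_pole, of P] by (simp add: polyP res_def)
qed

lemma sum_idx:
 fixes g :: "_ \<Rightarrow> complex"
 shows "(\<Sum>p\<in>idx. g p) = g (Inl (Inl ())) + (g (Inl (Inr True)) + g (Inl (Inr False))) +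
   (\<Sum>i\<in>A. g (Inr (Inl (Inl i))) + g (Inr (Inl (Inr i)))) + (\<Sum>j<k. g (Inr (Inr (Inl j))) + g (Inr (Inr (Inr j))))"
proof -
 have u: "(UNIV :: unit set) = {()}" by auto
 show ?thesis by (simp add: idx_def sum.Plus fin comp_def sum.distrib UNIV_bool u add_ac)
qed

lemma s_inv: "1 / s\<^sup>2 = t" using s s0 by (simp add: field_simps)

lemma res_0: "res (Inl (Inl ())) = - t"
proof -
 have 1: "(\<Prod>i\<in>A. (0 - x i) * (0 - 1 / x i)) = 1" by (rule prod.neutral) (use x0 in auto)
 have 2: "(\<Prod>j<k. (0 - - z j) * (0 - - (1 / z j))) = 1" by (rule prod.neutral) (use z0 in auto)
 have "res (Inl (Inl ())) = 1 / ((0 - s) * (0 - - s) * 1 * 1)" unfolding res_def prod_idx_remove(1) pole_simps 1 2 by simp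
 also have "... = - (1 / s\<^sup>2)" by (simp add: power2_eq_square)
 finally show ?thesis by (simp add: s_inv)
qed

text \<open>The reason for the choice of \<open>s\<close>: if \<open>t * v^2 = 1\<close>, then
  \<open>t * v = 1 / v\<close>, and each factor pair of \<open>N v\<close> is \<open>t\<close> times
  the corresponding pair of \<open>E v\<close>. The residue there depends on the \<open>x i\<close>
  only through their number.\<close>

lemma N_s: "t * v\<^sup>2 = 1 \<Longrightarrow> N v = t ^ card A * E v"
proof -
 assume v: "t * v\<^sup>2 = 1"
 hence v0: "v \<noteq> 0" by auto
 have tv: "t * v = 1 / v" using v v0 by (simp add: field_simps power2_eq_square)
 have "N v = (\<Prod>i\<in>A. t * ((v - x i) * (v - 1 / x i)))"
 proof (rule prod.cong[OF refl])
  fix i assume i: "i \<in> A"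
  have "(1 - t * v * x i) * (1 - t * v / x i) = (1 - 1 / v * x i) * (1 - 1 / v / x i)" unfolding tv ..
  also have "... = (1 / v) * (1 / v) * ((v - x i) * (v - 1 / x i))" using v0 x0[OF i] by (simp add: field_simps)
  also have "(1 / v) * (1 / v) = t" using v v0 by (simp add: field_simps power2_eq_square)
  finally show "(1 - t * v * x i) * (1 - t * v / x i) = t * ((v - x i) * (v - 1 / x i))" .
 qed
 thus ?thesis by (simp add: prod.distrib)
qed

lemma E_nonzero: "t * v\<^sup>2 = 1 \<Longrightarrow> E v \<noteq> 0"
proof -
 assume v: "t * v\<^sup>2 = 1"
 hence "t * v\<^sup>2 = t * s\<^sup>2" using s by simp
 hence "v\<^sup>2 = s\<^sup>2" using t by simp
 hence "v = s \<or> v = - s" by (simp add: power2_eq_iff)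
 hence "v \<noteq> x i" "v \<noteq> 1 / x i" if "i \<in> A" for i using x_sq[OF that] by metis+
 thus ?thesis using fin by (simp add: prod_zero_iff)
qed

lemma res_s: "res (Inl (Inr b)) = t ^ Suc (card A) / (2 * Q (if b then s else - s))"
proof -
 define v where "v = (if b then s else - s)"
 have v: "pole (Inl (Inr b)) = v" "pole (Inl (Inr (\<not> b))) = - v" by (cases b; simp add: v_def)+
 have tv: "t * v\<^sup>2 = 1" using s by (simp add: v_def)
 have "res (Inl (Inr b)) = t ^ card A * E v / ((v - 0) * (v - - v) * E v * Q v)" unfolding res_def prod_idx_remove(2) v pole_simps N_s[OF tv] by simp
 also have "... = t ^ card A / ((v - 0) * (v - - v) * Q v)" using E_nonzero[OF tv] by simp
 also have "(v - 0) * (v - - v) = 2 / t" using tv t by (simp add: field_simps power2_eq_square)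
 finally show ?thesis by (simp add: v_def)
qed

text \<open>The factors of \<open>N u\<close> with index \<open>i\<close> are
  \<open>(1 - t * u^2) * (1 - t)\<close>, and \<open>1 - t * u^2\<close> cancels the poles at
  \<open>s\<close> and \<open>- s\<close>. What remains is \<open>star_coeff\<close>, in the same
  form for \<open>u = x i\<close> and for \<open>u = 1 / x i\<close>.\<close>

lemma res_x_aux:
 assumes i: "i \<in> A" and u: "u = x i \<or> u = 1 / x i"
 shows "N u / ((u - 0) * ((u - s) * (u - - s)) * ((u - 1 / u) * (\<Prod>l\<in>A - {i}. (u - x l) * (u - 1 / x l))) * q) =
  t * (1 - t) * star_coeff t x (A - {i}) u / q"
proof -
 have u0: "u \<noteq> 0" using u x0[OF i] by auto
 have us: "u \<noteq> s" "u \<noteq> - s" using u x_sq[OF i] by auto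
 have usq: "1 - t * u\<^sup>2 = - t * ((u - s) * (u - - s))"
 proof -
  have "- t * ((u - s) * (u - - s)) = t * s\<^sup>2 - t * u\<^sup>2" by (simp add: power2_eq_square algebra_simps)
  thus ?thesis by (simp add: s)
 qed
 have "N u = (1 - t * u * x i) * (1 - t * u / x i) * (\<Prod>l\<in>A - {i}. (1 - t * u * x l) * (1 - t * u / x l))" by (rule prod.remove[OF fin i])
 also have "(1 - t * u * x i) * (1 - t * u / x i) = (1 - t * u\<^sup>2) * (1 - t)" using u x0[OF i] by (auto simp: power2_eq_square)
 finally have N: "N u = - t * ((u - s) * (u - - s)) * (1 - t) * (\<Prod>l\<in>A - {i}. (1 - t * u * x l) * (1 - t * u / x l))" unfolding usq .
 have D: "(\<Prod>l\<in>A - {i}. (u - x l) * (u - 1 / x l)) = (\<Prod>l\<in>A - {i}. (1 - u * x l) * (1 - u / x l))"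
  by (rule prod.cong[OF refl]) (use x0 in \<open>auto simp: field_simps\<close>)
 have uu: "(u - 0) * (u - 1 / u) = - (1 - u\<^sup>2)" using u0 by (simp add: power2_eq_square right_diff_distrib)
 define a where "a = (u - s) * (u - - s)"
 define n where "n = (\<Prod>l\<in>A - {i}. (1 - t * u * x l) * (1 - t * u / x l))"
 define d where "d = (\<Prod>l\<in>A - {i}. (1 - u * x l) * (1 - u / x l))"
 have a0: "a \<noteq> 0" using us by (auto simp: a_def eq_neg_iff_add_eq_0)
 have "star_coeff t x (A - {i}) u = 1 / (1 - u\<^sup>2) * (n / d)" by (simp add: star_coeff_def lw_factor_def n_def d_def prod_dividef prod.distrib)
 moreover have "N u / ((u - 0) * a * ((u - 1 / u) * d) * q) = a * (t * (1 - t) * n) / (a * ((1 - u\<^sup>2) * d * q))"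
 proof -
  have "(u - 0) * a * ((u - 1 / u) * d) * q = a * (((u - 0) * (u - 1 / u)) * d * q)" by (simp only: mult_ac)
  also have "... = - (a * ((1 - u\<^sup>2) * d * q))" unfolding uu by (simp only: mult_minus_left mult_minus_right)
  finally have den: "(u - 0) * a * ((u - 1 / u) * d) * q = - (a * ((1 - u\<^sup>2) * d * q))" .
  have num: "N u = - (a * (t * (1 - t) * n))" unfolding N a_def n_def by (simp only: mult_ac mult_minus_left mult_minus_right)
  show ?thesis unfolding den num by (rule minus_divide_divide)
 qed
 ultimately show ?thesis unfolding D a_def[symmetric] d_def[symmetric] using a0 by simp
qed

lemma res_x:
 assumes i: "i \<in> A"
 shows "res (Inr (Inl (Inl i))) = t * (1 - t) * star_coeff t x (A - {i}) (x i) / Q (x i)"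
  and "res (Inr (Inl (Inr i))) = t * (1 - t) * star_coeff t x (A - {i}) (1 / x i) / Q (1 / x i)"
proof -
 have xi: "1 / (1 / x i) = x i" by simp
 show "res (Inr (Inl (Inl i))) = t * (1 - t) * star_coeff t x (A - {i}) (x i) / Q (x i)" unfolding res_def prod_idx_remove(3)[OF i] pole_simps
  using res_x_aux[OF i, of "x i" "Q (x i)"] by simp
 show "res (Inr (Inl (Inr i))) = t * (1 - t) * star_coeff t x (A - {i}) (1 / x i) / Q (1 / x i)"
  unfolding res_def prod_idx_remove(4)[OF i] pole_simps using res_x_aux[OF i, of "1 / x i" "Q (1 / x i)"] by simp
qed

text \<open>The residue at \<open>u = - v\<close> up to factors common to \<open>v\<close> and
  \<open>1 / v\<close>. The kernel is evaluated at \<open>t * v\<close> because \<open>N\<close>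
  arises from \<open>E\<close> by this dilation.\<close>

definition shift_coeff :: "complex \<Rightarrow> complex" where
 "shift_coeff v = kern x A (t * v) / ((1 - t * v\<^sup>2) * (v - 1 / v) * (- v) ^ k)"

lemma kern_E:
 assumes "v \<noteq> 0"
 shows "kern x A v = (\<Prod>i\<in>A. x i / v) * E (- v)" "kern x A (t * v) = (\<Prod>i\<in>A. x i / (t * v)) * N (- v)"
 unfolding kern_def prod.distrib[symmetric] by (rule prod.cong[OF refl], use assms t x0 in \<open>force simp: field_simps\<close>)+

lemma kern_ratio:
 assumes "v \<noteq> 0" "kern x A v \<noteq> 0"
 shows "N (- v) / E (- v) = t ^ card A * kern x A (t * v) / kern x A v"
proof -
 define p where "p = (\<Prod>i\<in>A. x i / v)"
 have p: "p \<noteq> 0" using assms x0 fin by (auto simp: p_def)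
 have "(\<Prod>i\<in>A. x i / v) = (\<Prod>i\<in>A. t * (x i / (t * v)))" using t by simp
 hence "p = t ^ card A * (\<Prod>i\<in>A. x i / (t * v))" unfolding p_def by (simp only: prod.distrib prod_constant)
 hence "p * N (- v) = t ^ card A * kern x A (t * v)" unfolding kern_E(2)[OF assms(1)] by simp
 moreover have "kern x A v = p * E (- v)" unfolding kern_E(1)[OF assms(1)] p_def ..
 moreover have "N (- v) / E (- v) = (p * N (- v)) / (p * E (- v))" using p by simp
 ultimately show ?thesis by simp
qed

lemma kern_unit_nonzero:
 assumes "norm v = 1" "B \<subseteq> A"
 shows "kern x B v \<noteq> 0"
proof -
 have "1 + x i * v \<noteq> 0" "1 + x i / v \<noteq> 0" if "i \<in> A" for i
 proof -
  have n: "norm (x i * v) < 1" "norm (x i / v) < 1" using xn[OF that] assms by (simp_all add: norm_mult norm_divide)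
  show "1 + x i * v \<noteq> 0" "1 + x i / v \<noteq> 0" using n by (metis add_eq_0_iff norm_minus_cancel norm_one less_irrefl)+
 qed
 thus ?thesis unfolding kern_def using fin assms(2) by (auto simp: prod_zero_iff finite_subset)
qed

lemma kern_inverse: "kern x B (1 / v) = kern x B v" unfolding kern_def by (rule prod.cong) (auto simp: mult.commute)

lemma res_z_aux:
 assumes j: "j < k" and v: "v = z j \<or> v = 1 / z j"
 shows "N (- v) / ((- v - 0) * ((- v - s) * (- v - - s)) * E (- v) *
   ((- v - - (1 / v)) * (\<Prod>l\<in>{..<k} - {j}. (- v - - z l) * (- v - - (1 / z l))))) =
  t ^ Suc (card A) * shift_coeff v / (kern x A (z j) * (\<Prod>l\<in>{..<k} - {j}. W l - W j))"
proof -
 have nv: "norm v = 1" using v zn[OF j] by (auto simp: norm_divide)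
 have v0: "v \<noteq> 0" using nv by auto
 have kv: "kern x A v = kern x A (z j)" using v by (auto simp: kern_inverse)
 have kz: "kern x A (z j) \<noteq> 0" using kern_unit_nonzero[OF nv subset_refl] kv by simp
 have Wv: "v + 1 / v = W j" using v z0[OF j] by auto
 have P: "(\<Prod>l\<in>{..<k} - {j}. (- v - - z l) * (- v - - (1 / z l))) = (- v) ^ (k - 1) * (\<Prod>l\<in>{..<k} - {j}. W l - W j)"
 proof -
  have "(\<Prod>l\<in>{..<k} - {j}. (- v - - z l) * (- v - - (1 / z l))) = (\<Prod>l\<in>{..<k} - {j}. (- v) * (W l - W j))"
  proof (rule prod.cong[OF refl])
   fix l assume "l \<in> {..<k} - {j}"
   hence "z l \<noteq> 0" using z0 by auto
   thus "(- v - - z l) * (- v - - (1 / z l)) = (- v) * (W l - W j)" unfolding Wv[symmetric] using v0 by (simp add: field_simps)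
  qed
  thus ?thesis using j by (simp only: prod.distrib prod_constant) simp
 qed
 have q: "(- v - s) * (- v - - s) = - (1 / t) * (1 - t * v\<^sup>2)"
 proof -
  have "t * ((- v - s) * (- v - - s)) = t * v\<^sup>2 - t * s\<^sup>2" by (simp add: power2_eq_square algebra_simps)
  thus ?thesis using t s by (simp add: field_simps)
 qed
 have vk: "(- v) * (- v) ^ (k - 1) = (- v) ^ k" using j by (cases k) auto
 define w where "w = (\<Prod>l\<in>{..<k} - {j}. W l - W j)"
 have gen: "(- v - 0) * (- c * a) * e * ((- v - - i) * (p * w)) = c * (e * (a * (v - i) * ((- v) * p) * w))"
  for a c e i p :: complex by (simp add: algebra_simps)
 have "(- v - 0) * ((- v - s) * (- v - - s)) * E (- v) * ((- v - - (1 / v)) * ((- v) ^ (k - 1) * w)) =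
   1 / t * (E (- v) * ((1 - t * v\<^sup>2) * (v - 1 / v) * (- v) ^ k * w))" unfolding q gen vk ..
 moreover have "n / (1 / t * (e * d)) = t * ((n / e) / d)" for n e d :: complex using t by simp
 ultimately have "N (- v) / ((- v - 0) * ((- v - s) * (- v - - s)) * E (- v) *
   ((- v - - (1 / v)) * ((- v) ^ (k - 1) * w))) =
   t * ((N (- v) / E (- v)) / ((1 - t * v\<^sup>2) * (v - 1 / v) * (- v) ^ k * w))" by (simp only:)
 also have "... = t ^ Suc (card A) * shift_coeff v / (kern x A (z j) * w)"
  unfolding kern_ratio[OF v0 kz[folded kv]] kv shift_coeff_def by (simp add: mult_ac)
 finally show ?thesis unfolding P w_def .
qed

lemma res_z:
 assumes j: "j < k"
 shows "res (Inr (Inr (Inl j))) = t ^ Suc (card A) * shift_coeff (z j) / (kern x A (z j) * (\<Prod>l\<in>{..<k} - {j}. W l - W j))"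
  and "res (Inr (Inr (Inr j))) = t ^ Suc (card A) * shift_coeff (1 / z j) / (kern x A (z j) * (\<Prod>l\<in>{..<k} - {j}. W l - W j))"
proof -
 show "res (Inr (Inr (Inl j))) = t ^ Suc (card A) * shift_coeff (z j) / (kern x A (z j) * (\<Prod>l\<in>{..<k} - {j}. W l - W j))"
  unfolding res_def prod_idx_remove(5)[OF j] pole_simps using res_z_aux[OF j, of "z j"] by simp
 show "res (Inr (Inr (Inr j))) = t ^ Suc (card A) * shift_coeff (1 / z j) / (kern x A (z j) * (\<Prod>l\<in>{..<k} - {j}. W l - W j))"
  unfolding res_def prod_idx_remove(6)[OF j] pole_simps using res_z_aux[OF j, of "1 / z j"] by simp
qed

lemma Q_eq: "Q u = (\<Prod>j<k. 1 + u\<^sup>2 + u * W j)"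
 by (rule prod.cong[OF refl]) (use z0 in \<open>auto simp: field_simps power2_eq_square\<close>)

text \<open>\<open>Q (x i)\<close> collects the factors that the variable \<open>i\<close>
  contributes to the kernels at all \<open>z j\<close>. Passing to \<open>1 / x i\<close> costs
  \<open>x i ^ (2 * k)\<close>, and this is how the bound \<open>k\<close> enters the
  recursion.\<close>

lemma Q_kern:
 assumes i: "i \<in> A"
 shows "Q (x i) * (\<Prod>j<k. kern x (A - {i}) (z j)) = (\<Prod>j<k. kern x A (z j))"
  and "Q (1 / x i) * x i ^ (2 * k) = Q (x i)" and "Q (x i) \<noteq> 0"
proof -
 have "Q (x i) = (\<Prod>j<k. (1 + x i * z j) * (1 + x i / z j))" by (rule prod.cong[OF refl]) (use z0 in \<open>auto simp: field_simps\<close>)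
 moreover have "kern x A (z j) = (1 + x i * z j) * (1 + x i / z j) * kern x (A - {i}) (z j)" for j unfolding kern_def by (rule prod.remove[OF fin i])
 ultimately show 1: "Q (x i) * (\<Prod>j<k. kern x (A - {i}) (z j)) = (\<Prod>j<k. kern x A (z j))" by (simp only: prod.distrib)
 have "(\<Prod>j<k. kern x A (z j)) \<noteq> 0" using kern_unit_nonzero[OF zn] by simp
 show "Q (x i) \<noteq> 0"
 proof
  assume "Q (x i) = 0"
  hence "(\<Prod>j<k. kern x A (z j)) = 0" by (simp only: 1[symmetric] mult_zero_left)
  with \<open>(\<Prod>j<k. kern x A (z j)) \<noteq> 0\<close> show False ..
 qed
 have e: "(\<Prod>j<k. (x i)\<^sup>2) = x i ^ (2 * k)" by (simp add: power_mult)
 have "Q (1 / x i) * x i ^ (2 * k) = (\<Prod>j<k. (1 + (1 / x i)\<^sup>2 + (1 / x i) * W j) * (x i)\<^sup>2)"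
  unfolding Q_eq[of "1 / x i"] e[symmetric] by (rule prod.distrib[symmetric])
 also have "... = Q (x i)" unfolding Q_eq by (rule prod.cong[OF refl]) (use x0[OF i] in \<open>simp add: field_simps power2_eq_square\<close>)
 finally show "Q (1 / x i) * x i ^ (2 * k) = Q (x i)" .
qed

text \<open>The vanishing residue sum, divided by \<open>t\<close> and multiplied by
  \<open>\<Prod>j<k. kern x A (z j)\<close>: the residue at 0 gives the main term, those at
  \<open>x i\<close> and \<open>1 / x i\<close> the sum over \<open>i\<close>, and all others share
  the factor \<open>t ^ card A\<close>.\<close>

theorem star_partial_fractions:
 "(1 - t) * (\<Sum>i\<in>A. (star_coeff t x (A - {i}) (x i) + x i ^ (2 * k) * star_coeff t x (A - {i}) (1 / x i)) *
    (\<Prod>j<k. kern x (A - {i}) (z j))) =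
  (\<Prod>j<k. kern x A (z j)) - t ^ card A * ((1 / (2 * Q s) + 1 / (2 * Q (- s))) * (\<Prod>j<k. kern x A (z j)) +
   (\<Sum>j<k. (shift_coeff (z j) + shift_coeff (1 / z j)) * (\<Prod>l\<in>{..<k} - {j}. kern x A (z l)) /
    (\<Prod>l\<in>{..<k} - {j}. W l - W j)))"
proof -
 define F where "F = (\<Prod>j<k. kern x A (z j))"
 have Fx: "(\<Prod>j<k. kern x (A - {i}) (z j)) = F / Q (x i)" if "i \<in> A" for i unfolding F_def Q_kern(1)[OF that, symmetric]
  by (rule nonzero_mult_div_cancel_left[OF Q_kern(3)[OF that], symmetric])
 have Fz: "(\<Prod>l\<in>{..<k} - {j}. kern x A (z l)) = F / kern x A (z j)" if "j < k" for j
 proof -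
  have e: "F = kern x A (z j) * (\<Prod>l\<in>{..<k} - {j}. kern x A (z l))" unfolding F_def by (rule prod.remove) (use that in auto)
  show ?thesis unfolding e by (rule nonzero_mult_div_cancel_left[OF kern_unit_nonzero[OF zn[OF that] subset_refl], symmetric])
 qed
 have c: "star_coeff t x (A - {i}) (1 / x i) / Q (1 / x i) = x i ^ (2 * k) * star_coeff t x (A - {i}) (1 / x i) / Q (x i)"
  if "i \<in> A" for i
 proof -
  have "x i ^ (2 * k) \<noteq> 0" using x0[OF that] by simp
  hence "b / q = x i ^ (2 * k) * b / (q * x i ^ (2 * k))" for b q by simp
  thus ?thesis unfolding Q_kern(2)[OF that, symmetric] .
 qed
 have "0 = - t + (t ^ Suc (card A) / (2 * Q s) + t ^ Suc (card A) / (2 * Q (- s))) +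
   (\<Sum>i\<in>A. t * (1 - t) * star_coeff t x (A - {i}) (x i) / Q (x i) + t * (1 - t) * star_coeff t x (A - {i}) (1 / x i) / Q (1 / x i)) +
   (\<Sum>j<k. t ^ Suc (card A) * shift_coeff (z j) / (kern x A (z j) * (\<Prod>l\<in>{..<k} - {j}. W l - W j)) +
    t ^ Suc (card A) * shift_coeff (1 / z j) / (kern x A (z j) * (\<Prod>l\<in>{..<k} - {j}. W l - W j)))"
  using sum_res unfolding sum_idx by (simp add: res_0 res_s res_x res_z)
 also have "... = t * (- 1 + t ^ card A * (1 / (2 * Q s) + 1 / (2 * Q (- s))) +
   (1 - t) * (\<Sum>i\<in>A. (star_coeff t x (A - {i}) (x i) + x i ^ (2 * k) * star_coeff t x (A - {i}) (1 / x i)) / Q (x i)) +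
   t ^ card A * (\<Sum>j<k. (shift_coeff (z j) + shift_coeff (1 / z j)) / (kern x A (z j) * (\<Prod>l\<in>{..<k} - {j}. W l - W j))))"
 proof -
  have "(\<Sum>i\<in>A. t * (1 - t) * star_coeff t x (A - {i}) (x i) / Q (x i) + t * (1 - t) * star_coeff t x (A - {i}) (1 / x i) / Q (1 / x i)) =
   t * (1 - t) * (\<Sum>i\<in>A. (star_coeff t x (A - {i}) (x i) + x i ^ (2 * k) * star_coeff t x (A - {i}) (1 / x i)) / Q (x i))"
   unfolding sum_distrib_left
  proof (rule sum.cong[OF refl])
   fix i assume "i \<in> A"
   have e: "w * b / q = w * (b / q)" "w * a / q + w * (b / q) = w * ((a + b) / q)" for w a b q :: complex
    by (simp_all add: add_divide_distrib distrib_left)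
   show "t * (1 - t) * star_coeff t x (A - {i}) (x i) / Q (x i) + t * (1 - t) * star_coeff t x (A - {i}) (1 / x i) / Q (1 / x i) =
    t * (1 - t) * ((star_coeff t x (A - {i}) (x i) + x i ^ (2 * k) * star_coeff t x (A - {i}) (1 / x i)) / Q (x i))"
    unfolding e(1)[of "t * (1 - t)" "star_coeff t x (A - {i}) (1 / x i)"] c[OF \<open>i \<in> A\<close>] e(2) ..
  qed
  moreover have "(\<Sum>j<k. t ^ Suc (card A) * shift_coeff (z j) / (kern x A (z j) * (\<Prod>l\<in>{..<k} - {j}. W l - W j)) +
    t ^ Suc (card A) * shift_coeff (1 / z j) / (kern x A (z j) * (\<Prod>l\<in>{..<k} - {j}. W l - W j))) =
    t * t ^ card A * (\<Sum>j<k. (shift_coeff (z j) + shift_coeff (1 / z j)) / (kern x A (z j) * (\<Prod>l\<in>{..<k} - {j}. W l - W j)))"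
   unfolding sum_distrib_left by (rule sum.cong[OF refl]) (simp add: add_divide_distrib distrib_left)
  moreover have "- t + (t * n / a + t * n / b) + t * (1 - t) * e + t * n * f = t * (- 1 + n * (1 / a + 1 / b) + (1 - t) * e + n * f)"
   for n a b e f :: complex by (simp add: algebra_simps)
  ultimately show ?thesis by (simp only: power_Suc)
 qed
 finally have "0 = t * (- 1 + t ^ card A * (1 / (2 * Q s) + 1 / (2 * Q (- s))) +
   (1 - t) * (\<Sum>i\<in>A. (star_coeff t x (A - {i}) (x i) + x i ^ (2 * k) * star_coeff t x (A - {i}) (1 / x i)) / Q (x i)) +
   t ^ card A * (\<Sum>j<k. (shift_coeff (z j) + shift_coeff (1 / z j)) / (kern x A (z j) * (\<Prod>l\<in>{..<k} - {j}. W l - W j))))" .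
 moreover have "b = 1 - n * (q + c)" if "0 = t * (- 1 + n * q + b + n * c)" for n q b c
 proof -
  have "- 1 + n * q + b + n * c = 0" using that t by simp
  hence "b - (1 - n * (q + c)) = 0" by (simp add: algebra_simps)
  thus ?thesis by simp
 qed
 ultimately have "(1 - t) * (\<Sum>i\<in>A. (star_coeff t x (A - {i}) (x i) + x i ^ (2 * k) * star_coeff t x (A - {i}) (1 / x i)) / Q (x i)) =
   1 - t ^ card A * ((1 / (2 * Q s) + 1 / (2 * Q (- s))) +
    (\<Sum>j<k. (shift_coeff (z j) + shift_coeff (1 / z j)) / (kern x A (z j) * (\<Prod>l\<in>{..<k} - {j}. W l - W j))))" by blast
 from arg_cong[OF this, of "\<lambda>u. u * F"]
 have "(1 - t) * ((\<Sum>i\<in>A. (star_coeff t x (A - {i}) (x i) + x i ^ (2 * k) * star_coeff t x (A - {i}) (1 / x i)) / Q (x i)) * F) =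
   F - t ^ card A * ((1 / (2 * Q s) + 1 / (2 * Q (- s))) * F +
    (\<Sum>j<k. (shift_coeff (z j) + shift_coeff (1 / z j)) / (kern x A (z j) * (\<Prod>l\<in>{..<k} - {j}. W l - W j))) * F)"
  by (simp only: left_diff_distrib mult.assoc distrib_right mult_1)
 moreover have "(\<Sum>i\<in>A. (star_coeff t x (A - {i}) (x i) + x i ^ (2 * k) * star_coeff t x (A - {i}) (1 / x i)) / Q (x i)) * F =
   (\<Sum>i\<in>A. (star_coeff t x (A - {i}) (x i) + x i ^ (2 * k) * star_coeff t x (A - {i}) (1 / x i)) *
    (\<Prod>j<k. kern x (A - {i}) (z j)))" unfolding sum_distrib_right by (rule sum.cong[OF refl]) (simp add: Fx)
 moreover have "(\<Sum>j<k. (shift_coeff (z j) + shift_coeff (1 / z j)) / (kern x A (z j) * (\<Prod>l\<in>{..<k} - {j}. W l - W j))) * F =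
   (\<Sum>j<k. (shift_coeff (z j) + shift_coeff (1 / z j)) * (\<Prod>l\<in>{..<k} - {j}. kern x A (z l)) /
    (\<Prod>l\<in>{..<k} - {j}. W l - W j))" unfolding sum_distrib_right by (rule sum.cong[OF refl]) (simp add: Fz)
 ultimately show ?thesis unfolding F_def by simp
qed

end

section \<open>Pairing the kernel with the quadrature\<close>

lemma kern_laurent:
 assumes "finite A"
 shows "\<exists>c. (\<forall>m. c (- m) = c m) \<and> (\<forall>z. z \<noteq> 0 \<longrightarrow> kern x A z = (\<Sum>m=- int (card A)..int (card A). c m * z powi m))"
 using assms
proof (induction A rule: finite_induct)
 case empty
 show ?case by (intro exI[of _ "\<lambda>m. if m = 0 then 1 else 0"]) (simp add: kern_def)
next
 case (insert a A)
 define n where "n = int (card A)"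
 obtain c where c: "\<And>m. c (- m) = c m" "\<And>z. z \<noteq> 0 \<Longrightarrow> kern x A z = (\<Sum>m=- n..n. c m * z powi m)"
  using insert.IH unfolding n_def by blast
 define c0 where "c0 m = (if \<bar>m\<bar> \<le> n then c m else 0)" for m
 define d where "d m = (1 + (x a)\<^sup>2) * c0 m + x a * (c0 (m - 1) + c0 (m + 1))" for m
 have c0: "c0 (- m) = c0 m" for m by (simp add: c0_def c)
 have "d (- m) = d m" for m
 proof -
  have "c0 (- m - 1) = c0 (m + 1)" "c0 (- m + 1) = c0 (m - 1)" using c0[of "m + 1"] c0[of "m - 1"] by simp_all
  thus ?thesis by (simp add: d_def c0 add.commute)
 qed
 moreover have "kern x (insert a A) z = (\<Sum>m=- (n + 1)..n + 1. d m * z powi m)" if z: "z \<noteq> 0" for z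
 proof -
  let ?I = "{- (n + 1)..n + 1}"
  have S: "(\<Sum>m\<in>?I. c0 (m + i) * z powi (m + i)) = kern x A z" if i: "\<bar>i\<bar> \<le> 1" for i
  proof -
   have "(\<Sum>m\<in>?I. c0 (m + i) * z powi (m + i)) = (\<Sum>m\<in>{- (n + 1) + i..n + 1 + i}. c0 m * z powi m)"
    by (rule sum.reindex_bij_witness[where i = "\<lambda>m. m - i" and j = "\<lambda>m. m + i"]) auto
   also have "... = (\<Sum>m\<in>{- n..n}. c0 m * z powi m)" by (rule sum.mono_neutral_right) (use i in \<open>auto simp: c0_def\<close>)
   also have "... = (\<Sum>m\<in>{- n..n}. c m * z powi m)" by (rule sum.cong) (auto simp: c0_def)
   finally show ?thesis by (simp add: c(2)[OF z])
  qed
  have "kern x (insert a A) z = (1 + x a * z) * (1 + x a / z) * kern x A z" using insert by (simp add: kern_def)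
  also have "(1 + x a * z) * (1 + x a / z) = (1 + (x a)\<^sup>2) + x a * z + x a / z" using z by (simp add: power2_eq_square algebra_simps)
  also have "((1 + (x a)\<^sup>2) + x a * z + x a / z) * kern x A z =
    (1 + (x a)\<^sup>2) * (\<Sum>m\<in>?I. c0 (m + 0) * z powi (m + 0)) + x a * z * (\<Sum>m\<in>?I. c0 (m + (- 1)) * z powi (m + (- 1))) +
    x a / z * (\<Sum>m\<in>?I. c0 (m + 1) * z powi (m + 1))" by (simp only: S) (simp add: algebra_simps)
  also have "... = (\<Sum>m\<in>?I. d m * z powi m)" unfolding sum_distrib_left sum.distrib[symmetric]
   by (rule sum.cong[OF refl]) (use z in \<open>simp add: d_def power_int_add power_int_diff field_simps\<close>)
  finally show ?thesis .
 qed
 moreover have "int (card (insert a A)) = n + 1" using insert by (simp add: n_def)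
 ultimately show ?case by (intro exI[of _ d]) auto
qed

definition cdiff :: "nat \<Rightarrow> complex \<Rightarrow> complex" where
 "cdiff j z = z ^ Suc j - (1 / z) ^ Suc j"

lemma cvdm_permute:
 assumes tr: "tr permutes {..<k}" and z: "\<And>j. j < k \<Longrightarrow> z j \<noteq> 0"
 shows "cvdm k (z \<circ> tr) = of_int (sign tr) * cvdm k z"
proof -
 have "(z \<circ> tr) j \<noteq> 0" if "j < k" for j using z[of "tr j"] permutes_in_image[OF tr, of j] that by auto
 hence "cvdm k (z \<circ> tr) = pdet k (\<lambda>i j. z (tr j) ^ Suc i - (1 / z (tr j)) ^ Suc i)" using pdet_cvdm[of k "z \<circ> tr"] by simp
 also have "... = of_int (sign tr) * cvdm k z"
  by (subst pdet_permute_columns[OF tr, of "\<lambda>i j. z j ^ Suc i - (1 / z j) ^ Suc i"]) (simp only: pdet_cvdm[OF z])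
 finally show ?thesis .
qed

context quadrature
begin

definition Th :: "(nat \<Rightarrow> complex) \<Rightarrow> complex" where
 "Th zt = pdet k (\<lambda>i j. TH i (zt j))"

definition pts :: "(nat \<Rightarrow> complex) set" where "pts = PiE {..<k} (\<lambda>_. Z)"

lemma finite_pts: "finite pts" unfolding pts_def by (rule finite_PiE) (use finite_Z in auto)

lemma ptsD: "zt \<in> pts \<Longrightarrow> j < k \<Longrightarrow> zt j \<in> Z" by (auto simp: pts_def)

lemma Z_nonzero: "z \<in> Z \<Longrightarrow> z \<noteq> 0" using norm_Z by fastforce

text \<open>Multilinearity in the columns turns a determinant of quadrature sums into a sum over
  tuples of nodes, one node for each column.\<close>

lemma pdet_quadrature:
 "pdet k (\<lambda>i j. \<Sum>z\<in>Z. TH i z * f j z) = (\<Sum>zt\<in>pts. Th zt * (\<Prod>j<k. f j (zt j)))"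
proof -
 have "pdet k (\<lambda>i j. \<Sum>z\<in>Z. TH i z * f j z) =
   (\<Sum>pm | pm permutes {..<k}. of_int (sign pm) * (\<Sum>zt\<in>pts. \<Prod>j<k. TH (pm j) (zt j) * f j (zt j)))"
  unfolding pdet_def pts_def by (subst prod_sum_PiE) (use finite_Z in auto)
 also have "... = (\<Sum>zt\<in>pts. \<Sum>pm | pm permutes {..<k}. of_int (sign pm) * (\<Prod>j<k. TH (pm j) (zt j) * f j (zt j)))"
  unfolding sum_distrib_left by (rule sum.swap)
 also have "... = (\<Sum>zt\<in>pts. Th zt * (\<Prod>j<k. f j (zt j)))" by (simp add: Th_def pdet_def prod.distrib sum_distrib_right mult.assoc)
 finally show ?thesis .
qed

lemma Th_permute: "tr permutes {..<k} \<Longrightarrow> Th (zt \<circ> tr) = of_int (sign tr) * Th zt"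
 unfolding Th_def comp_def by (rule pdet_permute_columns)

lemma pts_permute:
 assumes "tr permutes {..<k}" "zt \<in> pts"
 shows "zt \<circ> tr \<in> pts" unfolding pts_def
proof (rule PiE_I)
 fix j assume "j \<in> {..<k}"
 thus "(zt \<circ> tr) j \<in> Z" using ptsD[OF assms(2)] permutes_in_image[OF assms(1), of j] by auto
next
 fix j assume "j \<notin> {..<k}"
 thus "(zt \<circ> tr) j = undefined" using assms permutes_not_in[OF assms(1), of j] by (auto simp: pts_def)
qed

lemma sum_pts_permute:
 assumes tr: "tr permutes {..<k}"
 shows "(\<Sum>zt\<in>pts. G (zt \<circ> tr)) = (\<Sum>zt\<in>pts. G zt)"
 by (rule sum.reindex_bij_witness[where i = "\<lambda>zt. zt \<circ> inv tr" and j = "\<lambda>zt. zt \<circ> tr"])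
   (use tr pts_permute permutes_inv in \<open>auto simp: comp_assoc permutes_inv_o\<close>)

text \<open>\<open>Th\<close> alternates under permutations of the nodes, so against it a
  determinant in the first \<open>m\<close> nodes may be replaced by \<open>fact m\<close> times its
  diagonal product. The case \<open>m = k - 1\<close> serves to keep one node apart.\<close>

lemma antisymmetrize:
 assumes m: "m \<le> k" and r: "\<And>zt pm. pm permutes {..<m} \<Longrightarrow> r (zt \<circ> pm) = r zt"
 shows "(\<Sum>zt\<in>pts. Th zt * pdet m (\<lambda>i j. g i (zt j)) * r zt) =
   fact m * (\<Sum>zt\<in>pts. Th zt * (\<Prod>j<m. g j (zt j)) * r zt)"
proof -
 let ?P = "{pm. pm permutes {..<m}}"
 have "(\<Sum>zt\<in>pts. Th zt * pdet m (\<lambda>i j. g i (zt j)) * r zt) =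
   (\<Sum>zt\<in>pts. \<Sum>pm\<in>?P. of_int (sign pm) * Th zt * (\<Prod>j<m. g (pm j) (zt j)) * r zt)"
  unfolding pdet_def sum_distrib_left sum_distrib_right by (intro sum.cong refl) (simp only: mult_ac)
 also have "... = (\<Sum>pm\<in>?P. \<Sum>zt\<in>pts. of_int (sign pm) * Th zt * (\<Prod>j<m. g (pm j) (zt j)) * r zt)" by (rule sum.swap)
 also have "... = (\<Sum>pm\<in>?P. \<Sum>zt\<in>pts. Th zt * (\<Prod>j<m. g j (zt j)) * r zt)"
 proof (rule sum.cong[OF refl])
  fix pm assume "pm \<in> ?P"
  hence pm: "pm permutes {..<m}" by simp
  hence pmk: "pm permutes {..<k}" by (rule permutes_subset) (use m in auto)
  have "(\<Sum>zt\<in>pts. Th zt * (\<Prod>j<m. g j (zt j)) * r zt) = (\<Sum>zt\<in>pts. Th (zt \<circ> pm) * (\<Prod>j<m. g j ((zt \<circ> pm) j)) * r (zt \<circ> pm))"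
   by (rule sum_pts_permute[OF pmk, symmetric])
  moreover have "(\<Prod>j<m. g (pm j) (zt j)) * 1 = (\<Prod>j<m. g j (zt (inv pm j)))" for zt
   using prod.permute[OF permutes_inv[OF pm], of "\<lambda>j. g (pm j) (zt j)"] permutes_inverses[OF pm] by (simp add: comp_def)
  ultimately show "(\<Sum>zt\<in>pts. of_int (sign pm) * Th zt * (\<Prod>j<m. g (pm j) (zt j)) * r zt) =
    (\<Sum>zt\<in>pts. Th zt * (\<Prod>j<m. g j (zt j)) * r zt)"
  proof -
   have inv: "inv pm permutes {..<k}" "inv pm permutes {..<m}" using pm pmk permutes_inv by blast+
   have "(\<Sum>zt\<in>pts. Th zt * (\<Prod>j<m. g j (zt j)) * r zt) =
    (\<Sum>zt\<in>pts. Th (zt \<circ> inv pm) * (\<Prod>j<m. g j ((zt \<circ> inv pm) j)) * r (zt \<circ> inv pm))"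
    by (rule sum_pts_permute[OF inv(1), symmetric])
   also have "... = (\<Sum>zt\<in>pts. of_int (sign pm) * Th zt * (\<Prod>j<m. g (pm j) (zt j)) * r zt)"
   proof (rule sum.cong[OF refl])
    fix zt
    have "(\<Prod>j<m. g j ((zt \<circ> inv pm) j)) = (\<Prod>j<m. g (pm j) (zt j))"
     using prod.permute[OF permutes_inv[OF pm], of "\<lambda>j. g (pm j) (zt j)"] permutes_inverses[OF pm] by (simp add: comp_def)
    moreover have "sign (inv pm) = sign pm" by (rule sign_inverse) (use pm in \<open>auto intro: permutes_imp_permutation\<close>)
    ultimately show "Th (zt \<circ> inv pm) * (\<Prod>j<m. g j ((zt \<circ> inv pm) j)) * r (zt \<circ> inv pm) =
      of_int (sign pm) * Th zt * (\<Prod>j<m. g (pm j) (zt j)) * r zt" by (simp only: Th_permute[OF inv(1)] r[OF inv(2)])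
   qed
   finally show ?thesis by simp
  qed
 qed
 also have "... = fact m * (\<Sum>zt\<in>pts. Th zt * (\<Prod>j<m. g j (zt j)) * r zt)" using card_permutations[of "{..<m}" m] by simp
 finally show ?thesis .
qed

lemma weight_antisym:
 assumes "i < k"
 shows "(\<Sum>z\<in>Z. TH i z * f (1 / z)) = - (\<Sum>z\<in>Z. TH i z * f z)"
proof -
 have "(\<Sum>z\<in>Z. TH i z * f (1 / z)) = (\<Sum>z\<in>Z. TH i (1 / z) * f z)"
  by (rule sum.reindex_bij_witness[where i = "\<lambda>z. 1 / z" and j = "\<lambda>z. 1 / z"]) (use inverse_Z in auto)
 also have "... = (\<Sum>z\<in>Z. - (TH i z * f z))" by (rule sum.cong) (use assms weight_inverse in auto)
 finally show ?thesis by (simp add: sum_negf)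
qed

text \<open>The partial fractions are available only where \<open>cvdm\<close> is nonzero. Elsewhere
  the weight vanishes: \<open>TH\<close> is odd under inversion, hence 0 where
  \<open>z = 1 / z\<close>, and nodes that agree up to inversion give columns that agree up to
  sign.\<close>

lemma Th_degenerate:
 assumes zt: "zt \<in> pts" and c: "cvdm k zt = 0"
 shows "Th zt = 0"
proof -
 have z: "zt j \<in> Z" "zt j \<noteq> 0" if "j < k" for j using ptsD[OF zt that] Z_nonzero by auto
 have "(\<exists>j<k. zt j - 1 / zt j = 0) \<or> \<not> inj_on (\<lambda>j. zt j + 1 / zt j) {..<k}" using c by (auto simp: cvdm_def vdm_eq_0_iff)
 thus ?thesis
 proof
  assume "\<exists>j<k. zt j - 1 / zt j = 0"
  then obtain j where j: "j < k" "1 / zt j = zt j" by auto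
  have "TH i (zt j) = 0" if "i < k" for i using weight_inverse[OF that z(1)[OF j(1)]] j(2) by simp
  hence "TH (pm j) (zt j) = 0" if "pm permutes {..<k}" for pm using permutes_in_image[OF that, of j] j(1) by auto
  thus ?thesis unfolding Th_def pdet_def using j(1) by (intro sum.neutral) (auto simp: prod_zero_iff)
 next
  assume "\<not> inj_on (\<lambda>j. zt j + 1 / zt j) {..<k}"
  then obtain a b where ab: "a < k" "b < k" "a \<noteq> b" "zt a + 1 / zt a = zt b + 1 / zt b" by (auto simp: inj_on_def)
  have "u = v \<or> u = 1 / v" if "u \<noteq> 0" "v \<noteq> 0" "u + 1 / u = v + 1 / v" for u v :: complex
  proof -
   have "(u - v) * (u * v - 1) = u * v * ((u + 1 / u) - (v + 1 / v))" using that(1,2) by (simp add: algebra_simps)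
   hence "u = v \<or> u * v = 1" using that(3) by simp
   thus ?thesis using that(2) by (auto simp: eq_divide_eq)
  qed
  from this[OF z(2)[OF ab(1)] z(2)[OF ab(2)] ab(4)] have "zt a = zt b \<or> zt a = 1 / zt b" .
  thus ?thesis
  proof
   assume "zt a = zt b"
   thus ?thesis unfolding Th_def by (intro pdet_equal_columns[OF ab(1-3)]) simp
  next
   assume e: "zt a = 1 / zt b"
   let ?c = "\<lambda>l. if l = a then - 1 else 1 :: complex"
   have "pdet k (\<lambda>i j. ?c j * TH i (zt j)) = 0" by (rule pdet_equal_columns[OF ab(1-3)]) (use ab e weight_inverse z in auto)
   moreover have "(\<Prod>j<k. ?c j) = - 1" using ab(1) by (simp add: prod.If_cases)
   ultimately show ?thesis unfolding Th_def pdet_scale_columns by simp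
  qed
 qed
qed

definition Rc :: "(nat \<Rightarrow> complex) \<Rightarrow> nat set \<Rightarrow> complex" where
 "Rc x A = pdet k (\<lambda>i j. \<Sum>z\<in>Z. TH i z * (cdiff j z * kern x A z))"

text \<open>The form of \<open>Rc\<close> to which the partial fractions apply: \<open>cvdm\<close>
  is itself a determinant in the nodes by \<open>pdet_cvdm\<close>, and the kernel product is
  symmetric, so \<open>antisymmetrize\<close> reduces it to the diagonal.\<close>

lemma sum_Th_cvdm:
 "(\<Sum>zt\<in>pts. Th zt * cvdm k zt * (\<Prod>j<k. kern x A (zt j))) = fact k * Rc x A"
proof -
 have "(\<Sum>zt\<in>pts. Th zt * cvdm k zt * (\<Prod>j<k. kern x A (zt j))) =
   (\<Sum>zt\<in>pts. Th zt * pdet k (\<lambda>i j. cdiff i (zt j)) * (\<Prod>j<k. kern x A (zt j)))"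
  unfolding cdiff_def by (intro sum.cong refl, subst pdet_cvdm) (use ptsD Z_nonzero in auto)
 also have "... = fact k * (\<Sum>zt\<in>pts. Th zt * (\<Prod>j<k. cdiff j (zt j)) * (\<Prod>j<k. kern x A (zt j)))"
  by (rule antisymmetrize) (auto simp: comp_def intro: prod.permute[symmetric, unfolded comp_def])
 also have "(\<Sum>zt\<in>pts. Th zt * (\<Prod>j<k. cdiff j (zt j)) * (\<Prod>j<k. kern x A (zt j))) = Rc x A"
  unfolding Rc_def pdet_quadrature by (simp add: prod.distrib mult.assoc)
 finally show ?thesis .
qed

text \<open>Under the functional the dilated kernel may be replaced by the kernel itself, in spite
  of the denominator. Each Laurent mode of degree \<open>m\<close> contributes a multiple of
  \<open>1 - (t * z^2) ^ m\<close>, so the division is exact, with exponents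
  \<open>2 * r - k - m\<close> for \<open>r < m\<close>. The reversal
  \<open>r \<mapsto> m - 1 - r\<close> is an affine reflection of these exponents and changes the
  sign of every term.\<close>

lemma moment_shifted_kern:
 assumes i: "i < k" and t: "t \<noteq> 0" "norm t < 1" and A: "finite A" "k + card A \<le> N"
 shows "(\<Sum>z\<in>Z. TH i z * ((1 / z) ^ k * (kern x A (t * z) - kern x A z) / (1 - t * z\<^sup>2))) = 0"
proof -
 obtain c where c: "\<And>m. c (- m) = c m" "\<And>z. z \<noteq> 0 \<Longrightarrow> kern x A z = (\<Sum>m=- int (card A)..int (card A). c m * z powi m)"
  using kern_laurent[OF A(1)] by blast
 have sym: "kern x A z = c 0 + (\<Sum>m=1..card A. c (int m) * (z powi int m + z powi (- int m)))" if z: "z \<noteq> 0" for z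
 proof -
  have "{- int (card A)..int (card A)} = {0} \<union> int ` {1..card A} \<union> (\<lambda>m. - int m) ` {1..card A}"
  proof (intro set_eqI iffI)
   fix m assume "m \<in> {- int (card A)..int (card A)}"
   hence "m = 0 \<or> (m > 0 \<and> nat m \<in> {1..card A}) \<or> (m < 0 \<and> nat (- m) \<in> {1..card A})" by auto
   thus "m \<in> {0} \<union> int ` {1..card A} \<union> (\<lambda>m. - int m) ` {1..card A}"
    by (elim disjE conjE) (auto intro!: image_eqI[of m int "nat m"] image_eqI[of m "\<lambda>m. - int m" "nat (- m)"])
  qed auto
  hence "kern x A z = (\<Sum>m\<in>{0} \<union> int ` {1..card A} \<union> (\<lambda>m. - int m) ` {1..card A}. c m * z powi m)"
   using c(2)[OF z] by simp
  also have "... = (\<Sum>m\<in>{0} \<union> int ` {1..card A}. c m * z powi m) + (\<Sum>m\<in>(\<lambda>m. - int m) ` {1..card A}. c m * z powi m)"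
   by (rule sum.union_disjoint) auto
  also have "(\<Sum>m\<in>{0} \<union> int ` {1..card A}. c m * z powi m) = (\<Sum>m\<in>{0}. c m * z powi m) + (\<Sum>m\<in>int ` {1..card A}. c m * z powi m)"
   by (rule sum.union_disjoint) auto
  finally show ?thesis by (simp add: sum.reindex inj_on_def comp_def c(1) sum.distrib distrib_left)
 qed
 have e: "(1 / z) ^ k * (kern x A (t * z) - kern x A z) / (1 - t * z\<^sup>2) =
   (\<Sum>m=1..card A. c (int m) * ((1 / t) ^ m * (1 - t ^ m)) * (\<Sum>r<m. t ^ r * z powi (2 * int r - int k - int m)))"
  if z: "z \<in> Z" for z
 proof -
  have z0: "z \<noteq> 0" using Z_nonzero[OF z] .
  have "norm (t * z\<^sup>2) < 1" using t norm_Z[OF z] by (simp add: norm_mult norm_power)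
  hence d: "1 - t * z\<^sup>2 \<noteq> 0" by auto
  have "kern x A (t * z) - kern x A z =
    (\<Sum>m=1..card A. c (int m) * ((t * z) powi int m + (t * z) powi (- int m) - (z powi int m + z powi (- int m))))"
   using t z0 by (simp add: sym sum_subtractf right_diff_distrib)
  also have "... = (\<Sum>m=1..card A. c (int m) * ((1 / t) ^ m * (1 - t ^ m)) * (1 / z) ^ m * (1 - (t * z\<^sup>2) ^ m))"
  proof (rule sum.cong[OF refl])
   fix m
   have 1: "t ^ m * (1 / t) ^ m = 1" "z ^ m * (1 / z) ^ m = 1" using t z0 by (simp_all flip: power_mult_distrib)
   have "(t * z) powi int m + (t * z) powi (- int m) - (z powi int m + z powi (- int m)) =
     t ^ m * z ^ m + (1 / t) ^ m * (1 / z) ^ m - (z ^ m + (1 / z) ^ m)"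
    by (simp add: power_int_minus power_mult_distrib power_inverse divide_inverse)
   also have "... = ((1 / t) ^ m * (1 - t ^ m)) * (1 / z) ^ m * (1 - (t * z\<^sup>2) ^ m)"
   proof -
    have "(t * z\<^sup>2) ^ m = t ^ m * (z ^ m * z ^ m)" by (simp add: power_mult_distrib power2_eq_square)
    moreover have "(b * (1 - a)) * y * (1 - a * (w * w)) = a * w + b * y - (w + y)"
     if "a * b = 1" "w * y = 1" for a b w y :: complex
    proof -
     have "(b * (1 - a)) * y * (1 - a * (w * w)) =
       b * y - (a * b) * y - (a * b) * (w * y) * w + (a * b) * (w * y) * (a * w)" by (simp add: algebra_simps)
     thus ?thesis using that by simp
    qed
    ultimately show ?thesis using 1 by simp
   qed
   finally show "c (int m) * ((t * z) powi int m + (t * z) powi (- int m) - (z powi int m + z powi (- int m))) =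
     c (int m) * ((1 / t) ^ m * (1 - t ^ m)) * (1 / z) ^ m * (1 - (t * z\<^sup>2) ^ m)" by simp
  qed
  finally have 1: "kern x A (t * z) - kern x A z =
    (\<Sum>m=1..card A. c (int m) * ((1 / t) ^ m * (1 - t ^ m)) * (1 / z) ^ m * (1 - (t * z\<^sup>2) ^ m))" .
  have 2: "(1 - (t * z\<^sup>2) ^ m) = (1 - t * z\<^sup>2) * (\<Sum>r<m. (t * z\<^sup>2) ^ r)" for m by (rule one_diff_power_eq)
  have "(1 / z) ^ k * (kern x A (t * z) - kern x A z) / (1 - t * z\<^sup>2) =
    (\<Sum>m=1..card A. c (int m) * ((1 / t) ^ m * (1 - t ^ m)) * ((1 / z) ^ k * (1 / z) ^ m * (\<Sum>r<m. (t * z\<^sup>2) ^ r)))"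
  proof -
   have "u * (\<Sum>m=1..n. f m * g m * (v * h m)) / v = (\<Sum>m=1..n. f m * (u * g m * h m))"
    if "v \<noteq> 0" for u v :: complex and f g h and n :: nat
    unfolding sum_distrib_left sum_divide_distrib by (rule sum.cong[OF refl]) (use that in \<open>simp add: mult_ac\<close>)
   from this[OF d] show ?thesis unfolding 1 2 .
  qed
  also have "... = (\<Sum>m=1..card A. c (int m) * ((1 / t) ^ m * (1 - t ^ m)) * (\<Sum>r<m. t ^ r * z powi (2 * int r - int k - int m)))"
  proof (intro sum.cong refl arg_cong2[of _ _ _ _ "(*)"])
   fix m
   show "(1 / z) ^ k * (1 / z) ^ m * (\<Sum>r<m. (t * z\<^sup>2) ^ r) = (\<Sum>r<m. t ^ r * z powi (2 * int r - int k - int m))"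
    unfolding sum_distrib_left
   proof (rule sum.cong[OF refl])
    fix r
    have "2 * int r - int k - int m = int (2 * r) - int k - int m" by simp
    hence "z powi (2 * int r - int k - int m) = z powi int (2 * r) / z powi int k / z powi int m"
     by (simp only: power_int_diff[of z, OF disjI1[OF z0]])
    hence "z powi (2 * int r - int k - int m) = z ^ (2 * r) / z ^ k / z ^ m" unfolding power_int_of_nat .
    thus "(1 / z) ^ k * (1 / z) ^ m * (t * z\<^sup>2) ^ r = t ^ r * z powi (2 * int r - int k - int m)"
     by (simp add: power_mult_distrib power_mult power_divide)
   qed
  qed
  finally show ?thesis .
 qed
 have "(\<Sum>z\<in>Z. TH i z * ((1 / z) ^ k * (kern x A (t * z) - kern x A z) / (1 - t * z\<^sup>2))) =
   (\<Sum>z\<in>Z. \<Sum>m=1..card A. c (int m) * ((1 / t) ^ m * (1 - t ^ m)) * (\<Sum>r<m. t ^ r * (TH i z * z powi (2 * int r - int k - int m))))"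
 proof (rule sum.cong[OF refl])
  fix z assume z: "z \<in> Z"
  have "u * (\<Sum>m=1..n. f m * (\<Sum>r<m. t ^ r * h m r)) = (\<Sum>m=1..n. f m * (\<Sum>r<m. t ^ r * (u * h m r)))"
   for u and f and h :: "nat \<Rightarrow> nat \<Rightarrow> complex" and n :: nat by (simp add: sum_distrib_left mult_ac)
  thus "TH i z * ((1 / z) ^ k * (kern x A (t * z) - kern x A z) / (1 - t * z\<^sup>2)) =
    (\<Sum>m=1..card A. c (int m) * ((1 / t) ^ m * (1 - t ^ m)) * (\<Sum>r<m. t ^ r * (TH i z * z powi (2 * int r - int k - int m))))"
   unfolding e[OF z] .
 qed
 also have "... = (\<Sum>m=1..card A. c (int m) * ((1 / t) ^ m * (1 - t ^ m)) *
   (\<Sum>r<m. t ^ r * (\<Sum>z\<in>Z. TH i z * z powi (2 * int r - int k - int m))))"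
  unfolding sum_distrib_left by (subst sum.swap, rule sum.cong[OF refl], rule sum.swap)
 also have "... = 0"
 proof (rule sum.neutral, rule ballI)
  fix m assume m: "m \<in> {1..card A}"
  let ?\<phi> = "affine_coeff t (Suc k) (Suc i)"
  let ?g = "\<lambda>r. t ^ r * ?\<phi> (2 * int r - int k - int m)"
  have m1: "(\<Sum>r<m. t ^ r * (\<Sum>z\<in>Z. TH i z * z powi (2 * int r - int k - int m))) = (\<Sum>r<m. ?g r)"
   by (intro sum.cong refl arg_cong2[of _ _ _ _ "(*)"] moment i) (use m A in auto)
  also have "(\<Sum>r<m. ?g r) = (\<Sum>r<m. ?g (m - 1 - r))" using sum.nat_diff_reindex[of ?g m] by simp
  also have "... = (\<Sum>r<m. - ?g r)"
  proof (rule sum.cong[OF refl])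
   fix r assume r: "r \<in> {..<m}"
   have i': "0 < Suc i" "Suc i < Suc k" using i by auto
   \<comment> \<open>The reversal sends the exponent \<open>a\<close> to
     \<open>- (a + 2 * (k + 1))\<close>, and the power of \<open>t\<close> that this translation
     costs makes up exactly for the change from \<open>t ^ r\<close> to
     \<open>t ^ (m - 1 - r)\<close>.\<close>
   define a where "a = 2 * int r - int k - int m"
   have a': "2 * int (m - 1 - r) - int k - int m = - (a + 2 * int (Suc k))" using r by (simp add: a_def of_nat_diff)
   have "?\<phi> (2 * int (m - 1 - r) - int k - int m) = - (t powi (a + int (Suc k)) * ?\<phi> a)"
    unfolding a' affine_coeff_minus[OF i'] affine_coeff_shift[OF i' t(1)] ..
   moreover have "t ^ (m - 1 - r) * t powi (a + int (Suc k)) = t ^ r"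
   proof -
    have "t ^ (m - 1 - r) * t powi (a + int (Suc k)) = t powi (int (m - 1 - r) + (a + int (Suc k)))" using t(1) by (simp add: power_int_add)
    also have "int (m - 1 - r) + (a + int (Suc k)) = int r" using r by (simp add: a_def of_nat_diff)
    finally show ?thesis by simp
   qed
   ultimately show "?g (m - 1 - r) = - ?g r" unfolding a_def[symmetric] by (metis mult.assoc mult_minus_right)
  qed
  finally have "(\<Sum>r<m. t ^ r * (\<Sum>z\<in>Z. TH i z * z powi (2 * int r - int k - int m))) = (\<Sum>r<m. - ?g r)" .
  moreover have "S = 0" if "S = (\<Sum>r<m. h r)" "S = (\<Sum>r<m. - h r)" for S and h :: "nat \<Rightarrow> complex"
   using that by (simp add: sum_negf)
  ultimately have "(\<Sum>r<m. t ^ r * (\<Sum>z\<in>Z. TH i z * z powi (2 * int r - int k - int m))) = 0" using m1 by blast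
  thus "c (int m) * ((1 / t) ^ m * (1 - t ^ m)) *
   (\<Sum>r<m. t ^ r * (\<Sum>z\<in>Z. TH i z * z powi (2 * int r - int k - int m))) = 0" by simp
 qed
 finally show ?thesis .
qed

end

section \<open>From residues to the last column of the determinant\<close>

lemma inverse_prod_partial_fractions:
 fixes X :: complex
 assumes W: "inj_on W {..<Suc n}" and X: "\<And>j. j < Suc n \<Longrightarrow> X + W j \<noteq> 0"
 shows "1 / (\<Prod>j<Suc n. X + W j) = (\<Sum>j<Suc n. 1 / ((X + W j) * (\<Prod>l\<in>{..<Suc n} - {j}. W l - W j)))"
proof -
 \<comment> \<open>The residue sum of \<open>1 / ((u - X) * \<Prod>j (u + W j))\<close>, where
   \<open>None\<close> indexes the node \<open>X\<close>.\<close>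
 define a where "a i = (case i of None \<Rightarrow> X | Some j \<Rightarrow> - W j)" for i
 let ?I = "insert None (Some ` {..<Suc n})"
 have inj: "inj_on a ?I" using W X by (auto simp: inj_on_def a_def eq_neg_iff_add_eq_0 add.commute) (metis add.commute add.right_inverse)+
 have "(\<Sum>i\<in>?I. poly 1 (a i) / (\<Prod>c\<in>?I - {i}. a i - a c)) = 0"
  by (rule lagrange_sum_indexed[OF _ inj]) (auto simp: card_insert_if card_image)
 moreover have "?I - {None} = Some ` {..<Suc n}" by auto
 moreover have "(\<Prod>c\<in>?I - {Some j}. a (Some j) - a c) = - ((X + W j) * (\<Prod>l\<in>{..<Suc n} - {j}. W l - W j))"
  if "j < Suc n" for j
 proof -
  have "?I - {Some j} = insert None (Some ` ({..<Suc n} - {j}))" by auto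
  moreover have "(\<Prod>c\<in>insert None (Some ` ({..<Suc n} - {j})). a (Some j) - a c) =
    (- W j - X) * (\<Prod>l\<in>{..<Suc n} - {j}. W l - W j)" by (subst prod.insert) (auto simp: a_def prod.reindex)
  ultimately show ?thesis by (simp add: algebra_simps)
 qed
 ultimately have "1 / (\<Prod>c\<in>Some ` {..<Suc n}. X - a c) +
   (\<Sum>j<Suc n. 1 / - ((X + W j) * (\<Prod>l\<in>{..<Suc n} - {j}. W l - W j))) = 0"
  by (subst (asm) sum.insert) (auto simp: sum.reindex a_def simp del: sum.lessThan_Suc prod.lessThan_Suc)
 moreover have "(\<Prod>c\<in>Some ` {..<Suc n}. X - a c) = (\<Prod>j<Suc n. X + W j)" by (simp add: prod.reindex a_def del: prod.lessThan_Suc)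
 ultimately show ?thesis by (simp add: sum_negf add_eq_0_iff2 eq_neg_iff_add_eq_0 del: sum.lessThan_Suc prod.lessThan_Suc)
qed

text \<open>The average over both square roots \<open>s\<close> and \<open>- s\<close> contains only
  integral powers of \<open>t\<close>. The denominators combine through
  \<open>t * (X + W) * (W - X) = - (1 - t * z^2) * (1 - t / z^2)\<close> with
  \<open>X = s + 1 / s\<close> and \<open>W = z + 1 / z\<close>; the power of \<open>t\<close> is
  \<open>k / 2\<close> rounded up, whence the distinction by parity.\<close>

lemma double_pole_sum:
 fixes t s z :: complex
 assumes s: "t * s\<^sup>2 = 1" and z: "z \<noteq> 0" and d: "1 - t * z\<^sup>2 \<noteq> 0" "1 - t * (1 / z)\<^sup>2 \<noteq> 0"
 shows "(z - 1 / z) * ((1 / s ^ k / (s + 1 / s + (z + 1 / z)) + 1 / (- s) ^ k / (- s + 1 / (- s) + (z + 1 / z))) / 2) =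
   - ((- 1) ^ k) * t ^ ((k + 1) div 2) *
    ((1 / z) ^ k * z ^ (2 * ((k + 1) div 2)) / (1 - t * z\<^sup>2) - z ^ k * (1 / z) ^ (2 * ((k + 1) div 2)) / (1 - t * (1 / z)\<^sup>2))"
proof -
 define y where "y = 1 / z"
 have zy: "z * y = 1" using z by (simp add: y_def)
 have s0: "s \<noteq> 0" using s by auto
 define X where "X = s + t * s"
 define W where "W = z + y"
 define a where "a = 1 - t * z\<^sup>2"
 define b where "b = 1 - t * y\<^sup>2"
 have ab: "a \<noteq> 0" "b \<noteq> 0" using d by (simp_all add: a_def b_def y_def)
 have "1 / s = t * s" using s s0 by (simp add: field_simps power2_eq_square)
 hence X: "s + 1 / s = X" "- s + 1 / (- s) = - X" by (simp_all add: X_def)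
 have D: "t * ((X + W) * (W - X)) = - (a * b)"
 proof -
  have "t * ((X + W) * (W - X)) = t * (z\<^sup>2 + 2 * (z * y) + y\<^sup>2) - t * s\<^sup>2 * (1 + t)\<^sup>2"
   by (simp add: X_def W_def power2_eq_square algebra_simps)
  also have "... = t * z\<^sup>2 + t * y\<^sup>2 - 1 - t\<^sup>2 * (z * y)\<^sup>2" unfolding zy s by (simp add: power2_eq_square algebra_simps)
  also have "... = - (a * b)" by (simp add: a_def b_def power2_eq_square algebra_simps)
  finally show ?thesis .
 qed
 hence n: "X + W \<noteq> 0" "W - X \<noteq> 0" using ab by auto
 have t0: "t \<noteq> 0" using s by auto
 have e: "P / ((X + W) * (W - X)) = - (t * P) / (a * b)" for P
 proof -
  have "P / ((X + W) * (W - X)) = (t * P) / (t * ((X + W) * (W - X)))" using t0 by simp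
  thus ?thesis unfolding D by simp
 qed
 have recip: "1 / A + 1 / B = (A + B) / (A * B)" if "A \<noteq> 0" "B \<noteq> 0" for A B :: complex using that by (simp add: field_simps)
 have half: "u * ((p / A + p / B) / 2) = p * (u * w / E)" if "1 / A + 1 / B = 2 * w / E" for u p A B w E :: complex
 proof -
  have "u * ((p / A + p / B) / 2) = u * p * ((1 / A + 1 / B) / 2)" by (simp add: add_divide_distrib algebra_simps)
  thus ?thesis unfolding that by simp
 qed
 show ?thesis
 proof (cases "even k")
  case True
  then obtain c where k: "k = 2 * c" by (elim evenE)
  have sk: "1 / s ^ k = t ^ c" "(- s) ^ k = s ^ k"
  proof -
   have "t ^ c * s ^ k = 1" unfolding k power_mult power_mult_distrib[symmetric] s by simp
   thus "1 / s ^ k = t ^ c" using s0 by (simp add: field_simps)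
  qed (simp add: k)
  have "1 / (X + W) + 1 / (W - X) = 2 * W / ((X + W) * (W - X))" using recip[OF n] by simp
  hence "1 / (X + W) + 1 / (- X + W) = 2 * W / ((X + W) * (W - X))" by simp
  from half[OF this] have "(z - y) * ((t ^ c / (X + W) + t ^ c / (- X + W)) / 2) = t ^ c * (((z - y) * W) / ((X + W) * (W - X)))" .
  also have "... = - (t ^ c * (1 / a - 1 / b))"
  proof -
   have "1 / a - 1 / b = (b - a) / (a * b)" using ab by (simp add: diff_frac_eq)
   moreover have "b - a = t * ((z - y) * W)" by (simp add: a_def b_def W_def power2_eq_square algebra_simps)
   ultimately show ?thesis unfolding e by simp
  qed
  finally have "(z - y) * ((t ^ c / (X + W) + t ^ c / (- X + W)) / 2) = - (t ^ c * (1 / a - 1 / b))" .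
  moreover have "y ^ k * z ^ (2 * c) = 1" "z ^ k * y ^ (2 * c) = 1" using zy by (simp_all add: k flip: power_mult_distrib) (simp add: mult.commute)
  ultimately show ?thesis unfolding X sk y_def[symmetric] W_def[symmetric] a_def[symmetric] b_def[symmetric] using k by simp
 next
  case False
  then obtain c where k: "k = 2 * c + 1" by (elim oddE)
  have sk: "1 / s ^ k = t ^ Suc c * s" "1 / (- s) ^ k = - (t ^ Suc c * s)"
  proof -
   have "s ^ (2 * Suc c) = s * s ^ k" by (simp add: k)
   hence "t ^ Suc c * s * s ^ k = (t * s\<^sup>2) ^ Suc c" unfolding power_mult_distrib power_mult[symmetric] by (simp only: mult.assoc)
   hence "t ^ Suc c * s * s ^ k = 1" unfolding s by simp
   thus 1: "1 / s ^ k = t ^ Suc c * s" using s0 by (simp add: field_simps)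
   have "(- s) ^ k = - (s ^ k)" by (simp add: k)
   thus "1 / (- s) ^ k = - (t ^ Suc c * s)" using 1 by simp
  qed
  have sX: "t * (s * X) = 1 + t"
  proof -
   have "t * (s * X) = t * s\<^sup>2 * (1 + t)" by (simp add: X_def power2_eq_square algebra_simps)
   thus ?thesis unfolding s by simp
  qed
  have "1 / (X + W) + 1 / - (W - X) = 2 * - X / ((X + W) * (W - X))"
   using recip[of "X + W" "- (W - X)"] n unfolding mult_minus_right minus_divide_right[symmetric] by simp
  from half[OF this, of "z - y" "t ^ Suc c * s"]
  have "(z - y) * ((t ^ Suc c * s / (X + W) + t ^ Suc c * s / - (W - X)) / 2) =
    t ^ Suc c * s * ((z - y) * - X / ((X + W) * (W - X)))" .
  moreover have "t ^ Suc c * s / - (W - X) = - (t ^ Suc c * s) / (- X + W)"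
  proof -
   have "p / - d = - p / d" for p d :: complex by simp
   moreover have "- X + W = W - X" by simp
   ultimately show ?thesis by (simp only:)
  qed
  ultimately have "(z - y) * ((t ^ Suc c * s / (X + W) + - (t ^ Suc c * s) / (- X + W)) / 2) =
    t ^ Suc c * (- ((z - y) * (s * X)) / ((X + W) * (W - X)))" by (simp only:) (simp add: mult_ac)
  also have "... = t ^ Suc c * ((z - y) * (1 + t) / (a * b))" unfolding e sX[symmetric] by (simp add: mult_ac)
  also have "(z - y) * (1 + t) = z - z * y * (t * y) - (y - z * y * (t * z))" unfolding zy by (simp add: algebra_simps)
  also have "... = z * b - y * a" by (simp add: a_def b_def power2_eq_square algebra_simps)
  also have "(z * b - y * a) / (a * b) = z / a - y / b" using ab by (simp add: field_simps)
  finally have "(z - y) * ((t ^ Suc c * s / (X + W) + - (t ^ Suc c * s) / (- X + W)) / 2) = t ^ Suc c * (z / a - y / b)" .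
  moreover have "y ^ k * z ^ (2 * Suc c) = z" "z ^ k * y ^ (2 * Suc c) = y"
  proof -
   have "2 * Suc c = Suc k" by (simp add: k)
   hence "y ^ k * z ^ (2 * Suc c) = (z * y) ^ k * z" "z ^ k * y ^ (2 * Suc c) = (z * y) ^ k * y"
    unfolding power_mult_distrib by (simp_all only: power_Suc mult_ac)
   thus "y ^ k * z ^ (2 * Suc c) = z" "z ^ k * y ^ (2 * Suc c) = y" by (simp_all add: zy)
  qed
  moreover have "(k + 1) div 2 = Suc c" "(- 1) ^ k = (- 1 :: complex)" by (simp_all add: k)
  ultimately show ?thesis unfolding X sk y_def[symmetric] W_def[symmetric] a_def[symmetric] b_def[symmetric] by (simp only: minus_minus mult_1)
 qed
qed

context quadrature
begin

text \<open>The \<open>shift_coeff\<close> of \<open>star_point\<close>, available here without the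
  assumptions of that locale, since degenerate tuples also occur in the sums.\<close>

definition scf :: "(nat \<Rightarrow> complex) \<Rightarrow> nat set \<Rightarrow> complex \<Rightarrow> complex" where
 "scf x A v = kern x A (t * v) / ((1 - t * v\<^sup>2) * (v - 1 / v) * (- v) ^ k)"

text \<open>The total contribution of a single node: the dilated residues at \<open>z\<close> and
  \<open>1 / z\<close>, and the share of the poles \<open>s\<close> and \<open>- s\<close> that
  partial fractions assign to this node.\<close>

definition gfun :: "complex \<Rightarrow> (nat \<Rightarrow> complex) \<Rightarrow> nat set \<Rightarrow> complex \<Rightarrow> complex" where
 "gfun s x A z = scf x A z + scf x A (1 / z) +
   kern x A z * ((1 / s ^ k / (s + 1 / s + (z + 1 / z)) + 1 / (- s) ^ k / (- s + 1 / (- s) + (z + 1 / z))) / 2)"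

text \<open>Multiplied by \<open>z - 1 / z\<close>, the contribution of a node is, up to sign, the
  difference of \<open>m (1 / z)\<close> and \<open>m z\<close>, which pairs to 0 with
  \<open>TH i\<close> by \<open>moment_shifted_kern\<close>, plus the kernel times a combination of
  finite geometric sums. The latter expresses the column by the columns \<open>k - 1 - 2 * r\<close>
  of the matrix of \<open>Rc\<close>.\<close>

lemma last_column_eq:
 assumes i: "i < k" and t: "t \<noteq> 0" "norm t < 1" and s: "t * s\<^sup>2 = 1" and A: "finite A" "k + card A \<le> N"
 shows "(\<Sum>z\<in>Z. TH i z * ((- 1) ^ (k - 1) * ((z - 1 / z) * gfun s x A z))) =
   (\<Sum>r<(k + 1) div 2. t ^ r * (\<Sum>z\<in>Z. TH i z * (cdiff (k - 1 - 2 * r) z * kern x A z)))"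
proof -
 let ?c = "(k + 1) div 2"
 define m where "m z = (1 / z) ^ k * (kern x A (t * z) - kern x A z) / (1 - t * z\<^sup>2)" for z
 have key: "TH i z * ((- 1) ^ (k - 1) * ((z - 1 / z) * gfun s x A z)) =
   (TH i z * m (1 / z) - TH i z * m z) + (\<Sum>r<?c. t ^ r * (TH i z * (cdiff (k - 1 - 2 * r) z * kern x A z)))"
  if z: "z \<in> Z" for z
 \<comment> \<open>At 1 and -1 the divisor \<open>z - 1 / z\<close> vanishes, but so does the
   weight.\<close>
 proof (cases "1 / z = z")
  case True
  hence "TH i z = 0" using weight_inverse[OF i z] by simp
  thus ?thesis by simp
 next
  case False
  have z0: "z \<noteq> 0" using Z_nonzero[OF z] .
  define y where "y = 1 / z"
  have zy: "z * y = 1" "z \<noteq> y" "y \<noteq> 0" "1 / y = z" using z0 False by (auto simp: y_def)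
  have nt: "norm (t * z\<^sup>2) < 1" "norm (t * y\<^sup>2) < 1" using t norm_Z[OF z] by (simp_all add: norm_mult norm_power norm_divide y_def)
  hence d: "1 - t * z\<^sup>2 \<noteq> 0" "1 - t * y\<^sup>2 \<noteq> 0" by auto
  define K1 where "K1 = kern x A (t * z)"
  define K2 where "K2 = kern x A (t * y)"
  define K0 where "K0 = kern x A z"
  have K: "kern x A y = K0" unfolding K0_def y_def kern_def by (rule prod.cong) (auto simp: mult.commute)
  have mz: "m z = y ^ k * (K1 - K0) / (1 - t * z\<^sup>2)" "m y = z ^ k * (K2 - K0) / (1 - t * y\<^sup>2)"
   unfolding m_def zy(4) K by (simp_all add: y_def K0_def K1_def K2_def)
  have sg: "(- v) ^ k = (- 1) ^ k * v ^ k" for v :: complex by (rule power_minus)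
  have yk: "1 / z ^ k = y ^ k" "1 / y ^ k = z ^ k" by (simp_all add: y_def power_divide)
  have s1: "(z - y) * scf x A z = (- 1) ^ k * (y ^ k * K1 / (1 - t * z\<^sup>2))"
  proof -
   have "(z - y) * scf x A z = K1 / (1 - t * z\<^sup>2) * (1 / (- z) ^ k)" using zy(2) by (simp add: scf_def y_def[symmetric] K1_def)
   also have "1 / (- z) ^ k = (- 1) ^ k * y ^ k" unfolding sg[of z] yk(1)[symmetric] by (cases "even k"; simp)
   finally show ?thesis by simp
  qed
  have s2: "(z - y) * scf x A y = - ((- 1) ^ k * (z ^ k * K2 / (1 - t * y\<^sup>2)))"
  proof -
   have "(z - y) * scf x A y = (z - y) / (y - z) * (K2 / (1 - t * y\<^sup>2) * (1 / (- y) ^ k))" by (simp add: scf_def zy(4) K2_def)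
   also have "(z - y) / (y - z) = - 1" using zy(2) by (simp add: divide_eq_minus_1_iff)
   also have "1 / (- y) ^ k = (- 1) ^ k * z ^ k" unfolding sg[of y] yk(2)[symmetric] by (cases "even k"; simp)
   finally show ?thesis by simp
  qed
  let ?u = "y ^ k * z ^ (2 * ?c) / (1 - t * z\<^sup>2) - z ^ k * y ^ (2 * ?c) / (1 - t * y\<^sup>2)"
  have s3: "(z - y) * ((1 / s ^ k / (s + 1 / s + (z + y)) + 1 / (- s) ^ k / (- s + 1 / (- s) + (z + y))) / 2) = - ((- 1) ^ k) * t ^ ?c * ?u"
   using double_pole_sum[OF s z0 d(1), of k] d(2) unfolding y_def by simp
  have "(z - y) * gfun s x A z = (z - y) * scf x A z + (z - y) * scf x A y +
    K0 * ((z - y) * ((1 / s ^ k / (s + 1 / s + (z + y)) + 1 / (- s) ^ k / (- s + 1 / (- s) + (z + y))) / 2))"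
   unfolding gfun_def y_def[symmetric] K0_def by (simp only: distrib_left mult_ac)
  also have "... = (- 1) ^ k * ((m z - m y) + K0 * (y ^ k * ((1 - (t * z\<^sup>2) ^ ?c) / (1 - t * z\<^sup>2)) - z ^ k * ((1 - (t * y\<^sup>2) ^ ?c) / (1 - t * y\<^sup>2))))"
  proof -
   have "e * (a * K1 / p) + - (e * (b * K2 / q)) + K0 * (- e * tt * (a * zz / p - b * yy / q)) =
     e * ((a * (K1 - K0) / p - b * (K2 - K0) / q) + K0 * (a * ((1 - tt * zz) / p) - b * ((1 - tt * yy) / q)))"
    for e a b p q zz yy tt :: complex by (simp add: diff_divide_distrib algebra_simps)
   thus ?thesis unfolding s1 s2 s3 mz power_mult_distrib power_mult[symmetric] .
  qed
  also have "y ^ k * ((1 - (t * z\<^sup>2) ^ ?c) / (1 - t * z\<^sup>2)) - z ^ k * ((1 - (t * y\<^sup>2) ^ ?c) / (1 - t * y\<^sup>2)) =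
    - (\<Sum>r<?c. t ^ r * cdiff (k - 1 - 2 * r) z)"
  proof -
   have q: "(1 - v ^ ?c) / (1 - v) = (\<Sum>r<?c. v ^ r)" if "1 - v \<noteq> 0" for v :: complex unfolding one_diff_power_eq using that by simp
   have r: "y ^ k * (t * z\<^sup>2) ^ r - z ^ k * (t * y\<^sup>2) ^ r = - (t ^ r * cdiff (k - 1 - 2 * r) z)" if "r < ?c" for r
   proof -
    have k: "k = Suc (k - 1 - 2 * r) + 2 * r" using that by auto
    define e where "e = Suc (k - 1 - 2 * r)"
    have k': "k = e + 2 * r" using k by (simp add: e_def)
    have c1: "y ^ (2 * r) * z ^ (2 * r) = 1" "z ^ (2 * r) * y ^ (2 * r) = 1" using zy(1) by (simp_all add: mult.commute flip: power_mult_distrib)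
    have "y ^ k * (t * z\<^sup>2) ^ r = t ^ r * (y ^ e * (y ^ (2 * r) * z ^ (2 * r)))"
     "z ^ k * (t * y\<^sup>2) ^ r = t ^ r * (z ^ e * (z ^ (2 * r) * y ^ (2 * r)))"
     unfolding power_mult_distrib power_mult[symmetric] by (subst k', simp add: power_add mult_ac)+
    moreover have "a - b = - (T * (q - p))" if "a = T * (p * 1)" "b = T * (q * 1)" for a b p q T :: complex
     using that by (simp add: algebra_simps)
    ultimately show ?thesis unfolding c1 cdiff_def e_def[symmetric] y_def[symmetric] by blast
   qed
   show ?thesis unfolding q[OF d(1)] q[OF d(2)] sum_distrib_left sum_subtractf[symmetric] sum_negf[symmetric]
    by (rule sum.cong[OF refl]) (simp only: r lessThan_iff)
  qed
  finally have "(z - y) * gfun s x A z = (- 1) ^ k * ((m z - m y) + K0 * - (\<Sum>r<?c. t ^ r * cdiff (k - 1 - 2 * r) z))" .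
  moreover have "(- 1) ^ (k - 1) * ((- 1) ^ k * u) = - u" for u :: complex using i by (cases k) auto
  ultimately have "(- 1) ^ (k - 1) * ((z - y) * gfun s x A z) = (m y - m z) + K0 * (\<Sum>r<?c. t ^ r * cdiff (k - 1 - 2 * r) z)" by simp
  thus ?thesis unfolding y_def[symmetric] K0_def[symmetric] by (simp add: right_diff_distrib distrib_left sum_distrib_left mult_ac)
 qed
 have "(\<Sum>z\<in>Z. TH i z * ((- 1) ^ (k - 1) * ((z - 1 / z) * gfun s x A z))) =
   ((\<Sum>z\<in>Z. TH i z * m (1 / z)) - (\<Sum>z\<in>Z. TH i z * m z)) +
   (\<Sum>z\<in>Z. \<Sum>r<?c. t ^ r * (TH i z * (cdiff (k - 1 - 2 * r) z * kern x A z)))"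
  unfolding sum_subtractf[symmetric] sum.distrib[symmetric] by (rule sum.cong[OF refl key])
 moreover have "(\<Sum>z\<in>Z. TH i z * m z) = 0" unfolding m_def by (rule moment_shifted_kern[OF i t A])
 moreover have "(\<Sum>z\<in>Z. \<Sum>r<?c. t ^ r * (TH i z * (cdiff (k - 1 - 2 * r) z * kern x A z))) =
   (\<Sum>r<?c. t ^ r * (\<Sum>z\<in>Z. TH i z * (cdiff (k - 1 - 2 * r) z * kern x A z)))" unfolding sum_distrib_left by (rule sum.swap)
 ultimately show ?thesis by (simp add: weight_antisym[OF i])
qed

end

context quadrature
begin

text \<open>Replacing the last column by \<open>last_column_eq\<close> gives a sum over
  \<open>r\<close>; for \<open>r > 0\<close> the new column \<open>n - 2 * r\<close> already occurs
  in the matrix, so only \<open>r = 0\<close> remains.\<close>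

lemma sum_Th_last:
 assumes k: "k = Suc n" and t: "t \<noteq> 0" "norm t < 1" and s: "t * s\<^sup>2 = 1" and A: "finite A" "k + card A \<le> N"
 shows "(\<Sum>zt\<in>pts. Th zt * pdet n (\<lambda>i j. cdiff i (zt j)) *
   ((- 1) ^ n * ((zt n - 1 / zt n) * gfun s x A (zt n)) * (\<Prod>j<n. kern x A (zt j)))) = fact n * Rc x A"
proof -
 let ?h = "\<lambda>z. (- 1) ^ n * ((z - 1 / z) * gfun s x A z)"
 let ?M = "\<lambda>i j. \<Sum>z\<in>Z. TH i z * (cdiff j z * kern x A z)"
 have "(\<Sum>zt\<in>pts. Th zt * pdet n (\<lambda>i j. cdiff i (zt j)) * (?h (zt n) * (\<Prod>j<n. kern x A (zt j)))) =
   fact n * (\<Sum>zt\<in>pts. Th zt * (\<Prod>j<n. cdiff j (zt j)) * (?h (zt n) * (\<Prod>j<n. kern x A (zt j))))"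
 proof (rule antisymmetrize)
  fix zt pm assume pm: "pm permutes {..<n}"
  have "pm n = n" by (rule permutes_not_in[OF pm]) simp
  moreover have "(\<Prod>j<n. kern x A ((zt \<circ> pm) j)) = (\<Prod>j<n. kern x A (zt j))"
   using prod.permute[OF pm, of "\<lambda>j. kern x A (zt j)"] by (simp add: comp_def)
  ultimately show "?h ((zt \<circ> pm) n) * (\<Prod>j<n. kern x A ((zt \<circ> pm) j)) = ?h (zt n) * (\<Prod>j<n. kern x A (zt j))"
   by (simp only: comp_apply)
 qed (simp add: k)
 also have "(\<Sum>zt\<in>pts. Th zt * (\<Prod>j<n. cdiff j (zt j)) * (?h (zt n) * (\<Prod>j<n. kern x A (zt j)))) =
   (\<Sum>zt\<in>pts. Th zt * (\<Prod>j<k. if j = n then ?h (zt j) else cdiff j (zt j) * kern x A (zt j)))"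
  by (rule sum.cong[OF refl]) (simp add: k prod.distrib mult_ac)
 also have "... = pdet k (\<lambda>i j. \<Sum>z\<in>Z. TH i z * (if j = n then ?h z else cdiff j z * kern x A z))"
  by (rule pdet_quadrature[symmetric])
 also have "... = pdet (Suc n) (\<lambda>i j. if j = n then \<Sum>r<(k + 1) div 2. t ^ r * ?M i (n - 2 * r) else ?M i j)"
  unfolding k[symmetric] by (rule pdet_cong) (use last_column_eq[OF _ t s A, of _ x] in \<open>auto simp: k\<close>)
 also have "... = (\<Sum>r<(k + 1) div 2. t ^ r * pdet (Suc n) (\<lambda>i j. if j = n then ?M i (n - 2 * r) else ?M i j))"
  by (rule pdet_last_column_sum) simp
 also have "... = (\<Sum>r\<in>{0}. t ^ r * pdet (Suc n) (\<lambda>i j. if j = n then ?M i (n - 2 * r) else ?M i j))"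
 proof (rule sum.mono_neutral_right)
  show "\<forall>r\<in>{..<(k + 1) div 2} - {0}. t ^ r * pdet (Suc n) (\<lambda>i j. if j = n then ?M i (n - 2 * r) else ?M i j) = 0"
  proof
   fix r assume "r \<in> {..<(k + 1) div 2} - {0}"
   hence r: "0 < r" "2 * r \<le> n" by (auto simp: k)
   have "pdet (Suc n) (\<lambda>i j. if j = n then ?M i (n - 2 * r) else ?M i j) = 0"
    by (rule pdet_equal_columns[of n _ "n - 2 * r"]) (use r in auto)
   thus "t ^ r * pdet (Suc n) (\<lambda>i j. if j = n then ?M i (n - 2 * r) else ?M i j) = 0" by simp
  qed
 qed (auto simp: k)
 also have "... = Rc x A"
 proof -
  have "pdet (Suc n) (\<lambda>i j. if j = n then ?M i n else ?M i j) = pdet (Suc n) ?M" by (rule pdet_cong) auto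
  thus ?thesis unfolding Rc_def k[symmetric]
   by (simp only: sum.insert[OF finite.emptyI] empty_iff not_False_eq_True sum.empty mult_0_right diff_zero power_0 mult_1 add_0_right)
 qed
 finally show ?thesis .
qed

definition Bfun :: "complex \<Rightarrow> (nat \<Rightarrow> complex) \<Rightarrow> nat set \<Rightarrow> (nat \<Rightarrow> complex) \<Rightarrow> complex" where
 "Bfun s x A z = (1 / (2 * (\<Prod>j<k. (s + z j) * (s + 1 / z j))) + 1 / (2 * (\<Prod>j<k. (- s + z j) * (- s + 1 / z j)))) *
    (\<Prod>j<k. kern x A (z j)) +
   (\<Sum>j<k. (scf x A (z j) + scf x A (1 / z j)) * (\<Prod>l\<in>{..<k} - {j}. kern x A (z l)) /
    (\<Prod>l\<in>{..<k} - {j}. (z l + 1 / z l) - (z j + 1 / z j)))"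

text \<open>The terms from the poles \<open>s\<close> and \<open>- s\<close> are distributed over
  the nodes by partial fractions in \<open>v + 1 / v + W j\<close>, so that the whole bracket
  becomes a sum of contributions of single nodes.\<close>

lemma Bfun_eq:
 assumes k: "k = Suc n" and s: "norm s > 1" and z: "\<And>j. j < k \<Longrightarrow> norm (z j) = 1" and c: "cvdm k z \<noteq> 0"
 shows "Bfun s x A z = (\<Sum>j<k. gfun s x A (z j) * (\<Prod>l\<in>{..<k} - {j}. kern x A (z l)) /
    (\<Prod>l\<in>{..<k} - {j}. (z l + 1 / z l) - (z j + 1 / z j)))"
proof -
 define W where "W j = z j + 1 / z j" for j
 define P where "P j = (\<Prod>l\<in>{..<k} - {j}. kern x A (z l))" for j
 define V where "V j = (\<Prod>l\<in>{..<k} - {j}. W l - W j)" for j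
 define F where "F = (\<Prod>j<k. kern x A (z j))"
 have z0: "z j \<noteq> 0" if "j < k" for j using z[OF that] by auto
 have inj: "inj_on W {..<k}" using c unfolding cvdm_def W_def by (simp add: vdm_eq_0_iff)
 have FP: "F = kern x A (z j) * P j" if "j < k" for j unfolding F_def P_def by (rule prod.remove) (use that in auto)
 have Q: "1 / (\<Prod>j<k. (v + z j) * (v + 1 / z j)) = (\<Sum>j<k. 1 / v ^ k / (v + 1 / v + W j) / V j)" if v: "norm v > 1" for v
 proof -
  have v0: "v \<noteq> 0" using v by auto
  have f: "(v + z j) * (v + 1 / z j) = v * (v + 1 / v + W j)" if "j < k" for j
  proof -
   have "(a + b) * (a + c) = a * (a + d + (b + c))" if "b * c = 1" "a * d = 1" for a b c d :: complex
   proof -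
    have "(a + b) * (a + c) = a * a + b * c + a * (b + c)" "a * (a + d + (b + c)) = a * a + a * d + a * (b + c)" by (simp_all add: algebra_simps)
    thus ?thesis using that by simp
   qed
   thus ?thesis using z0[OF that] v0 unfolding W_def by simp
  qed
  have nz: "v + 1 / v + W j \<noteq> 0" if "j < k" for j
  proof -
   have "norm (z j) = 1" "norm (1 / z j) = 1" using z[OF that] by (simp_all add: norm_divide)
   hence "v + z j \<noteq> 0" "v + 1 / z j \<noteq> 0" using v by (auto simp: add_eq_0_iff2)
   thus ?thesis using f[OF that] by auto
  qed
  have "(\<Prod>j<k. (v + z j) * (v + 1 / z j)) = v ^ k * (\<Prod>j<k. v + 1 / v + W j)"
  proof -
   have "(\<Prod>j<k. (v + z j) * (v + 1 / z j)) = (\<Prod>j<k. v * (v + 1 / v + W j))" by (rule prod.cong[OF refl]) (simp only: f lessThan_iff)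
   thus ?thesis by (simp only: prod.distrib prod_constant card_lessThan)
  qed
  hence "1 / (\<Prod>j<k. (v + z j) * (v + 1 / z j)) = 1 / v ^ k * (1 / (\<Prod>j<k. v + 1 / v + W j))" by simp
  also have "1 / (\<Prod>j<k. v + 1 / v + W j) = (\<Sum>j<k. 1 / ((v + 1 / v + W j) * V j))"
   unfolding V_def k by (rule inverse_prod_partial_fractions) (use inj nz k in auto)
  finally show ?thesis by (simp add: sum_distrib_left mult.assoc)
 qed
 have "(1 / (2 * (\<Prod>j<k. (s + z j) * (s + 1 / z j))) + 1 / (2 * (\<Prod>j<k. (- s + z j) * (- s + 1 / z j)))) * F =
   (\<Sum>j<k. kern x A (z j) * ((1 / s ^ k / (s + 1 / s + W j) + 1 / (- s) ^ k / (- s + 1 / (- s) + W j)) / 2) * P j / V j)"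
 proof -
  have "(1 / (2 * a) + 1 / (2 * b)) * F = (1 / a + 1 / b) * F / 2" for a b :: complex by (simp add: add_divide_distrib)
  hence "(1 / (2 * (\<Prod>j<k. (s + z j) * (s + 1 / z j))) + 1 / (2 * (\<Prod>j<k. (- s + z j) * (- s + 1 / z j)))) * F =
    ((\<Sum>j<k. 1 / s ^ k / (s + 1 / s + W j) / V j) + (\<Sum>j<k. 1 / (- s) ^ k / (- s + 1 / (- s) + W j) / V j)) * F / 2"
   using Q[of s] Q[of "- s"] s by (simp only: norm_minus_cancel)
  also have "... = (\<Sum>j<k. (1 / s ^ k / (s + 1 / s + W j) / V j + 1 / (- s) ^ k / (- s + 1 / (- s) + W j) / V j) * F / 2)"
   by (simp only: sum.distrib[symmetric] sum_distrib_right sum_divide_distrib)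
  also have "... = (\<Sum>j<k. kern x A (z j) * ((1 / s ^ k / (s + 1 / s + W j) + 1 / (- s) ^ k / (- s + 1 / (- s) + W j)) / 2) * P j / V j)"
  proof (rule sum.cong[OF refl])
   fix j assume "j \<in> {..<k}"
   hence "F = kern x A (z j) * P j" using FP by simp
   moreover have "(a / v + b / v) * (c * d) / 2 = c * ((a + b) / 2) * d / v" for a b c d v :: complex
    by (simp add: add_divide_distrib algebra_simps)
   ultimately show "(1 / s ^ k / (s + 1 / s + W j) / V j + 1 / (- s) ^ k / (- s + 1 / (- s) + W j) / V j) * F / 2 =
    kern x A (z j) * ((1 / s ^ k / (s + 1 / s + W j) + 1 / (- s) ^ k / (- s + 1 / (- s) + W j)) / 2) * P j / V j" by (simp only:)
  qed
  finally show ?thesis .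
 qed
 hence "Bfun s x A z = (\<Sum>j<k. kern x A (z j) * ((1 / s ^ k / (s + 1 / s + W j) + 1 / (- s) ^ k / (- s + 1 / (- s) + W j)) / 2) * P j / V j) +
   (\<Sum>j<k. (scf x A (z j) + scf x A (1 / z j)) * P j / V j)"
  unfolding Bfun_def F_def[symmetric] W_def[symmetric] P_def[symmetric] V_def[symmetric] by (simp only:)
 also have "... = (\<Sum>j<k. gfun s x A (z j) * P j / V j)" unfolding sum.distrib[symmetric]
 proof (rule sum.cong[OF refl])
  fix j
  have "a * p / v + b * p / v = (b + a) * p / v" for a b p v :: complex by (simp add: add_divide_distrib algebra_simps)
  thus "kern x A (z j) * ((1 / s ^ k / (s + 1 / s + W j) + 1 / (- s) ^ k / (- s + 1 / (- s) + W j)) / 2) * P j / V j +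
    (scf x A (z j) + scf x A (1 / z j)) * P j / V j = gfun s x A (z j) * P j / V j" unfolding gfun_def W_def[symmetric] by (simp only:)
 qed
 finally show ?thesis unfolding P_def V_def W_def .
qed

text \<open>By antisymmetry all \<open>k\<close> nodes contribute equally, so the last one may be
  singled out. Dividing \<open>cvdm k\<close> by the differences \<open>W l - W n\<close> leaves, up
  to sign, \<open>cvdm n\<close> times \<open>zt n - 1 / zt n\<close>, and
  \<open>sum_Th_last\<close> applies; \<open>k * fact n\<close> restores
  \<open>fact k\<close>.\<close>

lemma sum_Th_Bfun:
 assumes t: "t \<noteq> 0" "norm t < 1" and s: "t * s\<^sup>2 = 1" and A: "finite A" "k + card A \<le> N"
 shows "(\<Sum>zt\<in>pts. Th zt * cvdm k zt * Bfun s x A zt) = fact k * Rc x A"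
proof (cases k)
 case 0
 \<comment> \<open>Without nodes the two terms for \<open>s\<close> and \<open>- s\<close> are
   \<open>1 / 2\<close> each.\<close>
 have "Bfun s x A zt = (\<Prod>j<k. kern x A (zt j))" for zt unfolding Bfun_def by (simp add: 0)
 thus ?thesis using sum_Th_cvdm[of x A] by (simp only:)
next
 case (Suc n)
 have sn: "norm s > 1" by (rule norm_gt_1_of_mult_square[OF s t(2)])
 define T where "T j zt = Th zt * cvdm k zt * (gfun s x A (zt j) * (\<Prod>l\<in>{..<k} - {j}. kern x A (zt l)) /
    (\<Prod>l\<in>{..<k} - {j}. (zt l + 1 / zt l) - (zt j + 1 / zt j)))" for j zt
 have z0: "zt j \<noteq> 0" if "zt \<in> pts" "j < k" for zt j using ptsD[OF that] Z_nonzero by auto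
 have z1: "norm (zt j) = 1" if "zt \<in> pts" "j < k" for zt j using ptsD[OF that] norm_Z by auto
 have "(\<Sum>zt\<in>pts. Th zt * cvdm k zt * Bfun s x A zt) = (\<Sum>zt\<in>pts. \<Sum>j<k. T j zt)"
 proof (rule sum.cong[OF refl])
  fix zt assume zt: "zt \<in> pts"
  show "Th zt * cvdm k zt * Bfun s x A zt = (\<Sum>j<k. T j zt)"
  proof (cases "cvdm k zt = 0")
   case False
   have "Bfun s x A zt = (\<Sum>j<k. gfun s x A (zt j) * (\<Prod>l\<in>{..<k} - {j}. kern x A (zt l)) /
    (\<Prod>l\<in>{..<k} - {j}. (zt l + 1 / zt l) - (zt j + 1 / zt j)))" by (rule Bfun_eq[OF Suc sn _ False]) (rule z1[OF zt])
   thus ?thesis unfolding T_def by (simp only: sum_distrib_left)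
  qed (simp add: T_def)
 qed
 also have "... = (\<Sum>j<k. \<Sum>zt\<in>pts. T j zt)" by (rule sum.swap)
 also have "... = (\<Sum>j<k. \<Sum>zt\<in>pts. T n zt)"
 proof (rule sum.cong[OF refl])
  fix j assume j: "j \<in> {..<k}"
  let ?tr = "Transposition.transpose j n"
  have tr: "?tr permutes {..<k}" by (rule permutes_swap_id) (use j Suc in auto)
  have "T j (zt \<circ> ?tr) = T n zt" if zt: "zt \<in> pts" for zt
  proof -
   have sq: "of_int (sign ?tr) * of_int (sign ?tr) = (1 :: complex)" by (simp add: sign_swap_id)
   have im: "bij_betw ?tr ({..<k} - {j}) ({..<k} - {n})"
    by (rule bij_betw_byWitness[where f' = ?tr]) (use j Suc in \<open>auto simp: Transposition.transpose_def\<close>)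
   have p: "(\<Prod>l\<in>{..<k} - {j}. f (?tr l)) = (\<Prod>l\<in>{..<k} - {n}. f l)" for f :: "nat \<Rightarrow> complex"
    by (rule prod.reindex_bij_betw[OF im])
   have "T j (zt \<circ> ?tr) = of_int (sign ?tr) * Th zt * (of_int (sign ?tr) * cvdm k zt) *
     (gfun s x A (zt n) * (\<Prod>l\<in>{..<k} - {j}. kern x A (zt (?tr l))) /
    (\<Prod>l\<in>{..<k} - {j}. (zt (?tr l) + 1 / zt (?tr l)) - (zt n + 1 / zt n)))"
   proof -
    have cp: "cvdm k (zt \<circ> ?tr) = of_int (sign ?tr) * cvdm k zt" by (rule cvdm_permute[OF tr z0[OF zt]])
    have "?tr j = n" by simp
    thus ?thesis unfolding T_def Th_permute[OF tr] cp comp_apply by (simp only:)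
   qed
   also have "... = of_int (sign ?tr) * Th zt * (of_int (sign ?tr) * cvdm k zt) *
     (gfun s x A (zt n) * (\<Prod>l\<in>{..<k} - {n}. kern x A (zt l)) /
    (\<Prod>l\<in>{..<k} - {n}. (zt l + 1 / zt l) - (zt n + 1 / zt n)))"
    using p[of "\<lambda>l. kern x A (zt l)"] p[of "\<lambda>l. (zt l + 1 / zt l) - (zt n + 1 / zt n)"] by (simp only:)
   also have "... = (of_int (sign ?tr) * of_int (sign ?tr)) * T n zt" unfolding T_def by (simp only: mult_ac)
   finally show ?thesis unfolding sq by simp
  qed
  thus "(\<Sum>zt\<in>pts. T j zt) = (\<Sum>zt\<in>pts. T n zt)" using sum_pts_permute[OF tr, of "T j"] by simp
 qed
 also have "... = of_nat k * (\<Sum>zt\<in>pts. T n zt)" by simp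
 also have "(\<Sum>zt\<in>pts. T n zt) = (\<Sum>zt\<in>pts. Th zt * pdet n (\<lambda>i j. cdiff i (zt j)) *
   ((- 1) ^ n * ((zt n - 1 / zt n) * gfun s x A (zt n)) * (\<Prod>j<n. kern x A (zt j))))"
 proof (rule sum.cong[OF refl])
  fix zt assume zt: "zt \<in> pts"
  define W where "W j = zt j + 1 / zt j" for j
  have I: "{..<k} - {n} = {..<n}" using Suc by auto
  have d: "pdet n (\<lambda>i j. cdiff i (zt j)) = cvdm n zt" unfolding cdiff_def by (rule pdet_cvdm) (use z0[OF zt] Suc in auto)
  show "T n zt = Th zt * pdet n (\<lambda>i j. cdiff i (zt j)) *
   ((- 1) ^ n * ((zt n - 1 / zt n) * gfun s x A (zt n)) * (\<Prod>j<n. kern x A (zt j)))"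
  proof (cases "cvdm k zt = 0")
   case True
   thus ?thesis using Th_degenerate[OF zt] by (simp add: T_def)
  next
   case False
   have c: "cvdm k zt = cvdm n zt * (zt n - 1 / zt n) * (\<Prod>l<n. W n - W l)" unfolding Suc cvdm_def vdm_Suc W_def[symmetric] by simp
   have v: "(\<Prod>l<n. W n - W l) = (- 1) ^ n * (\<Prod>l<n. W l - W n)"
   proof -
    have "(\<Prod>l<n. W n - W l) = (\<Prod>l<n. - 1 * (W l - W n))" by simp
    thus ?thesis by (simp only: prod.distrib prod_constant card_lessThan)
   qed
   have nz: "(\<Prod>l<n. W l - W n) \<noteq> 0" using False unfolding c v by auto
   have "u * (a * b * (e * p)) * (g * q / p) = u * a * (e * (b * g) * q)" if "p \<noteq> 0" for u a b e p g q :: complex using that by simp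
   from this[OF nz] show ?thesis unfolding T_def I W_def[symmetric] d c v .
  qed
 qed
 also have "... = fact n * Rc x A" by (rule sum_Th_last[OF Suc t s A])
 finally show ?thesis by (simp add: Suc)
qed

text \<open>Averaged over the nodes, the main term and the bracket \<open>Bfun\<close> of the
  partial fractions both give \<open>fact k * Rc x A\<close>; this is where the factor
  \<open>1 - t ^ card A\<close> arises.\<close>

theorem Rc_star:
 assumes t: "t \<noteq> 0" "norm t < 1" and gen: "lw_generic x A" and xn: "\<And>i. i \<in> A \<Longrightarrow> norm (x i) < 1"
  and xt: "\<And>i. i \<in> A \<Longrightarrow> (x i)\<^sup>2 \<noteq> t" and N: "k + card A \<le> N"
 shows "(1 - t ^ card A) / (1 - t) * Rc x A =
  (\<Sum>i\<in>A. (star_coeff t x (A - {i}) (x i) + x i ^ (2 * k) * star_coeff t x (A - {i}) (1 / x i)) * Rc x (A - {i}))"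
proof -
 define s where "s = 1 / csqrt t"
 have s: "t * s\<^sup>2 = 1" using t by (simp add: s_def power_divide)
 have A: "finite A" using gen by (simp add: lw_generic_def)
 let ?c = "\<lambda>i. star_coeff t x (A - {i}) (x i) + x i ^ (2 * k) * star_coeff t x (A - {i}) (1 / x i)"
 have e: "Th zt * cvdm k zt * ((1 - t) * (\<Sum>i\<in>A. ?c i * (\<Prod>j<k. kern x (A - {i}) (zt j)))) =
   Th zt * cvdm k zt * ((\<Prod>j<k. kern x A (zt j)) - t ^ card A * Bfun s x A zt)" if zt: "zt \<in> pts" for zt
 proof (cases "cvdm k zt = 0")
  case False
  interpret sp: star_point t s x A k zt by standard (use t s gen xn xt False norm_Z ptsD[OF zt] in auto)
  have "sp.shift_coeff = scf x A" by (rule ext) (simp add: sp.shift_coeff_def scf_def)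
  thus ?thesis using sp.star_partial_fractions unfolding Bfun_def by simp
 qed simp
 have "(1 - t) * (\<Sum>i\<in>A. ?c i * (fact k * Rc x (A - {i}))) =
   (\<Sum>zt\<in>pts. Th zt * cvdm k zt * ((1 - t) * (\<Sum>i\<in>A. ?c i * (\<Prod>j<k. kern x (A - {i}) (zt j)))))"
 proof -
  have "(1 - t) * (\<Sum>i\<in>A. ?c i * (\<Sum>zt\<in>pts. Th zt * cvdm k zt * (\<Prod>j<k. kern x (A - {i}) (zt j)))) =
    (\<Sum>i\<in>A. \<Sum>zt\<in>pts. Th zt * cvdm k zt * ((1 - t) * (?c i * (\<Prod>j<k. kern x (A - {i}) (zt j)))))"
   unfolding sum_distrib_left by (intro sum.cong refl) (simp only: mult_ac)
  also have "... = (\<Sum>zt\<in>pts. \<Sum>i\<in>A. Th zt * cvdm k zt * ((1 - t) * (?c i * (\<Prod>j<k. kern x (A - {i}) (zt j)))))"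
   by (rule sum.swap)
  finally show ?thesis unfolding sum_Th_cvdm sum_distrib_left .
 qed
 also have "... = (\<Sum>zt\<in>pts. Th zt * cvdm k zt * ((\<Prod>j<k. kern x A (zt j)) - t ^ card A * Bfun s x A zt))" by (rule sum.cong[OF refl e])
 also have "... = (\<Sum>zt\<in>pts. Th zt * cvdm k zt * (\<Prod>j<k. kern x A (zt j))) - t ^ card A * (\<Sum>zt\<in>pts. Th zt * cvdm k zt * Bfun s x A zt)"
  unfolding sum_distrib_left sum_subtractf[symmetric] by (rule sum.cong[OF refl]) (simp only: right_diff_distrib mult_ac)
 also have "... = fact k * ((1 - t ^ card A) * Rc x A)" unfolding sum_Th_cvdm sum_Th_Bfun[OF t s A N] by (simp add: algebra_simps)
 finally have "fact k * ((1 - t) * (\<Sum>i\<in>A. ?c i * Rc x (A - {i}))) = fact k * ((1 - t ^ card A) * Rc x A)"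
  by (simp add: sum_distrib_left mult_ac)
 hence "(1 - t) * (\<Sum>i\<in>A. ?c i * Rc x (A - {i})) = (1 - t ^ card A) * Rc x A" by simp
 moreover have "1 - t \<noteq> 0" using t by auto
 ultimately show ?thesis by (simp add: field_simps)
qed

end

section \<open>Identification of the sign sum with the determinant\<close>

context quadrature
begin

text \<open>Without variables the matrix is twice the identity: for \<open>1 \<le> m \<le> k\<close>
  the only exponent \<open>m\<close> with nonzero \<open>affine_coeff\<close> is
  \<open>Suc i\<close>, and oddness doubles the entry.\<close>

lemma Rc_empty:
 assumes "k \<le> N"
 shows "Rc x {} = 2 ^ k"
proof -
 have "Rc x {} = pdet k (\<lambda>i j. 2 * (if i = j then 1 else 0))" unfolding Rc_def
 proof (rule pdet_cong)
  fix i j assume ij: "i < k" "j < k"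
  have "(\<Sum>z\<in>Z. TH i z * (cdiff j z * kern x {} z)) = (\<Sum>z\<in>Z. TH i z * z powi int (Suc j)) - (\<Sum>z\<in>Z. TH i z * z powi (- int (Suc j)))"
   unfolding sum_subtractf[symmetric]
  proof (rule sum.cong[OF refl])
   fix z :: complex
   have "z powi (- int (Suc j)) = (1 / z) ^ Suc j" by (simp only: power_int_minus power_int_of_nat power_one_over inverse_eq_divide)
   thus "TH i z * (cdiff j z * kern x {} z) = TH i z * z powi int (Suc j) - TH i z * z powi (- int (Suc j))"
    by (simp only: cdiff_def kern_def prod.empty mult_1_right right_diff_distrib power_int_of_nat)
  qed
  also have "... = affine_coeff t (Suc k) (Suc i) (int (Suc j)) - affine_coeff t (Suc k) (Suc i) (- int (Suc j))"
   using ij assms by (simp only: moment)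
  also have "... = 2 * affine_coeff t (Suc k) (Suc i) (int (Suc j))" using ij by (subst affine_coeff_minus) auto
  also have "affine_coeff t (Suc k) (Suc i) (int (Suc j)) = (if i = j then 1 else 0)"
  proof (cases "i = j")
   case False
   have "\<not> 2 * int (Suc k) dvd int (Suc j) - int (Suc i)"
   proof
    assume "2 * int (Suc k) dvd int (Suc j) - int (Suc i)"
    hence "\<bar>2 * int (Suc k)\<bar> \<le> \<bar>int (Suc j) - int (Suc i)\<bar>" by (rule dvd_imp_le_int[rotated]) (use False in simp)
    thus False using ij by (simp add: abs_if split: if_splits)
   qed
   moreover have "\<not> 2 * int (Suc k) dvd int (Suc j) + int (Suc i)"
   proof
    assume "2 * int (Suc k) dvd int (Suc j) + int (Suc i)"
    hence "\<bar>2 * int (Suc k)\<bar> \<le> \<bar>int (Suc j) + int (Suc i)\<bar>" by (rule dvd_imp_le_int[rotated]) simp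
    thus False using ij by (simp add: abs_if split: if_splits)
   qed
   ultimately show ?thesis using False by (simp add: affine_coeff_def)
  qed (simp add: affine_coeff_def)
  finally show "(\<Sum>z\<in>Z. TH i z * (cdiff j z * kern x {} z)) = 2 * (if i = j then 1 else 0)" .
 qed
 also have "... = 2 ^ k * pdet k (\<lambda>i j. if i = j then 1 else 0)" by (subst pdet_scale_columns[of k "\<lambda>_. 2"]) simp
 also have "pdet k (\<lambda>i j. if i = j then 1 else 0) = 1"
 proof -
  have "pdet k (\<lambda>i j. if i = j then 1 else 0) =
   (\<Sum>pm\<in>{id}. of_int (sign pm) * (\<Prod>j<k. if pm j = j then 1 else 0))" unfolding pdet_def
  proof (rule sum.mono_neutral_right)
   show "\<forall>pm\<in>{pm. pm permutes {..<k}} - {id}. of_int (sign pm) * (\<Prod>j<k. if pm j = j then 1 else 0) = (0 :: complex)"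
   proof
    fix pm assume "pm \<in> {pm. pm permutes {..<k}} - {id}"
    hence pm: "pm permutes {..<k}" "pm \<noteq> id" by auto
    then obtain j where "pm j \<noteq> j" by (auto simp: fun_eq_iff)
    hence "j < k" using permutes_not_in[OF pm(1), of j] by auto
    hence "(\<Prod>j<k. if pm j = j then 1 else 0 :: complex) = 0" using \<open>pm j \<noteq> j\<close> by (intro prod_zero) auto
    thus "of_int (sign pm) * (\<Prod>j<k. if pm j = j then 1 else 0) = (0 :: complex)" by simp
   qed
  qed (auto intro: permutes_id finite_permutations)
  thus ?thesis by (simp add: sign_id)
 qed
 finally show ?thesis by simp
qed

text \<open>\<open>sign_sum_star\<close> and \<open>Rc_star\<close> are the same recursion in the
  number of variables. It determines the values because \<open>1 - t ^ card A\<close> is nonzero;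
  \<open>2 ^ k\<close> matches the initial values.\<close>

lemma sign_sum_eq_Rc:
 assumes t: "t \<noteq> 0" "norm t < 1"
 shows "lw_generic x A \<Longrightarrow> (\<And>i. i \<in> A \<Longrightarrow> norm (x i) < 1) \<Longrightarrow> (\<And>i. i \<in> A \<Longrightarrow> (x i)\<^sup>2 \<noteq> t) \<Longrightarrow> k + card A \<le> N \<Longrightarrow>
  2 ^ k * sign_sum t x A k = Rc x A"
proof (induction "card A" arbitrary: A)
 case 0
 hence "A = {}" by (simp add: lw_generic_def)
 thus ?case using Rc_empty[of x] 0 by (simp add: sign_sum_def lw_phi_def pair_prod_def)
next
 case (Suc n)
 have fin: "finite A" using Suc.prems by (simp add: lw_generic_def)
 have IH: "2 ^ k * sign_sum t x (A - {i}) k = Rc x (A - {i})" if "i \<in> A" for i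
 proof (rule Suc.hyps(1))
  have c: "card A = Suc n" using Suc.hyps(2) by simp
  show "n = card (A - {i})" using that fin c by simp
  show "lw_generic x (A - {i})" using Suc.prems(1) by (auto simp: lw_generic_def inj_on_def)
  show "k + card (A - {i}) \<le> N" using Suc.prems(4) that fin c by simp
 qed (use Suc.prems in auto)
 have t1: "t \<noteq> 1" using t by auto
 have "(1 - t ^ card A) / (1 - t) * (2 ^ k * sign_sum t x A k) = 2 ^ k * ((1 - t ^ card A) / (1 - t) * sign_sum t x A k)" by simp
 also have "... = (\<Sum>i\<in>A. (star_coeff t x (A - {i}) (x i) + x i ^ (2 * k) * star_coeff t x (A - {i}) (1 / x i)) *
    (2 ^ k * sign_sum t x (A - {i}) k))" unfolding sign_sum_star[OF Suc.prems(1) t1] sum_distrib_left by (simp only: mult_ac)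
 also have "... = (\<Sum>i\<in>A. (star_coeff t x (A - {i}) (x i) + x i ^ (2 * k) * star_coeff t x (A - {i}) (1 / x i)) * Rc x (A - {i}))"
  by (rule sum.cong[OF refl]) (simp only: IH)
 also have "... = (1 - t ^ card A) / (1 - t) * Rc x A" by (rule Rc_star[OF t Suc.prems, symmetric])
 finally have "(1 - t ^ card A) / (1 - t) * (2 ^ k * sign_sum t x A k) = (1 - t ^ card A) / (1 - t) * Rc x A" .
 moreover have "norm t ^ Suc n < 1" by (rule power_Suc_less_one) (use t in auto)
 hence "norm (t ^ card A) < 1" unfolding Suc.hyps(2) norm_power .
 hence "1 - t ^ card A \<noteq> 0" by auto
 ultimately show ?case using t1 by simp
qed

lemma Rc_shifted:
 fixes e :: complex
 assumes "e = 0 \<or> e = 1"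
 shows "Rc x A = pdet k (\<lambda>i j. \<Sum>z\<in>Z. TH i z * ((cdiff j z + e * (z ^ j - (1 / z) ^ j)) * kern x A z))" using assms
proof
 assume e: "e = 1"
 have "(\<Sum>zt\<in>pts. Th zt * cvdm k zt * (\<Prod>j<k. kern x A (zt j))) =
   (\<Sum>zt\<in>pts. Th zt * pdet k (\<lambda>i j. cdiff i (zt j) + (zt j ^ i - (1 / zt j) ^ i)) * (\<Prod>j<k. kern x A (zt j)))"
  unfolding cdiff_def by (intro sum.cong refl, subst pdet_cvdm_shifted) (use ptsD Z_nonzero in auto)
 also have "... = fact k * (\<Sum>zt\<in>pts. Th zt * (\<Prod>j<k. cdiff j (zt j) + (zt j ^ j - (1 / zt j) ^ j)) * (\<Prod>j<k. kern x A (zt j)))"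
  by (rule antisymmetrize[of k _ "\<lambda>i z. cdiff i z + (z ^ i - (1 / z) ^ i)"])
   (auto simp: comp_def intro: prod.permute[symmetric, unfolded comp_def])
 also have "(\<Sum>zt\<in>pts. Th zt * (\<Prod>j<k. cdiff j (zt j) + (zt j ^ j - (1 / zt j) ^ j)) * (\<Prod>j<k. kern x A (zt j))) =
   pdet k (\<lambda>i j. \<Sum>z\<in>Z. TH i z * ((cdiff j z + (z ^ j - (1 / z) ^ j)) * kern x A z))"
  unfolding pdet_quadrature by (simp add: prod.distrib mult.assoc)
 finally show ?thesis unfolding sum_Th_cvdm by (simp add: e)
qed (simp add: Rc_def)

text \<open>Since the weights are odd, each difference in \<open>z\<close> and \<open>1 / z\<close>
  counts as twice its first half. The range of \<open>m\<close> is not symmetric because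
  \<open>1 + e / z\<close> adds one negative power.\<close>

lemma Rc_coeff:
 fixes e :: complex
 assumes e: "e = 0 \<or> e = 1" and N: "k + n \<le> N"
  and c: "\<And>z. z \<noteq> 0 \<Longrightarrow> (1 + e / z) * kern x A z = (\<Sum>m=- int (Suc n)..int n. c m * z powi m)"
 shows "Rc x A = 2 ^ k * pdet k (\<lambda>i j. \<Sum>m=- int (Suc n)..int n. c m * affine_coeff t (Suc k) (Suc i) (m + int (Suc j)))"
proof -
 have "Rc x A = pdet k (\<lambda>i j. 2 * (\<Sum>m=- int (Suc n)..int n. c m * affine_coeff t (Suc k) (Suc i) (m + int (Suc j))))"
  unfolding Rc_shifted[OF e]
 proof (rule pdet_cong)
  fix i j assume ij: "i < k" "j < k"
  define h where "h z = (z ^ Suc j + e * z ^ j) * kern x A z" for z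
  have k: "kern x A (1 / z) = kern x A z" for z unfolding kern_def by (rule prod.cong) (auto simp: mult.commute)
  have "(\<Sum>z\<in>Z. TH i z * ((cdiff j z + e * (z ^ j - (1 / z) ^ j)) * kern x A z)) =
    (\<Sum>z\<in>Z. TH i z * h z) - (\<Sum>z\<in>Z. TH i z * h (1 / z))" unfolding sum_subtractf[symmetric] h_def k cdiff_def
   by (rule sum.cong[OF refl]) (simp only: ring_distribs mult_ac add_ac diff_conv_add_uminus minus_add_distrib mult_minus_left mult_minus_right)
  also have "... = 2 * (\<Sum>z\<in>Z. TH i z * h z)" by (simp add: weight_antisym[OF ij(1)])
  also have "(\<Sum>z\<in>Z. TH i z * h z) = (\<Sum>z\<in>Z. \<Sum>m=- int (Suc n)..int n. c m * (TH i z * z powi (m + int (Suc j))))"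
  proof (rule sum.cong[OF refl])
   fix z assume "z \<in> Z"
   hence z: "z \<noteq> 0" by (rule Z_nonzero)
   have "h z = z ^ Suc j * ((1 + e / z) * kern x A z)" using z by (simp add: h_def algebra_simps)
   hence "TH i z * h z = (\<Sum>m=- int (Suc n)..int n. TH i z * (z ^ Suc j * (c m * z powi m)))" by (simp only: c[OF z] sum_distrib_left)
   also have "... = (\<Sum>m=- int (Suc n)..int n. c m * (TH i z * z powi (m + int (Suc j))))"
    using z by (intro sum.cong refl) (simp only: power_int_add[OF disjI1[OF z]] power_int_of_nat mult_ac)
   finally show "TH i z * h z = (\<Sum>m=- int (Suc n)..int n. c m * (TH i z * z powi (m + int (Suc j))))" .
  qed
  also have "... = (\<Sum>m=- int (Suc n)..int n. c m * (\<Sum>z\<in>Z. TH i z * z powi (m + int (Suc j))))"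
   unfolding sum_distrib_left by (rule sum.swap)
  also have "... = (\<Sum>m=- int (Suc n)..int n. c m * affine_coeff t (Suc k) (Suc i) (m + int (Suc j)))"
   by (intro sum.cong refl arg_cong2[of _ _ _ _ "(*)"] moment) (use ij N in auto)
  finally show "(\<Sum>z\<in>Z. TH i z * ((cdiff j z + e * (z ^ j - (1 / z) ^ j)) * kern x A z)) =
    2 * (\<Sum>m=- int (Suc n)..int n. c m * affine_coeff t (Suc k) (Suc i) (m + int (Suc j)))" .
 qed
 also have "... = (\<Prod>j<k. 2) * pdet k (\<lambda>i j. \<Sum>m=- int (Suc n)..int n. c m * affine_coeff t (Suc k) (Suc i) (m + int (Suc j)))"
  by (rule pdet_scale_columns)
 finally show ?thesis by simp
qed

end

definition theta_det :: "complex \<Rightarrow> nat \<Rightarrow> nat \<Rightarrow> (int \<Rightarrow> complex) \<Rightarrow> complex" where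
 "theta_det t k n c = pdet k (\<lambda>i j. \<Sum>m=- int (Suc n)..int n. c m * affine_coeff t (Suc k) (Suc i) (m + int (Suc j)))"

lemma sign_sum_eq_det_generic:
 fixes e :: complex
 assumes t: "t \<noteq> 0" "norm t < 1" and gen: "lw_generic x A" and xn: "\<And>i. i \<in> A \<Longrightarrow> norm (x i) < 1"
  and xt: "\<And>i. i \<in> A \<Longrightarrow> (x i)\<^sup>2 \<noteq> t" and e: "e = 0 \<or> e = 1"
  and c: "\<And>z. z \<noteq> 0 \<Longrightarrow> (1 + e / z) * kern x A z = (\<Sum>m=- int (Suc n)..int n. c m * z powi m)"
 shows "sign_sum t x A k = theta_det t k n c"
proof -
 \<comment> \<open>The exactness bound has to cover two degrees: that of the kernel in the
   recursion, and that of the given expansion.\<close>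
 obtain Z TH where "quadrature t k Z TH (k + n + card A)" using quadrature_exists by blast
 then interpret quadrature t k Z TH "k + n + card A" .
 have "2 ^ k * sign_sum t x A k = Rc x A" by (rule sign_sum_eq_Rc[OF t gen xn xt]) auto
 also have "... = 2 ^ k * theta_det t k n c" unfolding theta_det_def by (rule Rc_coeff[OF e _ c]) auto
 finally show ?thesis by simp
qed

text \<open>Both sides are continuous in \<open>t\<close>, which removes the genericity assumptions on \<open>t\<close>.\<close>
theorem sign_sum_eq_det:
 fixes e :: complex
 assumes t: "norm t \<le> 1" and gen: "lw_generic x A" and xn: "\<And>i. i \<in> A \<Longrightarrow> norm (x i) < 1" and e: "e = 0 \<or> e = 1"
  and c: "\<And>z. z \<noteq> 0 \<Longrightarrow> (1 + e / z) * kern x A z = (\<Sum>m=- int (Suc n)..int n. c m * z powi m)"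
 shows "sign_sum t x A k = theta_det t k n c"
proof -
 have fin: "finite A" using gen by (simp add: lw_generic_def)
 \<comment> \<open>The generic values of \<open>t\<close> omit finitely many points of the open
   disc; they are dense in the closed disc, which includes the value \<open>t = 1\<close> used later
   for the constant.\<close>
 define S where "S = {u. u \<noteq> 0 \<and> norm u < 1 \<and> (\<forall>i\<in>A. (x i)\<^sup>2 \<noteq> u)}"
 define D where "D u = sign_sum u x A k - theta_det u k n c" for u
 have "continuous_on (closure S) D"
 proof -
  have lw: "continuous_on (closure S) (\<lambda>u. lw_factor u a b)" for a b
   unfolding lw_factor_def by (cases "1 - a * b = 0") (auto intro!: continuous_intros)
  show ?thesis unfolding D_def theta_det_def sign_sum_def lw_phi_def pair_prod_def pdet_def case_prod_beta
   by (intro continuous_on_const continuous_on_diff continuous_on_sum continuous_on_mult continuous_on_prod continuous_affine_coeff lw)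
 qed
 moreover have "D u = 0" if "u \<in> S" for u
 proof -
  have "sign_sum u x A k = theta_det u k n c" by (rule sign_sum_eq_det_generic[OF _ _ gen xn _ e c]) (use that in \<open>auto simp: S_def\<close>)
  thus ?thesis by (simp add: D_def)
 qed
 moreover have "t \<in> closure S"
 proof -
  have S: "S = ball 0 1 - insert 0 ((\<lambda>i. (x i)\<^sup>2) ` A)" by (auto simp: S_def)
  have "ball (0::complex) 1 \<subseteq> closure S"
  proof
   fix u :: complex assume "u \<in> ball 0 1"
   hence "u islimpt ball 0 1" by (intro open_imp_islimpt) auto
   moreover have "u islimpt ball 0 1 \<longleftrightarrow> u islimpt S"
   proof -
    have "u islimpt (insert 0 ((\<lambda>i. (x i)\<^sup>2) ` A) \<union> ball 0 1) \<longleftrightarrow> u islimpt ball 0 1"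
     "u islimpt (insert 0 ((\<lambda>i. (x i)\<^sup>2) ` A) \<union> S) \<longleftrightarrow> u islimpt S"
     by (rule islimpt_Un_finite, use fin in simp)+
    moreover have "insert 0 ((\<lambda>i. (x i)\<^sup>2) ` A) \<union> ball 0 1 = insert 0 ((\<lambda>i. (x i)\<^sup>2) ` A) \<union> S"
     unfolding S by auto
    ultimately show ?thesis by simp
   qed
   ultimately show "u \<in> closure S" by (simp add: closure_def)
  qed
  hence "closure (ball (0::complex) 1) \<subseteq> closure S" by (rule closure_minimal) simp
  moreover have "t \<in> closure (ball (0::complex) 1)" using t by simp
  ultimately show ?thesis by (rule subsetD)
 qed
 ultimately have "D t = 0" by (rule continuous_constant_on_closure)
 thus ?thesis by (simp add: D_def)
qed

corollary bl_sum_eq_det: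
 fixes e :: complex
 assumes t: "norm t \<le> 1" and gen: "lw_generic x A" and xn: "\<And>i. i \<in> A \<Longrightarrow> norm (x i) < 1" and e: "e = 0 \<or> e = 1"
  and c: "\<And>z. z \<noteq> 0 \<Longrightarrow> (1 + e / z) * kern x A z = (\<Sum>m=- int (Suc n)..int n. c m * z powi m)"
 shows "bl_sum t x A k = theta_det t k n c"
proof -
 \<comment> \<open>The initial value comes from the determinant formula itself: for
   \<open>k = 0\<close> the determinant is empty, whatever the coefficients are.\<close>
 have "sign_sum t x B 0 = 1" if B: "B \<subseteq> A" for B
 proof -
  have gB: "lw_generic x B" using gen B unfolding lw_generic_def by (blast intro: finite_subset inj_on_subset)
  hence "finite B" by (simp add: lw_generic_def)
  from kern_laurent[OF this] obtain b where b: "\<And>z. z \<noteq> 0 \<Longrightarrow> kern x B z = (\<Sum>m=- int (card B)..int (card B). b m * z powi m)"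
   by blast
  have "sign_sum t x B 0 = theta_det t 0 (card B) (\<lambda>m. if m = - int (Suc (card B)) then 0 else b m)"
  proof (rule sign_sum_eq_det[OF t gB, of 0])
   fix z :: complex assume z: "z \<noteq> 0"
   have "{- int (Suc (card B))..int (card B)} = insert (- int (Suc (card B))) {- int (card B)..int (card B)}" by auto
   thus "(1 + 0 / z) * kern x B z = (\<Sum>m=- int (Suc (card B))..int (card B). (if m = - int (Suc (card B)) then 0 else b m) * z powi m)"
    using b[OF z] by simp
  qed (use xn B in auto)
  thus ?thesis by (simp add: theta_det_def)
 qed
 hence "bl_sum t x A k = sign_sum t x A k" by (rule bl_sum_eq_sign_sum[OF gen])
 thus ?thesis using sign_sum_eq_det[OF t gen xn e c] by simp
qed

section \<open>Theta functions\<close>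

lemma eventually_nonzero_deriv:
 fixes g :: "complex \<Rightarrow> complex"
 assumes "(g has_field_derivative d) (at z)" "d \<noteq> 0" "g z = 0"
 shows "eventually (\<lambda>w. g w \<noteq> 0) (at z)"
proof -
 have "(\<lambda>w. g w / (w - z)) \<midarrow>z\<rightarrow> d" using assms by (simp add: has_field_derivative_iff)
 hence "eventually (\<lambda>w. g w / (w - z) \<noteq> 0) (at z)" using assms(2) by (rule tendsto_imp_eventually_ne)
 thus ?thesis by (rule eventually_mono) auto
qed

text \<open>The quotient is completed by the ratio of the derivatives at the zeros of
  \<open>g\<close>. These are simple, hence isolated, and the quotient extends over each of them by
  the removable singularity theorem.\<close>

lemma divide_simple_zeros:
 assumes S: "open S" and f: "f holomorphic_on S" and g: "g holomorphic_on S"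
  and zeros: "\<And>z. z \<in> S \<Longrightarrow> g z = 0 \<Longrightarrow> f z = 0 \<and> deriv g z \<noteq> 0"
 obtains h where "h holomorphic_on S" "\<And>z. z \<in> S \<Longrightarrow> f z = g z * h z"
proof -
 define h where "h z = (if g z = 0 then deriv f z / deriv g z else f z / g z)" for z
 have "h holomorphic_on S"
 proof (subst holomorphic_on_open[OF S], intro ballI)
  fix z0 assume z0: "z0 \<in> S"
  define S1 where "S1 = {z \<in> S. g z \<noteq> 0}"
  have "continuous_on S g" using g by (rule holomorphic_on_imp_continuous_on)
  hence "open (S \<inter> g -` (- {0}))" using S by (rule continuous_open_preimage) auto
  moreover have "S \<inter> g -` (- {0}) = S1" by (auto simp: S1_def)
  ultimately have S1: "open S1" by simp
  have h1: "h holomorphic_on S1"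
  proof (rule holomorphic_transform)
   show "(\<lambda>z. f z / g z) holomorphic_on S1"
    by (intro holomorphic_intros holomorphic_on_subset[OF f] holomorphic_on_subset[OF g]) (auto simp: S1_def)
  qed (auto simp: S1_def h_def)
  show "\<exists>f'. (h has_field_derivative f') (at z0)"
  proof (cases "g z0 = 0")
   case False
   hence "z0 \<in> S1" using z0 by (simp add: S1_def)
   thus ?thesis using h1 S1 by (auto simp: holomorphic_on_open)
  next
   case True
   have gd: "(g has_field_derivative deriv g z0) (at z0)" and fd: "(f has_field_derivative deriv f z0) (at z0)"
    using f g S z0 by (auto intro: holomorphic_derivI)
   have f0: "f z0 = 0" and g': "deriv g z0 \<noteq> 0" using zeros[OF z0 True] by auto
   have lg: "(\<lambda>z. g z / (z - z0)) \<midarrow>z0\<rightarrow> deriv g z0" using gd True by (simp add: has_field_derivative_iff)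
   have lf: "(\<lambda>z. f z / (z - z0)) \<midarrow>z0\<rightarrow> deriv f z0" using fd f0 by (simp add: has_field_derivative_iff)
   have ev: "eventually (\<lambda>z. g z \<noteq> 0) (at z0)" by (rule eventually_nonzero_deriv[OF gd g' True])
   have "eventually (\<lambda>z. z \<in> S) (at z0)" using S z0 by (rule eventually_at_in_open')
   with ev have "eventually (\<lambda>z. z \<in> S1) (at z0)" by eventually_elim (simp add: S1_def)
   then obtain d where d: "d > 0" "\<And>z. z \<noteq> z0 \<Longrightarrow> dist z z0 < d \<Longrightarrow> z \<in> S1"
    unfolding eventually_at by auto
   have "h holomorphic_on ball z0 d"
   proof (rule no_isolated_singularity')
    show "finite {z0}" "open (ball z0 d)" by auto
    show "h holomorphic_on ball z0 d - {z0}"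
    proof (rule holomorphic_on_subset[OF h1], rule subsetI)
     fix z assume "z \<in> ball z0 d - {z0}"
     thus "z \<in> S1" using d(2)[of z] by (simp add: dist_commute)
    qed
    fix z assume "z \<in> {z0}"
    have "((\<lambda>z. (f z / (z - z0)) / (g z / (z - z0))) \<longlongrightarrow> deriv f z0 / deriv g z0) (at z0)"
     by (intro tendsto_divide lf lg g')
    moreover have "eventually (\<lambda>z. (f z / (z - z0)) / (g z / (z - z0)) = h z) (at z0)"
     using ev eventually_neq_at_within[of z0] by eventually_elim (simp add: h_def)
    ultimately have "(h \<longlongrightarrow> deriv f z0 / deriv g z0) (at z0)" by (rule Lim_transform_eventually)
    hence "(h \<longlongrightarrow> h z0) (at z0)" using True by (simp add: h_def)
    thus "(h \<longlongrightarrow> h z) (at z within ball z0 d)" using \<open>z \<in> {z0}\<close> by (auto intro: tendsto_within_subset)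
   qed
   thus ?thesis using d(1) by (auto simp: holomorphic_on_open)
  qed
 qed
 moreover have "f z = g z * h z" if "z \<in> S" for z using zeros[OF that] by (auto simp: h_def)
 ultimately show ?thesis using that by blast
qed

lemma norm_mult_power_summable:
 fixes a q :: complex
 assumes "norm q < 1"
 shows "summable (\<lambda>i. norm (a * q ^ i))" using assms by (simp add: norm_mult norm_power summable_mult summable_geometric)

lemma convergent_prod_qpoch:
 fixes a q :: complex
 assumes "norm q < 1"
 shows "convergent_prod (\<lambda>i. 1 - a * q ^ i)" by (rule abs_convergent_prod_imp_convergent_prod, rule summable_imp_abs_convergent_prod)
   (use norm_mult_power_summable[OF assms, of a] in simp)

lemma qpoch_inf_LIMSEQ:
 assumes "norm q < 1"
 shows "(\<lambda>n. \<Prod>i<n. 1 - a * q ^ i) \<longlonglongrightarrow> qpoch_inf a q"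
proof -
 have "(\<lambda>n. \<Prod>i\<le>n. 1 - a * q ^ i) \<longlonglongrightarrow> qpoch_inf a q"
  unfolding qpoch_inf_def by (rule convergent_prod_LIMSEQ[OF convergent_prod_qpoch[OF assms]])
 thus ?thesis by (simp add: LIMSEQ_lessThan_iff_atMost)
qed

lemma qpoch_inf_eq_0_iff:
 assumes "norm q < 1"
 shows "qpoch_inf a q = 0 \<longleftrightarrow> (\<exists>i. a * q ^ i = 1)"
proof -
 have "(\<lambda>i. 1 - a * q ^ i) has_prod qpoch_inf a q"
  unfolding qpoch_inf_def using convergent_prod_qpoch[OF assms] by (rule convergent_prod_has_prod)
 from has_prod_eq_0_iff[OF this] have "qpoch_inf a q = 0 \<longleftrightarrow> 0 \<in> range (\<lambda>i. 1 - a * q ^ i)" .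
 also have "... \<longleftrightarrow> (\<exists>i. a * q ^ i = 1)"
 proof
  assume "0 \<in> range (\<lambda>i. 1 - a * q ^ i)"
  then obtain i where "0 = 1 - a * q ^ i" by blast
  hence "a * q ^ i = 1" by (metis eq_iff_diff_eq_0)
  thus "\<exists>i. a * q ^ i = 1" ..
 next
  assume "\<exists>i. a * q ^ i = 1"
  then obtain i where "a * q ^ i = 1" ..
  hence "(\<lambda>i. 1 - a * q ^ i) i = 0" by simp
  thus "0 \<in> range (\<lambda>i. 1 - a * q ^ i)" by (metis rangeI)
 qed
 finally show ?thesis .
qed

lemma qpoch_inf_shift:
 assumes "norm q < 1"
 shows "qpoch_inf a q = (1 - a) * qpoch_inf (a * q) q"
proof -
 have "(\<lambda>n. \<Prod>i<Suc n. 1 - a * q ^ i) \<longlonglongrightarrow> qpoch_inf a q" by (rule LIMSEQ_Suc[OF qpoch_inf_LIMSEQ[OF assms]])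
 moreover have "(\<lambda>n. \<Prod>i<Suc n. 1 - a * q ^ i) = (\<lambda>n. (1 - a) * (\<Prod>i<n. 1 - (a * q) * q ^ i))"
  by (rule ext, subst prod.lessThan_Suc_shift) (simp add: mult_ac)
 moreover have "(\<lambda>n. (1 - a) * (\<Prod>i<n. 1 - (a * q) * q ^ i)) \<longlonglongrightarrow> (1 - a) * qpoch_inf (a * q) q"
  by (intro tendsto_mult tendsto_const qpoch_inf_LIMSEQ[OF assms])
 ultimately show ?thesis using LIMSEQ_unique by metis
qed

lemma qpoch_inf_holomorphic:
 assumes q: "norm q < 1" and S: "open S"
 shows "(\<lambda>a. qpoch_inf a q) holomorphic_on S"
proof -
 have "(\<lambda>a. qpoch_inf a q) holomorphic_on UNIV"
 proof (rule holomorphic_uniform_sequence[of _ "\<lambda>n a. \<Prod>i<n. 1 - a * q ^ i"])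
  show "(\<lambda>a. \<Prod>i<n. 1 - a * q ^ i) holomorphic_on UNIV" for n by (intro holomorphic_intros)
  fix x :: complex
  have "uniformly_convergent_on (cball x 1) (\<lambda>n a. \<Prod>i<n. 1 - a * q ^ i)"
  proof (rule uniformly_convergent_on_prod')
   show "continuous_on (cball x 1) (\<lambda>a. 1 - a * q ^ n)" for n by (intro continuous_intros)
   have "uniformly_convergent_on (cball x 1) (\<lambda>N a. \<Sum>n<N. norm (a * q ^ n))"
   proof (rule Weierstrass_m_test'[where M = "\<lambda>n. (norm x + 1) * norm q ^ n"])
    fix n a assume "a \<in> cball x 1"
    hence "norm a \<le> norm x + 1" using norm_triangle_ineq2[of a x] by (simp add: dist_norm norm_minus_commute)
    thus "norm (norm (a * q ^ n)) \<le> (norm x + 1) * norm q ^ n" by (simp add: norm_mult norm_power mult_right_mono)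
   next
    show "summable (\<lambda>n. (norm x + 1) * norm q ^ n)" using q by (intro summable_mult summable_geometric) simp
   qed
   thus "uniformly_convergent_on (cball x 1) (\<lambda>N a. \<Sum>n<N. norm (1 - a * q ^ n - 1))" by simp
  qed auto
  then obtain l where l: "uniform_limit (cball x 1) (\<lambda>n a. \<Prod>i<n. 1 - a * q ^ i) l sequentially"
   by (auto simp: uniformly_convergent_on_def)
  have "l a = qpoch_inf a q" if "a \<in> cball x 1" for a by (rule LIMSEQ_unique[OF tendsto_uniform_limitI[OF l that] qpoch_inf_LIMSEQ[OF q]])
  hence "uniform_limit (cball x 1) (\<lambda>n a. \<Prod>i<n. 1 - a * q ^ i) (\<lambda>a. qpoch_inf a q) sequentially"
   using l by (metis (no_types, lifting) uniform_limit_cong')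
  thus "\<exists>d>0. cball x d \<subseteq> UNIV \<and> uniform_limit (cball x d) (\<lambda>n a. \<Prod>i<n. 1 - a * q ^ i) (\<lambda>a. qpoch_inf a q) sequentially"
   by (intro exI[of _ 1]) auto
 qed auto
 thus ?thesis by (rule holomorphic_on_subset) auto
qed

lemma theta_inverse:
 assumes "norm p < 1" "a \<noteq> 0"
 shows "theta (1 / a) p = - theta a p / a"
proof -
 have "qpoch_inf a p = (1 - a) * qpoch_inf (p * a) p" using qpoch_inf_shift[OF assms(1), of a] by (simp add: mult.commute)
 moreover have "qpoch_inf (1 / a) p = (1 - 1 / a) * qpoch_inf (p / a) p" using qpoch_inf_shift[OF assms(1), of "1 / a"] by (simp add: mult.commute)
 ultimately have e: "theta (1 / a) p = (1 - 1 / a) * qpoch_inf (p / a) p * qpoch_inf (p * a) p"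
  "theta a p = (1 - a) * qpoch_inf (p * a) p * qpoch_inf (p / a) p" by (simp_all add: theta_def)
 have "(1 - 1 / a) * v * u = - ((1 - a) * u * v) / a" for u v :: complex using assms(2) by (simp add: field_simps)
 thus ?thesis unfolding e .
qed

lemma theta_shift:
 assumes "norm p < 1" "p \<noteq> 0" "a \<noteq> 0"
 shows "theta (p * a) p = - theta a p / a"
proof -
 have "theta (p * a) p = theta (1 / a) p" using assms by (simp add: theta_def mult.commute)
 thus ?thesis using theta_inverse[OF assms(1,3)] by (simp only:)
qed

lemma theta_holomorphic:
 assumes "norm p < 1" "f holomorphic_on S" "\<And>z. z \<in> S \<Longrightarrow> f z \<noteq> 0"
 shows "(\<lambda>z. theta (f z) p) holomorphic_on S"
proof -
 have 1: "(\<lambda>a. qpoch_inf a p) holomorphic_on UNIV" by (rule qpoch_inf_holomorphic[OF assms(1)]) auto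
 have "(\<lambda>z. qpoch_inf (f z) p) holomorphic_on S" using holomorphic_on_compose_gen[OF assms(2) 1, unfolded comp_def] by auto
 moreover have "(\<lambda>z. p / f z) holomorphic_on S" by (intro holomorphic_intros assms)
 hence "(\<lambda>z. qpoch_inf (p / f z) p) holomorphic_on S" using holomorphic_on_compose_gen[OF _ 1, unfolded comp_def] by auto
 ultimately show ?thesis unfolding theta_def by (rule holomorphic_on_mult)
qed

lemma theta_eq_0_iff:
 assumes p: "norm p < 1" "p \<noteq> 0" and a: "a \<noteq> 0"
 shows "theta a p = 0 \<longleftrightarrow> (\<exists>n::int. a = p powi n)"
proof
 assume "theta a p = 0"
 hence "(\<exists>i. a * p ^ i = 1) \<or> (\<exists>i. p / a * p ^ i = 1)" using qpoch_inf_eq_0_iff[OF p(1)] by (simp add: theta_def)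
 thus "\<exists>n::int. a = p powi n"
 proof (elim disjE exE)
  fix i assume "a * p ^ i = 1"
  hence "a = p powi (- int i)" using p by (simp add: power_int_minus field_simps)
  thus ?thesis ..
 next
  fix i assume "p / a * p ^ i = 1"
  hence "a = p ^ Suc i" using p a by (simp add: field_simps)
  hence "a = p powi int (Suc i)" unfolding power_int_of_nat .
  thus ?thesis ..
 qed
next
 assume "\<exists>n::int. a = p powi n"
 then obtain n :: int where n: "a = p powi n" ..
 have "(\<exists>i. a * p ^ i = 1) \<or> (\<exists>i. p / a * p ^ i = 1)"
 proof (cases n rule: int_cases)
  case (nonneg m)
  hence a': "a = p ^ m" using n by simp
  show ?thesis
  proof (cases m)
   case 0
   hence "a * p ^ 0 = 1" using a' by simp
   thus ?thesis by blast
  next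
   case (Suc i)
   hence "p / a * p ^ i = 1" using a' p by simp
   thus ?thesis by blast
  qed
 next
  case (neg m)
  hence "a = inverse (p ^ Suc m)" using n by (simp only: power_int_minus power_int_of_nat)
  moreover have "p ^ Suc m \<noteq> 0" using p by simp
  moreover have "u * v = 1" if "u = inverse v" "v \<noteq> 0" for u v :: complex using that by simp
  ultimately have "a * p ^ Suc m = 1" by blast
  thus ?thesis by blast
 qed
 thus "theta a p = 0" using qpoch_inf_eq_0_iff[OF p(1)] by (auto simp: theta_def)
qed

text \<open>At 1 the theta function is \<open>(1 - z) * G z\<close>, where \<open>G 1\<close> is the
  square of \<open>qpoch_inf p p\<close> and hence nonzero. Differentiating the quasi-periodicity
  carries this to all other zeros.\<close>

lemma theta_deriv_nonzero:
 assumes p: "norm p < 1" "p \<noteq> 0"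
 shows "deriv (\<lambda>z. theta z p) (p powi n) \<noteq> 0"
proof -
 let ?\<theta> = "\<lambda>z. theta z p"
 have hol: "?\<theta> holomorphic_on (- {0})" by (rule theta_holomorphic[OF p(1)]) auto
 have D: "(?\<theta> has_field_derivative deriv ?\<theta> z) (at z)" if "z \<noteq> 0" for z by (rule holomorphic_derivI[OF hol]) (use that in auto)
 have 0: "?\<theta> (p powi n) = 0" for n using theta_eq_0_iff[OF p, of "p powi n"] p by auto
 have step: "p * deriv ?\<theta> (p * z) = - deriv ?\<theta> z / z" if z: "z \<noteq> 0" and 0: "?\<theta> z = 0" for z
 proof -
  have d1: "((\<lambda>z. ?\<theta> (p * z)) has_field_derivative deriv ?\<theta> (p * z) * p) (at z)"
   by (rule DERIV_chain2[OF D]) (use z p in \<open>auto intro!: derivative_eq_intros\<close>)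
  have "((\<lambda>z. - ?\<theta> z / z) has_field_derivative - deriv ?\<theta> z / z) (at z)"
  proof -
   have "((\<lambda>z. - ?\<theta> z / z) has_field_derivative (- deriv ?\<theta> z * z - - ?\<theta> z * 1) / (z * z)) (at z)"
    by (rule DERIV_divide[OF DERIV_minus[OF D[OF z]] DERIV_ident z])
   thus ?thesis using z 0 by simp
  qed
  hence d2: "((\<lambda>z. ?\<theta> (p * z)) has_field_derivative - deriv ?\<theta> z / z) (at z)"
   by (rule has_field_derivative_transform_within_open[of _ _ _ "- {0}"]) (use theta_shift[OF p] z in auto)
  show ?thesis using DERIV_unique[OF d1 d2] by (simp only: mult.commute)
 qed
 have iff: "deriv ?\<theta> (p powi (n + 1)) = 0 \<longleftrightarrow> deriv ?\<theta> (p powi n) = 0" for n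
 proof -
  have e: "p powi (n + 1) = p * p powi n" using p by (simp add: power_int_add)
  have "p * deriv ?\<theta> (p * p powi n) = - deriv ?\<theta> (p powi n) / (p powi n)" by (rule step[OF _ 0]) (use p in simp)
  moreover have "x = 0 \<longleftrightarrow> y = 0" if "p * x = - y / w" "w \<noteq> 0" for x y w using that p by auto
  moreover have "p powi n \<noteq> 0" using p by simp
  ultimately show ?thesis unfolding e by blast
 qed
 have "deriv ?\<theta> 1 \<noteq> 0"
 proof -
  define G where "G z = qpoch_inf (p * z) p * qpoch_inf (p / z) p" for z
  have th: "?\<theta> z = (1 - z) * G z" for z using qpoch_inf_shift[OF p(1), of z] by (simp add: theta_def G_def mult.commute)
  have holG: "G holomorphic_on (- {0})"
  proof -
   have 1: "(\<lambda>a. qpoch_inf a p) holomorphic_on UNIV" by (rule qpoch_inf_holomorphic[OF p(1)]) auto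
   have "(\<lambda>z. p * z) holomorphic_on - {0}"
    by (rule holomorphic_on_mult[of "\<lambda>_. p" _ "\<lambda>z. z"]) (auto intro: holomorphic_intros)
   moreover have "(\<lambda>z. p / z) holomorphic_on - {0}"
    by (rule holomorphic_on_divide[of "\<lambda>_. p" _ "\<lambda>z. z"]) (auto intro: holomorphic_intros)
   ultimately show ?thesis unfolding G_def using holomorphic_on_compose_gen[OF _ 1, unfolded comp_def] by (intro holomorphic_on_mult) auto
  qed
  have "(G has_field_derivative deriv G 1) (at 1)" by (rule holomorphic_derivI[OF holG]) auto
  hence "((\<lambda>z. (1 - z) * G z) has_field_derivative - G 1) (at 1)" by (auto intro!: derivative_eq_intros)
  hence "deriv ?\<theta> 1 = - G 1" unfolding th by (rule DERIV_imp_deriv)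
  moreover have "qpoch_inf p p \<noteq> 0"
  proof
   assume "qpoch_inf p p = 0"
   then obtain i where "p ^ Suc i = 1" using qpoch_inf_eq_0_iff[OF p(1)] by auto
   hence "norm p ^ Suc i = 1" by (metis norm_one norm_power)
   moreover have "norm p ^ Suc i < 1" using p by (intro power_Suc_less_one) auto
   ultimately show False by simp
  qed
  ultimately show ?thesis by (simp add: G_def)
 qed
 thus ?thesis
 proof (induction n rule: int_induct[where k = 0])
  case (step2 i)
  thus ?case using iff[of "i - 1"] by simp
 qed (use iff in auto)
qed

text \<open>On a compact annulus \<open>f\<close> is bounded. Repeated multiplication by
  \<open>p\<close> reaches all smaller arguments, and for \<open>norm z \<le> r\<close> the
  multiplier \<open>c * z\<close> has norm at most 1, so the bound persists. One further step gains
  a factor proportional to \<open>norm w\<close>.\<close>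

lemma quasi_periodic_tendsto_0:
 fixes f :: "complex \<Rightarrow> complex"
 assumes p: "norm p < 1" "p \<noteq> 0" and f: "continuous_on (- {0}) f" and c: "\<And>z. z \<noteq> 0 \<Longrightarrow> f (p * z) = c * z * f z"
 shows "(f \<longlongrightarrow> 0) (at 0)"
proof -
 define r where "r = 1 / (norm c + 1)"
 have n0: "norm c + 1 > 0" using norm_ge_zero[of c] by linarith
 have r: "r > 0" "norm c * r \<le> 1" using n0 by (simp_all add: r_def)
 define A where "A = cball 0 r - ball (0::complex) (norm p * r)"
 have "compact A" unfolding A_def by (intro compact_diff) auto
 moreover have "0 \<notin> A" using r p by (auto simp: A_def)
 hence "continuous_on A f" by (intro continuous_on_subset[OF f]) auto
 ultimately have "bounded (f ` A)" by (intro compact_imp_bounded compact_continuous_image)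
 then obtain B where B: "B > 0" "\<And>u. u \<in> A \<Longrightarrow> norm (f u) \<le> B" by (auto simp: bounded_pos)
 have ind: "norm (f w) \<le> B" if "norm p ^ Suc n * r \<le> norm w" "norm w \<le> r" for n w using that
 proof (induction n arbitrary: w)
  case 0
  thus ?case using B(2)[of w] by (auto simp: A_def)
 next
  case (Suc n)
  show ?case
  proof (cases "norm p * r \<le> norm w")
   case True
   thus ?thesis using B(2)[of w] Suc.prems by (auto simp: A_def)
  next
   case False
   have "0 < norm p ^ Suc (Suc n) * r" using p r by (intro mult_pos_pos zero_less_power) auto
   hence "0 < norm w" using Suc.prems(1) by (rule less_le_trans)
   hence w: "w \<noteq> 0" by simp
   define u where "u = w / p"
   have u: "u \<noteq> 0" "w = p * u" using w p by (auto simp: u_def)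
   have "norm p * (norm p ^ Suc n * r) \<le> norm p * norm u" using Suc.prems(1) unfolding u(2) norm_mult by (simp add: mult.assoc)
   hence "norm p ^ Suc n * r \<le> norm u" using p by simp
   moreover have ur: "norm u \<le> r" using False p unfolding u(2) norm_mult by simp
   ultimately have "norm (f u) \<le> B" by (rule Suc.IH)
   moreover have "norm c * norm u \<le> 1" using r(2) ur mult_left_mono[OF ur, of "norm c"] by simp
   ultimately have "norm c * norm u * norm (f u) \<le> 1 * B" by (intro mult_mono) auto
   thus ?thesis unfolding u(2) c[OF u(1)] by (simp add: norm_mult)
  qed
 qed
 have bd: "norm (f w) \<le> B" if "w \<noteq> 0" "norm w \<le> r" for w
 proof -
  have "(\<lambda>n. norm p ^ Suc n * r) \<longlonglongrightarrow> 0 * r"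
   by (intro tendsto_mult tendsto_const LIMSEQ_Suc LIMSEQ_power_zero) (use p in auto)
  hence "eventually (\<lambda>n. norm p ^ Suc n * r < norm w) sequentially" using that(1) by (intro order_tendstoD(2)) auto
  then obtain n where "norm p ^ Suc n * r < norm w" by (auto simp: eventually_sequentially)
  thus ?thesis using ind[of n w] that by auto
 qed
 have "((\<lambda>w::complex. norm (c / p) * norm w * B) \<longlongrightarrow> norm (c / p) * norm (0::complex) * B) (at 0)"
  by (rule tendsto_mult[OF tendsto_mult[OF tendsto_const tendsto_norm[OF tendsto_ident_at]] tendsto_const])
 hence lim: "((\<lambda>w::complex. norm (c / p) * norm w * B) \<longlongrightarrow> 0) (at 0)" by simp
 have "norm (f w) \<le> norm (c / p) * norm w * B" if "w \<noteq> 0" "dist w 0 < norm p * r" for w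
 proof -
  define u where "u = w / p"
  have u: "u \<noteq> 0" "w = p * u" using that p by (auto simp: u_def)
  have "norm u \<le> r" using that(2) p unfolding u(2) by (simp add: norm_mult)
  hence "norm (f u) \<le> B" using bd[OF u(1)] by simp
  hence "norm c * norm u * norm (f u) \<le> norm c * norm u * B" by (intro mult_left_mono) auto
  hence "norm (f w) \<le> norm c * norm u * B" unfolding u(2) c[OF u(1)] by (simp add: norm_mult)
  also have "norm c * norm u = norm (c / p) * norm w" unfolding u_def by (simp add: norm_divide)
  finally show ?thesis .
 qed
 hence "eventually (\<lambda>w. norm (f w) \<le> norm (c / p) * norm w * B) (at 0)"
  unfolding eventually_at using r p by (intro exI[of _ "norm p * r"]) auto
 thus ?thesis using lim by (rule Lim_null_comparison)
qed

text \<open>In the inverse argument \<open>f\<close> satisfies the same kind of relation with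
  \<open>p / c\<close> in place of \<open>c\<close>, so it tends to 0 at infinity as well as at 0,
  and Liouville's theorem applies.\<close>

lemma quasi_periodic_entire_eq_0:
 fixes f :: "complex \<Rightarrow> complex"
 assumes p: "norm p < 1" "p \<noteq> 0" and f: "f holomorphic_on (- {0})" and c: "\<And>z. z \<noteq> 0 \<Longrightarrow> f (p * z) = c * z * f z"
  and z: "z \<noteq> 0"
 shows "f z = 0"
proof (cases "c = 0")
 case True
 thus ?thesis using c[of "z / p"] z p by simp
next
 case False
 have cont: "continuous_on (- {0}) f" using f by (rule holomorphic_on_imp_continuous_on)
 have lim0: "(f \<longlongrightarrow> 0) (at 0)" by (rule quasi_periodic_tendsto_0[OF p cont c])
 have limi: "(f \<longlongrightarrow> 0) at_infinity"
 proof -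
  have "((\<lambda>w. f (inverse w)) \<longlongrightarrow> 0) (at 0)"
  proof (rule quasi_periodic_tendsto_0[OF p, of _ "p / c"])
   show "continuous_on (- {0}) (\<lambda>w. f (inverse w))" by (rule continuous_on_compose2[OF cont]) (auto intro!: continuous_intros)
   fix w :: complex assume w: "w \<noteq> 0"
   have "f (p * inverse (p * w)) = c * inverse (p * w) * f (inverse (p * w))" by (rule c) (use w p in simp)
   moreover have "p * inverse (p * w) = inverse w" using p by simp
   ultimately have "f (inverse w) = c * inverse (p * w) * f (inverse (p * w))" by (simp only:)
   moreover have "b = p / c * w * a" if "a = c * inverse (p * w) * b" for a b using that False w p by (simp add: field_simps)
   ultimately show "f (inverse (p * w)) = p / c * w * f (inverse w)" by blast
  qed
  thus ?thesis by (simp add: lim_at_infinity_0 comp_def)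
 qed
 define F where "F w = (if w = 0 then 0 else f w)" for w
 have "F holomorphic_on UNIV"
 proof (rule no_isolated_singularity'[of "{0}"])
  show "F holomorphic_on UNIV - {0}" by (rule holomorphic_transform[of f]) (use f in \<open>auto simp: F_def Compl_eq_Diff_UNIV\<close>)
  fix w :: complex assume "w \<in> {0}"
  moreover have "(F \<longlongrightarrow> 0) (at 0)"
   by (rule Lim_transform_eventually[OF lim0]) (auto simp: eventually_at F_def intro!: exI[of _ 1])
  ultimately show "(F \<longlongrightarrow> F w) (at w within UNIV)" by (simp add: F_def)
 qed auto
 moreover have "(F \<longlongrightarrow> 0) at_infinity"
 proof (rule Lim_transform_eventually[OF limi])
  show "eventually (\<lambda>w. f w = F w) at_infinity" unfolding eventually_at_infinity by (rule exI[of _ 1]) (auto simp: F_def)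
 qed
 ultimately have "F z = 0" by (rule Liouville_weak)
 thus ?thesis using z by (simp add: F_def)
qed

text \<open>Dividing by theta functions removes the zeros one by one; the remaining function tends
 to \<open>0\<close> both at the origin and at infinity.\<close>
lemma quasi_periodic_eq_0:
 assumes p: "norm p < 1" "p \<noteq> 0" and B: "finite B"
  and f: "f holomorphic_on (- {0})" and c: "\<And>z. z \<noteq> 0 \<Longrightarrow> f (p * z) * z ^ card B = c * z * f z"
  and fB: "\<And>b. b \<in> B \<Longrightarrow> b \<noteq> 0 \<and> f b = 0"
  and ineq: "\<And>a b n. a \<in> B \<Longrightarrow> b \<in> B \<Longrightarrow> a = b * p powi n \<Longrightarrow> a = b"
  and z: "z \<noteq> 0"
 shows "f z = 0" using B f c fB ineq z
proof (induction B arbitrary: f c z rule: finite_induct)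
 case empty
 thus ?case using quasi_periodic_entire_eq_0[OF p empty(1), of c z] by simp
next
 case (insert b B)
 have b: "b \<noteq> 0" "f b = 0" using insert.prems(3) by auto
 show ?case
 proof (cases "c = 0")
  case True
  thus ?thesis using insert.prems(2)[of "z / p"] insert.prems(5) p by simp
 next
  case c0: False
 have hth: "(\<lambda>z. theta (z / b) p) holomorphic_on (- {0})"
  by (rule theta_holomorphic[OF p(1)]) (use b in \<open>auto intro!: holomorphic_intros\<close>)
 \<comment> \<open>A zero propagates along the whole orbit of \<open>b\<close> under multiplication
   by \<open>p\<close>; these are exactly the zeros of \<open>theta (z / b) p\<close>.\<close>
 have fz: "f (b * p powi n) = 0" for n
 proof (induction n rule: int_induct[where k = 0])
  case (step1 i)
  have e: "b * p powi (i + 1) = p * (b * p powi i)" using p by (simp add: power_int_add)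
  have "f (p * (b * p powi i)) = 0" using insert.prems(2)[of "b * p powi i"] step1 b p by auto
  thus ?case unfolding e .
 next
  case (step2 i)
  define y where "y = b * p powi (i - 1)"
  have e: "b * p powi i = p * y" using p by (simp add: power_int_diff y_def)
  have "f (p * y) = 0" using step2(2) unfolding e .
  moreover have y: "y \<noteq> 0" using b p by (simp add: y_def)
  ultimately have "c * y * f y = 0" using insert.prems(2)[of y] by simp
  hence "f y = 0" using y c0 by simp
  thus ?case unfolding y_def .
 qed (use b in simp)
 have th_deriv: "deriv (\<lambda>z. theta (z / b) p) z \<noteq> 0" if z: "z \<in> - {0}" and th0: "theta (z / b) p = 0" for z
 proof -
  obtain n where n: "z / b = p powi n" using theta_eq_0_iff[OF p, of "z / b"] b th0 z by auto
  have "((\<lambda>z. theta (z / b) p) has_field_derivative deriv (\<lambda>z. theta z p) (z / b) * (1 / b)) (at z)"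
  proof (rule DERIV_chain2[where f = "\<lambda>z. theta z p" and g = "\<lambda>z. z / b"])
   show "((\<lambda>z. theta z p) has_field_derivative deriv (\<lambda>z. theta z p) (z / b)) (at (z / b))"
    by (rule holomorphic_derivI[of _ "- {0}"]) (use z b in \<open>auto intro!: theta_holomorphic[OF p(1)] holomorphic_intros\<close>)
  qed (use b in \<open>auto intro!: derivative_eq_intros\<close>)
  hence "deriv (\<lambda>z. theta (z / b) p) z = deriv (\<lambda>z. theta z p) (z / b) * (1 / b)" by (rule DERIV_imp_deriv)
  thus ?thesis unfolding n using theta_deriv_nonzero[OF p, of n] b by simp
 qed
 obtain h where h: "h holomorphic_on (- {0})" "\<And>z. z \<in> - {0} \<Longrightarrow> f z = theta (z / b) p * h z"
 proof (rule divide_simple_zeros[OF _ insert.prems(1) hth])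
  fix z assume z: "z \<in> - {0}" and "theta (z / b) p = 0"
  then obtain n where n: "z / b = p powi n" using theta_eq_0_iff[OF p, of "z / b"] b by auto
  hence "z = b * p powi n" using b by (simp add: field_simps)
  hence "f z = 0" using fz by simp
  moreover have "deriv (\<lambda>z. theta (z / b) p) z \<noteq> 0" by (rule th_deriv[OF z]) fact
  ultimately show "f z = 0 \<and> deriv (\<lambda>z. theta (z / b) p) z \<noteq> 0" ..
 qed auto
 \<comment> \<open>Dividing by one theta function lowers the exponent of \<open>z\<close> by one and
   multiplies the constant by \<open>- 1 / b\<close>. Off the zeros this is a cancellation; at the
   zeros it follows by continuity of the defect \<open>D\<close>.\<close>
 have hc: "h (p * z) * z ^ card B = (- c / b) * z * h z" if z: "z \<noteq> 0" for z
 proof -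
  define D where "D w = h (p * w) * w ^ card B + c / b * w * h w" for w
  have D0: "D w = 0" if w: "w \<noteq> 0" "theta (w / b) p \<noteq> 0" for w
  proof -
   have "theta (p * (w / b)) p = - theta (w / b) p / (w / b)" by (rule theta_shift[OF p]) (use w b in auto)
   hence 1: "f (p * w) = - theta (w / b) p / (w / b) * h (p * w)" using h(2)[of "p * w"] w p by simp
   have "f (p * w) * w ^ card (insert b B) = c * w * f w" by (rule insert.prems(2)[OF w(1)])
   hence "f (p * w) * (w * w ^ card B) = c * w * (theta (w / b) p * h w)" using h(2)[of w] w insert.hyps by simp
   hence "theta (w / b) p * (b * D w) = 0" unfolding 1 D_def
   proof -
    assume e: "- theta (w / b) p / (w / b) * h (p * w) * (w * w ^ card B) = c * w * (theta (w / b) p * h w)"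
    have "T * (b * (H * W + c / b * w * g)) = 0" if e: "- T / (w / b) * H * (w * W) = c * w * (T * g)" for T H W g
    proof -
     have "T * (b * (H * W + c / b * w * g)) = T * b * H * W + c * w * (T * g)" using b by (simp add: algebra_simps)
     also have "... = T * b * H * W + - T / (w / b) * H * (w * W)" unfolding e ..
     also have "... = 0" using w(1) b by simp
     finally show ?thesis .
    qed
    from this[OF e] show "theta (w / b) p * (b * (h (p * w) * w ^ card B + c / b * w * h w)) = 0" .
   qed
   thus ?thesis using w b by simp
  qed
  have holD: "D holomorphic_on (- {0})"
  proof -
   have "(\<lambda>w. h (p * w)) holomorphic_on (- {0})"
    by (rule holomorphic_on_compose_gen[OF _ h(1), unfolded comp_def]) (use p in \<open>auto intro!: holomorphic_intros\<close>)
   thus ?thesis unfolding D_def by (intro holomorphic_intros h(1))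
  qed
  have "D z = 0"
  proof (cases "theta (z / b) p = 0")
   case True
   have "eventually (\<lambda>w. theta (w / b) p \<noteq> 0) (at z)"
    by (rule eventually_nonzero_deriv[OF holomorphic_derivI[OF hth] _ True]) (use th_deriv[OF _ True] z in auto)
   moreover have "eventually (\<lambda>w. w \<in> - {0}) (at z)" by (rule eventually_at_in_open') (use z in auto)
   ultimately have "eventually (\<lambda>w. 0 = D w) (at z)" by eventually_elim (use D0 in auto)
   hence "(D \<longlongrightarrow> 0) (at z)" by (rule Lim_transform_eventually[OF tendsto_const])
   moreover have "(D \<longlongrightarrow> D z) (at z)"
   proof -
    have "continuous_on (- {0}) D" using holD by (rule holomorphic_on_imp_continuous_on)
    hence "isCont D z" using continuous_on_eq_continuous_at[of "- {0}" D] z by auto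
    thus ?thesis by (simp only: isCont_def)
   qed
   ultimately have "0 = D z" by (rule LIM_unique)
   thus ?thesis by (rule sym)
  qed (use D0 z in auto)
  hence "h (p * z) * z ^ card B = - (c / b * z * h z)" unfolding D_def by (rule eq_neg_iff_add_eq_0[THEN iffD2])
  moreover have "- (c / b * z * v) = - c / b * z * v" for v by simp
  ultimately show ?thesis by (simp only:)
 qed
 have "h z = 0"
 proof (rule insert.IH[OF h(1) hc])
  show "a \<noteq> 0 \<and> h a = 0" if a: "a \<in> B" for a
  proof -
   have a0: "a \<noteq> 0" "f a = 0" using insert.prems(3)[of a] a by auto
   have "theta (a / b) p \<noteq> 0"
   proof
    assume "theta (a / b) p = 0"
    then obtain n where "a / b = p powi n" using theta_eq_0_iff[OF p, of "a / b"] a0 b by auto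
    hence "a = b * p powi n" using b by (simp add: field_simps)
    hence "a = b" using insert.prems(4) a by blast
    thus False using a insert.hyps by simp
   qed
   thus ?thesis using h(2)[of a] a0 by auto
  qed
  show "a = a'" if "a \<in> B" "a' \<in> B" "a = a' * p powi n" for a a' n
   by (rule insert.prems(4)[OF insertI2[OF that(1)] insertI2[OF that(2)] that(3)])
  show "z \<noteq> 0" by (rule insert.prems(5))
 qed
 thus ?thesis using h(2)[of z] insert.prems(5) by simp
 qed
qed

section \<open>Unordered sums and theta series\<close>

lemma tannery_infsum:
 fixes f :: "'i \<Rightarrow> nat \<Rightarrow> complex"
 assumes lim: "\<And>x. x \<in> A \<Longrightarrow> (\<lambda>n. f x n) \<longlonglongrightarrow> g x" and bd: "\<And>x n. x \<in> A \<Longrightarrow> norm (f x n) \<le> h x"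
  and h: "h summable_on A"
 shows "g summable_on A" "(\<lambda>n. \<Sum>\<^sub>\<infinity>x\<in>A. f x n) \<longlonglongrightarrow> (\<Sum>\<^sub>\<infinity>x\<in>A. g x)"
proof -
 have gb: "norm (g x) \<le> h x" if "x \<in> A" for x by (rule LIMSEQ_le_const2[OF tendsto_norm[OF lim[OF that]]]) (use bd[OF that] in auto)
 show g: "g summable_on A" by (rule abs_summable_summable, rule summable_on_comparison_test[OF h]) (use gb in auto)
 \<comment> \<open>Domination makes the convergence of the finite partial sums uniform in
   \<open>n\<close>, which permits the interchange of limits.\<close>
 have u: "uniform_limit UNIV (\<lambda>X n. \<Sum>x\<in>X. f x n) (\<lambda>n. \<Sum>\<^sub>\<infinity>x\<in>A. f x n) (finite_subsets_at_top A)"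
  by (rule Weierstrass_m_test_general[OF _ h]) (use bd in auto)
 show "(\<lambda>n. \<Sum>\<^sub>\<infinity>x\<in>A. f x n) \<longlonglongrightarrow> (\<Sum>\<^sub>\<infinity>x\<in>A. g x)"
 proof (rule tendstoI)
  fix e :: real assume e: "e > 0"
  hence e3: "e / 3 > 0" by simp
  have "eventually (\<lambda>X. \<forall>n. dist (\<Sum>x\<in>X. f x n) (\<Sum>\<^sub>\<infinity>x\<in>A. f x n) < e / 3) (finite_subsets_at_top A)"
   using uniform_limitD[OF u e3] by simp
  moreover have "eventually (\<lambda>X. dist (\<Sum>x\<in>X. g x) (\<Sum>\<^sub>\<infinity>x\<in>A. g x) < e / 3) (finite_subsets_at_top A)"
   using tendstoD[OF infsum_tendsto[OF g] e3] .
  moreover have "eventually (\<lambda>X. finite X \<and> X \<subseteq> A) (finite_subsets_at_top A)"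
   by (rule eventually_finite_subsets_at_top_weakI) auto
  ultimately have "eventually (\<lambda>X. (\<forall>n. dist (\<Sum>x\<in>X. f x n) (\<Sum>\<^sub>\<infinity>x\<in>A. f x n) < e / 3) \<and>
    dist (\<Sum>x\<in>X. g x) (\<Sum>\<^sub>\<infinity>x\<in>A. g x) < e / 3 \<and> finite X \<and> X \<subseteq> A) (finite_subsets_at_top A)"
   by eventually_elim auto
  then obtain X where X: "\<And>n. dist (\<Sum>x\<in>X. f x n) (\<Sum>\<^sub>\<infinity>x\<in>A. f x n) < e / 3"
    "dist (\<Sum>x\<in>X. g x) (\<Sum>\<^sub>\<infinity>x\<in>A. g x) < e / 3" "finite X" "X \<subseteq> A"
   using eventually_happens'[OF finite_subsets_at_top_neq_bot] by blast
  have "(\<lambda>n. \<Sum>x\<in>X. f x n) \<longlonglongrightarrow> (\<Sum>x\<in>X. g x)" by (rule tendsto_sum) (use lim X in auto)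
  from tendstoD[OF this e3] show "eventually (\<lambda>n. dist (\<Sum>\<^sub>\<infinity>x\<in>A. f x n) (\<Sum>\<^sub>\<infinity>x\<in>A. g x) < e) sequentially"
  proof eventually_elim
   case (elim n)
   thus ?case using X(1)[of n] X(2)
     dist_triangle[of "\<Sum>\<^sub>\<infinity>x\<in>A. f x n" "\<Sum>\<^sub>\<infinity>x\<in>A. g x" "\<Sum>x\<in>X. f x n"]
     dist_triangle[of "\<Sum>x\<in>X. f x n" "\<Sum>\<^sub>\<infinity>x\<in>A. g x" "\<Sum>x\<in>X. g x"] by (simp only: dist_commute)
  qed
 qed
qed

lemma summable_on_int_nonneg:
 fixes f :: "int \<Rightarrow> real"
 assumes "summable (\<lambda>n. f (int n))" "summable (\<lambda>n. f (- int n))" "\<And>m. f m \<ge> 0"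
 shows "f summable_on UNIV"
proof -
 have "f summable_on {0..}"
 proof -
  have "(\<lambda>n. f (int n)) summable_on UNIV" using assms by (intro norm_summable_imp_summable_on) simp
  moreover have "bij_betw int UNIV {0..}" by (rule bij_betwI[of _ _ _ nat]) auto
  ultimately show ?thesis using summable_on_reindex_bij_betw[of int UNIV "{0..}" f] by simp
 qed
 moreover have "f summable_on {..<0}"
 proof -
  have "summable (\<lambda>n. f (- int (Suc n)))" using summable_Suc_iff[of "\<lambda>n. f (- int n)"] assms(2) by simp
  hence "(\<lambda>n. f (- int (Suc n))) summable_on UNIV" using assms by (intro norm_summable_imp_summable_on) simp
  moreover have "bij_betw (\<lambda>n. - int (Suc n)) UNIV {..<0}" by (rule bij_betwI[of _ _ _ "\<lambda>m. nat (- m - 1)"]) auto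
  ultimately show ?thesis using summable_on_reindex_bij_betw[of "\<lambda>n. - int (Suc n)" UNIV "{..<0}" f] by simp
 qed
 ultimately have "f summable_on {0..} \<union> {..<0}" by (rule summable_on_Un_disjoint) auto
 moreover have "{0..} \<union> {..<0} = (UNIV :: int set)" by auto
 ultimately show ?thesis by simp
qed

lemma gauss_summable:
 fixes r R :: real
 assumes r: "0 \<le> r" "r < 1" and R: "R \<ge> 0"
 shows "(\<lambda>m::int. r ^ nat (m\<^sup>2) * R ^ nat \<bar>m\<bar>) summable_on UNIV"
proof -
 have "summable (\<lambda>n. (r ^ n * R) ^ n)"
 proof (rule summable_comparison_test_ev)
  have "(\<lambda>n. r ^ n * R) \<longlonglongrightarrow> 0 * R" by (intro tendsto_mult tendsto_const LIMSEQ_power_zero) (use r in auto)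
  hence "eventually (\<lambda>n. r ^ n * R < 1 / 2) sequentially" by (intro order_tendstoD(2)) auto
  thus "eventually (\<lambda>n. norm ((r ^ n * R) ^ n) \<le> (1 / 2) ^ n) sequentially"
  proof eventually_elim
   case (elim n)
   thus ?case using r R by (simp only: norm_power) (intro power_mono, auto)
  qed
  show "summable (\<lambda>n. (1 / 2 :: real) ^ n)" by (rule summable_geometric) simp
 qed
 moreover have "(r ^ n * R) ^ n = r ^ nat ((int n)\<^sup>2) * R ^ n" for n
 proof -
  have "nat ((int n)\<^sup>2) = n * n" by (simp add: power2_eq_square nat_mult_distrib)
  thus ?thesis by (simp add: power_mult_distrib power_mult)
 qed
 ultimately show ?thesis using r R by (intro summable_on_int_nonneg) simp_all
qed

lemma norm_powi_le:
 fixes X :: complex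
 assumes "norm X \<le> R" "norm (1 / X) \<le> R" "X \<noteq> 0"
 shows "norm (X powi m) \<le> R ^ nat \<bar>m\<bar>"
proof (cases "m \<ge> 0")
 case True
 hence "X powi m = X ^ nat \<bar>m\<bar>" by (simp add: power_int_def)
 thus ?thesis using assms by (simp add: norm_power power_mono)
next
 case False
 hence "X powi m = (1 / X) ^ nat \<bar>m\<bar>" by (simp add: power_int_def divide_inverse)
 thus ?thesis using assms by (simp only: norm_power) (intro power_mono, auto)
qed

text \<open>Taking \<open>r\<close> as the root of order \<open>4 * K\<close> of
  \<open>norm p\<close> turns the exponent \<open>(m^2 - i^2) / (4 * K)\<close> into Gaussian decay
  in \<open>m\<close>.\<close>

lemma norm_affine_coeff_gauss:
 assumes p: "norm p < 1" "p \<noteq> 0" and i: "0 < i" "i < K"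
 obtains r where "0 \<le> r" "r < 1" "\<And>m. norm (affine_coeff p K i m) \<le> r ^ nat (m\<^sup>2) / r ^ i\<^sup>2"
proof
 define r where "r = root (4 * K) (norm p)"
 have K: "4 * K > 0" using i by simp
 have r0: "r > 0" using K p by (simp add: r_def)
 show "0 \<le> r" using r0 by simp
 have rK: "r ^ (4 * K) = norm p" unfolding r_def using K by (intro real_root_pow_pos2) auto
 show "r < 1" unfolding r_def using K p by simp
 fix m
 show "norm (affine_coeff p K i m) \<le> r ^ nat (m\<^sup>2) / r ^ i\<^sup>2"
 proof (cases "2 * int K dvd m - int i \<or> 2 * int K dvd m + int i")
  case True
  then obtain e where e: "m\<^sup>2 - (int i)\<^sup>2 = 4 * int K * e" "e \<ge> 0" "(m\<^sup>2 - (int i)\<^sup>2) div (4 * int K) = e"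
   using affine_coeff_exponent[OF i] by blast
  have "norm (affine_coeff p K i m) = norm p ^ nat e" using True unfolding affine_coeff_def e(3) by (auto simp: norm_power)
  also have "... = r ^ (4 * K * nat e)" unfolding rK[symmetric] power_mult ..
  also have "nat (m\<^sup>2) = 4 * K * nat e + i\<^sup>2"
  proof -
   have "m\<^sup>2 = int (4 * K * nat e + i\<^sup>2)" using e by simp
   thus ?thesis by (simp only: nat_int)
  qed
  hence "r ^ (4 * K * nat e) = r ^ nat (m\<^sup>2) / r ^ i\<^sup>2" using r0 by (simp add: power_add)
  finally show ?thesis by simp
 next
  case False
  thus ?thesis using r0 by (simp add: affine_coeff_def)
 qed
qed

text \<open>A theta series in one variable: the alternating sum over an affine Weyl orbit. Its
  oddness and quasi-periodicity are those of \<open>affine_coeff\<close>.\<close>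

definition psi :: "complex \<Rightarrow> nat \<Rightarrow> nat \<Rightarrow> complex \<Rightarrow> complex" where
 "psi p K i X = (\<Sum>\<^sub>\<infinity>m. affine_coeff p K i m * X powi (- m))"

context
 fixes p :: complex and K i :: nat
 assumes p: "norm p < 1" "p \<noteq> 0" and i: "0 < i" "i < K"
begin

lemma psi_holomorphic: "psi p K i holomorphic_on (- {0})"
proof -
 obtain r where r: "0 \<le> r" "r < 1" "\<And>m. norm (affine_coeff p K i m) \<le> r ^ nat (m\<^sup>2) / r ^ i\<^sup>2"
  using norm_affine_coeff_gauss[OF p i] by blast
 have "\<exists>d. (psi p K i has_field_derivative d) (at z0)" if "z0 \<noteq> 0" for z0
 proof -
  define d where "d = norm z0 / 2"
  have d: "d > 0" using that by (simp add: d_def)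
  define R where "R = norm z0 + d + 1 / d"
  have R: "R \<ge> 0" using d by (simp add: R_def)
  have X: "X \<noteq> 0" "norm X \<le> R" "norm (1 / X) \<le> R" if "X \<in> cball z0 d" for X
  proof -
   have "norm (z0 - X) \<le> d" using that by (simp add: dist_norm)
   hence n: "norm X \<ge> d" "norm X \<le> norm z0 + d"
    using norm_triangle_ineq2[of z0 X] norm_triangle_ineq2[of X z0] by (simp_all add: d_def norm_minus_commute)
   thus "X \<noteq> 0" "norm X \<le> R" using d by (auto simp: R_def add_increasing2)
   have "norm (1 / X) \<le> 1 / d" using n d by (simp add: norm_divide frac_le)
   thus "norm (1 / X) \<le> R" using d by (simp add: R_def add_increasing)
  qed
  have ul: "uniform_limit (cball z0 d) (\<lambda>S X. \<Sum>m\<in>S. affine_coeff p K i m * X powi (- m)) (psi p K i) (finite_subsets_at_top UNIV)"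
   unfolding psi_def
  proof (rule Weierstrass_m_test_general)
   fix m X assume "X \<in> cball z0 d"
   hence "norm (X powi (- m)) \<le> R ^ nat \<bar>- m\<bar>" using X by (intro norm_powi_le) auto
   hence "norm (affine_coeff p K i m) * norm (X powi (- m)) \<le> (r ^ nat (m\<^sup>2) / r ^ i\<^sup>2) * R ^ nat \<bar>m\<bar>"
    by (intro mult_mono r(3)) (use r R in auto)
   thus "norm (affine_coeff p K i m * X powi (- m)) \<le> 1 / r ^ i\<^sup>2 * (r ^ nat (m\<^sup>2) * R ^ nat \<bar>m\<bar>)"
    by (simp add: norm_mult)
  next
   show "(\<lambda>m. 1 / r ^ i\<^sup>2 * (r ^ nat (m\<^sup>2) * R ^ nat \<bar>m\<bar>)) summable_on UNIV"
    by (intro summable_on_cmult_right gauss_summable r R)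
  qed
  have ev: "eventually (\<lambda>S. continuous_on (cball z0 d) (\<lambda>X. \<Sum>m\<in>S. affine_coeff p K i m * X powi (- m)) \<and>
    (\<lambda>X. \<Sum>m\<in>S. affine_coeff p K i m * X powi (- m)) holomorphic_on ball z0 d) (finite_subsets_at_top UNIV)"
  proof (intro always_eventually allI conjI)
   fix S :: "int set"
   have "(\<lambda>X. \<Sum>m\<in>S. affine_coeff p K i m * X powi (- m)) holomorphic_on cball z0 d" by (intro holomorphic_intros) (use X in auto)
   thus "continuous_on (cball z0 d) (\<lambda>X. \<Sum>m\<in>S. affine_coeff p K i m * X powi (- m))"
    "(\<lambda>X. \<Sum>m\<in>S. affine_coeff p K i m * X powi (- m)) holomorphic_on ball z0 d"
    by (auto intro: holomorphic_on_imp_continuous_on holomorphic_on_subset)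
  qed
  obtain "psi p K i holomorphic_on ball z0 d" by (rule holomorphic_uniform_limit[OF ev ul finite_subsets_at_top_neq_bot])
  thus ?thesis using d by (auto simp: holomorphic_on_open)
 qed
 thus ?thesis by (subst holomorphic_on_open) auto
qed

lemma psi_inverse: "psi p K i (1 / X) = - psi p K i X"
proof -
 have "psi p K i (1 / X) = (\<Sum>\<^sub>\<infinity>m. - (affine_coeff p K i m * X powi (- m)))" unfolding psi_def
 proof (rule infsum_reindex_bij_witness[where i = uminus and j = uminus])
  fix m :: int
  have "(1 / X) powi (- m) = X powi m" by (simp add: power_int_minus power_int_divide_distrib)
  thus "- (affine_coeff p K i (- m) * X powi (- (- m))) = affine_coeff p K i m * (1 / X) powi (- m)" using affine_coeff_minus[OF i, of p m] by simp
 qed auto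
 thus ?thesis by (simp add: infsum_uminus psi_def)
qed

lemma psi_shift: "X \<noteq> 0 \<Longrightarrow> psi p K i (p * X) = 1 / p ^ K * (1 / X) ^ (2 * K) * psi p K i X"
proof -
 assume X: "X \<noteq> 0"
 have "psi p K i (p * X) = (\<Sum>\<^sub>\<infinity>m. 1 / p ^ K * (1 / X) ^ (2 * K) * (affine_coeff p K i m * X powi (- m)))" unfolding psi_def
 proof (rule infsum_reindex_bij_witness[where i = "\<lambda>m. m + 2 * int K" and j = "\<lambda>m. m - 2 * int K"])
  fix m :: int
  define n where "n = m - 2 * int K"
  have m: "m = n + 2 * int K" by (simp add: n_def)
  have h1: "p powi (n + int K) * p powi (- (n + 2 * int K)) = 1 / p ^ K"
  proof -
   have "p powi (n + int K) * p powi (- (n + 2 * int K)) = p powi (- int K)" using p by (simp flip: power_int_add)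
   thus ?thesis by (simp add: power_int_minus divide_inverse)
  qed
  have h2: "X powi (- (n + 2 * int K)) = X powi (- n) * (1 / X) ^ (2 * K)"
  proof -
   have "X powi (- (n + 2 * int K)) = X powi (- n + - int (2 * K))" by simp
   also have "... = X powi (- n) * X powi (- int (2 * K))" using X by (simp only: power_int_add[OF disjI1[OF X]])
   also have "X powi (- int (2 * K)) = (1 / X) ^ (2 * K)" by (simp only: power_int_minus power_int_of_nat power_one_over inverse_eq_divide)
   finally show ?thesis .
  qed
  have g: "u * Y * (a * x) = A * a * (P * Q)" if "A * P = u" "Q = x * Y" for A P Q a u x Y :: complex unfolding that(1)[symmetric] that(2) by simp
  show "1 / p ^ K * (1 / X) ^ (2 * K) * (affine_coeff p K i (m - 2 * int K) * X powi (- (m - 2 * int K))) =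
    affine_coeff p K i m * (p * X) powi (- m)"
   unfolding n_def[symmetric] unfolding m affine_coeff_shift[OF i p(2)] power_int_mult_distrib by (rule g[OF h1 h2])
 qed auto
 thus ?thesis by (simp only: infsum_cmult_right' psi_def)
qed

end

section \<open>The finite Jacobi triple product\<close>

definition qf :: "complex \<Rightarrow> nat \<Rightarrow> complex" where
 "qf q r = (\<Prod>i<r. 1 - q ^ Suc i)"

text \<open>The convention \<open>1 / (q; q)\<^sub>r = 0\<close> for negative \<open>r\<close>.\<close>
definition qf_inv :: "complex \<Rightarrow> int \<Rightarrow> complex" where
 "qf_inv q r = (if r < 0 then 0 else 1 / qf q (nat r))"

lemma one_minus_power_nonzero:
 fixes q :: complex
 assumes "norm q < 1"
 shows "1 - q ^ Suc i \<noteq> 0"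
proof
 assume "1 - q ^ Suc i = 0"
 hence e: "norm q ^ Suc i = 1" by (metis eq_iff_diff_eq_0 norm_one norm_power)
 have "norm q * norm q ^ i \<le> norm q * 1" by (intro mult_left_mono power_le_one) (use assms in auto)
 thus False using e assms by simp
qed

lemma qf_inv_Suc:
 assumes "norm q < 1" "r \<ge> - 1"
 shows "qf_inv q r = qf_inv q (r + 1) * (1 - q ^ nat (r + 1))"
proof (cases "r = - 1")
 case False
 then obtain s where s: "r = int s" using assms(2) by (metis add.commute add_0 add_left_cancel int_one_le_iff_zero_less le_less nonneg_int_cases uminus_add_conv_diff zle_diff1_eq zless_imp_add1_zle diff_add_cancel verit_la_disequality le_minus_one_simps(1) minus_add_cancel)
 have "nat (r + 1) = Suc s" using s by simp
 thus ?thesis using s one_minus_power_nonzero[OF assms(1), of s] by (simp add: qf_inv_def qf_def)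
qed (simp add: qf_inv_def)

text \<open>With \<open>q = w^2\<close> this is \<open>w ^ (m^2)\<close> times the
  \<open>q\<close>-binomial coefficient of \<open>a + b\<close> over \<open>a + m\<close>; the
  convention for negative indices makes it vanish outside
  \<open>- a \<le> m \<le> b\<close>.\<close>

definition triple_coeff :: "complex \<Rightarrow> nat \<Rightarrow> nat \<Rightarrow> int \<Rightarrow> complex" where
 "triple_coeff w a b m = w ^ nat (m\<^sup>2) * qf (w\<^sup>2) (a + b) * qf_inv (w\<^sup>2) (int a + m) * qf_inv (w\<^sup>2) (int b - m)"

lemma triple_coeff_minus: "triple_coeff w a b (- m) = triple_coeff w b a m" by (simp add: triple_coeff_def add.commute mult_ac)

lemma triple_coeff_0: "\<not> (- int a \<le> m \<and> m \<le> int b) \<Longrightarrow> triple_coeff w a b m = 0"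
 by (auto simp: triple_coeff_def qf_inv_def)

text \<open>The Pascal rule for \<open>q\<close>-binomial coefficients, from
  \<open>1 - q ^ (e + f) = (1 - q ^ e) + q ^ e * (1 - q ^ f)\<close>.\<close>

lemma triple_coeff_Suc:
 assumes w: "norm (w\<^sup>2) < 1"
 shows "triple_coeff w (Suc a) b m = triple_coeff w a b m + w ^ (2 * a + 1) * triple_coeff w a b (m + 1)"
proof -
 define q where "q = w\<^sup>2"
 consider "m < - int (Suc a)" | "m > int b" | "- int (Suc a) \<le> m" "m \<le> int b" by linarith
 thus ?thesis
 proof cases
  case 3
  have q: "norm q < 1" using w by (simp add: q_def)
  define e where "e = nat (int a + m + 1)"
  define f where "f = nat (int b - m)"
  have e: "int e = int a + m + 1" and f: "int f = int b - m" using 3 by (simp_all add: e_def f_def)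
  define x where "x = qf_inv q (int (Suc a) + m)"
  define y where "y = qf_inv q (int b - m)"
  have x1: "qf_inv q (int a + m) = x * (1 - q ^ e)" using qf_inv_Suc[OF q, of "int a + m"] 3 by (simp add: x_def e_def add_ac)
  have y1: "qf_inv q (int b - (m + 1)) = y * (1 - q ^ f)" using qf_inv_Suc[OF q, of "int b - (m + 1)"] 3 by (simp add: y_def f_def algebra_simps)
  have x2: "qf_inv q (int a + (m + 1)) = x" by (simp add: x_def add_ac)
  have qS: "qf q (Suc a + b) = qf q (a + b) * (1 - q ^ (e + f))"
  proof -
   have "int (e + f) = int (Suc (a + b))" using e f by simp
   hence "e + f = Suc (a + b)" by (simp only: of_nat_eq_iff)
   thus ?thesis by (simp add: qf_def)
  qed
  have ww: "w ^ (2 * a + 1) * w ^ nat ((m + 1)\<^sup>2) = w ^ nat (m\<^sup>2) * q ^ e"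
  proof -
   have "int (2 * a + 1 + nat ((m + 1)\<^sup>2)) = 2 * int a + 1 + (m + 1)\<^sup>2" by simp
   also have "... = m\<^sup>2 + 2 * (int a + m + 1)" by (simp add: power2_eq_square algebra_simps)
   also have "... = int (nat (m\<^sup>2) + 2 * e)" using e by simp
   finally have "int (2 * a + 1 + nat ((m + 1)\<^sup>2)) = int (nat (m\<^sup>2) + 2 * e)" .
   hence "2 * a + 1 + nat ((m + 1)\<^sup>2) = nat (m\<^sup>2) + 2 * e" by (simp only: of_nat_eq_iff)
   thus ?thesis by (simp only: q_def power_mult[symmetric] power_add[symmetric])
  qed
  have "triple_coeff w a b m + w ^ (2 * a + 1) * triple_coeff w a b (m + 1) =
    w ^ nat (m\<^sup>2) * qf q (a + b) * (x * (1 - q ^ e)) * y + (w ^ (2 * a + 1) * w ^ nat ((m + 1)\<^sup>2)) * qf q (a + b) * x * (y * (1 - q ^ f))"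
   unfolding triple_coeff_def q_def[symmetric] x1 y1 x2 y_def[symmetric] by (simp only: mult.assoc)
  also have "... = w ^ nat (m\<^sup>2) * (qf q (a + b) * (1 - q ^ (e + f))) * x * y" unfolding ww by (simp add: power_add algebra_simps)
  also have "... = triple_coeff w (Suc a) b m" unfolding triple_coeff_def q_def[symmetric] qS x_def y_def ..
  finally show ?thesis by simp
 qed (simp_all add: triple_coeff_0)
qed

lemma finite_jacobi_triple_product:
 assumes w: "norm (w\<^sup>2) < 1" and z: "z \<noteq> 0"
 shows "(\<Prod>i<b. 1 + w ^ (2 * i + 1) * z) * (\<Prod>i<a. 1 + w ^ (2 * i + 1) / z) = (\<Sum>m=- int a..int b. triple_coeff w a b m * z powi m)"
 using z
proof (induction a arbitrary: b z)
 case (Suc a)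
 have S: "(\<Sum>m=- int (Suc a)..int b. triple_coeff w a b (m + i) * z powi (m + i)) = (\<Sum>m=- int a..int b. triple_coeff w a b m * z powi m)"
  if i: "i = 0 \<or> i = 1" for i
 proof -
  have "(\<Sum>m=- int (Suc a)..int b. triple_coeff w a b (m + i) * z powi (m + i)) =
    (\<Sum>m=- int (Suc a) + i..int b + i. triple_coeff w a b m * z powi m)"
   by (rule sum.reindex_bij_witness[where i = "\<lambda>m. m - i" and j = "\<lambda>m. m + i"]) auto
  also have "... = (\<Sum>m=- int a..int b. triple_coeff w a b m * z powi m)"
   by (rule sum.mono_neutral_right) (use i in \<open>auto intro!: triple_coeff_0\<close>)
  finally show ?thesis .
 qed
 let ?P = "(\<Prod>i<b. 1 + w ^ (2 * i + 1) * z) * (\<Prod>i<a. 1 + w ^ (2 * i + 1) / z)"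
 have "(\<Prod>i<b. 1 + w ^ (2 * i + 1) * z) * (\<Prod>i<Suc a. 1 + w ^ (2 * i + 1) / z) = ?P + w ^ (2 * a + 1) / z * ?P"
 proof -
  have "P * (Q * (1 + u)) = P * Q + u * (P * Q)" for P Q u :: complex by (simp add: algebra_simps)
  thus ?thesis unfolding prod.lessThan_Suc .
 qed
 also have "... = (\<Sum>m=- int (Suc a)..int b. triple_coeff w a b (m + 0) * z powi (m + 0)) +
   w ^ (2 * a + 1) / z * (\<Sum>m=- int (Suc a)..int b. triple_coeff w a b (m + 1) * z powi (m + 1))"
  unfolding Suc.IH[OF Suc.prems] by (simp only: S simp_thms)
 also have "... = (\<Sum>m=- int (Suc a)..int b. triple_coeff w (Suc a) b m * z powi m)" unfolding sum_distrib_left sum.distrib[symmetric]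
 proof (rule sum.cong[OF refl])
  fix m
  have "z powi (m + 1) = z * z powi m" using Suc.prems by (simp add: power_int_add)
  hence "w ^ (2 * a + 1) / z * (triple_coeff w a b (m + 1) * z powi (m + 1)) = w ^ (2 * a + 1) * triple_coeff w a b (m + 1) * z powi m"
   using Suc.prems by (simp only:) simp
  thus "triple_coeff w a b (m + 0) * z powi (m + 0) + w ^ (2 * a + 1) / z * (triple_coeff w a b (m + 1) * z powi (m + 1)) =
    triple_coeff w (Suc a) b m * z powi m" unfolding triple_coeff_Suc[OF w] by (simp only: add_0_right distrib_right)
 qed
 finally show ?case .
next
 case 0
 show ?case using 0
 \<comment> \<open>Growth in the other direction is reduced to the same Pascal rule by the symmetry
   \<open>triple_coeff_minus\<close>.\<close>
 proof (induction b)
  case 0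
  show ?case by (simp add: triple_coeff_def qf_def qf_inv_def)
 next
  case (Suc b)
  have S: "(\<Sum>m=- int 0..int (Suc b). triple_coeff w 0 b (m - i) * z powi (m - i)) = (\<Sum>m=- int 0..int b. triple_coeff w 0 b m * z powi m)"
   if i: "i = 0 \<or> i = 1" for i
  proof -
   have "(\<Sum>m=- int 0..int (Suc b). triple_coeff w 0 b (m - i) * z powi (m - i)) =
     (\<Sum>m=- int 0 - i..int (Suc b) - i. triple_coeff w 0 b m * z powi m)"
    by (rule sum.reindex_bij_witness[where i = "\<lambda>m. m + i" and j = "\<lambda>m. m - i"]) auto
   also have "... = (\<Sum>m=- int 0..int b. triple_coeff w 0 b m * z powi m)"
    by (rule sum.mono_neutral_right) (use i in \<open>auto intro!: triple_coeff_0\<close>)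
   finally show ?thesis .
  qed
  have c: "triple_coeff w 0 (Suc b) m = triple_coeff w 0 b m + w ^ (2 * b + 1) * triple_coeff w 0 b (m - 1)" for m
  proof -
   have "- m + 1 = - (m - 1)" by simp
   thus ?thesis using triple_coeff_Suc[OF w, of b 0 "- m"] by (simp only: triple_coeff_minus)
  qed
  let ?P = "(\<Prod>i<b. 1 + w ^ (2 * i + 1) * z) * (\<Prod>i<0. 1 + w ^ (2 * i + 1) / z)"
  have "(\<Prod>i<Suc b. 1 + w ^ (2 * i + 1) * z) * (\<Prod>i<0. 1 + w ^ (2 * i + 1) / z) = ?P + w ^ (2 * b + 1) * z * ?P"
  proof -
   have "(P * (1 + u * z)) * Q = P * Q + u * z * (P * Q)" for P Q u by (simp add: algebra_simps)
   thus ?thesis unfolding prod.lessThan_Suc .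
  qed
  also have "... = (\<Sum>m=- int 0..int (Suc b). triple_coeff w 0 b (m - 0) * z powi (m - 0)) +
    w ^ (2 * b + 1) * z * (\<Sum>m=- int 0..int (Suc b). triple_coeff w 0 b (m - 1) * z powi (m - 1))"
   unfolding Suc.IH[OF Suc.prems] by (simp only: S simp_thms)
  also have "... = (\<Sum>m=- int 0..int (Suc b). triple_coeff w 0 (Suc b) m * z powi m)" unfolding sum_distrib_left sum.distrib[symmetric]
  proof (rule sum.cong[OF refl])
   fix m
   have "z powi m = z * z powi (m - 1)" using Suc.prems by (simp add: power_int_diff)
   hence "w ^ (2 * b + 1) * z * (triple_coeff w 0 b (m - 1) * z powi (m - 1)) = w ^ (2 * b + 1) * triple_coeff w 0 b (m - 1) * z powi m"
    by (simp only: mult_ac)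
   thus "triple_coeff w 0 b (m - 0) * z powi (m - 0) + w ^ (2 * b + 1) * z * (triple_coeff w 0 b (m - 1) * z powi (m - 1)) =
     triple_coeff w 0 (Suc b) m * z powi m" unfolding c by (simp only: diff_zero distrib_right)
  qed
  finally show ?case .
 qed
qed

section \<open>Factorization of the determinant of theta series\<close>

text \<open>The annulus between the norms \<open>sqrt (norm p)\<close>, included, and
  \<open>1 / sqrt (norm p)\<close>, excluded, is a fundamental domain for multiplication by
  \<open>p\<close>; the conditions are squared to avoid roots.\<close>

lemma annulus_equivalent:
 assumes p: "norm p < 1" "p \<noteq> (0 :: complex)"
  and a: "norm p \<le> norm a ^ 2" "norm p * norm a ^ 2 < 1" and b: "norm p \<le> norm b ^ 2" "norm p * norm b ^ 2 < 1"
  and eq: "a = b * p powi n"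
 shows "a = b"
proof -
 have no: False if u: "norm p \<le> norm u ^ 2" and v: "norm p * norm v ^ 2 < 1" and e: "u = v * p ^ Suc m" for u v :: complex and m
 proof -
  have "norm u = norm v * norm p ^ m * norm p" using e by (simp add: norm_mult norm_power)
  also have "... \<le> norm v * 1 * norm p" by (intro mult_right_mono mult_left_mono power_le_one) (use p in auto)
  finally have "norm u ^ 2 \<le> (norm v * norm p) ^ 2" by (intro power_mono) auto
  also have "(norm v * norm p) ^ 2 = norm p * (norm p * norm v ^ 2)" by (simp add: power2_eq_square)
  also have "... < norm p * 1" by (intro mult_strict_left_mono v) (use p in auto)
  finally show False using u by simp
 qed
 show ?thesis
 proof (cases n rule: int_cases)
  case (nonneg m)
  hence e: "a = b * p ^ m" using eq by simp
  thus ?thesis using no[OF a(1) b(2)] by (cases m) auto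
 next
  case (neg m)
  have "b = a * p ^ Suc m"
  proof -
   have "a = b * inverse (p ^ Suc m)" using eq neg by (simp only: power_int_minus power_int_of_nat)
   moreover have "v = u * w" if "u = v * inverse w" "w \<noteq> 0" for u v w :: complex using that by simp
   ultimately show ?thesis using p by (metis power_not_zero)
  qed
  thus ?thesis using no[OF b(1) a(2)] by blast
 qed
qed

lemma theta_nonzero:
 assumes p: "norm p < 1" "p \<noteq> 0" and z: "norm p < norm z" "norm z < 1"
 shows "theta z p \<noteq> 0"
proof
 assume "theta z p = 0"
 moreover have "norm z > 0" using z(1) norm_ge_zero[of p] by linarith
 ultimately obtain n where n: "z = p powi n" using theta_eq_0_iff[OF p, of z] by auto
 show False
 proof (cases n rule: int_cases)
  case (nonneg m)
  hence e: "norm z = norm p ^ m" using n by (simp add: norm_power)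
  show False
  proof (cases m)
   case (Suc l)
   have "norm p * norm p ^ l \<le> norm p * 1" by (intro mult_left_mono power_le_one) (use p in auto)
   thus False using e Suc z by simp
  qed (use e z in simp)
 next
  case (neg m)
  hence "norm z = inverse (norm p ^ Suc m)" using n by (simp only: power_int_minus power_int_of_nat norm_inverse norm_power)
  moreover have "norm p ^ Suc m \<le> 1" by (intro power_le_one) (use p in auto)
  moreover have "norm p ^ Suc m > 0" using p by simp
  ultimately have "norm z \<ge> 1" by (simp only: one_le_inverse)
  thus False using z by simp
 qed
qed

definition psi_det :: "complex \<Rightarrow> nat \<Rightarrow> (nat \<Rightarrow> complex) \<Rightarrow> complex" where
 "psi_det p k X = pdet k (\<lambda>i j. psi p (Suc k) (Suc i) (X j))"

text \<open>The elliptic analogue of the Weyl denominator of type C, normalized by the monomial that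
  gives it the same behaviour as \<open>psi_det\<close> under
  \<open>X j \<mapsto> p * X j\<close>.\<close>

definition theta_prod :: "complex \<Rightarrow> nat \<Rightarrow> (nat \<Rightarrow> complex) \<Rightarrow> complex" where
 "theta_prod p k X = (\<Prod>j<k. (1 / X j) ^ Suc j * theta ((X j)\<^sup>2) p) *
   (\<Prod>(i, j)\<in>{(i, j). i < j \<and> j < k}. theta (X j / X i) p * theta (X i * X j) p)"

text \<open>The factors of \<open>theta_prod\<close> that involve the coordinate \<open>j\<close>,
  up to a constant: inverting the ratios \<open>X l / X j\<close> with \<open>l > j\<close> raises
  the power of \<open>1 / Z\<close> from \<open>Suc j\<close> to \<open>k\<close>.\<close>

definition theta_coord :: "complex \<Rightarrow> nat \<Rightarrow> (nat \<Rightarrow> complex) \<Rightarrow> nat \<Rightarrow> complex \<Rightarrow> complex" where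
 "theta_coord p k X j Z = (1 / Z) ^ k * theta (Z\<^sup>2) p * (\<Prod>l\<in>{..<k} - {j}. theta (Z / X l) p * theta (Z * X l) p)"

context
 fixes p :: complex and k :: nat
 assumes p: "norm p < 1" "p \<noteq> 0"
begin

lemma psi_det_holomorphic: "j < k \<Longrightarrow> (\<lambda>Z. psi_det p k (X(j := Z))) holomorphic_on (- {0})" unfolding psi_det_def pdet_def
proof (intro holomorphic_on_sum holomorphic_on_mult holomorphic_on_prod holomorphic_on_const)
 fix pm l assume "pm \<in> {pm. pm permutes {..<k}}" "l \<in> {..<k}"
 hence "pm l < k" using permutes_in_image[of pm "{..<k}" l] by auto
 hence "psi p (Suc k) (Suc (pm l)) holomorphic_on (- {0})" by (intro psi_holomorphic[OF p]) auto
 thus "(\<lambda>Z. psi p (Suc k) (Suc (pm l)) ((X(j := Z)) l)) holomorphic_on (- {0})" by (cases "l = j") auto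
qed

lemma psi_det_scale_coord:
 assumes j: "j < k" and c: "\<And>i. i < k \<Longrightarrow> psi p (Suc k) (Suc i) Z' = c * psi p (Suc k) (Suc i) Z"
 shows "psi_det p k (X(j := Z')) = c * psi_det p k (X(j := Z))"
proof -
 let ?c = "\<lambda>l. if l = j then c else 1"
 have "psi_det p k (X(j := Z')) = pdet k (\<lambda>i l. ?c l * psi p (Suc k) (Suc i) ((X(j := Z)) l))"
  unfolding psi_det_def by (rule pdet_cong) (use c in auto)
 also have "... = (\<Prod>l<k. ?c l) * psi_det p k (X(j := Z))" unfolding psi_det_def by (rule pdet_scale_columns)
 also have "(\<Prod>l<k. ?c l) = c" using j by simp
 finally show ?thesis .
qed

lemma psi_det_inverse: "j < k \<Longrightarrow> psi_det p k (X(j := 1 / Z)) = - psi_det p k (X(j := Z))"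
 using psi_det_scale_coord[of j "1 / Z" "- 1" Z X] psi_inverse[OF p] by simp

lemma psi_det_shift:
 "j < k \<Longrightarrow> Z \<noteq> 0 \<Longrightarrow> psi_det p k (X(j := p * Z)) = 1 / p ^ Suc k * (1 / Z) ^ (2 * Suc k) * psi_det p k (X(j := Z))"
proof (rule psi_det_scale_coord)
 fix i assume "i < k" and Z: "Z \<noteq> 0"
 thus "psi p (Suc k) (Suc i) (p * Z) = 1 / p ^ Suc k * (1 / Z) ^ (2 * Suc k) * psi p (Suc k) (Suc i) Z" by (intro psi_shift[OF p]) auto
qed

text \<open>At the fixed points 1 and -1 of inversion this is oddness. At a square root
  \<open>r\<close> of \<open>p\<close> one has \<open>p * (1 / r) = r\<close>, so shift and
  inversion give opposite values. At the other coordinates and their inverses two columns agree up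
  to sign.\<close>

lemma psi_det_zeros:
 assumes j: "j < k" and r: "r\<^sup>2 = p"
 shows "psi_det p k (X(j := 1)) = 0" "psi_det p k (X(j := - 1)) = 0" "psi_det p k (X(j := r)) = 0"
  "l < k \<Longrightarrow> l \<noteq> j \<Longrightarrow> psi_det p k (X(j := X l)) = 0" "l < k \<Longrightarrow> l \<noteq> j \<Longrightarrow> psi_det p k (X(j := 1 / X l)) = 0"
proof -
 have n: "a = 0" if "a = - a" for a :: complex using that by simp
 show "psi_det p k (X(j := 1)) = 0" by (rule n) (use psi_det_inverse[OF j, of X 1] in simp)
 show "psi_det p k (X(j := - 1)) = 0" by (rule n) (use psi_det_inverse[OF j, of X "- 1"] in simp)
 have r0: "r \<noteq> 0" using r p by auto
 have e1: "p * (1 / r) = r" using r r0 by (simp add: field_simps power2_eq_square)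
 have e2: "psi_det p k (X(j := p * (1 / r))) = 1 / p ^ Suc k * (1 / (1 / r)) ^ (2 * Suc k) * psi_det p k (X(j := 1 / r))"
  by (rule psi_det_shift[OF j]) (use r0 in simp)
 have e3: "1 / p ^ Suc k * (1 / (1 / r)) ^ (2 * Suc k) = 1"
 proof -
  have "1 / (1 / r) = r" "r ^ (2 * Suc k) = p ^ Suc k" by (simp, simp only: power_mult r)
  hence "(1 / (1 / r)) ^ (2 * Suc k) = p ^ Suc k" by (simp only:)
  moreover have "1 / u * u = 1" if "u \<noteq> 0" for u :: complex using that by simp
  moreover have "p ^ Suc k \<noteq> 0" using p by simp
  ultimately show ?thesis by (simp only:)
 qed
 have "psi_det p k (X(j := r)) = psi_det p k (X(j := 1 / r))" using e2 unfolding e1 e3 mult_1 .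
 thus "psi_det p k (X(j := r)) = 0" unfolding psi_det_inverse[OF j] by (rule n)
 show x: "psi_det p k (X(j := X l)) = 0" if "l < k" "l \<noteq> j" for l
  unfolding psi_det_def by (rule pdet_equal_columns[of j _ l]) (use that j in auto)
 show "l < k \<Longrightarrow> l \<noteq> j \<Longrightarrow> psi_det p k (X(j := 1 / X l)) = 0" unfolding psi_det_inverse[OF j] using x by simp
qed

lemma theta_zeros: "theta 1 p = 0" "theta p p = 0"
 using theta_eq_0_iff[OF p, of 1] theta_eq_0_iff[OF p, of p] p by (auto intro: exI[of _ 0] exI[of _ 1])

lemma theta_coord_holomorphic:
 assumes "\<And>l. l < k \<Longrightarrow> X l \<noteq> 0"
 shows "theta_coord p k X j holomorphic_on (- {0})"
proof -
 have "(\<lambda>Z. theta (Z / X l) p * theta (Z * X l) p) holomorphic_on (- {0})" if "l < k" for l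
  by (intro holomorphic_on_mult theta_holomorphic[OF p(1)]) (use assms that in \<open>auto intro!: holomorphic_intros\<close>)
 moreover have "(\<lambda>Z. theta (Z\<^sup>2) p) holomorphic_on (- {0})" by (rule theta_holomorphic[OF p(1)]) (auto intro!: holomorphic_intros)
 moreover have "(\<lambda>Z::complex. (1 / Z) ^ k) holomorphic_on (- {0})" by (auto intro!: holomorphic_intros)
 ultimately show ?thesis unfolding theta_coord_def by (intro holomorphic_on_mult[OF holomorphic_on_mult] holomorphic_on_prod) auto
qed

lemma theta_coord_shift:
 assumes X: "\<And>l. l < k \<Longrightarrow> X l \<noteq> 0" and Z: "Z \<noteq> 0" and j: "j < k"
 shows "theta_coord p k X j (p * Z) = 1 / p ^ Suc k * (1 / Z) ^ (2 * Suc k) * theta_coord p k X j Z"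
proof -
 have th: "theta (p * a) p = - theta a p / a" if "a \<noteq> 0" for a by (rule theta_shift[OF p that])
 have 1: "theta ((p * Z)\<^sup>2) p = 1 / p * (1 / Z) ^ 4 * theta (Z\<^sup>2) p"
 proof -
  have "(p * Z)\<^sup>2 = p * (p * Z\<^sup>2)" by (simp add: power2_eq_square)
  hence "theta ((p * Z)\<^sup>2) p = - (- theta (Z\<^sup>2) p / Z\<^sup>2) / (p * Z\<^sup>2)"
   using th[of "p * Z\<^sup>2"] th[of "Z\<^sup>2"] Z p by simp
  moreover have "- (- a / Z\<^sup>2) / (p * Z\<^sup>2) = 1 / p * (1 / Z) ^ 4 * a" for a
   by (simp add: power_divide power2_eq_square power4_eq_xxxx mult_ac)
  ultimately show ?thesis by simp
 qed
 have 2: "theta (p * Z / X l) p * theta (p * Z * X l) p = (1 / Z) ^ 2 * (theta (Z / X l) p * theta (Z * X l) p)"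
  if "l \<in> {..<k} - {j}" for l
 proof -
  have x: "X l \<noteq> 0" using X that by auto
  have "theta (p * Z / X l) p = - theta (Z / X l) p / (Z / X l)" "theta (p * Z * X l) p = - theta (Z * X l) p / (Z * X l)"
   using th[of "Z / X l"] th[of "Z * X l"] x Z by (simp_all add: mult.assoc)
  moreover have "- a / (Z / X l) * (- b / (Z * X l)) = (1 / Z) ^ 2 * (a * b)" for a b using x Z by (simp add: power2_eq_square field_simps)
  ultimately show ?thesis by simp
 qed
 have "(\<Prod>l\<in>{..<k} - {j}. theta (p * Z / X l) p * theta (p * Z * X l) p) =
   (\<Prod>l\<in>{..<k} - {j}. (1 / Z) ^ 2 * (theta (Z / X l) p * theta (Z * X l) p))" by (rule prod.cong[OF refl 2])
 also have "... = ((1 / Z) ^ 2) ^ (k - 1) * (\<Prod>l\<in>{..<k} - {j}. theta (Z / X l) p * theta (Z * X l) p)"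
  using j by (simp only: prod.distrib prod_constant) simp
 finally have 3: "(\<Prod>l\<in>{..<k} - {j}. theta (p * Z / X l) p * theta (p * Z * X l) p) =
   (1 / Z) ^ (2 * (k - 1)) * (\<Prod>l\<in>{..<k} - {j}. theta (Z / X l) p * theta (Z * X l) p)" by (simp only: power_mult)
 have 4: "(1 / (p * Z)) ^ k = 1 / p ^ k * (1 / Z) ^ k" by (simp add: power_divide power_mult_distrib)
 have e: "4 + 2 * (k - 1) = 2 * Suc k" using j by simp
 have "(1 / Z) ^ (2 * Suc k) = (1 / Z) ^ 4 * (1 / Z) ^ (2 * (k - 1))" unfolding power_add[symmetric] e ..
 moreover have "1 / p ^ Suc k = 1 / p ^ k * (1 / p)" by simp
 ultimately show ?thesis unfolding theta_coord_def 1 3 4 by (simp only: mult_ac)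
qed

lemma theta_coord_zeros:
 assumes X: "\<And>l. l < k \<Longrightarrow> X l \<noteq> 0"
 shows "Z = 1 \<or> Z = - 1 \<or> Z\<^sup>2 = p \<or> (\<exists>l<k. l \<noteq> j \<and> (Z = X l \<or> Z = 1 / X l)) \<Longrightarrow> theta_coord p k X j Z = 0"
proof -
 have main: "theta_coord p k X j Z = 0" if l: "l < k" "l \<noteq> j" "Z = X l \<or> Z = 1 / X l" for l
 proof -
  have "Z / X l = 1 \<or> Z * X l = 1" using X[OF l(1)] l(3) by auto
  hence z: "theta (Z / X l) p * theta (Z * X l) p = 0" by (elim disjE) (simp_all only: theta_zeros mult_zero_left mult_zero_right)
  have "(\<Prod>l\<in>{..<k} - {j}. theta (Z / X l) p * theta (Z * X l) p) = 0"
  proof (rule prod_zero)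
   show "\<exists>l\<in>{..<k} - {j}. theta (Z / X l) p * theta (Z * X l) p = 0" by (intro bexI[where x = l] z) (use l(1,2) in simp)
  qed simp
  thus ?thesis by (simp only: theta_coord_def mult_zero_right)
 qed
 show "Z = 1 \<or> Z = - 1 \<or> Z\<^sup>2 = p \<or> (\<exists>l<k. l \<noteq> j \<and> (Z = X l \<or> Z = 1 / X l)) \<Longrightarrow> theta_coord p k X j Z = 0"
 proof (elim disjE exE conjE)
  fix l assume "l < k" "l \<noteq> j" "Z = X l"
  thus "theta_coord p k X j Z = 0" by (intro main) auto
 next
  fix l assume "l < k" "l \<noteq> j" "Z = 1 / X l"
  thus "theta_coord p k X j Z = 0" by (intro main) auto
 qed (simp_all add: theta_coord_def theta_zeros)
qed

text \<open>The difference of both sides is quasi-periodic with a multiplier of degree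
  \<open>2 * Suc k\<close> in \<open>1 / Z\<close> and has one zero more than that allows: the
  points 1, -1, \<open>r\<close> and \<open>- r\<close>, the \<open>X l\<close> and
  \<open>1 / X l\<close> for the other \<open>l\<close>, and \<open>X j\<close> by construction. The
  bounds on the norms keep these zeros inequivalent under multiplication by
  \<open>p\<close>.\<close>

lemma psi_det_theta_coord:
 assumes j: "j < k" and X: "\<And>l. l < k \<Longrightarrow> norm p < norm (X l) ^ 2 \<and> norm (X l) < 1" and inj: "inj_on X {..<k}" and Z: "Z \<noteq> 0"
 shows "psi_det p k (X(j := Z)) * theta_coord p k X j (X j) = theta_coord p k X j Z * psi_det p k X"
proof -
 define r where "r = csqrt p"
 have r: "r\<^sup>2 = p" by (simp add: r_def)
 have nr: "norm r ^ 2 = norm p" using r by (metis norm_power)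
 have X0: "X l \<noteq> 0" if "l < k" for l using X[OF that] p by auto
 define F where "F Z = psi_det p k (X(j := Z)) * theta_coord p k X j (X j) - theta_coord p k X j Z * psi_det p k X" for Z
 let ?L = "{..<k} - {j}"
 define B1 where "B1 = {1, - 1, r, - r}"
 define B2 where "B2 = X ` {..<k}"
 define B3 where "B3 = (\<lambda>l. 1 / X l) ` ?L"
 define B where "B = B1 \<union> B2 \<union> B3"
 have r0: "r \<noteq> 0" and r1: "norm r < 1"
 proof -
  show "r \<noteq> 0" using r p by auto
  show "norm r < 1"
  proof (rule ccontr)
   assume "\<not> norm r < 1"
   hence "1 \<le> norm r ^ 2" by (simp add: one_le_power)
   thus False using nr p by simp
  qed
 qed
 have n1: "norm b = 1 \<or> norm b ^ 2 = norm p" if "b \<in> B1" for b using that nr by (auto simp: B1_def)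
 have n2: "norm p < norm b ^ 2 \<and> norm b < 1" if "b \<in> B2" for b using that X by (auto simp: B2_def)
 have n3: "1 < norm b \<and> norm p * norm b ^ 2 < 1" if "b \<in> B3" for b
 proof -
  obtain l where l: "l < k" "b = 1 / X l" using \<open>b \<in> B3\<close> by (auto simp: B3_def)
  have "norm (X l) > 0" using X0[OF l(1)] by simp
  thus ?thesis using X[OF l(1)] unfolding l(2) by (simp add: norm_divide power_divide divide_less_eq less_divide_eq)
 qed
 have fin: "finite B1" "finite B2" "finite B3" by (simp_all add: B1_def B2_def B3_def)
 have c1: "card B1 = 4"
 proof -
  have u: "u \<noteq> 1 \<and> u \<noteq> - 1" if "norm u < 1" for u :: complex using that by auto
  have "1 \<noteq> r" "1 \<noteq> - r" "- 1 \<noteq> r" "- 1 \<noteq> - r" using u[of r] u[of "- r"] r1 by auto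
  moreover have "r \<noteq> - r" "(1::complex) \<noteq> - 1" using r0 by auto
  ultimately have "distinct [1, - 1, r, - r]" by (simp only: distinct.simps list.set insert_iff empty_iff simp_thms)
  hence "card (set [1, - 1, r, - r]) = length [1, - 1, r, - r]" by (rule distinct_card)
  thus ?thesis unfolding B1_def by simp
 qed
 have c2: "card B2 = k" unfolding B2_def by (simp add: card_image inj)
 have c3: "card B3 = k - 1"
 proof -
  have "inj_on (\<lambda>l. 1 / X l) ?L" using inj X0 by (auto simp: inj_on_def)
  thus ?thesis unfolding B3_def using j by (simp add: card_image)
 qed
 have "card (B1 \<union> B2) = card B1 + card B2"
 proof (rule card_Un_disjoint)
  show "B1 \<inter> B2 = {}" using n1 n2 by fastforce
 qed (use fin in auto)
 moreover have "card (B1 \<union> B2 \<union> B3) = card (B1 \<union> B2) + card B3"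
 proof (rule card_Un_disjoint)
  have "norm b \<le> 1" if "b \<in> B1 \<union> B2" for b using that r1 n2[of b] by (auto simp: B1_def)
  thus "(B1 \<union> B2) \<inter> B3 = {}" using n3 by fastforce
 qed (use fin in auto)
 \<comment> \<open>Four fixed points, \<open>k\<close> coordinates and \<open>k - 1\<close>
   inverses: \<open>X j\<close> belongs to \<open>B2\<close>, but its inverse is left out of
   \<open>B3\<close>.\<close>
 ultimately have cB: "card B = 2 * Suc k + 1" using c1 c2 c3 j by (simp add: B_def)
 have nB: "norm p \<le> norm b ^ 2" "norm p * norm b ^ 2 < 1" if b: "b \<in> B" for b
 proof -
  have "norm p \<le> norm b ^ 2 \<and> norm p * norm b ^ 2 < 1" using b unfolding B_def Un_iff
  proof (elim disjE)
   assume "b \<in> B1"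
   from n1[OF this] show ?thesis
   proof
    assume e: "norm b ^ 2 = norm p"
    have "norm p * norm p < 1 * 1" by (intro mult_strict_mono) (use p in auto)
    thus ?thesis unfolding e by simp
   qed (use p in simp)
  next
   assume "b \<in> B2"
   note h = n2[OF this]
   have "norm b ^ 2 \<le> 1" using h by (simp add: power_le_one)
   hence "norm p * norm b ^ 2 \<le> norm p * 1" by (intro mult_left_mono) auto
   hence "norm p * norm b ^ 2 < 1" using p(1) by linarith
   thus ?thesis using h by simp
  next
   assume "b \<in> B3"
   note h = n3[OF this]
   have "1 \<le> norm b ^ 2" using h by (simp add: one_le_power)
   hence "norm p \<le> norm b ^ 2" using p(1) by linarith
   thus ?thesis using h by simp
  qed
  thus "norm p \<le> norm b ^ 2" "norm p * norm b ^ 2 < 1" by auto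
 qed
 have "F Z = 0"
 proof (rule quasi_periodic_eq_0[OF p, of B F "1 / p ^ Suc k"])
  show "finite B" using fin by (simp add: B_def)
  show "F holomorphic_on - {0}" unfolding F_def
   by (intro holomorphic_on_diff holomorphic_on_mult holomorphic_on_const psi_det_holomorphic[OF j] theta_coord_holomorphic X0)
  show "F (p * z) * z ^ card B = 1 / p ^ Suc k * z * F z" if z: "z \<noteq> 0" for z
  proof -
   have "F (p * z) = 1 / p ^ Suc k * (1 / z) ^ (2 * Suc k) * F z"
   proof -
    have ts: "theta_coord p k X j (p * z) = 1 / p ^ Suc k * (1 / z) ^ (2 * Suc k) * theta_coord p k X j z" by (rule theta_coord_shift[OF X0 z j])
    have "u * v * a * b - u * v * c * d = u * v * (a * b - c * d)" for u v a b c d :: complex by (simp add: algebra_simps)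
    thus ?thesis unfolding F_def psi_det_shift[OF j z] ts .
   qed
   moreover have "(1 / z) ^ (2 * Suc k) * z ^ card B = z" unfolding cB
   proof -
    have "(1 / z) ^ (2 * Suc k) * z ^ (2 * Suc k + 1) = (1 / z * z) ^ (2 * Suc k) * z"
     unfolding power_mult_distrib power_add by (simp only: power_one_right mult_ac)
    thus "(1 / z) ^ (2 * Suc k) * z ^ (2 * Suc k + 1) = z" using z by simp
   qed
   moreover have "(a * b * f) * c = a * z * f" if "b * c = z" for a b c f :: complex unfolding that[symmetric] by (simp only: mult_ac)
   ultimately show ?thesis by (simp only:)
  qed
  show "b \<noteq> 0 \<and> F b = 0" if b: "b \<in> B" for b
  proof
   show "b \<noteq> 0" using nB(1)[OF b] p by auto
   show "F b = 0"
   proof (cases "b = X j")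
    case True
    thus ?thesis by (simp add: F_def)
   next
    case False
    have rr: "(- r)\<^sup>2 = p" using r by simp
    have "psi_det p k (X(j := b)) = 0" using b False psi_det_zeros[OF j r, where X = X] psi_det_zeros(3)[OF j rr, where X = X]
     unfolding B_def B1_def B2_def B3_def by auto
    moreover have "theta_coord p k X j b = 0"
     by (rule theta_coord_zeros[OF X0]) (use b False r rr in \<open>auto simp: B_def B1_def B2_def B3_def\<close>)
    ultimately show ?thesis by (simp add: F_def)
   qed
  qed
  show "a = b" if "a \<in> B" "b \<in> B" "a = b * p powi n" for a b n by (rule annulus_equivalent[OF p _ _ _ _ that(3)]) (use nB that in auto)
  show "Z \<noteq> 0" by (rule Z)
 qed
 thus ?thesis by (simp add: F_def)
qed

lemma theta_prod_coord:
 assumes j: "j < k" and X: "\<And>l. l < k \<Longrightarrow> X l \<noteq> 0"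
 obtains C where "\<And>Z. Z \<noteq> 0 \<Longrightarrow> theta_prod p k (X(j := Z)) = C * theta_coord p k X j Z"
proof -
 let ?P = "{(i, l). i < l \<and> l < k}"
 let ?P' = "{(i, l). i < l \<and> l < k \<and> i \<noteq> j \<and> l \<noteq> j}"
 define D where "D = (\<Prod>l\<in>{..<k} - {j}. (1 / X l) ^ Suc l * theta ((X l)\<^sup>2) p) *
   (\<Prod>(i, l)\<in>?P'. theta (X l / X i) p * theta (X i * X l) p) * (\<Prod>l\<in>{j<..<k}. - X l)"
 have "theta_prod p k (X(j := Z)) = D * theta_coord p k X j Z" if Z: "Z \<noteq> 0" for Z
 proof -
  let ?X = "X(j := Z)"
  let ?f = "\<lambda>(i, l). theta (?X l / ?X i) p * theta (?X i * ?X l) p"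
  have 1: "(\<Prod>l<k. (1 / ?X l) ^ Suc l * theta ((?X l)\<^sup>2) p) =
    (1 / Z) ^ Suc j * theta (Z\<^sup>2) p * (\<Prod>l\<in>{..<k} - {j}. (1 / X l) ^ Suc l * theta ((X l)\<^sup>2) p)"
  proof (subst prod.remove[of _ j])
   show "(1 / ?X j) ^ Suc j * theta ((?X j)\<^sup>2) p * (\<Prod>l\<in>{..<k} - {j}. (1 / ?X l) ^ Suc l * theta ((?X l)\<^sup>2) p) =
    (1 / Z) ^ Suc j * theta (Z\<^sup>2) p * (\<Prod>l\<in>{..<k} - {j}. (1 / X l) ^ Suc l * theta ((X l)\<^sup>2) p)"
    by (intro arg_cong2[of _ _ _ _ "(*)"] prod.cong) auto
  qed (use j in auto)
  have fP: "finite ?P'" by (rule finite_subset[of _ "{..<k} \<times> {..<k}"]) auto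
  have P: "?P = ?P' \<union> ((\<lambda>i. (i, j)) ` {..<j} \<union> (\<lambda>l. (j, l)) ` {j<..<k})" using j by auto
  have "prod ?f ?P = prod ?f ?P' * prod ?f ((\<lambda>i. (i, j)) ` {..<j} \<union> (\<lambda>l. (j, l)) ` {j<..<k})"
   by (subst P, rule prod.union_disjoint) (use fP in auto)
  also have "prod ?f ((\<lambda>i. (i, j)) ` {..<j} \<union> (\<lambda>l. (j, l)) ` {j<..<k}) =
    prod ?f ((\<lambda>i. (i, j)) ` {..<j}) * prod ?f ((\<lambda>l. (j, l)) ` {j<..<k})" by (rule prod.union_disjoint) auto
  also have "prod ?f ((\<lambda>i. (i, j)) ` {..<j}) = (\<Prod>l<j. theta (Z / X l) p * theta (Z * X l) p)"
   by (subst prod.reindex) (auto simp: inj_on_def mult.commute intro!: prod.cong)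
  also have "prod ?f ((\<lambda>l. (j, l)) ` {j<..<k}) = (\<Prod>l\<in>{j<..<k}. (1 / Z * - X l) * (theta (Z / X l) p * theta (Z * X l) p))"
  proof (subst prod.reindex)
   show "prod (?f \<circ> (\<lambda>l. (j, l))) {j<..<k} = (\<Prod>l\<in>{j<..<k}. (1 / Z * - X l) * (theta (Z / X l) p * theta (Z * X l) p))"
   proof (rule prod.cong[OF refl])
    fix l assume l: "l \<in> {j<..<k}"
    hence x: "X l \<noteq> 0" using X by auto
    have "theta (1 / (Z / X l)) p = - theta (Z / X l) p / (Z / X l)" by (rule theta_inverse[OF p(1)]) (use x Z in simp)
    hence "theta (X l / Z) p = (1 / Z * - X l) * theta (Z / X l) p" by simp
    thus "(?f \<circ> (\<lambda>l. (j, l))) l = (1 / Z * - X l) * (theta (Z / X l) p * theta (Z * X l) p)" using l by simp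
   qed
  qed (auto simp: inj_on_def)
  also have "... = (1 / Z) ^ (k - Suc j) * (\<Prod>l\<in>{j<..<k}. - X l) * (\<Prod>l\<in>{j<..<k}. theta (Z / X l) p * theta (Z * X l) p)"
   by (simp only: prod.distrib prod_constant card_greaterThanLessThan)
  also have "prod ?f ?P' = (\<Prod>(i, l)\<in>?P'. theta (X l / X i) p * theta (X i * X l) p)" by (rule prod.cong) auto
  finally have 2: "prod ?f ?P = (\<Prod>(i, l)\<in>?P'. theta (X l / X i) p * theta (X i * X l) p) *
    ((\<Prod>l<j. theta (Z / X l) p * theta (Z * X l) p) * ((1 / Z) ^ (k - Suc j) * (\<Prod>l\<in>{j<..<k}. - X l) * (\<Prod>l\<in>{j<..<k}. theta (Z / X l) p * theta (Z * X l) p)))" .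
  have L: "{..<k} - {j} = {..<j} \<union> {j<..<k}" using j by auto
  have 3: "(\<Prod>l\<in>{..<k} - {j}. theta (Z / X l) p * theta (Z * X l) p) =
    (\<Prod>l<j. theta (Z / X l) p * theta (Z * X l) p) * (\<Prod>l\<in>{j<..<k}. theta (Z / X l) p * theta (Z * X l) p)"
   unfolding L by (rule prod.union_disjoint) auto
  have 4: "(1 / Z) ^ k = (1 / Z) ^ Suc j * (1 / Z) ^ (k - Suc j)" unfolding power_add[symmetric] using j by simp
  show ?thesis unfolding theta_prod_def 1 2 D_def theta_coord_def 3 4 by (simp only: mult_ac)
 qed
 thus ?thesis using that by blast
qed

lemma theta_prod_nonzero:
 assumes X: "\<And>l. l < k \<Longrightarrow> norm p < norm (X l) ^ 2 \<and> norm (X l) < 1"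
  and dec: "\<And>i j. i < j \<Longrightarrow> j < k \<Longrightarrow> norm (X j) < norm (X i)"
 shows "theta_prod p k X \<noteq> 0"
proof -
 have X0: "norm (X l) > 0" if "l < k" for l using X[OF that] p by auto
 have sq: "norm p < norm (X l)" if "l < k" for l
 proof -
  have "norm (X l) ^ 2 \<le> norm (X l) * 1" unfolding power2_eq_square by (intro mult_left_mono) (use X[OF that] in auto)
  thus ?thesis using X[OF that] by simp
 qed
 have "theta ((X l)\<^sup>2) p \<noteq> 0" if "l < k" for l
 proof (rule theta_nonzero[OF p])
  show "norm p < norm ((X l)\<^sup>2)" using X[OF that] by (simp add: norm_power)
  show "norm ((X l)\<^sup>2) < 1" using X[OF that] by (simp add: norm_power power_less_one_iff)
 qed
 moreover have "theta (X j / X i) p \<noteq> 0" "theta (X i * X j) p \<noteq> 0" if ij: "i < j" "j < k" for i j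
 proof -
  have i: "i < k" using ij by simp
  show "theta (X j / X i) p \<noteq> 0"
  proof (rule theta_nonzero[OF p])
   have "norm p * norm (X i) \<le> norm p * 1" by (intro mult_left_mono) (use X[OF i] in auto)
   hence "norm p * norm (X i) < norm (X j)" using sq[OF ij(2)] by simp
   thus "norm p < norm (X j / X i)" using X0[OF i] by (simp add: norm_divide less_divide_eq)
   show "norm (X j / X i) < 1" using dec[OF ij] X0[OF i] by (simp add: norm_divide)
  qed
  show "theta (X i * X j) p \<noteq> 0"
  proof (rule theta_nonzero[OF p])
   have "norm (X j) ^ 2 < norm (X i) * norm (X j)" unfolding power2_eq_square by (intro mult_strict_right_mono dec ij X0)
   thus "norm p < norm (X i * X j)" using X[OF ij(2)] by (simp add: norm_mult)
   have "norm (X i) * norm (X j) < 1 * 1" by (intro mult_strict_mono) (use X[OF i] X[OF ij(2)] in auto)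
   thus "norm (X i * X j) < 1" by (simp add: norm_mult)
  qed
 qed
 moreover have "X l \<noteq> 0" if "l < k" for l using X0[OF that] by auto
 moreover have "finite {(i, j). i < j \<and> j < k}" by (rule finite_subset[of _ "{..<k} \<times> {..<k}"]) auto
 ultimately show ?thesis unfolding theta_prod_def by (auto simp: prod_zero_iff)
qed

text \<open>The points are moved from \<open>Y\<close> to \<open>X\<close> one coordinate at a time.
  The inequality \<open>norm (Y l) \<le> norm (X l)\<close> keeps the mixed sequences strictly
  decreasing in norm, so that the theta product stays nonzero and can be cancelled.\<close>

theorem psi_det_theta_prod:
 assumes X: "\<And>l. l < k \<Longrightarrow> norm p < norm (X l) ^ 2 \<and> norm (X l) < 1" and Y: "\<And>l. l < k \<Longrightarrow> norm p < norm (Y l) ^ 2 \<and> norm (Y l) < 1"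
  and decX: "\<And>i j. i < j \<Longrightarrow> j < k \<Longrightarrow> norm (X j) < norm (X i)"
  and decY: "\<And>i j. i < j \<Longrightarrow> j < k \<Longrightarrow> norm (Y j) < norm (Y i)"
  and le: "\<And>l. l < k \<Longrightarrow> norm (Y l) \<le> norm (X l)"
 shows "psi_det p k X * theta_prod p k Y = psi_det p k Y * theta_prod p k X"
proof -
 define H where "H n = (\<lambda>j. if j < n then X j else Y j)" for n
 have HX: "norm p < norm (H n l) ^ 2 \<and> norm (H n l) < 1" if "l < k" for n l using X Y that by (simp add: H_def)
 have Hd: "norm (H n j) < norm (H n i)" if ij: "i < j" "j < k" for n i j
 proof -
  have "norm (Y j) < norm (X i)" using le[OF ij(2)] decX[OF ij] by linarith
  thus ?thesis using decX[OF ij] decY[OF ij] ij by (simp add: H_def)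
 qed
 have Hinj: "inj_on (H n) {..<k}" for n
 proof (rule inj_onI)
  fix i j assume "i \<in> {..<k}" "j \<in> {..<k}" "H n i = H n j"
  thus "i = j" using Hd[of i j n] Hd[of j i n] by (cases i j rule: linorder_cases) auto
 qed
 have H0: "H n l \<noteq> 0" if "l < k" for n l using HX[OF that, of n] p by auto
 have "psi_det p k (H n) * theta_prod p k Y = psi_det p k Y * theta_prod p k (H n)" if "n \<le> k" for n using that
 proof (induction n)
  case 0
  have "H 0 = Y" by (simp add: H_def)
  thus ?case by simp
 next
  case (Suc n)
  hence n: "n < k" by simp
  have S: "H (Suc n) = (H n)(n := X n)" by (auto simp: H_def fun_eq_iff)
  have Xn: "X n \<noteq> 0" using X[OF n] p by auto
  obtain C where C: "\<And>Z. Z \<noteq> 0 \<Longrightarrow> theta_prod p k ((H n)(n := Z)) = C * theta_coord p k (H n) n Z"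
   using theta_prod_coord[OF n, of "H n"] H0 by blast
  have e1: "psi_det p k (H (Suc n)) * theta_coord p k (H n) n (H n n) = theta_coord p k (H n) n (X n) * psi_det p k (H n)"
   unfolding S by (rule psi_det_theta_coord[OF n HX Hinj Xn])
  have e2: "theta_prod p k (H (Suc n)) = C * theta_coord p k (H n) n (X n)" unfolding S by (rule C[OF Xn])
  have e3: "theta_prod p k (H n) = C * theta_coord p k (H n) n (H n n)" using C[of "H n n"] H0[OF n] by simp
  have e4: "psi_det p k (H (Suc n)) * theta_prod p k (H n) = theta_prod p k (H (Suc n)) * psi_det p k (H n)"
   using arg_cong[OF e1, of "\<lambda>u. C * u"] unfolding e2 e3 by (simp only: mult_ac)
  have nz: "theta_prod p k (H n) \<noteq> 0" by (rule theta_prod_nonzero[OF HX Hd])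
  have IH: "psi_det p k (H n) * theta_prod p k Y = psi_det p k Y * theta_prod p k (H n)" using Suc by simp
  have "(psi_det p k (H (Suc n)) * theta_prod p k Y) * theta_prod p k (H n) =
    (psi_det p k (H (Suc n)) * theta_prod p k (H n)) * theta_prod p k Y" by (simp only: mult_ac)
  also have "... = theta_prod p k (H (Suc n)) * (psi_det p k (H n) * theta_prod p k Y)" unfolding e4 by (simp only: mult_ac)
  also have "... = (psi_det p k Y * theta_prod p k (H (Suc n))) * theta_prod p k (H n)" unfolding IH by (simp only: mult_ac)
  finally show ?case using nz by simp
 qed
 from this[of k] have "psi_det p k (H k) * theta_prod p k Y = psi_det p k Y * theta_prod p k (H k)" by simp
 moreover have "psi_det p k (H k) = psi_det p k X" unfolding psi_det_def by (rule pdet_cong) (simp add: H_def)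
 moreover have "theta_prod p k (H k) = theta_prod p k X" unfolding theta_prod_def by (intro arg_cong2[of _ _ _ _ "(*)"] prod.cong) (auto simp: H_def)
 ultimately show ?thesis by simp
qed

end

section \<open>The limit of infinitely many variables\<close>

lemma qf_LIMSEQ: "norm q < 1 \<Longrightarrow> qf q \<longlonglongrightarrow> qpoch_inf q q"
proof -
 assume "norm q < 1"
 moreover have "qf q = (\<lambda>n. \<Prod>i<n. 1 - q * q ^ i)" by (rule ext) (simp add: qf_def)
 ultimately show ?thesis using qpoch_inf_LIMSEQ[of q q] by simp
qed

lemma qpoch_inf_self_nonzero:
 assumes "norm q < 1"
 shows "qpoch_inf q q \<noteq> 0"
proof
 assume "qpoch_inf q q = 0"
 then obtain i where "q * q ^ i = 1" using qpoch_inf_eq_0_iff[OF assms] by auto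
 thus False using one_minus_power_nonzero[OF assms, of i] by simp
qed

lemma qf_inv_LIMSEQ:
 assumes q: "norm q < 1"
 shows "(\<lambda>n. qf_inv q (int n + m)) \<longlonglongrightarrow> 1 / qpoch_inf q q"
proof -
 have 1: "(\<lambda>n. 1 / qf q n) \<longlonglongrightarrow> 1 / qpoch_inf q q"
  by (rule tendsto_divide[OF tendsto_const qf_LIMSEQ[OF q] qpoch_inf_self_nonzero[OF q]])
 have 2: "filterlim (\<lambda>n. nat (int n + m)) sequentially sequentially" unfolding filterlim_at_top
 proof
  fix N
  show "eventually (\<lambda>n. N \<le> nat (int n + m)) sequentially" by (rule eventually_sequentiallyI[of "N + nat \<bar>m\<bar>"]) linarith
 qed
 have "(\<lambda>n. 1 / qf q (nat (int n + m))) \<longlonglongrightarrow> 1 / qpoch_inf q q" by (rule filterlim_compose[OF 1 2])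
 moreover have "eventually (\<lambda>n. 1 / qf q (nat (int n + m)) = qf_inv q (int n + m)) sequentially"
  by (rule eventually_sequentiallyI[of "nat \<bar>m\<bar>"]) (simp add: qf_inv_def)
 ultimately show ?thesis by (rule Lim_transform_eventually)
qed

definition xvar :: "complex \<Rightarrow> nat \<Rightarrow> nat \<Rightarrow> complex" where
 "xvar w \<sigma> a = w ^ (2 * a + \<sigma> + 1)"

text \<open>The monomials that split off from rows and columns when the Gaussian exponents are
  completed to squares; they cancel those of \<open>theta_prod\<close> in
  \<open>gam_theta_prod\<close>.\<close>

definition gam :: "complex \<Rightarrow> nat \<Rightarrow> nat \<Rightarrow> complex" where
 "gam w \<sigma> k = (\<Prod>i<k. w ^ (Suc i)\<^sup>2) * (\<Prod>j<k. w ^ (Suc j * (Suc j - \<sigma>)))"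

context
 fixes w :: complex and \<sigma> :: nat
 assumes w: "norm w < 1" "w \<noteq> 0" and \<sigma>: "\<sigma> = 0 \<or> \<sigma> = 1"
begin

abbreviation (input) xs :: "nat \<Rightarrow> complex" where "xs \<equiv> xvar w \<sigma>"

text \<open>The triple product is taken at \<open>w ^ \<sigma> * z\<close>. For
  \<open>\<sigma> = 1\<close> its second product has one factor more, and the surplus factor is
  \<open>1 + 1 / z\<close>.\<close>

definition tc :: "nat \<Rightarrow> int \<Rightarrow> complex" where
 "tc n m = triple_coeff w (n + \<sigma>) n m * w powi (int \<sigma> * m)"

lemma norm_w2: "norm (w\<^sup>2) < 1" using w by (simp add: norm_power power_less_one_iff)

lemma norm_xs_less: "norm (xs a) < 1"
proof -
 have "norm w * norm w ^ (2 * a + \<sigma>) \<le> norm w * 1" by (intro mult_left_mono power_le_one) (use w in auto)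
 moreover have "norm (xs a) = norm w * norm w ^ (2 * a + \<sigma>)" by (simp add: xvar_def norm_mult norm_power)
 ultimately show ?thesis using w(1) by linarith
qed

lemma xs_nonzero: "xs a \<noteq> 0" using w by (simp add: xvar_def)

lemma inj_xs: "inj xs"
proof (rule injI)
 fix a b assume "xs a = xs b"
 hence "norm w ^ (2 * a + \<sigma> + 1) = norm w ^ (2 * b + \<sigma> + 1)" unfolding xvar_def by (metis norm_power)
 hence "2 * a + \<sigma> + 1 = 2 * b + \<sigma> + 1" by (rule power_inject_exp'[THEN iffD1, rotated -1]) (use w in auto)
 thus "a = b" by simp
qed

lemma lw_generic_xs: "lw_generic xs {..<n}" unfolding lw_generic_def
proof (intro conjI ballI)
 show "inj_on xs {..<n}" using inj_xs by (rule inj_on_subset) auto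
 fix i j
 have "norm (xs i * xs j) < 1 * 1" unfolding norm_mult by (intro mult_strict_mono' norm_xs_less) auto
 thus "xs i * xs j \<noteq> 1" by auto
qed (simp_all add: xs_nonzero)

lemma kern_xs:
 assumes z: "z \<noteq> 0"
 shows "(1 + of_nat \<sigma> / z) * kern xs {..<n} z = (\<Sum>m=- int (Suc n)..int n. tc n m * z powi m)"
proof -
 define u where "u = w ^ \<sigma> * z"
 have u: "u \<noteq> 0" using w z by (simp add: u_def)
 have "(\<Prod>i<n. 1 + w ^ (2 * i + 1) * u) * (\<Prod>i<n + \<sigma>. 1 + w ^ (2 * i + 1) / u) = (1 + of_nat \<sigma> / z) * kern xs {..<n} z"
  using \<sigma>
 proof
  assume 0: "\<sigma> = 0"
  show ?thesis unfolding u_def kern_def xvar_def prod.distrib by (simp add: 0)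
 next
  assume 1: "\<sigma> = 1"
  have a: "(\<Prod>i<n. 1 + w ^ (2 * i + 1) * u) = (\<Prod>i<n. 1 + xs i * z)" unfolding u_def xvar_def by (rule prod.cong) (simp_all add: 1)
  have "(\<Prod>i<n + \<sigma>. 1 + w ^ (2 * i + 1) / u) = (1 + w / u) * (\<Prod>i<n. 1 + w ^ (2 * Suc i + 1) / u)"
  proof -
   have "n + \<sigma> = Suc n" by (simp add: 1)
   thus ?thesis by (simp only: prod.lessThan_Suc_shift) simp
  qed
  also have "(\<Prod>i<n. 1 + w ^ (2 * Suc i + 1) / u) = (\<Prod>i<n. 1 + xs i / z)"
   unfolding u_def xvar_def by (rule prod.cong) (use w in \<open>simp_all add: 1\<close>)
  also have "w / u = 1 / z" using w by (simp add: u_def 1)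
  finally show ?thesis unfolding a kern_def prod.distrib by (simp add: 1)
 qed
 moreover have "(\<Prod>i<n. 1 + w ^ (2 * i + 1) * u) * (\<Prod>i<n + \<sigma>. 1 + w ^ (2 * i + 1) / u) =
   (\<Sum>m=- int (n + \<sigma>)..int n. triple_coeff w (n + \<sigma>) n m * u powi m)" by (rule finite_jacobi_triple_product[OF norm_w2 u])
 moreover have "... = (\<Sum>m=- int (n + \<sigma>)..int n. tc n m * z powi m)"
  by (rule sum.cong[OF refl]) (simp add: tc_def u_def power_int_mult_distrib power_int_mult)
 \<comment> \<open>For \<open>\<sigma> = 0\<close> the lowest coefficient is 0; the common range
   spares a distinction of cases later.\<close>
 moreover have "... = (\<Sum>m=- int (Suc n)..int n. tc n m * z powi m)"
  by (rule sum.mono_neutral_left) (use \<sigma> in \<open>auto simp: tc_def intro!: triple_coeff_0\<close>)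
 ultimately show ?thesis by simp
qed

lemma tc_LIMSEQ: "(\<lambda>n. tc n m) \<longlonglongrightarrow> w ^ nat (m\<^sup>2) * w powi (int \<sigma> * m) / qpoch_inf (w\<^sup>2) (w\<^sup>2)"
proof -
 let ?q = "w\<^sup>2"
 note q = norm_w2
 have "(\<lambda>n. qf ?q (2 * n + \<sigma>)) \<longlonglongrightarrow> qpoch_inf ?q ?q"
 proof (rule filterlim_compose[OF qf_LIMSEQ[OF q]])
  show "filterlim (\<lambda>n. 2 * n + \<sigma>) sequentially sequentially" by (rule filterlim_subseq) (auto simp: strict_mono_def)
 qed
 moreover have "(\<lambda>n. qf_inv ?q (int n + (int \<sigma> + m))) \<longlonglongrightarrow> 1 / qpoch_inf ?q ?q" "(\<lambda>n. qf_inv ?q (int n + (- m))) \<longlonglongrightarrow> 1 / qpoch_inf ?q ?q"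
  by (rule qf_inv_LIMSEQ[OF q])+
 ultimately have "(\<lambda>n. w ^ nat (m\<^sup>2) * qf ?q (2 * n + \<sigma>) * qf_inv ?q (int n + (int \<sigma> + m)) * qf_inv ?q (int n + (- m)) * w powi (int \<sigma> * m))
  \<longlonglongrightarrow> w ^ nat (m\<^sup>2) * qpoch_inf ?q ?q * (1 / qpoch_inf ?q ?q) * (1 / qpoch_inf ?q ?q) * w powi (int \<sigma> * m)"
  by (intro tendsto_mult tendsto_const)
 moreover have "w ^ nat (m\<^sup>2) * qf ?q (2 * n + \<sigma>) * qf_inv ?q (int n + (int \<sigma> + m)) * qf_inv ?q (int n + (- m)) * w powi (int \<sigma> * m) = tc n m" for n
  by (simp add: tc_def triple_coeff_def add_ac mult_2)
 ultimately show ?thesis using qpoch_inf_self_nonzero[OF q] by simp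
qed

text \<open>The bound is uniform in \<open>n\<close>: the finite products \<open>qf\<close> and
  their reciprocals are bounded since they converge to a nonzero limit, and
  \<open>w powi (\<sigma> * m)\<close> costs only a linear exponent against the Gaussian
  one.\<close>

lemma tc_bound:
 obtains B where "B > 0" "\<And>n m. norm (tc n m) \<le> B * (norm w ^ nat (m\<^sup>2) * (1 / norm w) ^ nat \<bar>m\<bar>)"
proof -
 let ?q = "w\<^sup>2"
 note q = norm_w2
 have "Bseq (qf ?q)" by (rule convergent_imp_Bseq) (use qf_LIMSEQ[OF q] in \<open>auto simp: convergent_def\<close>)
 then obtain B1 where B1: "B1 > 0" "\<And>n. norm (qf ?q n) \<le> B1" by (auto elim: BseqE)
 have "(\<lambda>n. 1 / qf ?q n) \<longlonglongrightarrow> 1 / qpoch_inf ?q ?q"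
  by (rule tendsto_divide[OF tendsto_const qf_LIMSEQ[OF q] qpoch_inf_self_nonzero[OF q]])
 hence "Bseq (\<lambda>n. 1 / qf ?q n)" by (intro convergent_imp_Bseq) (auto simp: convergent_def)
 then obtain B2 where B2: "B2 > 0" "\<And>n. norm (1 / qf ?q n) \<le> B2" by (auto elim: BseqE)
 have B2': "norm (qf_inv ?q r) \<le> B2" for r using B2 by (simp add: qf_inv_def)
 have R: "1 / norm w \<ge> 1" "norm w > 0" using w by (simp_all add: le_divide_eq)
 show ?thesis
 proof (rule that[of "B1 * B2 * B2"])
  show "B1 * B2 * B2 > 0" using B1 B2 by simp
  fix n m
  have "norm (w powi (int \<sigma> * m)) \<le> (1 / norm w) ^ nat \<bar>int \<sigma> * m\<bar>"
  proof (rule norm_powi_le)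
   show "norm w \<le> 1 / norm w" using R w(1) by linarith
  qed (use w in \<open>simp_all add: norm_divide\<close>)
  also have "... \<le> (1 / norm w) ^ nat \<bar>m\<bar>" by (intro power_increasing R) (use \<sigma> in auto)
  finally have 1: "norm (w powi (int \<sigma> * m)) \<le> (1 / norm w) ^ nat \<bar>m\<bar>" .
  have "norm (tc n m) = norm (qf ?q (n + \<sigma> + n)) * norm (qf_inv ?q (int (n + \<sigma>) + m)) * norm (qf_inv ?q (int n - m)) *
    (norm w ^ nat (m\<^sup>2) * norm (w powi (int \<sigma> * m)))" by (simp only: tc_def triple_coeff_def norm_mult norm_power mult_ac)
  also have "... \<le> (B1 * B2 * B2) * (norm w ^ nat (m\<^sup>2) * (1 / norm w) ^ nat \<bar>m\<bar>)"
   by (intro mult_mono B1(2) B2' 1 order_refl mult_nonneg_nonneg) (use B1 B2 in auto)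
  finally show "norm (tc n m) \<le> B1 * B2 * B2 * (norm w ^ nat (m\<^sup>2) * (1 / norm w) ^ nat \<bar>m\<bar>)" .
 qed
qed

text \<open>On the support \<open>m^2 = i^2 + 4 * K * e\<close>, where \<open>e\<close> is the
  exponent of \<open>t\<close>. The Gaussian factor therefore turns the base \<open>t\<close> into
  \<open>t * w ^ (4 * K)\<close>, which for \<open>K = Suc k\<close> is \<open>p\<close>.\<close>

lemma affine_coeff_gauss:
 assumes i: "0 < i" "i < K"
 shows "w ^ nat (m\<^sup>2) * affine_coeff t K i m = w ^ i\<^sup>2 * affine_coeff (t * w ^ (4 * K)) K i m"
proof (cases "2 * int K dvd m - int i \<or> 2 * int K dvd m + int i")
 case True
 then obtain e where e: "m\<^sup>2 - (int i)\<^sup>2 = 4 * int K * e" "e \<ge> 0" "(m\<^sup>2 - (int i)\<^sup>2) div (4 * int K) = e"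
  using affine_coeff_exponent[OF i] by blast
 have "m\<^sup>2 = int (4 * K * nat e + i\<^sup>2)" using e by simp
 hence "nat (m\<^sup>2) = 4 * K * nat e + i\<^sup>2" by (simp only: nat_int)
 hence "w ^ nat (m\<^sup>2) * t ^ nat e = w ^ i\<^sup>2 * (t * w ^ (4 * K)) ^ nat e" by (simp add: power_add power_mult power_mult_distrib)
 thus ?thesis using True unfolding affine_coeff_def e(3) by auto
qed (simp add: affine_coeff_def)

lemma theta_det_LIMSEQ:
 assumes t: "norm t \<le> 1"
 shows "(\<lambda>n. theta_det t k n (tc n)) \<longlonglongrightarrow>
  gam w \<sigma> k / qpoch_inf (w\<^sup>2) (w\<^sup>2) ^ k * psi_det (t * w ^ (4 * Suc k)) k (\<lambda>j. w ^ (2 * Suc j - \<sigma>))"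
proof -
 let ?Q = "qpoch_inf (w\<^sup>2) (w\<^sup>2)"
 let ?p = "t * w ^ (4 * Suc k)"
 obtain B where B: "B > 0" "\<And>n m. norm (tc n m) \<le> B * (norm w ^ nat (m\<^sup>2) * (1 / norm w) ^ nat \<bar>m\<bar>)" using tc_bound by blast
 define c where "c m = w ^ nat (m\<^sup>2) * w powi (int \<sigma> * m) / ?Q" for m
 have entry: "(\<lambda>n. \<Sum>m=- int (Suc n)..int n. tc n m * affine_coeff t (Suc k) (Suc i) (m + int (Suc j))) \<longlonglongrightarrow>
   w ^ (Suc i)\<^sup>2 * (w ^ (Suc j * (Suc j - \<sigma>)) * (1 / ?Q * psi ?p (Suc k) (Suc i) (w ^ (2 * Suc j - \<sigma>))))" if ij: "i < k" "j < k" for i j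
 proof -
  let ?a = "\<lambda>m. affine_coeff t (Suc k) (Suc i) (m + int (Suc j))"
  have "(\<lambda>n. \<Sum>\<^sub>\<infinity>m. tc n m * ?a m) \<longlonglongrightarrow> (\<Sum>\<^sub>\<infinity>m. c m * ?a m)"
  proof (rule tannery_infsum(2)[where f = "\<lambda>m n. tc n m * ?a m" and g = "\<lambda>m. c m * ?a m"
     and h = "\<lambda>m. B * (norm w ^ nat (m\<^sup>2) * (1 / norm w) ^ nat \<bar>m\<bar>)"])
   show "(\<lambda>n. tc n m * ?a m) \<longlonglongrightarrow> c m * ?a m" for m unfolding c_def by (rule tendsto_mult[OF tc_LIMSEQ tendsto_const])
   show "norm (tc n m * ?a m) \<le> B * (norm w ^ nat (m\<^sup>2) * (1 / norm w) ^ nat \<bar>m\<bar>)" for n m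
   proof -
    have "norm (tc n m) * norm (?a m) \<le> B * (norm w ^ nat (m\<^sup>2) * (1 / norm w) ^ nat \<bar>m\<bar>) * 1"
     by (intro mult_mono B norm_affine_coeff_le t) (use B(1) in auto)
    thus ?thesis by (simp add: norm_mult)
   qed
   show "(\<lambda>m. B * (norm w ^ nat (m\<^sup>2) * (1 / norm w) ^ nat \<bar>m\<bar>)) summable_on UNIV"
    by (intro summable_on_cmult_right gauss_summable) (use w in auto)
  qed
  moreover have "(\<Sum>\<^sub>\<infinity>m. tc n m * ?a m) = (\<Sum>m=- int (Suc n)..int n. tc n m * ?a m)" for n
  proof -
   have "(\<Sum>\<^sub>\<infinity>m. tc n m * ?a m) = (\<Sum>\<^sub>\<infinity>m\<in>{- int (Suc n)..int n}. tc n m * ?a m)"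
    by (rule infsum_cong_neutral) (use \<sigma> in \<open>auto simp: tc_def intro!: triple_coeff_0\<close>)
   thus ?thesis by simp
  qed
  moreover have "(\<Sum>\<^sub>\<infinity>m. c m * ?a m) = w ^ (Suc i)\<^sup>2 * (w ^ (Suc j * (Suc j - \<sigma>)) * (1 / ?Q * psi ?p (Suc k) (Suc i) (w ^ (2 * Suc j - \<sigma>))))"
  proof -
   define J where "J = Suc j"
   have "(\<Sum>\<^sub>\<infinity>m. c m * ?a m) = (\<Sum>\<^sub>\<infinity>m. (w ^ (Suc i)\<^sup>2 * (w ^ (J * (J - \<sigma>)) * (1 / ?Q))) * (affine_coeff ?p (Suc k) (Suc i) m * (w ^ (2 * J - \<sigma>)) powi (- m)))"
   \<comment> \<open>Substituting \<open>l = m + J\<close> completes the square: \<open>m^2 +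
     \<sigma> * m = l^2 + J * (J - \<sigma>) - (2 * J - \<sigma>) * l\<close>. The linear term
     becomes the argument of \<open>psi\<close>, the constant one a factor of
     \<open>gam\<close>.\<close>
   proof (rule infsum_reindex_bij_witness[where i = "\<lambda>m. m - int J" and j = "\<lambda>m. m + int J"])
    fix m :: int
    define l where "l = m + int J"
    have m: "m = l - int J" by (simp add: l_def)
    have J\<sigma>: "int (J - \<sigma>) = int J - int \<sigma>" "int (2 * J - \<sigma>) = 2 * int J - int \<sigma>" using \<sigma> by (auto simp: J_def)
    have pw: "w ^ nat (l\<^sup>2) = w powi (l\<^sup>2)" "w ^ nat (m\<^sup>2) = w powi (m\<^sup>2)" for l m :: int by (simp_all add: power_int_def)
    have "w ^ nat (m\<^sup>2) * w powi (int \<sigma> * m) = w powi (m\<^sup>2 + int \<sigma> * m)" using w by (simp add: pw power_int_add)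
    also have "m\<^sup>2 + int \<sigma> * m = l\<^sup>2 + (int (J * (J - \<sigma>)) + int (2 * J - \<sigma>) * (- l))"
     unfolding of_nat_mult J\<sigma> m by (simp add: power2_eq_square algebra_simps)
    also have "w powi ... = w ^ nat (l\<^sup>2) * (w ^ (J * (J - \<sigma>)) * (w ^ (2 * J - \<sigma>)) powi (- l))"
     unfolding power_int_add[OF disjI1[OF w(2)]] pw power_int_mult power_int_of_nat ..
    finally have 1: "w ^ nat (m\<^sup>2) * w powi (int \<sigma> * m) = w ^ nat (l\<^sup>2) * (w ^ (J * (J - \<sigma>)) * (w ^ (2 * J - \<sigma>)) powi (- l))" .
    have 2: "w ^ nat (l\<^sup>2) * affine_coeff t (Suc k) (Suc i) l = w ^ (Suc i)\<^sup>2 * affine_coeff ?p (Suc k) (Suc i) l"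
     by (rule affine_coeff_gauss) (use ij in auto)
    show "(w ^ (Suc i)\<^sup>2 * (w ^ (J * (J - \<sigma>)) * (1 / ?Q))) *
     (affine_coeff ?p (Suc k) (Suc i) (m + int J) * (w ^ (2 * J - \<sigma>)) powi (- (m + int J))) = c m * ?a m"
    proof -
     have g: "(u * (b * (1 / Q))) * (f * x) = M / Q * a" if "M = L * (b * x)" "L * a = u * f" for u b Q f x M a L :: complex
     proof -
      have "M / Q * a = (L * a) * (b * x) / Q" unfolding that(1) by simp
      hence e: "M / Q * a = u * f * (b * x) / Q" unfolding that(2) .
      show ?thesis unfolding e by (simp add: mult_ac)
     qed
     show ?thesis unfolding c_def J_def[symmetric] l_def[symmetric] by (rule g[OF 1 2])
    qed
   qed auto
   thus ?thesis unfolding psi_def infsum_cmult_right' J_def by (simp only: mult.assoc)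
  qed
  ultimately show ?thesis by simp
 qed
 have "(\<lambda>n. theta_det t k n (tc n)) \<longlonglongrightarrow>
   pdet k (\<lambda>i j. w ^ (Suc i)\<^sup>2 * (w ^ (Suc j * (Suc j - \<sigma>)) * (1 / ?Q * psi ?p (Suc k) (Suc i) (w ^ (2 * Suc j - \<sigma>)))))"
  unfolding theta_det_def pdet_def
 proof (intro tendsto_sum tendsto_mult tendsto_const tendsto_prod)
  fix pm j assume "pm \<in> {pm. pm permutes {..<k}}" "j \<in> {..<k}"
  hence "pm j < k" "j < k" using permutes_in_image[of pm "{..<k}" j] by auto
  thus "(\<lambda>n. \<Sum>m=- int (Suc n)..int n. tc n m * affine_coeff t (Suc k) (Suc (pm j)) (m + int (Suc j))) \<longlonglongrightarrow>
   w ^ (Suc (pm j))\<^sup>2 * (w ^ (Suc j * (Suc j - \<sigma>)) * (1 / ?Q * psi ?p (Suc k) (Suc (pm j)) (w ^ (2 * Suc j - \<sigma>))))" by (rule entry)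
 qed
 moreover have "pdet k (\<lambda>i j. w ^ (Suc i)\<^sup>2 * (w ^ (Suc j * (Suc j - \<sigma>)) * (1 / ?Q * psi ?p (Suc k) (Suc i) (w ^ (2 * Suc j - \<sigma>))))) =
   (\<Prod>i<k. w ^ (Suc i)\<^sup>2) * ((\<Prod>j<k. w ^ (Suc j * (Suc j - \<sigma>))) * ((\<Prod>j<k. 1 / ?Q) * psi_det ?p k (\<lambda>j. w ^ (2 * Suc j - \<sigma>))))"
  unfolding psi_det_def by (simp only: pdet_scale_rows pdet_scale_columns)
 moreover have "... = gam w \<sigma> k / ?Q ^ k * psi_det ?p k (\<lambda>j. w ^ (2 * Suc j - \<sigma>))" by (simp add: gam_def power_divide)
 ultimately show ?thesis by simp
qed

end

section \<open>Infinite products along residue classes\<close>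

lemma qpoch_inf_split:
 assumes q: "norm q < 1" and M: "M > 0"
 shows "qpoch_inf a q = (\<Prod>r<M. qpoch_inf (a * q ^ r) (q ^ M))"
proof -
 have qM: "norm (q ^ M) < 1" using q M by (simp add: norm_power power_less_one_iff)
 have "(\<Prod>i<n * M. 1 - a * q ^ i) = (\<Prod>r<M. \<Prod>i<n. 1 - a * q ^ r * (q ^ M) ^ i)" for n
 proof -
  have "(\<Prod>i<n * M. 1 - a * q ^ i) = (\<Prod>m<n. prod (\<lambda>i. 1 - a * q ^ i) {m * M..<m * M + M})" by (rule prod.nat_group[symmetric])
  also have "... = (\<Prod>m<n. \<Prod>r<M. 1 - a * q ^ r * (q ^ M) ^ m)"
  proof (rule prod.cong[OF refl])
   fix m
   show "prod (\<lambda>i. 1 - a * q ^ i) {m * M..<m * M + M} = (\<Prod>r<M. 1 - a * q ^ r * (q ^ M) ^ m)"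
    by (rule sym, rule prod.reindex_bij_witness[where i = "\<lambda>i. i - m * M" and j = "\<lambda>r. m * M + r"])
     (auto simp: power_add power_mult[symmetric] mult_ac)
  qed
  also have "... = (\<Prod>r<M. \<Prod>m<n. 1 - a * q ^ r * (q ^ M) ^ m)" by (rule prod.swap)
  finally show ?thesis .
 qed
 moreover have "(\<lambda>n. \<Prod>r<M. \<Prod>i<n. 1 - a * q ^ r * (q ^ M) ^ i) \<longlonglongrightarrow> (\<Prod>r<M. qpoch_inf (a * q ^ r) (q ^ M))"
  by (intro tendsto_prod qpoch_inf_LIMSEQ qM)
 moreover have "(\<lambda>n. \<Prod>i<n * M. 1 - a * q ^ i) \<longlonglongrightarrow> qpoch_inf a q"
 proof (rule filterlim_compose[OF qpoch_inf_LIMSEQ[OF q]])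
  show "filterlim (\<lambda>n. n * M) sequentially sequentially" by (rule filterlim_subseq) (use M in \<open>auto simp: strict_mono_def\<close>)
 qed
 ultimately show ?thesis using LIMSEQ_unique by simp
qed

text \<open>The multiplicity of \<open>qpoch_inf (q ^ m) p\<close> in the theta product: it occurs
  in the theta functions of \<open>q ^ m\<close> and of its mirror image
  \<open>q ^ (2 * Suc k - m)\<close>. It is \<open>k\<close> but for a deficit at odd
  \<open>m\<close> and a surplus at the self-mirrored \<open>m = Suc k\<close>.\<close>

lemma theta_index_count:
 assumes m: "0 < m" "m < 2 * Suc k"
 shows "card {j\<in>{1..k}. m \<le> 2 * j \<and> j \<noteq> m} + card {j\<in>{1..k}. 2 * Suc k - m \<le> 2 * j \<and> j \<noteq> 2 * Suc k - m} + (if odd m then 1 else 0) =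
  k + (if m = Suc k then 1 else 0)"
proof -
 have c: "card {j\<in>{1..k}. m \<le> 2 * j \<and> j \<noteq> m} = Suc k - (m + 1) div 2 - (if m \<le> k then 1 else 0)"
  if m: "0 < m" "m < 2 * Suc k" for m
 proof -
  have "{j\<in>{1..k}. m \<le> 2 * j \<and> j \<noteq> m} = {(m + 1) div 2..k} - {m}" using m by auto
  moreover have "m \<in> {(m + 1) div 2..k} \<longleftrightarrow> m \<le> k" using m by auto
  ultimately show ?thesis by (simp add: card_Diff_singleton_if)
 qed
 obtain m' where m': "2 * Suc k - m = m'" "m + m' = 2 * Suc k" "0 < m'" "m' < 2 * Suc k" using m by auto
 show ?thesis unfolding m'(1) c[OF m] c[OF m'(3,4)]
 proof (cases "even m")
  case True
  then obtain a where a: "m = 2 * a" by (elim evenE)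
  hence "even m'" using m'(2) by presburger
  then obtain b where b: "m' = 2 * b" by (elim evenE)
  show "Suc k - (m + 1) div 2 - (if m \<le> k then 1 else 0) + (Suc k - (m' + 1) div 2 - (if m' \<le> k then 1 else 0)) + (if odd m then 1 else 0) =
    k + (if m = Suc k then 1 else 0)" using m'(2-4) m unfolding a b by auto
 next
  case False
  then obtain a where a: "m = 2 * a + 1" by (elim oddE)
  hence "odd m'" using m'(2) by presburger
  then obtain b where b: "m' = 2 * b + 1" by (elim oddE)
  show "Suc k - (m + 1) div 2 - (if m \<le> k then 1 else 0) + (Suc k - (m' + 1) div 2 - (if m' \<le> k then 1 else 0)) + (if odd m then 1 else 0) =
    k + (if m = Suc k then 1 else 0)" using m'(2-4) m unfolding a b by auto
 qed
qed

text \<open>Each theta function is the product of two of the \<open>a m = (q ^ m; q ^ (2 k + 2))\<close>, and all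
 infinite products involved are monomials in these.\<close>
lemma theta_product_at_powers:
 assumes q: "norm q < 1" "q \<noteq> 0" and p: "p = q ^ (2 * Suc k)"
 shows "qpoch_inf p p ^ k * (\<Prod>j\<in>{1..k}. theta (q ^ (2 * j)) p * (\<Prod>i\<in>{1..<j}. theta (q ^ (j - i)) p * theta (q ^ (i + j)) p)) * qpoch_inf q (q\<^sup>2) =
  qpoch_inf q q ^ k * qpoch_inf (q ^ Suc k) p"
proof -
 define a where "a m = qpoch_inf (q ^ m) p" for m
 define T where "T m = theta (q ^ m) p" for m
 let ?M = "{1..<2 * Suc k}"
 let ?N = "\<lambda>m. card {j\<in>{1..k}. m \<le> 2 * j \<and> j \<noteq> m}"
 have T: "T m = a m * a (2 * Suc k - m)" if "m \<in> ?M" for m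
 proof -
  have "p / q ^ m = q ^ (2 * Suc k - m)" unfolding p using that q by (intro power_diff[symmetric]) auto
  thus ?thesis by (simp only: T_def a_def theta_def)
 qed
 \<comment> \<open>For fixed \<open>j\<close> the exponents \<open>j - i\<close>,
   \<open>i + j\<close> and \<open>2 * j\<close> run once through the numbers from 1 to
   \<open>2 * j\<close> with \<open>j\<close> omitted.\<close>
 have inner: "T (2 * j) * (\<Prod>i\<in>{1..<j}. T (j - i) * T (i + j)) = (\<Prod>m\<in>?M. if m \<le> 2 * j \<and> j \<noteq> m then T m else 1)"
  if j: "j \<in> {1..k}" for j
 proof -
  have "{m\<in>?M. m \<le> 2 * j \<and> j \<noteq> m} = {1..<j} \<union> {Suc j..2 * j}" using j by auto
  hence "(\<Prod>m\<in>?M. if m \<le> 2 * j \<and> j \<noteq> m then T m else 1) = (\<Prod>m\<in>{1..<j} \<union> {Suc j..2 * j}. T m)"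
   by (subst prod.inter_filter[symmetric]) auto
  also have "... = (\<Prod>m\<in>{1..<j}. T m) * (\<Prod>m\<in>{Suc j..2 * j}. T m)" by (rule prod.union_disjoint) auto
  also have "(\<Prod>m\<in>{1..<j}. T m) = (\<Prod>i\<in>{1..<j}. T (j - i))"
   by (rule prod.reindex_bij_witness[where i = "\<lambda>i. j - i" and j = "\<lambda>i. j - i"]) auto
  also have "{Suc j..2 * j} = insert (2 * j) {Suc j..<2 * j}" using j by auto
  hence "(\<Prod>m\<in>{Suc j..2 * j}. T m) = T (2 * j) * (\<Prod>m\<in>{Suc j..<2 * j}. T m)" by simp
  also have "(\<Prod>m\<in>{Suc j..<2 * j}. T m) = (\<Prod>i\<in>{1..<j}. T (i + j))"
   by (rule prod.reindex_bij_witness[where i = "\<lambda>i. i + j" and j = "\<lambda>m. m - j"]) auto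
  finally show ?thesis by (simp add: prod.distrib mult_ac)
 qed
 have "(\<Prod>j\<in>{1..k}. T (2 * j) * (\<Prod>i\<in>{1..<j}. T (j - i) * T (i + j))) =
   (\<Prod>j\<in>{1..k}. \<Prod>m\<in>?M. if m \<le> 2 * j \<and> j \<noteq> m then T m else 1)" by (rule prod.cong[OF refl inner])
 also have "... = (\<Prod>m\<in>?M. \<Prod>j\<in>{1..k}. if m \<le> 2 * j \<and> j \<noteq> m then T m else 1)" by (rule prod.swap)
 also have "... = (\<Prod>m\<in>?M. T m ^ ?N m)" by (rule prod.cong[OF refl], subst prod.inter_filter[symmetric]) auto
 also have "... = (\<Prod>m\<in>?M. a m ^ ?N m * a (2 * Suc k - m) ^ ?N m)" by (rule prod.cong[OF refl]) (simp only: T power_mult_distrib)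
 also have "... = (\<Prod>m\<in>?M. a m ^ ?N m) * (\<Prod>m\<in>?M. a (2 * Suc k - m) ^ ?N m)" by (rule prod.distrib)
 also have "(\<Prod>m\<in>?M. a (2 * Suc k - m) ^ ?N m) = (\<Prod>m\<in>?M. a m ^ ?N (2 * Suc k - m))"
  by (rule prod.reindex_bij_witness[where i = "\<lambda>m. 2 * Suc k - m" and j = "\<lambda>m. 2 * Suc k - m"]) auto
 finally have prodT: "(\<Prod>j\<in>{1..k}. T (2 * j) * (\<Prod>i\<in>{1..<j}. T (j - i) * T (i + j))) =
   (\<Prod>m\<in>?M. a m ^ (?N m + ?N (2 * Suc k - m)))" by (simp only: prod.distrib power_add)
 have odd: "qpoch_inf q (q\<^sup>2) = (\<Prod>m\<in>?M. a m ^ (if odd m then 1 else 0))"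
 proof -
  have "norm (q\<^sup>2) < 1" using q by (simp add: norm_power power_less_one_iff)
  hence "qpoch_inf q (q\<^sup>2) = (\<Prod>r<Suc k. qpoch_inf (q * (q\<^sup>2) ^ r) ((q\<^sup>2) ^ Suc k))" by (rule qpoch_inf_split) simp
  also have "... = (\<Prod>r<Suc k. a (2 * r + 1))" unfolding a_def p power_mult by (simp add: power_mult)
  also have "... = (\<Prod>m\<in>{m\<in>?M. odd m}. a m)"
   by (rule prod.reindex_bij_witness[where i = "\<lambda>m. m div 2" and j = "\<lambda>r. 2 * r + 1"]) auto
  also have "... = (\<Prod>m\<in>?M. if odd m then a m else 1)" by (rule prod.inter_filter) simp
  also have "... = (\<Prod>m\<in>?M. a m ^ (if odd m then 1 else 0))" by (rule prod.cong) auto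
  finally show ?thesis .
 qed
 have all: "qpoch_inf q q = qpoch_inf p p * (\<Prod>m\<in>?M. a m)"
 proof -
  have "qpoch_inf q q = (\<Prod>r<2 * Suc k. qpoch_inf (q * q ^ r) (q ^ (2 * Suc k)))" by (rule qpoch_inf_split[OF q(1)]) simp
  also have "... = (\<Prod>m\<in>{1..2 * Suc k}. a m)"
   by (rule prod.reindex_bij_witness[where i = "\<lambda>m. m - 1" and j = Suc]) (auto simp: a_def p)
  also have "{1..2 * Suc k} = insert (2 * Suc k) ?M" by auto
  also have "(\<Prod>m\<in>insert (2 * Suc k) ?M. a m) = a (2 * Suc k) * (\<Prod>m\<in>?M. a m)" by (rule prod.insert) auto
  finally show ?thesis by (simp only: a_def p)
 qed
 have "(\<Prod>m\<in>?M. a m ^ (?N m + ?N (2 * Suc k - m))) * (\<Prod>m\<in>?M. a m ^ (if odd m then 1 else 0)) =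
   (\<Prod>m\<in>?M. a m ^ (?N m + ?N (2 * Suc k - m) + (if odd m then 1 else 0)))" by (simp only: prod.distrib power_add)
 also have "... = (\<Prod>m\<in>?M. a m ^ (k + (if m = Suc k then 1 else 0)))" by (rule prod.cong[OF refl], subst theta_index_count) auto
 also have "... = (\<Prod>m\<in>?M. a m) ^ k * (\<Prod>m\<in>?M. a m ^ (if m = Suc k then 1 else 0))"
  by (simp only: power_add prod.distrib prod_power_distrib)
 also have "(\<Prod>m\<in>?M. a m ^ (if m = Suc k then 1 else 0)) = (\<Prod>m\<in>?M. if m = Suc k then a m else 1)" by (rule prod.cong) auto
 also have "... = a (Suc k)" by (subst prod.delta) auto
 finally have "(\<Prod>m\<in>?M. a m ^ (?N m + ?N (2 * Suc k - m))) * (\<Prod>m\<in>?M. a m ^ (if odd m then 1 else 0)) = (\<Prod>m\<in>?M. a m) ^ k * a (Suc k)" .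
 thus ?thesis unfolding T_def[symmetric] prodT odd all power_mult_distrib a_def[of "Suc k", symmetric] mult.assoc by (simp only:)
qed

section \<open>Domination and exchange of the limit with the sum\<close>

lemma supp_subset_iff: "{a::nat. f a \<noteq> (0::nat)} \<subseteq> {..<n} \<longleftrightarrow> (\<forall>a\<ge>n. f a = 0)"
proof
 assume h: "{a. f a \<noteq> 0} \<subseteq> {..<n}"
 show "\<forall>a\<ge>n. f a = 0"
 proof (intro allI impI, rule ccontr)
  fix a assume "n \<le> a" "f a \<noteq> 0"
  hence "a \<in> {..<n}" by (intro subsetD[OF h]) simp
  thus False using \<open>n \<le> a\<close> by simp
 qed
next
 assume h: "\<forall>a\<ge>n. f a = 0"
 show "{a. f a \<noteq> 0} \<subseteq> {..<n}"
 proof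
  fix a assume "a \<in> {a. f a \<noteq> 0}"
  hence "f a \<noteq> 0" by simp
  moreover have "f a = 0" if "n \<le> a" using h that by simp
  ultimately show "a \<in> {..<n}" by (cases "n \<le> a") simp_all
 qed
qed

lemma hlb_scale: "s \<noteq> 0 \<Longrightarrow> hlb t (s * u) (s * v) = hlb t u v"
proof -
 assume s: "s \<noteq> 0"
 have "hlb t (s * u) (s * v) = (s * (u - t * v)) / (s * (u - v))" by (simp add: hlb_def algebra_simps)
 thus ?thesis using s by (simp add: hlb_def)
qed

text \<open>For nonzero variables in geometric progression the factor depends only on the distance
  \<open>d\<close> and the order, and its norm exceeds 1 by at most a multiple of
  \<open>norm q ^ d\<close>. Hence products of such factors are bounded independently of their
  length.\<close>

lemma norm_hlb_le:
 assumes q: "norm q < 1" "q \<noteq> 0" and t: "norm t \<le> 1" and d: "d > 0"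
 shows "norm (hlb t u (u * q ^ d)) \<le> 1 + 2 / (1 - norm q) * norm q ^ d"
  "norm (hlb t (u * q ^ d) u) \<le> 1 + 2 / (1 - norm q) * norm q ^ d"
  "u \<noteq> 0 \<Longrightarrow> norm (hlb t u (u * q ^ d) - 1) \<le> 2 / (1 - norm q) * norm q ^ d"
proof -
 define r where "r = norm q"
 have r: "0 < r" "r < 1" using q by (simp_all add: r_def)
 have rd: "r ^ d \<le> r" using d r by (metis Suc_leI One_nat_def less_imp_le power_decreasing power_one_right)
 have n: "norm (q ^ d) = r ^ d" by (simp add: norm_power r_def)
 have den: "norm (1 - q ^ d) \<ge> 1 - r ^ d" "1 - r ^ d > 0" "1 - r ^ d \<ge> 1 - r"
  using norm_triangle_ineq2[of 1 "q ^ d"] rd r by (simp_all add: n)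
 have le: "2 * r ^ d / (1 - r ^ d) \<le> 2 / (1 - r) * r ^ d"
 proof -
  have "2 * r ^ d / (1 - r ^ d) \<le> 2 * r ^ d / (1 - r)" using den r by (intro divide_left_mono mult_pos_pos) auto
  thus ?thesis by simp
 qed
 have key: "norm N / norm (1 - q ^ d) \<le> 1 + 2 / (1 - r) * r ^ d" if "norm N \<le> 1 + r ^ d" for N :: complex
 proof -
  have "norm N / norm (1 - q ^ d) \<le> (1 + r ^ d) / (1 - r ^ d)" using that den r by (intro frac_le) auto
  also have "... = 1 + 2 * r ^ d / (1 - r ^ d)" using den by (simp add: field_simps)
  finally show ?thesis using le by simp
 qed
 have R: "0 \<le> 2 / (1 - r) * r ^ d" using r by simp
 have tq: "norm (t * q ^ d) \<le> r ^ d"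
 proof -
  have "norm t * norm (q ^ d) \<le> 1 * norm (q ^ d)" by (intro mult_right_mono t) auto
  thus ?thesis by (simp only: norm_mult n mult_1)
 qed
 have 1: "norm (1 - t * q ^ d) \<le> 1 + r ^ d" using norm_triangle_ineq4[of 1 "t * q ^ d"] tq by simp
 have 2: "norm (q ^ d - t) \<le> 1 + r ^ d" using norm_triangle_ineq4[of "q ^ d" t] t n by simp
 show "norm (hlb t u (u * q ^ d)) \<le> 1 + 2 / (1 - norm q) * norm q ^ d"
 proof (cases "u = 0")
  case False
  have "hlb t u (u * q ^ d) = (1 - t * q ^ d) / (1 - q ^ d)" using hlb_scale[OF False, of t 1 "q ^ d"] by (simp add: hlb_def)
  thus ?thesis using key[OF 1] by (simp add: norm_divide r_def)
 qed (use R in \<open>simp add: hlb_def r_def\<close>)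
 show "norm (hlb t (u * q ^ d) u) \<le> 1 + 2 / (1 - norm q) * norm q ^ d"
 proof (cases "u = 0")
  case False
  have "hlb t (u * q ^ d) u = (q ^ d - t) / (q ^ d - 1)" using hlb_scale[OF False, of t "q ^ d" 1] by (simp add: hlb_def)
  hence "norm (hlb t (u * q ^ d) u) = norm (q ^ d - t) / norm (1 - q ^ d)" by (simp only: norm_divide norm_minus_commute)
  thus ?thesis using key[OF 2] by (simp add: r_def)
 qed (use R in \<open>simp add: hlb_def r_def\<close>)
 show "norm (hlb t u (u * q ^ d) - 1) \<le> 2 / (1 - norm q) * norm q ^ d" if "u \<noteq> 0"
 proof -
  have nz: "1 - q ^ d \<noteq> 0" using den by auto
  have "hlb t u (u * q ^ d) - 1 = (1 - t * q ^ d) / (1 - q ^ d) - 1" using hlb_scale[OF that, of t 1 "q ^ d"] by (simp add: hlb_def)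
  also have "... = (1 - t) * q ^ d / (1 - q ^ d)" using nz by (simp add: field_simps)
  finally have "norm (hlb t u (u * q ^ d) - 1) = norm ((1 - t) * q ^ d) / norm (1 - q ^ d)" by (simp only: norm_divide)
  also have "... \<le> 2 * r ^ d / (1 - r ^ d)"
  proof (rule frac_le)
   have "norm (1 - t) \<le> 2" using norm_triangle_ineq4[of 1 t] t by simp
   thus "norm ((1 - t) * q ^ d) \<le> 2 * r ^ d" unfolding norm_mult n using r by (intro mult_right_mono) auto
  qed (use den r in auto)
  finally show ?thesis using le by (simp add: r_def)
 qed
qed

lemma sum_bounded_funs:
 fixes u :: "nat \<Rightarrow> nat \<Rightarrow> real"
 shows "(\<Sum>g\<in>bounded_funs k {..<n}. \<Prod>a<n. u a (g a)) = (\<Prod>a<n. \<Sum>j\<le>k. u a j)"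
proof (induction n)
 case 0
 have "bounded_funs k {..<0} = {\<lambda>_. 0}" by (auto simp: bounded_funs_def fun_eq_iff)
 thus ?case by simp
next
 case (Suc n)
 have "(\<Sum>g\<in>bounded_funs k {..<Suc n}. \<Prod>a<Suc n. u a (g a)) =
   (\<Sum>(g, j)\<in>bounded_funs k {..<n} \<times> {..k}. (\<Prod>a<n. u a (g a)) * u n j)"
 proof (rule sum.reindex_bij_witness[where i = "\<lambda>(g, j). g(n := j)" and j = "\<lambda>g. (g(n := 0), g n)"])
  fix g assume "g \<in> bounded_funs k {..<Suc n}"
  have "(\<Prod>a<n. u a ((g(n := 0)) a)) = (\<Prod>a<n. u a (g a))" by (rule prod.cong) auto
  thus "(case (g(n := 0), g n) of (g, j) \<Rightarrow> (\<Prod>a<n. u a (g a)) * u n j) = (\<Prod>a<Suc n. u a (g a))" by simp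
 qed (auto simp: bounded_funs_def less_Suc_eq fun_eq_iff)
 also have "... = (\<Sum>g\<in>bounded_funs k {..<n}. \<Sum>j\<le>k. (\<Prod>a<n. u a (g a)) * u n j)" by (rule sum.cartesian_product[symmetric])
 also have "... = (\<Prod>a<Suc n. \<Sum>j\<le>k. u a j)" by (simp add: sum_distrib_left[symmetric] sum_distrib_right[symmetric] Suc)
 finally show ?case .
qed

lemma inv_prod_nested:
 "inv_prod t x {..<n} g = (\<Prod>a<n. \<Prod>c\<in>{c. c < n \<and> g c < g a}. hlb t (x a) (x c))"
proof -
 have "{(a, c). a \<in> {..<n} \<and> c \<in> {..<n} \<and> g c < g a} = (SIGMA a:{..<n}. {c. c < n \<and> g c < g a})" by auto
 thus ?thesis unfolding inv_prod_def by (simp add: prod.Sigma)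
qed

context
 fixes w t :: complex and \<sigma> k :: nat
 assumes w: "norm w < 1" "w \<noteq> 0" and t: "norm t < 1"
begin

abbreviation (input) xw where "xw \<equiv> xvar w \<sigma>"
abbreviation (input) qw where "qw \<equiv> w\<^sup>2"
abbreviation (input) suppw where "suppw g \<equiv> {a::nat. g a \<noteq> (0::nat)}"

definition gfuns :: "(nat \<Rightarrow> nat) set" where
 "gfuns = {g. finite (suppw g) \<and> (\<forall>a. g a \<le> k)}"

text \<open>The summand of \<open>bl_sum\<close> for \<open>n\<close> variables, extended by 0 to
  one index set for all \<open>n\<close>, as dominated convergence demands. Outer factors off the
  support would be 1, so the outer product stays finite in the limit.\<close>

definition bl_term :: "nat \<Rightarrow> (nat \<Rightarrow> nat) \<Rightarrow> complex" where
 "bl_term n g = (if suppw g \<subseteq> {..<n} then \<Prod>a\<in>suppw g. xw a ^ (2 * g a) * (\<Prod>c<n. if g c < g a then hlb t (xw a) (xw c) else 1) else 0)"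

definition bl_lim :: "(nat \<Rightarrow> nat) \<Rightarrow> complex" where
 "bl_lim g = (\<Prod>a\<in>suppw g. xw a ^ (2 * g a) * (\<Prod>c. if g c < g a then hlb t (xw a) (xw c) else 1))"

text \<open>From \<open>1 + x \<le> exp x\<close>: with \<open>r = norm (w^2)\<close>, each factor
  exceeds 1 in norm by at most \<open>2 / (1 - r)\<close> times \<open>r\<close> to the distance,
  and the two geometric tails sum to at most \<open>2 / (1 - r)\<close>.\<close>

definition bl_const :: real where
 "bl_const = exp (2 / (1 - norm qw) * (2 / (1 - norm qw)))"

definition bl_bound :: "(nat \<Rightarrow> nat) \<Rightarrow> real" where
 "bl_bound g = (\<Prod>a\<in>suppw g. bl_const * norm (xw a) ^ (2 * g a))"

lemma qw: "norm qw < 1" "qw \<noteq> 0" using w by (simp_all add: norm_power power_less_one_iff)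

lemma X_shift: "xw (a + d) = xw a * qw ^ d"
proof -
 have "2 * (a + d) + \<sigma> + 1 = (2 * a + \<sigma> + 1) + 2 * d" by simp
 thus ?thesis unfolding xvar_def power_mult[symmetric] power_add[symmetric] by (simp only:)
qed

lemma X_nonzero: "xw a \<noteq> 0" using w by (simp add: xvar_def)

lemma norm_hlb_X: "c \<noteq> a \<Longrightarrow> norm (hlb t (xw a) (xw c)) \<le> 1 + 2 / (1 - norm qw) * norm qw ^ nat \<bar>int a - int c\<bar>"
proof (cases "c > a")
 case True
 then obtain d where d: "c = a + d" "d > 0" using less_imp_add_positive by blast
 thus ?thesis using norm_hlb_le(1)[OF qw, of t d "xw a"] t by (simp add: X_shift)
next
 case False
 assume "c \<noteq> a"
 then obtain d where d: "a = c + d" "d > 0" using False less_imp_add_positive[of c a] by force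
 thus ?thesis using norm_hlb_le(2)[OF qw, of t d "xw c"] t by (simp add: X_shift)
qed

lemma norm_hlb_prod:
 fixes g :: "nat \<Rightarrow> nat"
 shows "norm (\<Prod>c<n. if g c < g a then hlb t (xw a) (xw c) else 1) \<le> bl_const"
proof -
 define r where "r = norm qw"
 have r: "0 \<le> r" "r < 1" using qw by (simp_all add: r_def)
 define f where "f c = 2 / (1 - r) * r ^ nat \<bar>int a - int c\<bar>" for c
 have f0: "f c \<ge> 0" for c using r by (simp add: f_def)
 have "norm (\<Prod>c<n. if g c < g a then hlb t (xw a) (xw c) else 1) \<le> (\<Prod>c<n. 1 + f c)" unfolding prod_norm[symmetric]
 proof (rule prod_mono)
  fix c
  show "0 \<le> norm (if g c < g a then hlb t (xw a) (xw c) else 1) \<and> norm (if g c < g a then hlb t (xw a) (xw c) else 1) \<le> 1 + f c"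
   using norm_hlb_X[of c a] f0[of c] by (cases "c = a") (auto simp: f_def r_def)
 qed
 also have "... \<le> exp (\<Sum>c<n. f c)" by (rule prod_le_exp_sum) (use f0 in auto)
 also have "(\<Sum>c<n. f c) \<le> 2 / (1 - r) * (2 / (1 - r))"
 proof -
  have geo: "(\<Sum>i\<in>I. r ^ i) \<le> 1 / (1 - r)" if "finite I" for I :: "nat set"
  proof -
   have "(\<Sum>i\<in>I. r ^ i) \<le> (\<Sum>i. r ^ i)" by (rule sum_le_suminf) (use r that in \<open>auto intro: summable_geometric\<close>)
   thus ?thesis using suminf_geometric[of r] r by simp
  qed
  have "(\<Sum>c<n. r ^ nat \<bar>int a - int c\<bar>) \<le> (\<Sum>c\<in>{..<a} \<union> {a..<a + n}. r ^ nat \<bar>int a - int c\<bar>)"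
   by (rule sum_mono2) (use r in auto)
  also have "... = (\<Sum>c\<in>{..<a}. r ^ nat \<bar>int a - int c\<bar>) + (\<Sum>c\<in>{a..<a + n}. r ^ nat \<bar>int a - int c\<bar>)"
   by (rule sum.union_disjoint) auto
  also have "(\<Sum>c\<in>{..<a}. r ^ nat \<bar>int a - int c\<bar>) = (\<Sum>i\<in>{1..a}. r ^ i)"
   by (rule sum.reindex_bij_witness[where i = "\<lambda>i. a - i" and j = "\<lambda>c. a - c"]) (auto simp: of_nat_diff intro!: arg_cong[of _ _ "\<lambda>e. r ^ e"])
  also have "(\<Sum>c\<in>{a..<a + n}. r ^ nat \<bar>int a - int c\<bar>) = (\<Sum>i\<in>{..<n}. r ^ i)"
   by (rule sum.reindex_bij_witness[where i = "\<lambda>i. a + i" and j = "\<lambda>c. c - a"]) (auto intro!: arg_cong[of _ _ "\<lambda>e. r ^ e"])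
  finally have "(\<Sum>c<n. r ^ nat \<bar>int a - int c\<bar>) \<le> 1 / (1 - r) + 1 / (1 - r)" using geo[of "{1..a}"] geo[of "{..<n}"] by simp
  hence "(\<Sum>c<n. r ^ nat \<bar>int a - int c\<bar>) \<le> 2 / (1 - r)" by simp
  thus ?thesis unfolding f_def sum_distrib_left[symmetric] using r by (intro mult_left_mono) auto
 qed
 finally show ?thesis by (simp add: bl_const_def r_def)
qed

lemma bl_const_pos: "bl_const \<ge> 0" by (simp add: bl_const_def)

lemma norm_bl_term: "norm (bl_term n g) \<le> bl_bound g"
proof (cases "suppw g \<subseteq> {..<n}")
 case True
 have "norm (bl_term n g) \<le> (\<Prod>a\<in>suppw g. norm (xw a) ^ (2 * g a) * bl_const)"
  unfolding bl_term_def if_P[OF True] prod_norm[symmetric] norm_mult norm_power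
  by (intro prod_mono conjI mult_nonneg_nonneg mult_left_mono norm_hlb_prod[unfolded prod_norm[symmetric]]) (auto intro: prod_nonneg)
 thus ?thesis by (simp add: bl_bound_def mult.commute)
next
 case False
 have "0 \<le> bl_bound g" unfolding bl_bound_def by (intro prod_nonneg) (simp add: bl_const_pos)
 thus ?thesis using False by (simp add: bl_term_def)
qed

lemma bl_term_LIMSEQ:
 assumes "g \<in> gfuns"
 shows "(\<lambda>n. bl_term n g) \<longlonglongrightarrow> bl_lim g"
proof -
 have fin: "finite (suppw g)" using assms by (simp add: gfuns_def)
 have "(\<lambda>n. \<Prod>c<n. if g c < g a then hlb t (xw a) (xw c) else 1) \<longlonglongrightarrow> (\<Prod>c. if g c < g a then hlb t (xw a) (xw c) else 1)" for a
 proof -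
  let ?f = "\<lambda>c. if g c < g a then hlb t (xw a) (xw c) else 1"
  have "summable (\<lambda>c. norm (?f c - 1))"
  proof (rule summable_comparison_test_ev)
   show "eventually (\<lambda>c. norm (norm (?f c - 1)) \<le> 2 / (1 - norm qw) / norm qw ^ a * norm qw ^ c) sequentially"
   proof (rule eventually_sequentiallyI[of "Suc a"])
    fix c assume "Suc a \<le> c"
    then obtain d where d: "c = a + d" "d > 0" using less_imp_add_positive[of a c] by auto
    have "norm (hlb t (xw a) (xw c) - 1) \<le> 2 / (1 - norm qw) * norm qw ^ d"
     using norm_hlb_le(3)[OF qw, of t d "xw a"] t d X_nonzero by (simp add: X_shift)
    moreover have "2 / (1 - norm qw) / norm qw ^ a * norm qw ^ c = 2 / (1 - norm qw) * norm qw ^ d" using qw by (simp add: d power_add)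
    moreover have "0 \<le> 2 / (1 - norm qw) * norm qw ^ d" using qw by simp
    ultimately show "norm (norm (?f c - 1)) \<le> 2 / (1 - norm qw) / norm qw ^ a * norm qw ^ c" by simp
   qed
   show "summable (\<lambda>c. 2 / (1 - norm qw) / norm qw ^ a * norm qw ^ c)" by (intro summable_mult summable_geometric) (use qw in simp)
  qed
  hence "convergent_prod ?f" by (intro abs_convergent_prod_imp_convergent_prod summable_imp_abs_convergent_prod)
  hence "(\<lambda>n. \<Prod>c\<le>n. ?f c) \<longlonglongrightarrow> prodinf ?f" by (rule convergent_prod_LIMSEQ)
  thus ?thesis by (simp only: LIMSEQ_lessThan_iff_atMost)
 qed
 hence "(\<lambda>n. \<Prod>a\<in>suppw g. xw a ^ (2 * g a) * (\<Prod>c<n. if g c < g a then hlb t (xw a) (xw c) else 1)) \<longlonglongrightarrow> bl_lim g"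
  unfolding bl_lim_def by (intro tendsto_prod tendsto_mult tendsto_const)
 moreover have "eventually (\<lambda>n. (\<Prod>a\<in>suppw g. xw a ^ (2 * g a) * (\<Prod>c<n. if g c < g a then hlb t (xw a) (xw c) else 1)) = bl_term n g) sequentially"
 proof -
  obtain m where m: "\<forall>a\<in>suppw g. a < m" using fin finite_nat_set_iff_bounded by auto
  show ?thesis
  proof (rule eventually_sequentiallyI[of m])
   fix n assume "m \<le> n"
   hence "suppw g \<subseteq> {..<n}"
   proof (intro subsetI)
    fix a assume "a \<in> suppw g"
    hence "a < m" using m by simp
    thus "a \<in> {..<n}" using \<open>m \<le> n\<close> by simp
   qed
   thus "(\<Prod>a\<in>suppw g. xw a ^ (2 * g a) * (\<Prod>c<n. if g c < g a then hlb t (xw a) (xw c) else 1)) = bl_term n g"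
    unfolding bl_term_def by (rule if_P[symmetric])
  qed
 qed
 ultimately show ?thesis by (rule Lim_transform_eventually)
qed

text \<open>A finite set of exponent functions lies in some \<open>bounded_funs k {..<n}\<close>,
  over which the sum of products factors into a product of sums over single exponents. Each factor
  exceeds 1 by at most a multiple of \<open>r ^ a\<close>, so these products are bounded in
  \<open>n\<close>.\<close>

lemma bl_bound_summable: "bl_bound summable_on gfuns"
proof (rule nonneg_bounded_partial_sums_imp_summable_on)
 define r where "r = norm qw"
 have r: "0 \<le> r" "r < 1" using qw by (simp_all add: r_def)
 show "bl_bound g \<ge> 0" for g unfolding bl_bound_def by (intro prod_nonneg) (simp add: bl_const_pos)
 show "eventually (\<lambda>F. sum bl_bound F \<le> exp (real k * bl_const * (1 / (1 - r)))) (finite_subsets_at_top gfuns)"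
 proof (rule eventually_finite_subsets_at_top_weakI)
  fix F assume F: "finite F" "F \<subseteq> gfuns"
  have "finite (\<Union>g\<in>F. suppw g)" using F by (auto simp: gfuns_def)
  then obtain n where n: "\<forall>a\<in>(\<Union>g\<in>F. suppw g). a < n" using finite_nat_set_iff_bounded by auto
  define u where "u a j = (if j = 0 then 1 else bl_const * norm (xw a) ^ (2 * j))" for a j
  have sub: "F \<subseteq> bounded_funs k {..<n}"
  proof
   fix g assume g: "g \<in> F"
   hence "g a = 0" if "a \<ge> n" for a using n that by (metis (mono_tags) UN_I mem_Collect_eq not_le)
   thus "g \<in> bounded_funs k {..<n}" using F g by (auto simp: bounded_funs_def gfuns_def)
  qed
  have bu: "bl_bound g = (\<Prod>a<n. u a (g a))" if "g \<in> bounded_funs k {..<n}" for g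
  proof -
   have "suppw g \<subseteq> {..<n}" using that by (force simp: bounded_funs_def)
   hence "(\<Prod>a<n. u a (g a)) = (\<Prod>a\<in>suppw g. u a (g a))" by (intro prod.mono_neutral_right) (auto simp: u_def)
   also have "... = bl_bound g" unfolding bl_bound_def by (rule prod.cong) (auto simp: u_def)
   finally show ?thesis by simp
  qed
  have u0: "u a j \<ge> 0" for a j by (simp add: u_def bl_const_pos)
  have "sum bl_bound F \<le> sum bl_bound (bounded_funs k {..<n})"
   by (rule sum_mono2) (use sub finite_bounded_funs in \<open>auto simp: bl_bound_def bl_const_pos intro!: prod_nonneg\<close>)
  also have "... = (\<Sum>g\<in>bounded_funs k {..<n}. \<Prod>a<n. u a (g a))" by (rule sum.cong[OF refl bu])
  also have "... = (\<Prod>a<n. \<Sum>j\<le>k. u a j)" by (rule sum_bounded_funs)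
  also have "... \<le> (\<Prod>a<n. 1 + real k * bl_const * r ^ a)"
  proof (rule prod_mono, rule conjI)
   fix a
   show "0 \<le> (\<Sum>j\<le>k. u a j)" by (rule sum_nonneg) (rule u0)
   have x2: "norm (xw a) ^ (2 * j) \<le> r ^ a" if j: "j > 0" for j
   proof -
    have "norm (xw a) ^ (2 * j) = norm w ^ ((2 * a + \<sigma> + 1) * (2 * j))" by (simp only: xvar_def norm_power power_mult)
    also have "... \<le> norm w ^ (2 * a)"
    proof (rule power_decreasing)
     have "2 * a \<le> (2 * a + \<sigma> + 1) * 1" by simp
     also have "... \<le> (2 * a + \<sigma> + 1) * (2 * j)" by (rule mult_le_mono2) (use j in simp)
     finally show "2 * a \<le> (2 * a + \<sigma> + 1) * (2 * j)" .
    qed (use w in auto)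
    finally show ?thesis by (simp add: r_def norm_power power_mult)
   qed
   have "(\<Sum>j\<le>k. u a j) = u a 0 + (\<Sum>j=1..k. u a j)" by (simp add: sum.atMost_shift sum.atLeast1_atMost_eq)
   also have "(\<Sum>j=1..k. u a j) \<le> (\<Sum>j=1..k. bl_const * r ^ a)"
    by (rule sum_mono) (use x2 in \<open>auto simp: u_def intro!: mult_left_mono bl_const_pos\<close>)
   finally show "(\<Sum>j\<le>k. u a j) \<le> 1 + real k * bl_const * r ^ a" by (simp add: u_def)
  qed
  also have "... \<le> exp (\<Sum>a<n. real k * bl_const * r ^ a)" by (rule prod_le_exp_sum) (use r bl_const_pos in auto)
  also have "(\<Sum>a<n. real k * bl_const * r ^ a) \<le> real k * bl_const * (1 / (1 - r))"
  proof -
   have "(\<Sum>a<n. r ^ a) \<le> (\<Sum>a. r ^ a)" by (rule sum_le_suminf) (use r in \<open>auto intro: summable_geometric\<close>)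
   hence "(\<Sum>a<n. r ^ a) \<le> 1 / (1 - r)" using suminf_geometric[of r] r by simp
   thus ?thesis unfolding sum_distrib_left[symmetric] by (intro mult_left_mono) (auto simp: bl_const_pos)
  qed
  finally show "sum bl_bound F \<le> exp (real k * bl_const * (1 / (1 - r)))" by simp
 qed
qed

lemma bl_term_eq:
 assumes "suppw g \<subseteq> {..<n}"
 shows "bl_term n g = (\<Prod>a<n. xw a ^ (2 * g a)) * inv_prod t xw {..<n} g"
proof -
 have "(\<Prod>c\<in>{c. c < n \<and> g c < g a}. hlb t (xw a) (xw c)) = (\<Prod>c<n. if g c < g a then hlb t (xw a) (xw c) else 1)" for a
 proof -
  have "{c. c < n \<and> g c < g a} = {c\<in>{..<n}. g c < g a}" by auto
  thus ?thesis by (simp only: prod.inter_filter finite_lessThan)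
 qed
 hence "(\<Prod>a<n. xw a ^ (2 * g a)) * inv_prod t xw {..<n} g =
   (\<Prod>a<n. xw a ^ (2 * g a) * (\<Prod>c<n. if g c < g a then hlb t (xw a) (xw c) else 1))"
  unfolding inv_prod_nested by (simp only: prod.distrib)
 also have "... = (\<Prod>a\<in>suppw g. xw a ^ (2 * g a) * (\<Prod>c<n. if g c < g a then hlb t (xw a) (xw c) else 1))"
  by (rule prod.mono_neutral_right) (use assms in auto)
 finally show ?thesis using assms by (simp add: bl_term_def)
qed

lemma bounded_funs_eq: "bounded_funs k {..<n} = {g\<in>gfuns. suppw g \<subseteq> {..<n}}"
proof (intro set_eqI iffI)
 fix g assume g: "g \<in> bounded_funs k {..<n}"
 hence s: "suppw g \<subseteq> {..<n}" by (force simp: bounded_funs_def)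
 moreover have "finite (suppw g)" using s by (rule finite_subset) simp
 moreover have "g a \<le> k" for a using g by (cases "a < n") (auto simp: bounded_funs_def)
 ultimately show "g \<in> {g\<in>gfuns. suppw g \<subseteq> {..<n}}" by (simp add: gfuns_def)
next
 fix g assume "g \<in> {g\<in>gfuns. suppw g \<subseteq> {..<n}}"
 thus "g \<in> bounded_funs k {..<n}" by (auto simp: bounded_funs_def gfuns_def)
qed

lemma infsum_bl_term:
 assumes "G \<subseteq> gfuns"
 shows "(\<Sum>\<^sub>\<infinity>g\<in>G. bl_term n g) = (\<Sum>g\<in>{g\<in>G. suppw g \<subseteq> {..<n}}. (\<Prod>a<n. xw a ^ (2 * g a)) * inv_prod t xw {..<n} g)"
proof -
 have fin: "finite {g\<in>G. suppw g \<subseteq> {..<n}}"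
 proof (rule finite_subset)
  show "{g\<in>G. suppw g \<subseteq> {..<n}} \<subseteq> bounded_funs k {..<n}" unfolding bounded_funs_eq using assms by blast
 qed (rule finite_bounded_funs, simp)
 have "(\<Sum>\<^sub>\<infinity>g\<in>G. bl_term n g) = (\<Sum>\<^sub>\<infinity>g\<in>{g\<in>G. suppw g \<subseteq> {..<n}}. bl_term n g)"
  by (rule infsum_cong_neutral) (auto simp: bl_term_def)
 also have "... = (\<Sum>g\<in>{g\<in>G. suppw g \<subseteq> {..<n}}. bl_term n g)" using fin by simp
 also have "... = (\<Sum>g\<in>{g\<in>G. suppw g \<subseteq> {..<n}}. (\<Prod>a<n. xw a ^ (2 * g a)) * inv_prod t xw {..<n} g)"
  by (rule sum.cong) (auto simp: bl_term_eq)
 finally show ?thesis .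
qed

definition even_shape :: "(nat \<Rightarrow> nat) \<Rightarrow> nat list" where
 "even_shape g = shape (\<lambda>a. 2 * g a)"

lemma mset_even_shape: "mset (even_shape g) = image_mset (\<lambda>a. 2 * g a) (mset_set (suppw g))" by (simp add: even_shape_def mset_shape)

text \<open>The power of \<open>q\<close> in the theorem is absorbed into the variables: scaling all
  of them by \<open>w ^ (\<sigma> + 1)\<close> multiplies the symmetrization by that factor to the
  power \<open>sum_list lam\<close> and leaves every \<open>hlb\<close> unchanged. Partitions with
  more than \<open>n\<close> parts give 0 on both sides.\<close>

lemma hall_littlewood_bl_term:
 assumes lam: "is_partition lam" and even: "\<And>m. m \<in> set lam \<Longrightarrow> even m \<and> m \<le> 2 * k"
 shows "qw ^ ((\<sigma> + 1) * sum_list lam div 2) * hall_littlewood n lam t (\<lambda>i. qw ^ i) =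
  (\<Sum>\<^sub>\<infinity>g\<in>{g\<in>gfuns. even_shape g = lam}. bl_term n g)"
proof (cases "length lam \<le> n")
 case False
 have "bl_term n g = 0" if g: "g \<in> gfuns" "even_shape g = lam" for g
 proof -
  have "length lam = card (suppw g)" using arg_cong[OF mset_even_shape[of g], of size] g by simp
  hence "\<not> suppw g \<subseteq> {..<n}" using False card_mono[of "{..<n}" "suppw g"] by auto
  thus ?thesis by (simp add: bl_term_def)
 qed
 hence "(\<Sum>\<^sub>\<infinity>g\<in>{g\<in>gfuns. even_shape g = lam}. bl_term n g) = 0" by (intro infsum_0) auto
 thus ?thesis using False by (simp add: hall_littlewood_def)
next
 case True
 let ?G = "{g\<in>{g\<in>gfuns. even_shape g = lam}. suppw g \<subseteq> {..<n}}"
 define F where "F = {f. (\<forall>a\<ge>n. f a = 0) \<and> shape f = lam}"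
 have inj: "inj_on (\<lambda>i. qw ^ i) {..<n}"
 proof (rule inj_onI)
  fix i j assume "qw ^ i = qw ^ j"
  hence "norm qw ^ i = norm qw ^ j" by (metis norm_power)
  thus "i = j" by (rule power_inject_exp'[THEN iffD1, rotated -1]) (use qw in auto)
 qed
 have "qw ^ ((\<sigma> + 1) * sum_list lam div 2) * hall_littlewood n lam t (\<lambda>i. qw ^ i) =
   (\<Sum>f\<in>F. qw ^ ((\<sigma> + 1) * sum_list lam div 2) * ((\<Prod>a<n. (qw ^ a) ^ f a) * inv_prod t (\<lambda>i. qw ^ i) {..<n} f))"
  unfolding hall_littlewood_eq[OF inj True] hl_sym_eq_sum(2)[OF inj t lam True] F_def sum_distrib_left ..
 also have "... = (\<Sum>g\<in>?G. (\<Prod>a<n. xw a ^ (2 * g a)) * inv_prod t xw {..<n} g)"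
 proof (rule sum.reindex_bij_witness[where i = "\<lambda>g a. 2 * g a" and j = "\<lambda>f a. f a div 2"])
  have val: "even (f a) \<and> f a \<le> 2 * k" and supp_f: "finite (suppw f)" if f: "f \<in> F" for f a
  proof -
   have s: "suppw f \<subseteq> {..<n}" using f unfolding F_def supp_subset_iff by simp
   thus fin: "finite (suppw f)" by (rule finite_subset) simp
   show "even (f a) \<and> f a \<le> 2 * k"
   proof (cases "f a = 0")
    case False
    have "set lam = f ` suppw f" using f arg_cong[OF mset_shape[of f], of set_mset] fin by (simp add: F_def)
    thus ?thesis using even False by auto
   qed simp
  qed
  show d: "(\<lambda>a. 2 * (f a div 2)) = f" if "f \<in> F" for f using val[OF that] by auto
  show "(\<lambda>a. f a div 2) \<in> ?G" if f: "f \<in> F" for f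
  proof -
   have "suppw (\<lambda>a. f a div 2) \<subseteq> suppw f" by auto
   moreover have "suppw f \<subseteq> {..<n}" using f unfolding F_def supp_subset_iff by simp
   moreover have "f a div 2 \<le> k" for a using val[OF f, of a] by auto
   moreover have "even_shape (\<lambda>a. f a div 2) = lam" unfolding even_shape_def d[OF f] using f by (simp add: F_def)
   ultimately show ?thesis using supp_f[OF f] by (auto simp: gfuns_def intro: finite_subset)
  qed
  show "(\<lambda>a. 2 * g a div 2) = g" for g :: "nat \<Rightarrow> nat" by simp
  show "(\<lambda>a. 2 * g a) \<in> F" if g: "g \<in> ?G" for g using g unfolding F_def supp_subset_iff by (simp add: even_shape_def)
  show "(\<Prod>a<n. xw a ^ (2 * (f a div 2))) * inv_prod t xw {..<n} (\<lambda>a. f a div 2) =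
    qw ^ ((\<sigma> + 1) * sum_list lam div 2) * ((\<Prod>a<n. (qw ^ a) ^ f a) * inv_prod t (\<lambda>i. qw ^ i) {..<n} f)" if f: "f \<in> F" for f
  proof -
   define g where "g a = f a div 2" for a
   have fg: "f a = 2 * g a" for a using fun_cong[OF d[OF f], of a] by (simp add: g_def)
   have s: "suppw f \<subseteq> {..<n}" using f unfolding F_def supp_subset_iff by simp
   have "sum_list lam = sum_mset (mset (shape f))" using f by (simp add: F_def sum_mset_sum_list)
   also have "... = (\<Sum>a\<in>suppw f. f a)" by (simp add: mset_shape sum_unfold_sum_mset)
   also have "... = (\<Sum>a<n. f a)" by (rule sum.mono_neutral_left) (use s in auto)
   finally have "sum_list lam = 2 * (\<Sum>a<n. g a)" by (simp add: fg sum_distrib_left)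
   \<comment> \<open>The sum of the parts is even, so the truncating division loses nothing.\<close>
   hence "(\<sigma> + 1) * sum_list lam div 2 = 2 * ((\<sigma> + 1) * (\<Sum>a<n. g a)) div 2" by (simp only: mult.left_commute)
   also have "... = (\<sigma> + 1) * (\<Sum>a<n. g a)" by (rule nonzero_mult_div_cancel_left) simp
   finally have "(\<sigma> + 1) * sum_list lam div 2 = (\<Sum>a<n. (\<sigma> + 1) * g a)" by (simp only: sum_distrib_left)
   hence e1: "qw ^ ((\<sigma> + 1) * sum_list lam div 2) = (\<Prod>a<n. qw ^ ((\<sigma> + 1) * g a))" by (simp only: power_sum)
   have "qw ^ ((\<sigma> + 1) * g a) * (qw ^ a) ^ (2 * g a) = xw a ^ (2 * g a)" for a
   proof -
    have "2 * ((\<sigma> + 1) * g a) + 2 * a * (2 * g a) = (2 * a + \<sigma> + 1) * (2 * g a)" by (simp add: algebra_simps)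
    thus ?thesis unfolding xvar_def power_mult[symmetric] power_add[symmetric] by (simp only:)
   qed
   hence e2: "(\<Prod>a<n. qw ^ ((\<sigma> + 1) * g a)) * (\<Prod>a<n. (qw ^ a) ^ f a) = (\<Prod>a<n. xw a ^ (2 * g a))"
    unfolding prod.distrib[symmetric] fg by simp
   have "hlb t (xw a) (xw c) = hlb t (qw ^ a) (qw ^ c)" for a c
   proof -
    have "xw b = w ^ (\<sigma> + 1) * qw ^ b" for b
    proof -
     have "2 * b + \<sigma> + 1 = (\<sigma> + 1) + 2 * b" by simp
     thus ?thesis unfolding xvar_def power_mult[symmetric] power_add[symmetric] by (simp only:)
    qed
    thus ?thesis using hlb_scale[of "w ^ (\<sigma> + 1)"] w by simp
   qed
   hence e3: "inv_prod t xw {..<n} g = inv_prod t (\<lambda>i. qw ^ i) {..<n} f" unfolding inv_prod_def by (simp add: fg)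
   show ?thesis unfolding g_def[symmetric] e1 e2[symmetric] e3 by (simp only: mult.assoc)
  qed
 qed
 also have "... = (\<Sum>\<^sub>\<infinity>g\<in>{g\<in>gfuns. even_shape g = lam}. bl_term n g)" by (rule infsum_bl_term[symmetric]) auto
 finally show ?thesis .
qed

text \<open>Dominated convergence is applied twice: to all exponent functions, where it yields
  \<open>V\<close>, and to those of a given shape, where it identifies the specialization in
  infinitely many variables. The sum over all functions is then grouped by shape.\<close>

theorem has_sum_hall_littlewood:
 assumes lim: "(\<lambda>n. bl_sum t xw {..<n} k) \<longlonglongrightarrow> V"
 shows "((\<lambda>lam. qw ^ ((\<sigma> + 1) * sum_list lam div 2) * hall_littlewood_spec lam qw t) has_sum V)
  {lam. is_partition lam \<and> (\<forall>m\<in>set lam. even m \<and> m \<le> 2 * k)}" (is "(?P has_sum V) ?L")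
proof -
 let ?G = "\<lambda>lam. {g\<in>gfuns. even_shape g = lam}"
 have tann: "bl_lim summable_on G" "(\<lambda>n. \<Sum>\<^sub>\<infinity>g\<in>G. bl_term n g) \<longlonglongrightarrow> (\<Sum>\<^sub>\<infinity>g\<in>G. bl_lim g)" if "G \<subseteq> gfuns" for G
 proof -
  have b: "bl_bound summable_on G" using bl_bound_summable that by (rule summable_on_subset_banach)
  have l: "\<And>g. g \<in> G \<Longrightarrow> (\<lambda>n. bl_term n g) \<longlonglongrightarrow> bl_lim g" using bl_term_LIMSEQ that by auto
  show "bl_lim summable_on G" by (rule tannery_infsum(1)[where f = "\<lambda>g n. bl_term n g" and h = bl_bound, OF l norm_bl_term b])
  show "(\<lambda>n. \<Sum>\<^sub>\<infinity>g\<in>G. bl_term n g) \<longlonglongrightarrow> (\<Sum>\<^sub>\<infinity>g\<in>G. bl_lim g)"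
   by (rule tannery_infsum(2)[where f = "\<lambda>g n. bl_term n g" and h = bl_bound, OF l norm_bl_term b])
 qed
 have "(\<Sum>\<^sub>\<infinity>g\<in>gfuns. bl_term n g) = bl_sum t xw {..<n} k" for n
  unfolding infsum_bl_term[OF subset_refl] bl_sum_def bounded_funs_eq ..
 hence eV: "(\<Sum>\<^sub>\<infinity>g\<in>gfuns. bl_lim g) = V" using LIMSEQ_unique[OF tann(2)[OF subset_refl]] lim by simp
 have V: "(bl_lim has_sum V) gfuns" using has_sum_infsum[OF tann(1)[OF subset_refl]] unfolding eV .
 have P: "?P lam = (\<Sum>\<^sub>\<infinity>g\<in>?G lam. bl_lim g)" if lam: "lam \<in> ?L" for lam
 proof -
  let ?c = "qw ^ ((\<sigma> + 1) * sum_list lam div 2)"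
  have c: "?c \<noteq> 0" using w by simp
  have "(\<lambda>n. ?c * hall_littlewood n lam t (\<lambda>i. qw ^ i)) \<longlonglongrightarrow> (\<Sum>\<^sub>\<infinity>g\<in>?G lam. bl_lim g)"
  proof -
   have e: "(\<lambda>n. ?c * hall_littlewood n lam t (\<lambda>i. qw ^ i)) = (\<lambda>n. \<Sum>\<^sub>\<infinity>g\<in>?G lam. bl_term n g)"
    by (rule ext, rule hall_littlewood_bl_term) (use lam in auto)
   show ?thesis unfolding e by (rule tann(2)) auto
  qed
  hence "(\<lambda>n. (?c * hall_littlewood n lam t (\<lambda>i. qw ^ i)) / ?c) \<longlonglongrightarrow> (\<Sum>\<^sub>\<infinity>g\<in>?G lam. bl_lim g) / ?c"
   by (rule tendsto_divide[OF _ tendsto_const c])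
  moreover have "(\<lambda>n. (?c * hall_littlewood n lam t (\<lambda>i. qw ^ i)) / ?c) = (\<lambda>n. hall_littlewood n lam t (\<lambda>i. qw ^ i))"
   using c by (intro ext) (rule nonzero_mult_div_cancel_left)
  ultimately have "(\<lambda>n. hall_littlewood n lam t (\<lambda>i. qw ^ i)) \<longlonglongrightarrow> (\<Sum>\<^sub>\<infinity>g\<in>?G lam. bl_lim g) / ?c" by (simp only:)
  hence e: "hall_littlewood_spec lam qw t = (\<Sum>\<^sub>\<infinity>g\<in>?G lam. bl_lim g) / ?c" unfolding hall_littlewood_spec_def by (rule limI)
  show ?thesis unfolding e times_divide_eq_right by (rule nonzero_mult_div_cancel_left[OF c])
 qed
 have even_shape_L: "even_shape g \<in> ?L" if g: "g \<in> gfuns" for g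
 proof -
  have "suppw (\<lambda>a. 2 * g a) = suppw g" by auto
  hence fin: "finite (suppw (\<lambda>a. 2 * g a))" using g unfolding gfuns_def by simp
  have "set (even_shape g) = (\<lambda>a. 2 * g a) ` suppw g" using arg_cong[OF mset_even_shape[of g], of set_mset] g by (simp add: gfuns_def)
  thus ?thesis using is_partition_shape[OF fin] g by (auto simp: even_shape_def gfuns_def)
 qed
 have "((\<lambda>(lam, g). bl_lim g) has_sum V) (SIGMA lam:?L. ?G lam)"
 proof -
  have "bij_betw (\<lambda>g. (even_shape g, g)) gfuns (SIGMA lam:?L. ?G lam)" by (rule bij_betwI[where g = snd]) (use even_shape_L in auto)
  from has_sum_reindex_bij_betw[OF this, of "\<lambda>(lam, g). bl_lim g" V] show ?thesis using V by simp
 qed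
 thus ?thesis
 proof (rule has_sum_SigmaD)
  fix lam assume lam: "lam \<in> ?L"
  have "(bl_lim has_sum (\<Sum>\<^sub>\<infinity>g\<in>?G lam. bl_lim g)) (?G lam)" by (rule has_sum_infsum[OF tann(1)]) auto
  thus "((\<lambda>g. (\<lambda>(lam, g). bl_lim g) (lam, g)) has_sum ?P lam) (?G lam)" unfolding P[OF lam] prod.case .
 qed
qed

end

section \<open>The constant factor\<close>

lemma power_less_of_less:
 fixes x :: real
 assumes "0 < x" "x < 1" "m < n"
 shows "x ^ n < x ^ m" by (rule power_strict_decreasing) (use assms in auto)

text \<open>At \<open>t = 1\<close> all pair factors are 1, so the sum over subsets is an expanded
  product with one two-term factor for each variable.\<close>

lemma sign_sum_1:
 assumes "lw_generic x A" "\<And>a. a \<in> A \<Longrightarrow> norm (x a) < 1"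
 shows "sign_sum 1 x A k = (\<Prod>a\<in>A. (1 - x a ^ (2 * Suc k)) / (1 - (x a)\<^sup>2))"
proof -
 have fin: "finite A" using assms by (simp add: lw_generic_def)
 let ?f = "\<lambda>a. - (x a ^ (2 * Suc k)) / (1 - (x a)\<^sup>2)" and ?g = "\<lambda>a. 1 / (1 - (x a)\<^sup>2)"
 have "(\<Prod>i\<in>B. x i ^ (2 * k)) * lw_phi 1 (flip B x) A = (\<Prod>a\<in>B. ?f a) * (\<Prod>a\<in>A - B. ?g a)" if B: "B \<subseteq> A" for B
 proof -
  have gf: "lw_generic (flip B x) A" using assms(1) by (rule lw_generic_flip)
  have "pair_prod A (\<lambda>i j. lw_factor 1 (flip B x i) (flip B x j)) = 1" unfolding pair_prod_def
  proof (rule prod.neutral, clarify)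
   fix i j assume "i \<in> A" "j \<in> A" "i < j"
   hence "flip B x i * flip B x j \<noteq> 1" using gf by (auto simp: lw_generic_def)
   thus "lw_factor 1 (flip B x i) (flip B x j) = 1" by (simp add: lw_factor_def)
  qed
  hence "lw_phi 1 (flip B x) A = (\<Prod>a\<in>A. 1 / (1 - (flip B x a)\<^sup>2))" by (simp add: lw_phi_def)
  also have "... = (\<Prod>a\<in>B. 1 / (1 - (flip B x a)\<^sup>2)) * (\<Prod>a\<in>A - B. 1 / (1 - (flip B x a)\<^sup>2))"
   by (subst prod.subset_diff[OF B fin]) (rule mult.commute)
  also have "(\<Prod>a\<in>A - B. 1 / (1 - (flip B x a)\<^sup>2)) = (\<Prod>a\<in>A - B. ?g a)" by (rule prod.cong) (auto simp: flip_def)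
  finally have "(\<Prod>i\<in>B. x i ^ (2 * k)) * lw_phi 1 (flip B x) A =
    (\<Prod>a\<in>B. x a ^ (2 * k) * (1 / (1 - (flip B x a)\<^sup>2))) * (\<Prod>a\<in>A - B. ?g a)" by (simp only: prod.distrib mult.assoc)
  also have "(\<Prod>a\<in>B. x a ^ (2 * k) * (1 / (1 - (flip B x a)\<^sup>2))) = (\<Prod>a\<in>B. ?f a)"
  proof (rule prod.cong[OF refl])
   fix a assume a: "a \<in> B"
   hence x0: "x a \<noteq> 0" and x1: "x a * x a \<noteq> 1" using assms(1) B by (auto simp: lw_generic_def)
   have "y * (1 / (1 - (1 / u)\<^sup>2)) = - (y * (u * u)) / (1 - u\<^sup>2)" if "u \<noteq> 0" "u * u \<noteq> 1" for u y :: complex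
   proof -
    have "1 - (1 / u)\<^sup>2 = - (1 - u\<^sup>2) / (u * u)" using that by (simp add: field_simps power2_eq_square)
    moreover have "y * (1 / (- d / v)) = - (y * v) / d" for d v :: complex by simp
    ultimately show ?thesis by (simp only:)
   qed
   from this[OF x0 x1, of "x a ^ (2 * k)"] show "x a ^ (2 * k) * (1 / (1 - (flip B x a)\<^sup>2)) = ?f a" using a by (simp add: flip_def mult_ac)
  qed
  finally show ?thesis .
 qed
 hence "sign_sum 1 x A k = (\<Sum>B\<in>Pow A. (\<Prod>a\<in>B. ?f a) * (\<Prod>a\<in>A - B. ?g a))"
  unfolding sign_sum_def by (intro sum.cong refl) auto
 also have "... = (\<Prod>a\<in>A. ?f a + ?g a)" by (rule prod_add[OF fin, symmetric])
 also have "... = (\<Prod>a\<in>A. (1 - x a ^ (2 * Suc k)) / (1 - (x a)\<^sup>2))"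
  by (rule prod.cong) (simp_all add: add_divide_distrib[symmetric] diff_divide_distrib)
 finally show ?thesis .
qed

text \<open>The product as the limit delivers it, with exponents lowered by \<open>\<sigma>\<close>;
  \<open>theta_pairs_eq\<close> brings it into the form of the theorem.\<close>

definition theta_pairs :: "complex \<Rightarrow> complex \<Rightarrow> nat \<Rightarrow> nat \<Rightarrow> complex" where
 "theta_pairs q p \<sigma> k = (\<Prod>j\<in>{1..k}. theta (q ^ (2 * j - \<sigma>)) p * (\<Prod>i\<in>{1..<j}. theta (q ^ (j - i)) p * theta (q ^ (i + j - \<sigma>)) p))"

lemma gam_theta_prod:
 assumes w: "w \<noteq> 0" and \<sigma>: "\<sigma> = 0 \<or> \<sigma> = 1"
 shows "gam w \<sigma> k * theta_prod p k (\<lambda>j. w ^ (2 * Suc j - \<sigma>)) = theta_pairs (w\<^sup>2) p \<sigma> k"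
proof -
 let ?X = "\<lambda>j. w ^ (2 * Suc j - \<sigma>)"
 let ?q = "w\<^sup>2"
 have sq: "(?X j)\<^sup>2 = ?q ^ (2 * Suc j - \<sigma>)" for j by (simp only: power_mult[symmetric] mult.commute)
 have ra: "?X j / ?X i = ?q ^ (Suc j - Suc i)" if "i < j" for i j
 proof -
  have "2 * Suc j - \<sigma> = 2 * (Suc j - Suc i) + (2 * Suc i - \<sigma>)" using that \<sigma> by auto
  hence "?X j = ?q ^ (Suc j - Suc i) * ?X i" by (simp only: power_add power_mult)
  moreover have "?X i \<noteq> 0" using w by simp
  moreover have "a / c = b" if "a = b * c" "c \<noteq> 0" for a b c :: complex using that by simp
  ultimately show ?thesis by metis
 qed
 have mu: "?X i * ?X j = ?q ^ (Suc i + Suc j - \<sigma>)" for i j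
 proof -
  have "2 * Suc i - \<sigma> + (2 * Suc j - \<sigma>) = 2 * (Suc i + Suc j - \<sigma>)" using \<sigma> by auto
  thus ?thesis by (simp only: power_mult[symmetric] power_add[symmetric])
 qed
 have "(\<Prod>(i, j)\<in>{(i, j). i < j \<and> j < k}. theta (?X j / ?X i) p * theta (?X i * ?X j) p) =
   (\<Prod>(j, i)\<in>(SIGMA j:{..<k}. {..<j}). theta (?q ^ (Suc j - Suc i)) p * theta (?q ^ (Suc i + Suc j - \<sigma>)) p)"
 proof (rule prod.reindex_bij_witness[where i = "\<lambda>(j, i). (i, j)" and j = "\<lambda>(i, j). (j, i)"], goal_cases)
  case (5 a)
  then obtain i j where "a = (i, j)" and ij: "i < j" by auto
  thus ?case by (simp only: prod.case ra[OF ij] mu)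
 qed auto
 also have "... = (\<Prod>j<k. \<Prod>i<j. theta (?q ^ (Suc j - Suc i)) p * theta (?q ^ (Suc i + Suc j - \<sigma>)) p)"
  by (rule prod.Sigma[symmetric]) auto
 finally have P: "(\<Prod>(i, j)\<in>{(i, j). i < j \<and> j < k}. theta (?X j / ?X i) p * theta (?X i * ?X j) p) =
   (\<Prod>j<k. \<Prod>i<j. theta (?q ^ (Suc j - Suc i)) p * theta (?q ^ (Suc i + Suc j - \<sigma>)) p)" .
 have "gam w \<sigma> k * (\<Prod>j<k. (1 / ?X j) ^ Suc j) = (\<Prod>j<k. w ^ (Suc j)\<^sup>2 * w ^ (Suc j * (Suc j - \<sigma>)) * (1 / ?X j) ^ Suc j)"
  by (simp only: gam_def prod.distrib)
 also have "... = (\<Prod>j<k. 1)"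
 proof (rule prod.cong[OF refl])
  fix j
  have "(Suc j)\<^sup>2 + Suc j * (Suc j - \<sigma>) = (2 * Suc j - \<sigma>) * Suc j"
   using \<sigma> by (elim disjE) (simp_all add: power2_eq_square algebra_simps)
  hence "w ^ (Suc j)\<^sup>2 * w ^ (Suc j * (Suc j - \<sigma>)) = ?X j ^ Suc j" by (simp only: power_add[symmetric] power_mult[symmetric])
  moreover have "u * (1 / v) ^ n = 1" if "u = v ^ n" "v \<noteq> 0" for u v :: complex and n using that by (simp add: power_divide)
  ultimately show "w ^ (Suc j)\<^sup>2 * w ^ (Suc j * (Suc j - \<sigma>)) * (1 / ?X j) ^ Suc j = 1" using w by (metis power_not_zero)
 qed
 finally have g: "gam w \<sigma> k * (\<Prod>j<k. (1 / ?X j) ^ Suc j) = 1" by simp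
 have "gam w \<sigma> k * theta_prod p k ?X = (gam w \<sigma> k * (\<Prod>j<k. (1 / ?X j) ^ Suc j)) *
   (\<Prod>j<k. theta (?q ^ (2 * Suc j - \<sigma>)) p * (\<Prod>i<j. theta (?q ^ (Suc j - Suc i)) p * theta (?q ^ (Suc i + Suc j - \<sigma>)) p))"
  unfolding theta_prod_def P sq by (simp only: prod.distrib mult.assoc)
 also have "(\<Prod>j<k. theta (?q ^ (2 * Suc j - \<sigma>)) p * (\<Prod>i<j. theta (?q ^ (Suc j - Suc i)) p * theta (?q ^ (Suc i + Suc j - \<sigma>)) p)) =
   theta_pairs ?q p \<sigma> k" unfolding theta_pairs_def
 proof (rule prod.reindex_bij_witness[where i = "\<lambda>j. j - 1" and j = Suc])
  fix j assume "j \<in> {..<k}"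
  have "(\<Prod>i<j. theta (?q ^ (Suc j - Suc i)) p * theta (?q ^ (Suc i + Suc j - \<sigma>)) p) =
    (\<Prod>i\<in>{1..<Suc j}. theta (?q ^ (Suc j - i)) p * theta (?q ^ (i + Suc j - \<sigma>)) p)"
   by (rule prod.reindex_bij_witness[where i = "\<lambda>i. i - 1" and j = Suc]) auto
  thus "theta (?q ^ (2 * Suc j - \<sigma>)) p * (\<Prod>i\<in>{1..<Suc j}. theta (?q ^ (Suc j - i)) p * theta (?q ^ (i + Suc j - \<sigma>)) p) =
    theta (?q ^ (2 * Suc j - \<sigma>)) p * (\<Prod>i<j. theta (?q ^ (Suc j - Suc i)) p * theta (?q ^ (Suc i + Suc j - \<sigma>)) p)"
   by (simp only:)
 qed auto
 finally show ?thesis unfolding g by simp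
qed

lemma gam_nonzero: "w \<noteq> 0 \<Longrightarrow> gam w \<sigma> k \<noteq> 0" by (simp add: gam_def)

text \<open>For \<open>t = 1\<close> the alternating sum factors completely, which determines the constant.\<close>
lemma psi_det_at_powers:
 assumes s: "norm s < 1" "s \<noteq> 0" and p: "p = s ^ (2 * Suc k)"
 shows "psi_det p k (\<lambda>j. s ^ Suc j) = qpoch_inf p p ^ k * theta_prod p k (\<lambda>j. s ^ Suc j)"
proof -
 \<comment> \<open>Here \<open>v\<close> and \<open>s\<close> take the places of \<open>w\<close>
   and \<open>q\<close>, with \<open>\<sigma> = 0\<close> and \<open>t = 1\<close>. Then
   \<open>t * w ^ (4 * Suc k)\<close> becomes \<open>p\<close>, and the points of the determinant
   are the powers of \<open>s\<close>.\<close>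
 define v where "v = csqrt s"
 have v2: "v\<^sup>2 = s" by (simp add: v_def)
 have v: "norm v < 1" "v \<noteq> 0"
 proof -
  show "v \<noteq> 0" using v2 s by auto
  show "norm v < 1"
  proof (rule ccontr)
   assume "\<not> norm v < 1"
   hence "1 \<le> norm v ^ 2" by (simp add: one_le_power)
   thus False using s(1) unfolding v2[symmetric] norm_power by simp
  qed
 qed
 let ?x = "xvar v 0"
 have s2: "norm (s\<^sup>2) < 1" using s by (simp add: norm_power power_less_one_iff)
 have pn: "norm p < 1" unfolding p using s by (simp add: norm_power power_less_one_iff del: power_Suc)
 have ne1: "qpoch_inf s (s\<^sup>2) \<noteq> 0"
 proof
  assume "qpoch_inf s (s\<^sup>2) = 0"
  then obtain i where "s * (s\<^sup>2) ^ i = 1" using qpoch_inf_eq_0_iff[OF s2] by auto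
  hence "1 - s ^ Suc (2 * i) = 0" by (simp add: power_mult)
  thus False using one_minus_power_nonzero[OF s(1)] by blast
 qed
 have vp: "1 * v ^ (4 * Suc k) = p"
 proof -
  have "4 * Suc k = 2 * (2 * Suc k)" by simp
  thus ?thesis unfolding p by (simp only: power_mult v2 mult_1)
 qed
 have vX: "(\<lambda>j. v ^ (2 * Suc j - 0)) = (\<lambda>j. s ^ Suc j)" by (simp only: diff_zero power_mult v2)
 have lim1: "(\<lambda>n. theta_det 1 k n (tc v 0 n)) \<longlonglongrightarrow> gam v 0 k / qpoch_inf s s ^ k * psi_det p k (\<lambda>j. s ^ Suc j)"
  using theta_det_LIMSEQ[OF v, of 0 1 k] unfolding vp vX v2 by simp
 \<comment> \<open>With \<open>x = v ^ (2 * a + 1)\<close> one has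
   \<open>x ^ (2 * Suc k) = s ^ Suc k * p ^ a\<close> and \<open>x^2 = s * (s^2) ^ a\<close>, so the
   factored sum is a ratio of finite products with bases \<open>p\<close> and
   \<open>s^2\<close>.\<close>
 have "theta_det 1 k n (tc v 0 n) = (\<Prod>a<n. (1 - s ^ Suc k * p ^ a)) / (\<Prod>a<n. (1 - s * (s\<^sup>2) ^ a))" for n
 proof -
  have gen: "lw_generic ?x {..<n}" by (rule lw_generic_xs[OF v]) simp
  have x1: "norm (?x a) < 1" for a :: nat by (rule norm_xs_less[OF v]) simp
  have "sign_sum 1 ?x {..<n} k = theta_det 1 k n (tc v 0 n)"
  proof (rule sign_sum_eq_det[OF _ gen x1, of 1 "of_nat 0"])
   fix z :: complex assume "z \<noteq> 0"
   thus "(1 + of_nat 0 / z) * kern ?x {..<n} z = (\<Sum>m=- int (Suc n)..int n. tc v 0 n m * z powi m)" by (intro kern_xs[OF v]) simp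
  qed auto
  moreover have "sign_sum 1 ?x {..<n} k = (\<Prod>a<n. (1 - ?x a ^ (2 * Suc k)) / (1 - (?x a)\<^sup>2))" by (rule sign_sum_1[OF gen x1])
  moreover have "(?x a)\<^sup>2 = s * (s\<^sup>2) ^ a" for a :: nat
  proof -
   have "(2 * a + 0 + 1) * 2 = 2 * (1 + 2 * a)" by simp
   hence "(?x a)\<^sup>2 = s ^ (1 + 2 * a)" unfolding xvar_def power_mult[symmetric] v2[symmetric] by (simp only:)
   thus ?thesis by (simp only: power_add power_one_right power_mult)
  qed
  moreover have "?x a ^ (2 * Suc k) = s ^ Suc k * p ^ a" for a :: nat
  proof -
   have "(2 * a + 0 + 1) * (2 * Suc k) = 2 * (Suc k + 2 * Suc k * a)" by simp
   hence "?x a ^ (2 * Suc k) = s ^ (Suc k + 2 * Suc k * a)" unfolding xvar_def power_mult[symmetric] v2[symmetric] by (simp only:)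
   thus ?thesis by (simp only: power_add power_mult p)
  qed
  ultimately show ?thesis by (simp only: prod_dividef)
 qed
 moreover have "(\<lambda>n. (\<Prod>a<n. (1 - s ^ Suc k * p ^ a)) / (\<Prod>a<n. (1 - s * (s\<^sup>2) ^ a))) \<longlonglongrightarrow> qpoch_inf (s ^ Suc k) p / qpoch_inf s (s\<^sup>2)"
 by (rule tendsto_divide[OF qpoch_inf_LIMSEQ[OF pn] qpoch_inf_LIMSEQ[OF s2] ne1])
 ultimately have e: "gam v 0 k / qpoch_inf s s ^ k * psi_det p k (\<lambda>j. s ^ Suc j) = qpoch_inf (s ^ Suc k) p / qpoch_inf s (s\<^sup>2)"
  using LIMSEQ_unique[OF lim1] by simp
 have ne2: "qpoch_inf s s \<noteq> 0" by (rule qpoch_inf_self_nonzero[OF s(1)])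
 have "qpoch_inf p p ^ k * theta_pairs s p 0 k * qpoch_inf s (s\<^sup>2) = qpoch_inf s s ^ k * qpoch_inf (s ^ Suc k) p"
  using theta_product_at_powers[OF s p] unfolding theta_pairs_def by (simp only: diff_zero)
 moreover have "theta_pairs s p 0 k = gam v 0 k * theta_prod p k (\<lambda>j. s ^ Suc j)"
  using gam_theta_prod[OF v(2), of 0 k p] unfolding vX v2 by simp
 moreover have "gam v 0 k \<noteq> 0" by (rule gam_nonzero[OF v(2)])
 moreover have "D = P * T" if "g / Q * D = A / B" "P * (g * T) * B = Q * A" "g \<noteq> 0" "Q \<noteq> 0" "B \<noteq> 0" for g Q D A B P T :: complex
 proof -
  have "g * D * B = A * Q" using that(1,4,5) by (simp add: field_simps)
  hence "(g * B) * D = (g * B) * (P * T)" using that(2) by (simp add: mult_ac)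
  thus ?thesis using that(3,5) by simp
 qed
 ultimately show ?thesis using e ne1 ne2 by (metis power_not_zero)
qed

text \<open>The factor between determinant and theta product depends only on \<open>p\<close> and
  \<open>k\<close>, so it is read off at the powers of a root \<open>s\<close> of \<open>p\<close>
  of order \<open>2 * Suc k\<close>. Since \<open>norm t < 1\<close>, one has
  \<open>norm s \<le> norm w ^ 2\<close>, and the points \<open>s ^ Suc j\<close> lie below
  \<open>w ^ (2 * Suc j - \<sigma>)\<close> in norm, as \<open>psi_det_theta_prod\<close>
  requires.\<close>

lemma psi_det_eq_nonzero:
 assumes w: "norm w < 1" "w \<noteq> 0" and \<sigma>: "\<sigma> = 0 \<or> \<sigma> = 1" and t: "norm t < 1" "t \<noteq> 0" and p: "p = t * w ^ (4 * Suc k)"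
 shows "psi_det p k (\<lambda>j. w ^ (2 * Suc j - \<sigma>)) = qpoch_inf p p ^ k * theta_prod p k (\<lambda>j. w ^ (2 * Suc j - \<sigma>))"
proof -
 let ?X = "\<lambda>j. w ^ (2 * Suc j - \<sigma>)"
 have p0: "p \<noteq> 0" using p t w by simp
 have np: "norm p = norm t * norm w ^ (4 * Suc k)" by (simp add: p norm_mult norm_power del: power_Suc)
 have w01: "0 < norm w" "norm w < 1" using w by auto
 have wp: "norm w ^ (4 * Suc k) < 1" "0 < norm w ^ (4 * Suc k)" using power_less_of_less[OF w01, of 0 "4 * Suc k"] w01 by (simp_all del: power_Suc)
 have p_less: "norm p < norm w ^ (4 * Suc k)" unfolding np using t wp by (simp add: mult_less_cancel_right1 del: power_Suc)
 hence p1: "norm p < 1" using wp by linarith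
 define s where "s = exp (Ln p / of_nat (2 * Suc k))"
 have s: "s ^ (2 * Suc k) = p"
 proof -
  have "s ^ (2 * Suc k) = exp (of_nat (2 * Suc k) * (Ln p / of_nat (2 * Suc k)))" unfolding s_def by (rule exp_of_nat_mult[symmetric])
  also have "of_nat (2 * Suc k) * (Ln p / of_nat (2 * Suc k)) = Ln p"
   by (simp only: nonzero_mult_div_cancel_left times_divide_eq_right of_nat_eq_0_iff mult_eq_0_iff zero_neq_numeral nat.simps simp_thms)
  finally show ?thesis using p0 by simp
 qed
 have s0: "s \<noteq> 0" by (simp add: s_def)
 have ns: "norm s ^ (2 * Suc k) = norm p" by (simp only: norm_power[symmetric] s)
 have sw: "norm s \<le> norm w ^ 2"
 proof (rule ccontr)
  assume "\<not> norm s \<le> norm w ^ 2"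
  hence "(norm w ^ 2) ^ (2 * Suc k) < norm s ^ (2 * Suc k)" by (intro power_strict_mono) auto
  also have "(norm w ^ 2) ^ (2 * Suc k) = norm w ^ (4 * Suc k)"
  proof -
   have "4 * Suc k = 2 * (2 * Suc k)" by simp
   thus ?thesis by (simp only: power_mult)
  qed
  finally show False using p_less ns by simp
 qed
 have w2: "norm w ^ 2 < 1" using power_less_of_less[OF w01, of 0 2] by simp
 have s1: "norm s < 1" using sw w2 by linarith
 have sp: "0 < norm s" using s0 by simp
 have ann: "norm p < norm (s ^ Suc l) ^ 2 \<and> norm (s ^ Suc l) < 1" if l: "l < k" for l
 proof
  have "norm s ^ (2 * Suc k) < norm s ^ (Suc l * 2)" by (rule power_less_of_less[OF sp s1]) (use l in simp)
  thus "norm p < norm (s ^ Suc l) ^ 2" unfolding ns by (simp only: norm_power power_mult)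
  have "norm s ^ Suc l < norm s ^ 0" by (rule power_less_of_less[OF sp s1]) simp
  thus "norm (s ^ Suc l) < 1" by (simp only: norm_power power_0)
 qed
 have psi: "psi_det p k ?X * theta_prod p k (\<lambda>j. s ^ Suc j) = psi_det p k (\<lambda>j. s ^ Suc j) * theta_prod p k ?X"
 proof (rule psi_det_theta_prod[OF p1 p0])
  fix l assume l: "l < k"
  show "norm p < norm (?X l) ^ 2 \<and> norm (?X l) < 1"
  proof
   have "norm p < norm w ^ (4 * Suc k)" by (rule p_less)
   also have "... < norm w ^ ((2 * Suc l - \<sigma>) * 2)" by (rule power_less_of_less[OF w01]) (use l in simp)
   finally show "norm p < norm (?X l) ^ 2" by (simp only: norm_power power_mult)
   have "norm w ^ (2 * Suc l - \<sigma>) < norm w ^ 0" by (rule power_less_of_less[OF w01]) (use \<sigma> in auto)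
   thus "norm (?X l) < 1" by (simp only: norm_power power_0)
  qed
  show "norm p < norm (s ^ Suc l) ^ 2 \<and> norm (s ^ Suc l) < 1" by (rule ann[OF l])
  show "norm (s ^ Suc l) \<le> norm (?X l)"
  proof -
   have "norm s ^ Suc l \<le> (norm w ^ 2) ^ Suc l" by (intro power_mono sw) simp
   also have "... = norm w ^ (2 * Suc l)" by (simp only: power_mult)
   also have "... \<le> norm w ^ (2 * Suc l - \<sigma>)" by (rule power_decreasing) (use w01 in auto)
   finally show ?thesis by (simp only: norm_power)
  qed
 next
  fix i j :: nat assume "i < j" "j < k"
  show "norm (?X j) < norm (?X i)" unfolding norm_power by (rule power_less_of_less[OF w01]) (use \<open>i < j\<close> \<sigma> in auto)
  show "norm (s ^ Suc j) < norm (s ^ Suc i)" unfolding norm_power by (rule power_less_of_less[OF sp s1]) (use \<open>i < j\<close> in auto)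
 qed
 have nz: "theta_prod p k (\<lambda>j. s ^ Suc j) \<noteq> 0"
 proof (rule theta_prod_nonzero[OF p1 p0])
  fix l assume l: "l < k"
  show "norm p < norm (s ^ Suc l) ^ 2 \<and> norm (s ^ Suc l) < 1" by (rule ann[OF l])
 next
  fix i j :: nat assume "i < j" "j < k"
  show "norm (s ^ Suc j) < norm (s ^ Suc i)" unfolding norm_power by (rule power_less_of_less[OF sp s1]) (use \<open>i < j\<close> in auto)
 qed
 have "psi_det p k ?X * theta_prod p k (\<lambda>j. s ^ Suc j) = (qpoch_inf p p ^ k * theta_prod p k ?X) * theta_prod p k (\<lambda>j. s ^ Suc j)"
  unfolding psi psi_det_at_powers[OF s1 s0 s[symmetric]] by (simp only: mult_ac)
 thus ?thesis using nz by simp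
qed

section \<open>The degenerate cases \<open>t = 0\<close> and \<open>q = 0\<close>\<close>

lemma qpoch_inf_0: "qpoch_inf a 0 = 1 - a"
proof -
 have "qpoch_inf a 0 = (1 - a) * qpoch_inf 0 0" using qpoch_inf_shift[of 0 a] by simp
 moreover have "qpoch_inf 0 (0 :: complex) = 1" by (simp add: qpoch_inf_def)
 ultimately show ?thesis by simp
qed

lemma theta_0: "theta a 0 = 1 - a" by (simp add: theta_def qpoch_inf_0)

text \<open>By \<open>0 ^ 0 = 1\<close> only the terms of exponent 0 survive, that is
  \<open>m = i\<close> and \<open>m = - i\<close>.\<close>

lemma psi_0:
 assumes i: "0 < i" "i < K" and X: "X \<noteq> 0"
 shows "psi 0 K i X = - (X ^ i - (1 / X) ^ i)"
proof -
 have a: "affine_coeff 0 K i m = (if m = int i then 1 else if m = - int i then - 1 else 0)" for m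
 proof (cases "2 * int K dvd m - int i \<or> 2 * int K dvd m + int i")
  case True
  then obtain e where e: "m\<^sup>2 - (int i)\<^sup>2 = 4 * int K * e" "e \<ge> 0" "(m\<^sup>2 - (int i)\<^sup>2) div (4 * int K) = e"
   using affine_coeff_exponent[OF i] by blast
  show ?thesis
  proof (cases "e = 0")
   case True
   hence "m\<^sup>2 = (int i)\<^sup>2" using e by simp
   hence m: "m = int i \<or> m = - int i" by (simp add: power2_eq_iff)
   have "\<not> 2 * int K dvd - int i - int i" using affine_coeff_exclusive[OF i, of "- int i"] by auto
   thus ?thesis using m i by (auto simp: affine_coeff_def)
  next
   case False
   hence "m \<noteq> int i" "m \<noteq> - int i" using e i by auto
   thus ?thesis using False e(2) unfolding affine_coeff_def e(3) by (simp add: power_0_left)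
  qed
 next
  case False
  hence "m \<noteq> int i" "m \<noteq> - int i" by auto
  thus ?thesis using False by (simp add: affine_coeff_def)
 qed
 have "psi 0 K i X = (\<Sum>\<^sub>\<infinity>m\<in>{int i, - int i}. affine_coeff 0 K i m * X powi (- m))"
  unfolding psi_def by (rule infsum_cong_neutral) (auto simp: a)
 also have "... = (\<Sum>m\<in>{int i, - int i}. affine_coeff 0 K i m * X powi (- m))" by (rule infsum_finite) simp
 also have "... = X powi (- int i) - X powi int i" using i by (simp add: a)
 also have "X powi (- int i) = (1 / X) ^ i" by (simp only: power_int_minus power_int_of_nat power_one_over inverse_eq_divide)
 finally show ?thesis by simp
qed

text \<open>For \<open>p = 0\<close> the identity degenerates to the Weyl denominator formula of
  type C, since \<open>theta a 0 = 1 - a\<close>.\<close>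

lemma psi_det_0:
 assumes X: "\<And>l. l < k \<Longrightarrow> X l \<noteq> 0"
 shows "psi_det 0 k X = theta_prod 0 k X"
proof -
 have "psi_det 0 k X = pdet k (\<lambda>i j. - 1 * (X j ^ Suc i - (1 / X j) ^ Suc i))"
  unfolding psi_det_def by (rule pdet_cong, subst psi_0) (use X in auto)
 also have "... = (\<Prod>j<k. - 1) * cvdm k X" by (subst pdet_scale_columns) (simp only: pdet_cvdm[OF X])
 also have "... = (\<Prod>j<k. - 1 * (X j - 1 / X j) * (\<Prod>i<j. (X j + 1 / X j) - (X i + 1 / X i)))"
  by (simp only: cvdm_def vdm_def prod.distrib mult.assoc)
 also have "... = (\<Prod>j<k. (1 / X j) ^ Suc j * (1 - (X j)\<^sup>2) * (\<Prod>i<j. (1 - X j / X i) * (1 - X i * X j)))"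
 proof (rule prod.cong[OF refl])
  fix j assume j: "j \<in> {..<k}"
  have x: "X j \<noteq> 0" using X j by simp
  have "(\<Prod>i<j. (X j + 1 / X j) - (X i + 1 / X i)) = (\<Prod>i<j. 1 / X j * ((1 - X j / X i) * (1 - X i * X j)))"
  proof (rule prod.cong[OF refl])
   fix i assume "i \<in> {..<j}"
   hence "X i \<noteq> 0" using X j by simp
   thus "(X j + 1 / X j) - (X i + 1 / X i) = 1 / X j * ((1 - X j / X i) * (1 - X i * X j))" using x by (simp add: field_simps)
  qed
  also have "... = (1 / X j) ^ j * (\<Prod>i<j. (1 - X j / X i) * (1 - X i * X j))" by (simp only: prod.distrib prod_constant card_lessThan)
  finally have e: "(\<Prod>i<j. (X j + 1 / X j) - (X i + 1 / X i)) = (1 / X j) ^ j * (\<Prod>i<j. (1 - X j / X i) * (1 - X i * X j))" .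
  have f: "- 1 * (X j - 1 / X j) = 1 / X j * (1 - (X j)\<^sup>2)" using x by (simp add: field_simps power2_eq_square)
  show "- 1 * (X j - 1 / X j) * (\<Prod>i<j. (X j + 1 / X j) - (X i + 1 / X i)) =
    (1 / X j) ^ Suc j * (1 - (X j)\<^sup>2) * (\<Prod>i<j. (1 - X j / X i) * (1 - X i * X j))" unfolding e f power_Suc by (simp only: mult_ac)
 qed
 also have "... = (\<Prod>j<k. (1 / X j) ^ Suc j * (1 - (X j)\<^sup>2)) * (\<Prod>j<k. \<Prod>i<j. (1 - X j / X i) * (1 - X i * X j))"
  by (rule prod.distrib)
 also have "(\<Prod>j<k. \<Prod>i<j. (1 - X j / X i) * (1 - X i * X j)) = (\<Prod>(j, i)\<in>(SIGMA j:{..<k}. {..<j}). (1 - X j / X i) * (1 - X i * X j))"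
  by (rule prod.Sigma) auto
 also have "... = (\<Prod>(i, j)\<in>{(i, j). i < j \<and> j < k}. (1 - X j / X i) * (1 - X i * X j))"
  by (rule prod.reindex_bij_witness[where i = "\<lambda>(i, j). (j, i)" and j = "\<lambda>(j, i). (i, j)"]) auto
 finally show ?thesis unfolding theta_prod_def theta_0 .
qed

text \<open>For \<open>q = 0\<close> the points \<open>q ^ i\<close> coincide from
  \<open>i = 1\<close> on, so the limit in \<open>hall_littlewood\<close> is taken at a point with
  equal coordinates. The perturbation \<open>x i + s * (i + 1)\<close> separates all coordinates
  except for finitely many \<open>s\<close>.\<close>

lemma at_within_inj_neq_bot':
 fixes x :: "nat \<Rightarrow> complex"
 shows "at x within {y. inj_on y {..<n}} \<noteq> bot"
proof -
 define h :: "complex \<Rightarrow> nat \<Rightarrow> complex" where "h = (\<lambda>s i. x i + s * of_nat (Suc i))"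
 define B where "B = (\<lambda>(i, j). (x j - x i) / (of_nat i - of_nat j)) ` ({..<n} \<times> {..<n}) - {0}"
 have "continuous_on UNIV h" by (rule continuous_on_coordinatewise_then_product) (auto simp: h_def intro!: continuous_intros)
 hence "(h \<longlongrightarrow> h 0) (at 0)" by (auto simp: continuous_on_def)
 moreover have "h 0 = x" by (simp add: h_def)
 ultimately have "(h \<longlongrightarrow> x) (at 0)" by simp
 moreover have "inj_on (h s) {..<n}" if s: "s \<noteq> 0" "s \<notin> B" for s
 proof (rule inj_onI, rule ccontr)
  fix i j assume i: "i \<in> {..<n}" "j \<in> {..<n}" and e: "h s i = h s j" and ij: "i \<noteq> j"
  have "x i + s * of_nat (Suc i) = x j + s * of_nat (Suc j)" using e by (simp only: h_def)
  hence "s * (of_nat i - of_nat j) = x j - x i" by (simp add: algebra_simps)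
  moreover have "of_nat i - of_nat j \<noteq> (0 :: complex)" using ij by simp
  ultimately have "s = (x j - x i) / (of_nat i - of_nat j)" by (simp add: eq_divide_eq)
  hence "s \<in> B" using i s(1) unfolding B_def by force
  thus False using s(2) by simp
 qed
 moreover have "eventually (\<lambda>s. s \<notin> B) (at 0)"
 proof -
  have "finite B" unfolding B_def by simp
  hence "open (- B)" by (simp add: finite_imp_closed open_Compl)
  hence "eventually (\<lambda>s. s \<in> - B) (nhds 0)" by (rule eventually_nhds_in_open) (simp add: B_def)
  thus ?thesis by (simp add: eventually_at_filter eventually_mono)
 qed
 moreover have "h s \<noteq> x" if "s \<noteq> 0" for s using that by (auto simp: h_def fun_eq_iff intro!: exI[of _ 0])
 ultimately have "filterlim h (at x within {y. inj_on y {..<n}}) (at 0)"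
  unfolding filterlim_at by (auto simp: eventually_at_filter elim!: eventually_mono)
 thus ?thesis by (metis filterlim_def filtermap_bot_iff le_bot at_neq_bot)
qed

text \<open>For \<open>q = 0\<close> the empty partition is the only one that contributes; its
  polynomial is constant, so the limit exists at every point.\<close>

lemma hall_littlewood_Nil:
 assumes t: "norm t < 1"
 shows "hall_littlewood n [] t x = 1"
proof -
 let ?F = "at x within {y. inj_on y {..<n}}"
 have "{f :: nat \<Rightarrow> nat. (\<forall>a\<ge>n. f a = 0) \<and> shape f = []} = {\<lambda>_. 0}"
 proof (intro equalityI subsetI)
  fix f :: "nat \<Rightarrow> nat" assume "f \<in> {f. (\<forall>a\<ge>n. f a = 0) \<and> shape f = []}"
  hence f: "\<forall>a\<ge>n. f a = 0" "shape f = []" by auto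
  have "{a. f a \<noteq> 0} \<subseteq> {..<n}"
  proof
   fix a assume "a \<in> {a. f a \<noteq> 0}"
   thus "a \<in> {..<n}" using f(1) by (cases "a < n") auto
  qed
  hence "finite {a. f a \<noteq> 0}" by (rule finite_subset) simp
  moreover have "mset_set {a. f a \<noteq> 0} = {#}" using mset_shape[of f] unfolding f(2) by simp
  ultimately have "{a. f a \<noteq> 0} = {}" by (auto simp only: mset_set_empty_iff)
  thus "f \<in> {\<lambda>_. 0}" by (auto simp: fun_eq_iff)
 qed (auto simp: shape_eqI)
 moreover have "is_partition []" by (simp add: is_partition_def)
 ultimately have "hl_sym n [] t y = 1" if "inj_on y {..<n}" for y using hl_sym_eq_sum(2)[OF that t, of "[]"] by (simp add: inv_prod_def)
 hence "(hl_sym n [] t \<longlongrightarrow> 1) ?F" by (intro tendsto_eventually) (auto simp: eventually_at_filter)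
 thus ?thesis by (simp add: hall_littlewood_def tendsto_Lim[OF at_within_inj_neq_bot'])
qed

section \<open>Assembling the identity\<close>

lemma prod_telescope_shift:
 fixes f :: "nat \<Rightarrow> complex"
 shows "(\<Prod>i\<in>{1..<Suc n}. f (i + m)) * f (Suc n + m) = f (Suc m) * (\<Prod>i\<in>{1..<Suc n}. f (i + Suc m))"
proof (induction n)
 case (Suc n)
 have s: "(\<Prod>i\<in>{1..<Suc (Suc n)}. g i) = (\<Prod>i\<in>{1..<Suc n}. g i) * g (Suc n)" for g :: "nat \<Rightarrow> complex"
  by (rule prod.atLeastLessThan_Suc) simp
 have "Suc (Suc n) + m = Suc n + Suc m" by simp
 thus ?case unfolding s by (simp only: Suc.IH mult.assoc)
qed simp

text \<open>For \<open>\<sigma> = 1\<close> the exponents \<open>2 * j - 1\<close> and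
  \<open>i + j - 1\<close> are traded for \<open>j\<close> and \<open>i + j\<close>: for each
  \<open>j\<close> both sides multiply the theta functions of the powers of \<open>q\<close> from
  \<open>j\<close> to \<open>2 * j - 1\<close>, each once.\<close>

lemma theta_pairs_eq:
 assumes \<sigma>: "\<sigma> = 0 \<or> \<sigma> = 1"
 shows "theta_pairs q p \<sigma> k = (\<Prod>i=1..k. theta (q ^ ((2 - \<sigma>) * i)) p) *
  (\<Prod>(i, j)\<in>{(i, j). 1 \<le> i \<and> i < j \<and> j \<le> k}. theta (q ^ (j - i)) p * theta (q ^ (i + j)) p)"
proof -
 have "theta (q ^ (2 * j - \<sigma>)) p * (\<Prod>i\<in>{1..<j}. theta (q ^ (j - i)) p * theta (q ^ (i + j - \<sigma>)) p) =
   theta (q ^ ((2 - \<sigma>) * j)) p * (\<Prod>i\<in>{1..<j}. theta (q ^ (j - i)) p * theta (q ^ (i + j)) p)" if j: "j \<in> {1..k}" for j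
  using \<sigma>
 proof
  assume \<sigma>1: "\<sigma> = 1"
  obtain m where m: "j = Suc m" using j by (cases j) auto
  let ?f = "\<lambda>i. theta (q ^ i) p"
  have a: "2 * Suc m - 1 = Suc m + m" "(2 - 1) * Suc m = Suc m" "i + Suc m - 1 = i + m" for i by simp_all
  have "?f (Suc m + m) * (\<Prod>i\<in>{1..<Suc m}. ?f (i + m)) = ?f (Suc m) * (\<Prod>i\<in>{1..<Suc m}. ?f (i + Suc m))"
   using prod_telescope_shift[of ?f m m] by (simp only: mult.commute)
  moreover have swap: "u * (y * v) = z * (y * r)" if "u * v = z * r" for u v y z r :: complex using that by (metis mult.left_commute)
  ultimately show ?thesis unfolding m \<sigma>1 a prod.distrib by (intro swap)
 qed simp
 hence "theta_pairs q p \<sigma> k = (\<Prod>j=1..k. theta (q ^ ((2 - \<sigma>) * j)) p *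
   (\<Prod>i\<in>{1..<j}. theta (q ^ (j - i)) p * theta (q ^ (i + j)) p))" unfolding theta_pairs_def by (rule prod.cong[OF refl])
 also have "... = (\<Prod>j=1..k. theta (q ^ ((2 - \<sigma>) * j)) p) * (\<Prod>j=1..k. \<Prod>i\<in>{1..<j}. theta (q ^ (j - i)) p * theta (q ^ (i + j)) p)"
  by (rule prod.distrib)
 also have "(\<Prod>j=1..k. \<Prod>i\<in>{1..<j}. theta (q ^ (j - i)) p * theta (q ^ (i + j)) p) =
   (\<Prod>(j, i)\<in>(SIGMA j:{1..k}. {1..<j}). theta (q ^ (j - i)) p * theta (q ^ (i + j)) p)" by (rule prod.Sigma) auto
 also have "... = (\<Prod>(i, j)\<in>{(i, j). 1 \<le> i \<and> i < j \<and> j \<le> k}. theta (q ^ (j - i)) p * theta (q ^ (i + j)) p)"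
  by (rule prod.reindex_bij_witness[where i = "\<lambda>(i, j). (j, i)" and j = "\<lambda>(j, i). (i, j)"]) auto
 finally show ?thesis .
qed

lemma partition_parts_le_iff:
 assumes "is_partition lam"
 shows "part lam 0 \<le> b \<longleftrightarrow> (\<forall>m\<in>set lam. m \<le> b)"
 using assms by (cases lam) (auto simp: part_def is_partition_def)

lemma psi_det_eq:
 assumes w: "norm w < 1" "w \<noteq> 0" and \<sigma>: "\<sigma> = 0 \<or> \<sigma> = 1" and t: "norm t < 1" and p: "p = t * w ^ (4 * Suc k)"
 shows "psi_det p k (\<lambda>j. w ^ (2 * Suc j - \<sigma>)) = qpoch_inf p p ^ k * theta_prod p k (\<lambda>j. w ^ (2 * Suc j - \<sigma>))"
proof (cases "t = 0")
 case True
 hence p0: "p = 0" by (simp add: p)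
 have "psi_det 0 k (\<lambda>j. w ^ (2 * Suc j - \<sigma>)) = theta_prod 0 k (\<lambda>j. w ^ (2 * Suc j - \<sigma>))"
  by (rule psi_det_0) (use w in simp)
 thus ?thesis unfolding p0 by (simp only: qpoch_inf_0 diff_zero power_one mult_1)
next
 case False
 show ?thesis by (rule psi_det_eq_nonzero[OF w \<sigma> t False p])
qed

theorem theorem1p5:
  fixes k \<sigma> :: nat and q t p :: complex
  assumes "k \<ge> 1" and "\<sigma> \<in> {0, 1}"
    and "norm q < 1" and "norm t < 1"
    and "p = t * q ^ (2 * k + 2)"
  shows "((\<lambda>lam. q ^ ((\<sigma> + 1) * sum_list lam div 2) * hall_littlewood_spec lam q t) has_sum
           qpoch_inf p p ^ k / qpoch_inf q q ^ k *
           (\<Prod>i=1..k. theta (q ^ ((2 - \<sigma>) * i)) p) *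
           (\<Prod>(i, j)\<in>{(i, j). 1 \<le> i \<and> i < j \<and> j \<le> k}.
              theta (q ^ (j - i)) p * theta (q ^ (i + j)) p))
         {lam. is_partition lam \<and> (\<forall>m\<in>set lam. even m) \<and> part lam 0 \<le> 2 * k}"
proof -
 have \<sigma>: "\<sigma> = 0 \<or> \<sigma> = 1" using assms(2) by simp
 have L: "{lam. is_partition lam \<and> (\<forall>m\<in>set lam. even m) \<and> part lam 0 \<le> 2 * k} =
   {lam. is_partition lam \<and> (\<forall>m\<in>set lam. even m \<and> m \<le> 2 * k)}" (is "_ = ?L") using partition_parts_le_iff by blast
 have "((\<lambda>lam. q ^ ((\<sigma> + 1) * sum_list lam div 2) * hall_littlewood_spec lam q t) has_sum
   qpoch_inf p p ^ k / qpoch_inf q q ^ k * theta_pairs q p \<sigma> k) ?L"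
 proof (cases "q = 0")
  case True
  have p0: "p = 0" using assms(5) True by simp
  show ?thesis unfolding True p0
  \<comment> \<open>For \<open>q = 0\<close> the power of \<open>q\<close> vanishes unless the
    partition is empty: a nonempty even partition has size at least 2, so the exponent is positive
    even for \<open>\<sigma> = 0\<close>.\<close>
  proof (rule has_sum_finite_neutralI[of "{[]}"])
   show "{[]} \<subseteq> ?L" by (simp add: is_partition_def)
   fix lam assume lam: "lam \<in> ?L - {[]}"
   then obtain m where m: "m \<in> set lam" by (cases lam) auto
   hence "even m" "m \<noteq> 0" using lam by (auto simp: is_partition_def intro: ccontr)
   hence "2 \<le> m" by presburger
   also have "m \<le> sum_list lam" using m by (rule member_le_sum_list) simp
   also have "sum_list lam \<le> (\<sigma> + 1) * sum_list lam" by simp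
   finally have "(\<sigma> + 1) * sum_list lam div 2 \<noteq> 0" by linarith
   hence "(0 :: complex) ^ ((\<sigma> + 1) * sum_list lam div 2) = 0" by (simp add: power_0_left)
   thus "0 ^ ((\<sigma> + 1) * sum_list lam div 2) * hall_littlewood_spec lam 0 t = 0" by (simp only: mult_zero_left)
  next
   have "hall_littlewood_spec [] 0 t = 1" unfolding hall_littlewood_spec_def hall_littlewood_Nil[OF assms(4)] by simp
   moreover have "theta_pairs 0 0 \<sigma> k = 1"
   proof -
    have z: "(0 :: complex) ^ n = 0" if "0 < n" for n using that by (rule zero_power)
    have "(\<Prod>i\<in>{1..<j}. theta (0 ^ (j - i)) 0 * theta (0 ^ (i + j)) 0) = 1" for j by (rule prod.neutral) (auto simp: theta_0 z)
    moreover have "theta (0 ^ ((2 - \<sigma>) * j)) 0 = 1" if "j \<in> {1..k}" for j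
    proof -
     have "0 < (2 - \<sigma>) * j" using that \<sigma> by auto
     thus ?thesis by (simp only: z theta_0 diff_zero)
    qed
    ultimately show ?thesis unfolding theta_pairs_eq[OF \<sigma>] by (auto intro!: prod.neutral simp: theta_0 z)
   qed
   ultimately show "qpoch_inf 0 0 ^ k / qpoch_inf 0 0 ^ k * theta_pairs 0 0 \<sigma> k =
     (\<Sum>lam\<in>{[]}. 0 ^ ((\<sigma> + 1) * sum_list lam div 2) * hall_littlewood_spec lam 0 t)" by (simp add: qpoch_inf_0)
  qed simp
 next
  case False
  \<comment> \<open>Both values of \<open>\<sigma>\<close> involve half-integral powers of
    \<open>q\<close>: in the variables for \<open>\<sigma> = 0\<close>, in the points of the
    determinant for \<open>\<sigma> = 1\<close>.\<close>
  define w where "w = csqrt q"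
  have w2: "w\<^sup>2 = q" by (simp add: w_def)
  have w0: "w \<noteq> 0" using w2 False by auto
  have w1: "norm w < 1"
  proof (rule ccontr)
   assume "\<not> norm w < 1"
   hence "1 \<le> norm w ^ 2" by (simp add: one_le_power)
   thus False using assms(3) unfolding w2[symmetric] norm_power by simp
  qed
  have p: "p = t * w ^ (4 * Suc k)"
  proof -
   have "4 * Suc k = 2 * (2 * k + 2)" by simp
   thus ?thesis unfolding assms(5) by (simp only: power_mult w2)
  qed
  have "bl_sum t (xvar w \<sigma>) {..<n} k = theta_det t k n (tc w \<sigma> n)" for n
  proof (rule bl_sum_eq_det[of t "xvar w \<sigma>" "{..<n}" "of_nat \<sigma>"])
   show "norm t \<le> 1" using assms(4) by simp
   show "lw_generic (xvar w \<sigma>) {..<n}" by (rule lw_generic_xs[OF w1 w0 \<sigma>])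
   show "norm (xvar w \<sigma> i) < 1" for i by (rule norm_xs_less[OF w1 w0 \<sigma>])
   show "(of_nat \<sigma> :: complex) = 0 \<or> of_nat \<sigma> = (1 :: complex)" using \<sigma> by auto
   show "(1 + of_nat \<sigma> / z) * kern (xvar w \<sigma>) {..<n} z = (\<Sum>m=- int (Suc n)..int n. tc w \<sigma> n m * z powi m)" if "z \<noteq> 0" for z
    by (rule kern_xs[OF w1 w0 \<sigma> that])
  qed
  moreover have "(\<lambda>n. theta_det t k n (tc w \<sigma> n)) \<longlonglongrightarrow> gam w \<sigma> k / qpoch_inf q q ^ k * psi_det p k (\<lambda>j. w ^ (2 * Suc j - \<sigma>))"
   using theta_det_LIMSEQ[OF w1 w0 \<sigma>, of t k] assms(4) unfolding w2 p by simp
  moreover have "gam w \<sigma> k / qpoch_inf q q ^ k * psi_det p k (\<lambda>j. w ^ (2 * Suc j - \<sigma>)) =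
    qpoch_inf p p ^ k / qpoch_inf q q ^ k * theta_pairs q p \<sigma> k"
   unfolding psi_det_eq[OF w1 w0 \<sigma> assms(4) p] w2[symmetric] gam_theta_prod[OF w0 \<sigma>, symmetric] by simp
  ultimately have "(\<lambda>n. bl_sum t (xvar w \<sigma>) {..<n} k) \<longlonglongrightarrow> qpoch_inf p p ^ k / qpoch_inf q q ^ k * theta_pairs q p \<sigma> k"
   by (simp only:)
  from has_sum_hall_littlewood[OF w1 w0 assms(4) this] show ?thesis unfolding w2 .
 qed
 thus ?thesis unfolding L theta_pairs_eq[OF \<sigma>] mult.assoc .
qed

end
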